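(* Let $(\mathbf u,\mathbf W)$ be a minimizer for $J$ in $\mathcal F(\Omega)$. Suppose that the $f_i$ and the $g_i$, $1\le i\le N$, are bounded; that $u_1$ is $C_0$-Lipschitz on an open ball $B_0$ for some $C_0\ge0$; that there is $C_F\ge0$ such that $|F(\mathbf V)-F(\mathbf V')|\le C_F\sum_{i=1}^N|V_i\Delta V'_i|$ for all $\mathbf V,\mathbf V'\in\mathcal W(\Omega)$; and that there are $\lambda>0$ and $\varepsilon>0$ such that for each measurable set $A\subset W_1$ with $0<|A|\le\varepsilon$, there are disjoint subsets $A_j\subset A$, $2\le j\le N$, with $$F(W_1\setminus A,W_2\cup A_2,\dots,W_N\cup A_N)\le F(\mathbf W)-\lambda|A|.$$ Set $\Omega_1=\{x\in\Omega: u_1(x)>0\}$, $v=\max(0,u_1)$, and let $\mu$ be the distribution $$\mu=\Delta v-\big[f_1v-\tfrac12g_1\big]\mathbf 1_{\Omega_1}.$$ Then $\mu$ is, in $B_0$, a locally Ahlfors-regular positive measure whose support (in $B_0$) is $\partial\Omega_1$. More precisely, there are constants $C_1\ge1$ and $r_0\le1$ such that $$C_1^{-1}r^{n-1}\le\mu(B(x,r))\le C_1r^{n-1}$$ for $x\in\partial\Omega_1$ and $0<r\le r_0$ such that $B(x,2r)\subset B_0$. The constant $C_1$ depends on $n$, the $L^\infty$ bounds on the $f_i$ and $g_i$, $C_0$, $C_F$, and $\lambda$. The radius $r_0$ depends on these constants, plus $\varepsilon$.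
   Context: $n\ge2$ and $N\ge1$ are integers; $|A|$ is the Lebesgue measure of $A$; $B(x,r)$ is the open ball; $A\Delta B=(A\setminus B)\cup(B\setminus A)$; $\Omega\subset\mathbb R^n$ is a Borel set with $|\Omega|<+\infty$. $W^{1,2}(\mathbb R^n)$ denotes the set of functions in $L^2_{loc}(\mathbb R^n)$ whose distributional gradient lies in $L^2(\mathbb R^n)$. $\mathcal W(\Omega)$ is the set of $N$-tuples $\mathbf W=(W_1,\dots,W_N)$ of pairwise disjoint Borel subsets of $\Omega$. $\mathcal F(\Omega)$ is the set of pairs $(\mathbf u,\mathbf W)$ with $\mathbf W\in\mathcal W(\Omega)$ and $\mathbf u=(u_1,\dots,u_N)$ an $N$-tuple of real-valued functions $u_i\in W^{1,2}(\mathbb R^n)$ such that $u_i(x)=0$ for almost every $x\in\mathbb R^n\setminus W_i$. For $(\mathbf u,\mathbf W)\in\mathcal F(\Omega)$ and $F:\mathcal W(\Omega)\to\mathbb R$, $$J(\mathbf u,\mathbf W)=\sum_{i=1}^N\int|\nabla u_i|^2\,dx+\sum_{i=1}^N\int[u_i^2f_i-u_ig_i]\,dx+F(W_1,\dots,W_N).$$ A minimizer for $J$ in $\mathcal F(\Omega)$ is a pair $(\mathbf u,\mathbf W)\in\mathcal F(\Omega)$ such that $J(\mathbf u,\mathbf W)\le J(\mathbf u^*,\mathbf W^* )$ for all $(\mathbf u^*,\mathbf W^* )\in\mathcal F(\Omega)$. Convention: $\mathbf u$ is identified with its continuous representative.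
   Formalization: Ω₁ is taken as {x : u₁(x)>0}, without intersecting with Ω; literally, removing one interior point of {u₁>0} from Ω adds a boundary point of Ω₁ near which μ vanishes, and in B₀ both sets agree whenever the claim holds. *)

theory Defs
  imports "HOL-Analysis.Analysis"
begin

section \<open>Test functions\<close>

definition partial_deriv :: "'n::finite \<Rightarrow> (real^'n \<Rightarrow> real) \<Rightarrow> real^'n \<Rightarrow> real" where
  "partial_deriv i \<phi> x = frechet_derivative \<phi> (at x) (axis i 1)"

primrec C_k :: "nat \<Rightarrow> (real^'n::finite \<Rightarrow> real) \<Rightarrow> bool" where
  "C_k 0 \<phi> \<longleftrightarrow> continuous_on UNIV \<phi>"
| "C_k (Suc k) \<phi> \<longleftrightarrow> (\<forall>x. \<phi> differentiable at x) \<and> (\<forall>i. C_k k (partial_deriv i \<phi>))"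

definition test_function :: "(real^'n::finite) set \<Rightarrow> (real^'n \<Rightarrow> real) \<Rightarrow> bool" where
  "test_function U \<phi> \<longleftrightarrow> (\<forall>k. C_k k \<phi>) \<and>
     compact (closure {x. \<phi> x \<noteq> 0}) \<and> closure {x. \<phi> x \<noteq> 0} \<subseteq> U"

definition laplacian :: "(real^'n::finite \<Rightarrow> real) \<Rightarrow> real^'n \<Rightarrow> real" where
  "laplacian \<phi> x = (\<Sum>i\<in>UNIV. partial_deriv i (partial_deriv i \<phi>) x)"


section \<open>Sobolev functions and distributions\<close>

definition locally_integrable :: "(real^'n::finite \<Rightarrow> 'b::euclidean_space) \<Rightarrow> bool" where
  "locally_integrable h \<longleftrightarrow> (\<forall>K. compact K \<longrightarrow> set_integrable lebesgue K h)"

definition has_weak_gradient :: "(real^'n::finite \<Rightarrow> real) \<Rightarrow> (real^'n \<Rightarrow> real^'n) \<Rightarrow> bool" where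
  "has_weak_gradient u G \<longleftrightarrow> locally_integrable u \<and> locally_integrable G \<and>
     (\<forall>\<phi> i. test_function UNIV \<phi> \<longrightarrow>
        (LINT x|lebesgue. u x * partial_deriv i \<phi> x) = - (LINT x|lebesgue. (G x $ i) * \<phi> x))"

text \<open>A weak gradient is unique up to a null set, so integrals of
  \<open>weak_gradient u\<close> do not depend on the choice made here.\<close>

definition weak_gradient :: "(real^'n::finite \<Rightarrow> real) \<Rightarrow> real^'n \<Rightarrow> real^'n" where
  "weak_gradient u = (SOME G. has_weak_gradient u G)"

text \<open>Only the gradient is required to be globally square integrable; the function itself
  is only locally so.\<close>

definition W12 :: "(real^'n::finite \<Rightarrow> real) set" where
  "W12 = {u. u \<in> borel_measurable lebesgue \<and> locally_integrable (\<lambda>x. (u x)\<^sup>2) \<and>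
     (\<exists>G. has_weak_gradient u G \<and> integrable lebesgue (\<lambda>x. (norm (G x))\<^sup>2))}"

text \<open>Distributions are represented by their action on test functions.\<close>

definition distr_of :: "(real^'n::finite \<Rightarrow> real) \<Rightarrow> (real^'n \<Rightarrow> real) \<Rightarrow> real" where
  "distr_of h \<phi> = (LINT x|lebesgue. h x * \<phi> x)"

definition distr_laplacian :: "(real^'n::finite \<Rightarrow> real) \<Rightarrow> (real^'n \<Rightarrow> real) \<Rightarrow> real" where
  "distr_laplacian h \<phi> = (LINT x|lebesgue. h x * laplacian \<phi> x)"

text \<open>The distribution \<open>T\<close> is, in the open set \<open>U\<close>, the positive Radon measure \<open>\<nu>\<close>.
  A measure on \<open>U\<close> is encoded as a Borel measure on the whole space that does not charge
  the complement of \<open>U\<close> and is finite on the compact subsets of \<open>U\<close>; these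
  conditions determine \<open>\<nu>\<close> uniquely from \<open>T\<close>.\<close>

definition is_positive_measure_in ::
    "(real^'n::finite) set \<Rightarrow> ((real^'n \<Rightarrow> real) \<Rightarrow> real) \<Rightarrow> (real^'n) measure \<Rightarrow> bool" where
  "is_positive_measure_in U T \<nu> \<longleftrightarrow> sets \<nu> = sets borel \<and> emeasure \<nu> (- U) = 0 \<and>
     (\<forall>K. compact K \<and> K \<subseteq> U \<longrightarrow> emeasure \<nu> K < \<infinity>) \<and>
     (\<forall>\<phi>. test_function U \<phi> \<longrightarrow> T \<phi> = (LINT x|\<nu>. \<phi> x))"

definition measure_support_in :: "(real^'n::finite) set \<Rightarrow> (real^'n) measure \<Rightarrow> (real^'n) set" where
  "measure_support_in U \<nu> = {x\<in>U. \<forall>r>0. emeasure \<nu> (ball x r) > 0}"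


section \<open>The functional\<close>

text \<open>\<open>N\<close>-tuples are functions on \<open>nat\<close> of which only the values on \<open>{1..N}\<close> matter;
  tuples of sets are made extensional so that a function of tuples depends on nothing else.\<close>

definition disjoint_tuples :: "nat \<Rightarrow> (real^'n::finite) set \<Rightarrow> (nat \<Rightarrow> (real^'n) set) set" where
  "disjoint_tuples N \<Omega> =
     {W \<in> {1..N} \<rightarrow>\<^sub>E {A \<in> sets borel. A \<subseteq> \<Omega>}. disjoint_family_on W {1..N}}"

definition admissible ::
    "nat \<Rightarrow> (real^'n::finite) set \<Rightarrow> ((nat \<Rightarrow> real^'n \<Rightarrow> real) \<times> (nat \<Rightarrow> (real^'n) set)) set" where
  "admissible N \<Omega> = {(u, W). W \<in> disjoint_tuples N \<Omega> \<and>
     (\<forall>i\<in>{1..N}. u i \<in> W12 \<and> (AE x in lebesgue. x \<notin> W i \<longrightarrow> u i x = 0))}"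

definition J_functional ::
    "nat \<Rightarrow> (nat \<Rightarrow> real^'n::finite \<Rightarrow> real) \<Rightarrow> (nat \<Rightarrow> real^'n \<Rightarrow> real) \<Rightarrow>
     ((nat \<Rightarrow> (real^'n) set) \<Rightarrow> real) \<Rightarrow>
     (nat \<Rightarrow> real^'n \<Rightarrow> real) \<Rightarrow> (nat \<Rightarrow> (real^'n) set) \<Rightarrow> real" where
  "J_functional N f g F u W =
     (\<Sum>i=1..N. LINT x|lebesgue. (norm (weak_gradient (u i) x))\<^sup>2) +
     (\<Sum>i=1..N. LINT x|lebesgue. (u i x)\<^sup>2 * f i x - u i x * g i x) + F W"

definition is_minimizer ::
    "nat \<Rightarrow> (real^'n::finite) set \<Rightarrow> (nat \<Rightarrow> real^'n \<Rightarrow> real) \<Rightarrow> (nat \<Rightarrow> real^'n \<Rightarrow> real) \<Rightarrow>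
     ((nat \<Rightarrow> (real^'n) set) \<Rightarrow> real) \<Rightarrow>
     (nat \<Rightarrow> real^'n \<Rightarrow> real) \<Rightarrow> (nat \<Rightarrow> (real^'n) set) \<Rightarrow> bool" where
  "is_minimizer N \<Omega> f g F u W \<longleftrightarrow> (u, W) \<in> admissible N \<Omega> \<and>
     (\<forall>(u', W')\<in>admissible N \<Omega>. J_functional N f g F u W \<le> J_functional N f g F u' W')"

definition ess_bounded_by :: "(real^'n::finite \<Rightarrow> real) \<Rightarrow> real \<Rightarrow> bool" where
  "ess_bounded_by h M \<longleftrightarrow> h \<in> borel_measurable lebesgue \<and> (AE x in lebesgue. \<bar>h x\<bar> \<le> M)"

text \<open>The tuple obtained from \<open>W\<close> by removing \<open>A\<close> from \<open>W 1\<close> and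
  adding \<open>A' j \<subseteq> A\<close> to the \<open>W j\<close> with \<open>j \<ge> 2\<close>.\<close>

definition reassign ::
    "nat \<Rightarrow> (nat \<Rightarrow> (real^'n::finite) set) \<Rightarrow> (real^'n) set \<Rightarrow> (nat \<Rightarrow> (real^'n) set) \<Rightarrow> nat \<Rightarrow> (real^'n) set" where
  "reassign N W A A' = (\<lambda>j\<in>{1..N}. if j = 1 then W 1 - A else W j \<union> A' j)"

text \<open>The set \<open>\<Omega>\<^sub>1\<close> where the continuous representative of \<open>u\<^sub>1\<close> is positive.
  The set \<open>\<Omega>\<close> only matters up to null sets in the problem, and almost every point of
  \<open>{x. u\<^sub>1 x > 0}\<close> lies in \<open>\<Omega>\<close>. No further intersection with \<open>\<Omega>\<close> is taken: it would
  change nothing if \<open>u\<^sub>1\<close> vanishes pointwise off \<open>\<Omega>\<close>, while a null set of holes of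
  \<open>\<Omega>\<close> inside the open set \<open>{u\<^sub>1 > 0}\<close> would otherwise create spurious points of the
  topological boundary.\<close>

definition positivity_set :: "(real^'n::finite \<Rightarrow> real) \<Rightarrow> (real^'n) set" where
  "positivity_set u = {x. u x > 0}"

text \<open>The distribution \<open>\<Delta>v - [f v - g/2] 1\<close> with \<open>v = max(0, u)\<close>.\<close>

definition mu_distr ::
    "(real^'n::finite \<Rightarrow> real) \<Rightarrow> (real^'n \<Rightarrow> real) \<Rightarrow> (real^'n \<Rightarrow> real) \<Rightarrow> (real^'n \<Rightarrow> real) \<Rightarrow> real" where
  "mu_distr u f g = (let v = (\<lambda>x. max 0 (u x)) in
     (\<lambda>\<phi>. distr_laplacian v \<phi> -
        distr_of (\<lambda>x. (f x * v x - g x / 2) * indicat_real (positivity_set u) x) \<phi>))"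

end

theory Submission
  imports Defs
begin

text \<open>
  Write \<open>u\<close> for the Lipschitz component \<open>u\<^sub>1\<close>, \<open>v = max 0 u\<close>, \<open>G\<close> for the weak gradient of
  \<open>u\<close>, \<open>B\<close> for the ball on which \<open>u\<close> is Lipschitz, \<open>T\<close> for the distribution \<open>\<mu>\<close> and \<open>n\<close> for
  the dimension.

  \<^emph>\<open>Positivity.\<close> Let \<open>\<eta>\<close> be a smooth step that vanishes on the nonpositive numbers. The
  function \<open>\<phi> \<eta>(k u)\<close> vanishes wherever \<open>u\<close> does, so any multiple of it may be added to \<open>u\<close>
  without changing the partition, and minimality gives an Euler-Lagrange equation
  (\<open>Euler_Lagrange\<close>). Rearranged, it says that the integral of
  \<open>k \<eta>'(k u) |G|\<^sup>2 \<phi>\<close> is minus the integral of \<open>\<eta>(k u) G \<bullet> \<nabla>\<phi> + \<eta>(k u) (f u - g/2) \<phi>\<close>. The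
  right-hand side tends to \<open>T \<phi>\<close> (\<open>T_limit\<close>), while the integrands on the left are
  nonnegative for \<open>\<phi> \<ge> 0\<close> and live on the set \<open>0 < u < 1/k\<close>. Hence \<open>T\<close> is positive and
  vanishes off the frontier of \<open>{u > 0}\<close>. A Riesz representation theorem for positive
  distributions (\<open>representation\<close>) then gives the measure.

  \<^emph>\<open>Upper bound.\<close> Near a point \<open>a\<close> of the frontier \<open>v \<le> C\<^sub>0 |x - a|\<close>, so testing with a bump at
  scale \<open>r\<close>, whose Laplacian is of order \<open>r\<^sup>-\<^sup>2\<close>, costs at most \<open>C r\<^sup>n\<^sup>-\<^sup>1\<close> (\<open>upper_bound\<close>).

  \<^emph>\<open>Nondegeneracy.\<close> If \<open>u \<le> c r\<close> on a ball of radius \<open>r\<close>, cutting \<open>u\<close> off to \<open>0\<close> on a smaller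
  concentric ball and giving the volume away saves \<open>\<lambda>\<close> times the volume of \<open>{u > 0}\<close> there,
  and costs at most a multiple of \<open>c\<close> times the volume of \<open>{u > 0}\<close> in the larger ball
  (\<open>mass_decay\<close>). After \<open>n + 1\<close> such steps the volume is of order \<open>c\<^sup>n\<^sup>+\<^sup>1 r\<^sup>n\<close>, whereas a point
  with \<open>u > c r / 2\<close> forces a volume of order \<open>c\<^sup>n r\<^sup>n\<close> because \<open>u\<close> is Lipschitz. So \<open>u \<le> c r / 2\<close>
  on the ball of half the radius (\<open>halving\<close>), and iterating at every nearby centre gives
  \<open>u \<le> 0\<close> near the centre. Around a frontier point the supremum of \<open>u\<close> over a ball of radius
  \<open>r\<close> is therefore at least a multiple of \<open>r\<close> (\<open>nondegeneracy\<close>).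

  \<^emph>\<open>Lower bound.\<close> Let \<open>m(s)\<close> be a smooth weighted mean of \<open>v\<close> at scale \<open>s\<close> around a frontier point.
  Nondegeneracy gives \<open>m(r) \<ge> c r\<close>, and \<open>m(\<delta> r) \<le> C \<delta> r\<close> is less than half of that for small \<open>\<delta>\<close>;
  so \<open>m'(s) \<ge> c/2\<close> for some \<open>s\<close> between \<open>\<delta> r\<close> and \<open>r\<close>. The weight is chosen so that
  \<open>m'(s)\<close> is \<open>s\<^sup>1\<^sup>-\<^sup>n\<close> times the integral of \<open>v\<close> against the Laplacian of a bump of radius \<open>s\<close>,
  which is at most the \<open>\<mu>\<close>-measure of the ball up to an error of order \<open>s\<^sup>n\<close>
  (\<open>DERIV_mean\<close>, \<open>lower_bound\<close>).

  The calculus needed for weak gradients is obtained from difference quotients: those of a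
  Lipschitz function are bounded, hence converge weakly to the weak gradient against continuous
  functions, and this gives the chain rule (\<open>dquot_weak_limit\<close>, \<open>chain_rule_smooth\<close>).
\<close>

section \<open>Calculus of smooth functions\<close>
lemma partial_deriv_eqI:
  assumes "(\<phi> has_derivative \<phi>') (at x)"
  shows "partial_deriv i \<phi> x = \<phi>' (axis i 1)"
  using assms unfolding partial_deriv_def by (metis frechet_derivative_at)

lemma C_k_continuous: "C_k k \<phi> \<Longrightarrow> continuous_on UNIV \<phi>"
  by (cases k) (auto simp: continuous_on_eq_continuous_at differentiable_imp_continuous_within)

lemma C_k_mono_Suc: "C_k (Suc k) \<phi> \<Longrightarrow> C_k k \<phi>"
proof (induction k arbitrary: \<phi>)
  case 0
  then show ?case using C_k_continuous[of "Suc 0"] by simp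
next
  case (Suc k)
  have "C_k k (partial_deriv i \<phi>)" for i
    using Suc.IH[of "partial_deriv i \<phi>"] Suc.prems by simp
  then show ?case using Suc.prems by simp
qed

lemma C_k_const: "C_k k (\<lambda>x. c)"
proof (induction k arbitrary: c)
  case (Suc k)
  have "partial_deriv i (\<lambda>x::real^'a. c) = (\<lambda>x. 0)" for i
    by (rule ext, rule partial_deriv_eqI[THEN trans]) (auto intro: has_derivative_const)
  then show ?case using Suc by simp
qed simp

lemma C_k_add: "C_k k \<phi> \<Longrightarrow> C_k k \<psi> \<Longrightarrow> C_k k (\<lambda>x. \<phi> x + \<psi> x)"
proof (induction k arbitrary: \<phi> \<psi>)
  case 0 then show ?case by (auto intro: continuous_on_add)
next
  case (Suc k)
  have "partial_deriv i (\<lambda>x. \<phi> x + \<psi> x) = (\<lambda>x. partial_deriv i \<phi> x + partial_deriv i \<psi> x)" for i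
    using Suc.prems
    by (intro ext partial_deriv_eqI[THEN trans])
       (auto intro!: has_derivative_add simp: frechet_derivative_works partial_deriv_def)
  then show ?case using Suc by auto
qed

lemma C_k_mult: "C_k k \<phi> \<Longrightarrow> C_k k \<psi> \<Longrightarrow> C_k k (\<lambda>x. \<phi> x * \<psi> x)"
proof (induction k arbitrary: \<phi> \<psi>)
  case 0 then show ?case by (auto intro: continuous_on_mult)
next
  case (Suc k)
  have "partial_deriv i (\<lambda>x. \<phi> x * \<psi> x) = (\<lambda>x. \<phi> x * partial_deriv i \<psi> x + partial_deriv i \<phi> x * \<psi> x)" for i
    using Suc.prems
    by (intro ext partial_deriv_eqI[THEN trans])
       (auto intro!: has_derivative_mult simp: frechet_derivative_works partial_deriv_def)
  then show ?case using Suc C_k_mono_Suc[OF Suc.prems(1)] C_k_mono_Suc[OF Suc.prems(2)]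
    by (auto intro!: C_k_add)
qed

lemma C_k_nth: "C_k k (\<lambda>x. x $ j)"
proof (cases k)
  case (Suc m)
  have d: "((\<lambda>x::real^'a. x $ j) has_derivative (\<lambda>h. h $ j)) (at x)" for x
    by (rule bounded_linear.has_derivative[OF bounded_linear_vec_nth]) (rule has_derivative_ident)
  have "partial_deriv i (\<lambda>x::real^'a. x $ j) = (\<lambda>x. axis i 1 $ j)" for i
    by (rule ext, rule partial_deriv_eqI[OF d])
  then show ?thesis unfolding Suc using d C_k_const by (auto simp: differentiable_def)
qed (simp add: continuous_intros)

lemma C_k_sum: "(\<And>j. j \<in> S \<Longrightarrow> C_k k (\<phi> j)) \<Longrightarrow> C_k k (\<lambda>x. \<Sum>j\<in>S. \<phi> j x)"
  by (induction S rule: infinite_finite_induct) (auto simp: C_k_const intro: C_k_add)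

definition smooth :: "(real^'n::finite \<Rightarrow> real) \<Rightarrow> bool" where
  "smooth \<phi> \<longleftrightarrow> (\<forall>k. C_k k \<phi>)"

named_theorems smooth_intros

lemma smooth_const [smooth_intros]: "smooth (\<lambda>x. c)"
  and smooth_nth [smooth_intros]: "smooth (\<lambda>x. x $ j)"
  and smooth_add [smooth_intros]: "smooth \<phi> \<Longrightarrow> smooth \<psi> \<Longrightarrow> smooth (\<lambda>x. \<phi> x + \<psi> x)"
  and smooth_mult [smooth_intros]: "smooth \<phi> \<Longrightarrow> smooth \<psi> \<Longrightarrow> smooth (\<lambda>x. \<phi> x * \<psi> x)"
  by (auto simp: smooth_def C_k_const C_k_nth C_k_add C_k_mult)

lemma smooth_sum [smooth_intros]: "(\<And>j. j \<in> S \<Longrightarrow> smooth (\<phi> j)) \<Longrightarrow> smooth (\<lambda>x. \<Sum>j\<in>S. \<phi> j x)"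
  by (auto simp: smooth_def C_k_sum)

lemma smooth_diff [smooth_intros]: "smooth \<phi> \<Longrightarrow> smooth \<psi> \<Longrightarrow> smooth (\<lambda>x. \<phi> x - \<psi> x)"
  using smooth_add[OF _ smooth_mult[OF smooth_const[of "-1"]], of \<phi> \<psi>] by simp

lemma smooth_continuous: "smooth \<phi> \<Longrightarrow> continuous_on S \<phi>"
  unfolding smooth_def using C_k_continuous[of 0] continuous_on_subset by blast

lemma smooth_differentiable: "smooth \<phi> \<Longrightarrow> \<phi> differentiable at x"
  unfolding smooth_def by (metis C_k.simps(2))

lemma smooth_partial_deriv [smooth_intros]: "smooth \<phi> \<Longrightarrow> smooth (partial_deriv i \<phi>)"
  unfolding smooth_def by (metis C_k.simps(2))

lemma partial_deriv_add:
  "smooth \<phi> \<Longrightarrow> smooth \<psi> \<Longrightarrow> partial_deriv i (\<lambda>x. \<phi> x + \<psi> x) = (\<lambda>x. partial_deriv i \<phi> x + partial_deriv i \<psi> x)"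
  using smooth_differentiable
  by (intro ext partial_deriv_eqI[THEN trans])
     (auto intro!: has_derivative_add simp: frechet_derivative_works partial_deriv_def)

lemma partial_deriv_mult:
  "smooth \<phi> \<Longrightarrow> smooth \<psi> \<Longrightarrow>
    partial_deriv i (\<lambda>x. \<phi> x * \<psi> x) = (\<lambda>x. \<phi> x * partial_deriv i \<psi> x + partial_deriv i \<phi> x * \<psi> x)"
  using smooth_differentiable
  by (intro ext partial_deriv_eqI[THEN trans])
     (auto intro!: has_derivative_mult simp: frechet_derivative_works partial_deriv_def)

lemma partial_deriv_const: "partial_deriv i (\<lambda>x. c) = (\<lambda>x. 0)"
  by (rule ext, rule partial_deriv_eqI[THEN trans]) (auto intro: has_derivative_const)

lemma partial_deriv_cmult:
  "smooth \<phi> \<Longrightarrow> partial_deriv i (\<lambda>x. c * \<phi> x) = (\<lambda>x. c * partial_deriv i \<phi> x)"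
  using partial_deriv_mult[OF smooth_const, of \<phi> i c] by (simp add: partial_deriv_const)

lemma laplacian_add:
  "smooth \<phi> \<Longrightarrow> smooth \<psi> \<Longrightarrow> laplacian (\<lambda>x. \<phi> x + \<psi> x) x = laplacian \<phi> x + laplacian \<psi> x"
  unfolding laplacian_def by (simp add: partial_deriv_add smooth_partial_deriv sum.distrib)

lemma laplacian_cmult:
  "smooth \<phi> \<Longrightarrow> laplacian (\<lambda>x. c * \<phi> x) x = c * laplacian \<phi> x"
  unfolding laplacian_def by (simp add: partial_deriv_cmult smooth_partial_deriv sum_distrib_left)

text \<open>
  The one-dimensional analogue of \<open>C_k\<close>: outer functions of compositions.
\<close>
primrec D_k :: "nat \<Rightarrow> (real \<Rightarrow> real) \<Rightarrow> bool" where
  "D_k 0 h \<longleftrightarrow> continuous_on UNIV h"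
| "D_k (Suc k) h \<longleftrightarrow> (\<exists>h'. (\<forall>x. (h has_real_derivative h' x) (at x)) \<and> D_k k h')"

lemma D_k_SucI: "(\<And>x. (h has_real_derivative h' x) (at x)) \<Longrightarrow> D_k k h' \<Longrightarrow> D_k (Suc k) h"
  by auto

definition smooth1 :: "(real \<Rightarrow> real) \<Rightarrow> bool" where
  "smooth1 h \<longleftrightarrow> (\<forall>k. D_k k h)"

lemma D_k_continuous: "D_k k h \<Longrightarrow> continuous_on UNIV h"
  by (cases k) (auto simp: continuous_on_eq_continuous_at intro: DERIV_isCont)

lemma D_k_mono_Suc: "D_k (Suc k) h \<Longrightarrow> D_k k h"
proof (induction k arbitrary: h)
  case 0
  then show ?case using D_k_continuous[of "Suc 0"] by simp
next
  case (Suc k)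
  then obtain h' where "\<forall>x. (h has_real_derivative h' x) (at x)" "D_k (Suc k) h'" by auto
  with Suc.IH[of h'] show ?case by auto
qed

lemma D_k_const: "D_k k (\<lambda>x. c)"
  by (induction k arbitrary: c) (auto intro: exI[of _ "\<lambda>x. 0"])

lemma D_k_add: "D_k k f \<Longrightarrow> D_k k g \<Longrightarrow> D_k k (\<lambda>x. f x + g x)"
proof (induction k arbitrary: f g)
  case 0 then show ?case by (auto intro: continuous_on_add)
next
  case (Suc k)
  then obtain f' g' where "\<forall>x. (f has_real_derivative f' x) (at x)" "D_k k f'"
    "\<forall>x. (g has_real_derivative g' x) (at x)" "D_k k g'" by auto
  with Suc.IH[of f' g'] show ?case
    by (auto intro!: exI[of _ "\<lambda>x. f' x + g' x"] DERIV_add)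
qed

lemma D_k_mult: "D_k k f \<Longrightarrow> D_k k g \<Longrightarrow> D_k k (\<lambda>x. f x * g x)"
proof (induction k arbitrary: f g)
  case 0 then show ?case by (auto intro: continuous_on_mult)
next
  case (Suc k)
  then obtain f' g' where *: "\<forall>x. (f has_real_derivative f' x) (at x)" "D_k k f'"
    "\<forall>x. (g has_real_derivative g' x) (at x)" "D_k k g'" by auto
  have "D_k k (\<lambda>x. f' x * g x + g' x * f x)"
    using * D_k_mono_Suc[OF Suc.prems(1)] D_k_mono_Suc[OF Suc.prems(2)] by (intro D_k_add Suc.IH)
  moreover have "((\<lambda>x. f x * g x) has_real_derivative f' x * g x + g' x * f x) (at x)" for x
    using * by (intro DERIV_mult) auto
  ultimately show ?case by (rule D_k_SucI[rotated])
qed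

lemma D_k_affine: "D_k k h \<Longrightarrow> D_k k (\<lambda>x. h (a * x + b))"
proof (induction k arbitrary: h)
  case 0 then show ?case
    by (auto intro!: continuous_on_compose2[of UNIV h] continuous_intros)
next
  case (Suc k)
  then obtain h' where *: "\<forall>x. (h has_real_derivative h' x) (at x)" "D_k k h'" by auto
  have "((\<lambda>x. h (a * x + b)) has_real_derivative h' (a * x + b) * a) (at x)" for x
    by (rule DERIV_chain2[of h, OF _]) (use * in \<open>auto intro!: derivative_eq_intros\<close>)
  moreover have "D_k k (\<lambda>x. h' (a * x + b) * a)"
    using D_k_mult[OF Suc.IH[OF *(2)] D_k_const[of k a]] by simp
  ultimately show ?case by (rule D_k_SucI)
qed

lemma smooth1_const [smooth_intros]: "smooth1 (\<lambda>x. c)"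
  and smooth1_add [smooth_intros]: "smooth1 f \<Longrightarrow> smooth1 g \<Longrightarrow> smooth1 (\<lambda>x. f x + g x)"
  and smooth1_mult [smooth_intros]: "smooth1 f \<Longrightarrow> smooth1 g \<Longrightarrow> smooth1 (\<lambda>x. f x * g x)"
  and smooth1_affine: "smooth1 f \<Longrightarrow> smooth1 (\<lambda>x. f (a * x + b))"
  by (auto simp: smooth1_def D_k_const D_k_add D_k_mult D_k_affine)

lemma smooth1_antideriv:
  "(\<And>x. (F has_real_derivative f x) (at x)) \<Longrightarrow> smooth1 f \<Longrightarrow> smooth1 F"
  unfolding smooth1_def
  by (metis D_k.simps(2) D_k_mono_Suc)

lemma smooth1_obtain_deriv:
  assumes "smooth1 f"
  obtains f' where "\<And>x. (f has_real_derivative f' x) (at x)" "smooth1 f'"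
proof -
  obtain f' where f': "\<And>x. (f has_real_derivative f' x) (at x)"
    using assms unfolding smooth1_def by (metis D_k.simps(2))
  have "D_k k f'" for k
  proof -
    obtain g where g: "\<And>x. (f has_real_derivative g x) (at x)" "D_k k g"
      using assms unfolding smooth1_def by (metis D_k.simps(2))
    then have "g = f'" using f' DERIV_unique by blast
    with g show ?thesis by simp
  qed
  with f' that show ?thesis by (auto simp: smooth1_def)
qed

lemma smooth1_continuous: "smooth1 f \<Longrightarrow> continuous_on S f"
  unfolding smooth1_def using D_k_continuous[of 0] continuous_on_subset by blast

lemma C_k_compose: "D_k k h \<Longrightarrow> C_k k \<phi> \<Longrightarrow> C_k k (\<lambda>x. h (\<phi> x))"
proof (induction k arbitrary: h)
  case 0 then show ?case
    by (auto intro!: continuous_on_compose2[of UNIV h])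
next
  case (Suc k)
  then obtain h' where *: "\<And>x. (h has_real_derivative h' x) (at x)" "D_k k h'" by auto
  have d: "((\<lambda>x. h (\<phi> x)) has_derivative (\<lambda>v. h' (\<phi> x) * frechet_derivative \<phi> (at x) v)) (at x)" for x
    using *(1)[of "\<phi> x"] Suc.prems(2)
    by (auto simp: frechet_derivative_works has_field_derivative_def dest: has_derivative_compose)
  have "partial_deriv i (\<lambda>x. h (\<phi> x)) = (\<lambda>x. h' (\<phi> x) * partial_deriv i \<phi> x)" for i
    by (rule ext, subst partial_deriv_eqI[OF d]) (simp add: partial_deriv_def)
  moreover have "C_k k (\<lambda>x. h' (\<phi> x) * partial_deriv i \<phi> x)" for i
    using Suc.IH[OF *(2) C_k_mono_Suc[OF Suc.prems(2)]] Suc.prems(2) by (auto intro!: C_k_mult)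
  ultimately show ?case using d by (auto simp: differentiable_def)
qed

lemma smooth_compose: "smooth1 h \<Longrightarrow> smooth \<phi> \<Longrightarrow> smooth (\<lambda>x. h (\<phi> x))"
  by (auto simp: smooth_def smooth1_def C_k_compose)

lemma partial_deriv_compose:
  assumes "(h has_real_derivative h') (at (\<phi> x))" "\<phi> differentiable at x"
  shows "partial_deriv i (\<lambda>x. h (\<phi> x)) x = h' * partial_deriv i \<phi> x"
proof -
  have "((\<lambda>x. h (\<phi> x)) has_derivative (\<lambda>v. h' * frechet_derivative \<phi> (at x) v)) (at x)"
    using assms
    by (auto simp: frechet_derivative_works has_field_derivative_def dest: has_derivative_compose)
  from partial_deriv_eqI[OF this] show ?thesis by (simp add: partial_deriv_def)
qed

definition bump_exp :: "real \<Rightarrow> real" where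
  "bump_exp t = (if t > 0 then exp (- inverse t) else 0)"

lemma poly_exp_tendsto_0: "((\<lambda>y. poly p y * exp (- y)) \<longlongrightarrow> (0::real)) at_top"
proof (induction p)
  case 0 then show ?case by simp
next
  case (pCons a p)
  have "((\<lambda>y::real. \<Sum>i\<le>degree (pCons a p). coeff (pCons a p) i * (y ^ i / exp y)) \<longlongrightarrow> (\<Sum>i\<le>degree (pCons a p). coeff (pCons a p) i * 0)) at_top"
    by (intro tendsto_intros tendsto_power_div_exp_0)
  then show ?case
    by (simp only: poly_altdef sum_distrib_right exp_minus divide_inverse mult.assoc mult_zero_right sum.neutral_const)
qed

text \<open>
  The functions \<open>p(1/t) exp(-1/t)\<close>, extended by \<open>0\<close>, form a class that is closed under
  differentiation, because the factor \<open>1/t\<^sup>2\<close> from the chain rule is again a polynomial in \<open>1/t\<close>;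
  so it is enough to differentiate once, and only the point \<open>0\<close> needs an argument.
\<close>
lemma D_k_poly_exp: "D_k k (\<lambda>t. if t > 0 then poly p (inverse t) * exp (- inverse t) else 0)"
proof (induction k arbitrary: p)
  have lim: "((\<lambda>t. if t > 0 then poly p (inverse t) * exp (- inverse t) else 0) \<longlongrightarrow> 0) (at (0::real))" for p
  proof -
    have "((\<lambda>t. poly p (inverse t) * exp (- inverse t)) \<longlongrightarrow> 0) (at_right (0::real))"
      by (rule filterlim_compose[OF poly_exp_tendsto_0 filterlim_inverse_at_top_right])
    then have r: "((\<lambda>t. if t > 0 then poly p (inverse t) * exp (- inverse t) else 0) \<longlongrightarrow> 0) (at_right (0::real))"
      by (rule Lim_transform_eventually) (auto simp: eventually_at_filter)
    have l: "((\<lambda>t. if t > 0 then poly p (inverse t) * exp (- inverse t) else 0) \<longlongrightarrow> 0) (at_left (0::real))"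
      by (rule Lim_transform_eventually[OF tendsto_const]) (auto simp: eventually_at_filter)
    show ?thesis using l r by (simp add: filterlim_split_at)
  qed
  have D: "((\<lambda>t. if t > 0 then poly p (inverse t) * exp (- inverse t) else 0) has_real_derivative
        (if t > 0 then poly ([:0,0,1:] * (p - pderiv p)) (inverse t) * exp (- inverse t) else 0)) (at t)"
    (is "(?f has_real_derivative ?f' t) (at t)") for p t
  proof -
    consider "t > 0" | "t < 0" | "t = 0" by linarith
    then show ?thesis
    proof cases
      case 1
      have "((\<lambda>t. poly p (inverse t) * exp (- inverse t)) has_real_derivative ?f' t) (at t)"
        using 1 by (auto intro!: derivative_eq_intros DERIV_chain2[OF poly_DERIV] simp: field_simps power2_eq_square)
      then show ?thesis
        by (rule DERIV_cong_ev[THEN iffD1, rotated -1])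
           (use 1 in \<open>auto intro: eventually_mono[OF eventually_gt_at_top] simp: eventually_nhds intro!: exI[of _ "{0<..}"]\<close>)
    next
      case 2
      have "((\<lambda>t. 0) has_real_derivative ?f' t) (at t)" using 2 by simp
      then show ?thesis
        by (rule DERIV_cong_ev[THEN iffD1, rotated -1])
           (use 2 in \<open>auto simp: eventually_nhds intro!: exI[of _ "{..<0}"]\<close>)
    next
      case 3
      have "((\<lambda>t. if t > 0 then poly ([:0,1:] * p) (inverse t) * exp (- inverse t) else 0) \<longlongrightarrow> 0) (at (0::real))"
        by (rule lim)
      then have "((\<lambda>h. (?f (0 + h) - ?f 0) / h) \<longlongrightarrow> 0) (at 0)"
        by (rule Lim_transform_eventually) (auto simp: eventually_at_filter field_simps)
      then show ?thesis unfolding 3 DERIV_def by simp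
    qed
  qed
  {
    case 0
    show ?case using D[of p] by (auto simp: continuous_on_eq_continuous_at intro: DERIV_isCont)
  next
    case (Suc k)
    show ?case by (rule D_k_SucI[OF D Suc])
  }
qed

lemma smooth1_bump_exp: "smooth1 bump_exp"
  unfolding smooth1_def bump_exp_def[abs_def]
proof
  show "D_k k (\<lambda>t. if t > 0 then exp (- inverse t) else 0)" for k
    using D_k_poly_exp[where p="[:1:]" and k=k] by (simp cong: if_cong)
qed

section \<open>Steps, bumps and smooth cutoffs\<close>
lemma bump_exp_nonneg: "0 \<le> bump_exp t"
  and bump_exp_pos: "0 < t \<Longrightarrow> 0 < bump_exp t"
  and bump_exp_zero: "t \<le> 0 \<Longrightarrow> bump_exp t = 0"
  by (auto simp: bump_exp_def)

lemma bump_exp_mono: "s \<le> t \<Longrightarrow> bump_exp s \<le> bump_exp t"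
  by (auto simp: bump_exp_def le_imp_inverse_le)

text \<open>
  At \<open>0\<close> the value of the derivative follows from its continuity.
\<close>
lemma DERIV_bump_exp:
  "(bump_exp has_real_derivative bump_exp t * (inverse t)\<^sup>2) (at t)"
proof -
  obtain E' where E': "\<And>x. (bump_exp has_real_derivative E' x) (at x)" "smooth1 E'"
    using smooth1_obtain_deriv[OF smooth1_bump_exp] by blast
  have pos: "E' t = bump_exp t * (inverse t)\<^sup>2" if "t > 0" for t
  proof -
    have "((\<lambda>t. exp (- inverse t)) has_real_derivative exp (- inverse t) * (inverse t)\<^sup>2) (at t)"
      using that by (auto intro!: derivative_eq_intros simp: power2_eq_square)
    then have "(bump_exp has_real_derivative exp (- inverse t) * (inverse t)\<^sup>2) (at t)"
      by (rule DERIV_cong_ev[THEN iffD1, rotated -1])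
        (use that in \<open>auto simp: eventually_nhds bump_exp_def intro!: exI[of _ "{0<..}"]\<close>)
    from DERIV_unique[OF E'(1) this] show ?thesis using that by (simp add: bump_exp_def)
  qed
  have neg: "E' t = 0" if "t < 0" for t
  proof -
    have "((\<lambda>t. 0) has_real_derivative 0) (at t)" by simp
    then have "(bump_exp has_real_derivative 0) (at t)"
      by (rule DERIV_cong_ev[THEN iffD1, rotated -1])
        (use that in \<open>auto simp: eventually_nhds bump_exp_def intro!: exI[of _ "{..<0}"]\<close>)
    from DERIV_unique[OF E'(1) this] show ?thesis .
  qed
  have "E' t = bump_exp t * (inverse t)\<^sup>2"
  proof -
    consider "t > 0" | "t < 0" | "t = 0" by linarith
    then show ?thesis
    proof cases
      case 3
      have "(E' \<longlongrightarrow> E' 0) (at_left 0)"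
        using smooth1_continuous[OF E'(2), of UNIV]
        by (metis UNIV_I continuous_on_def filterlim_at_split)
      moreover have "(E' \<longlongrightarrow> 0) (at_left 0)"
        by (rule Lim_transform_eventually[OF tendsto_const]) (auto simp: eventually_at_filter neg)
      ultimately have "E' 0 = 0" using tendsto_unique trivial_limit_at_left_real by blast
      then show ?thesis by (simp add: 3 bump_exp_def)
    qed (use pos neg in \<open>auto simp: bump_exp_def\<close>)
  qed
  with E'(1)[of t] show ?thesis by simp
qed

text \<open>
  Integrating from \<open>-1\<close> instead of \<open>0\<close> puts every \<open>t \<ge> 0\<close> in the interior of the interval of
  integration and changes nothing, since \<open>f\<close> vanishes on the negative axis.
\<close>
lemma smooth1_antideriv_ex:
  assumes "smooth1 f" "\<And>t. t \<le> 0 \<Longrightarrow> f t = 0"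
  obtains F where "smooth1 F" "\<And>t. (F has_real_derivative f t) (at t)" "\<And>t. t \<le> 0 \<Longrightarrow> F t = 0"
proof -
  define F where "F t = integral {-1..t} f" for t
  have F0: "F t = 0" if "t \<le> 0" for t
  proof -
    have "F t = integral {-1..t} (\<lambda>x. 0)"
      unfolding F_def using that assms(2) by (intro integral_cong) auto
    then show ?thesis by simp
  qed
  have D: "(F has_real_derivative f t) (at t)" for t
  proof (cases "t < 0")
    case True
    have "((\<lambda>t. 0) has_real_derivative 0) (at t)" by simp
    then have "(F has_real_derivative 0) (at t)"
      by (rule DERIV_cong_ev[THEN iffD1, rotated -1])
        (use True F0 in \<open>auto simp: eventually_nhds intro!: exI[of _ "{..<0}"]\<close>)
    then show ?thesis using assms(2) True by simp
  next
    case False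
    have "(F has_real_derivative f t) (at t within {-1..t+1})"
      unfolding F_def[abs_def]
      by (rule integral_has_real_derivative) (use False smooth1_continuous[OF assms(1)] in auto)
    then show ?thesis using False by (simp add: at_within_Icc_at)
  qed
  show thesis by (rule that[of F]) (use D F0 smooth1_antideriv[OF D assms(1)] in auto)
qed

text \<open>
  A normalized antiderivative of \<open>exp(-1/t) exp(-1/(1-t))\<close>, the bump on the unit interval.
\<close>
lemma smooth_step_ex:
  "\<exists>s. smooth1 s \<and> (\<forall>t. 0 \<le> s t \<and> s t \<le> 1) \<and> (\<forall>t\<le>0. s t = 0) \<and> (\<forall>t\<ge>1. s t = 1) \<and> mono s"
proof -
  define k where "k t = bump_exp t * bump_exp (- 1 * t + 1)" for t
  have k: "smooth1 k" unfolding k_def[abs_def]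
    by (intro smooth1_mult smooth1_bump_exp smooth1_affine)
  have kn: "0 \<le> k t" for t by (simp add: k_def bump_exp_nonneg)
  obtain F where F: "smooth1 F" "\<And>t. (F has_real_derivative k t) (at t)" "\<And>t. t \<le> 0 \<Longrightarrow> F t = 0"
    using smooth1_antideriv_ex[OF k] by (auto simp: k_def bump_exp_zero)
  have mono: "F a \<le> F b" if "a \<le> b" for a b
    using that F(2) kn by (meson DERIV_nonneg_imp_nondecreasing)
  have "F 0 < F 1"
  proof (rule DERIV_pos_imp_increasing_open[of 0 1])
    show "continuous_on {0..1} F" by (rule smooth1_continuous[OF F(1)])
    show "\<exists>y. (F has_real_derivative y) (at x) \<and> 0 < y" if "0 < x" "x < 1" for x
      using F(2)[of x] that by (intro exI[of _ "k x"]) (auto simp: k_def bump_exp_pos)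
  qed simp
  then have pos: "0 < F 1" by (simp add: F(3))
  have F1: "F t = F 1" if "t \<ge> 1" for t
  proof (cases "t = 1")
    case False
    show ?thesis
    proof (rule DERIV_isconst_end[of 1 t])
      show "(F has_real_derivative 0) (at x)" if "1 < x" "x < t" for x
        using F(2)[of x] that by (simp add: k_def bump_exp_zero)
    qed (use that False smooth1_continuous[OF F(1)] in auto)
  qed simp
  define s where "s t = inverse (F 1) * F t" for t
  have s1: "s t \<le> 1" for t
  proof -
    have "F t \<le> F 1" using mono F1 linear by metis
    then show ?thesis using pos by (simp add: s_def field_simps)
  qed
  have "0 \<le> F t" for t using mono F(3) by (metis linear order_refl)
  then have "smooth1 s \<and> (\<forall>t. 0 \<le> s t \<and> s t \<le> 1) \<and> (\<forall>t\<le>0. s t = 0) \<and> (\<forall>t\<ge>1. s t = 1) \<and> mono s"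
  proof (intro conjI allI impI)
    show "smooth1 s" unfolding s_def[abs_def] by (intro smooth1_mult smooth1_const F(1))
    show "mono s" using mono pos by (intro monoI) (simp add: s_def mult_left_mono)
    show "s t = 1" if "t \<ge> 1" for t using pos F1[OF that] by (simp add: s_def)
  qed (use \<open>\<And>t. 0 \<le> F t\<close> pos F(3) s1 in \<open>auto simp: s_def\<close>)
  then show ?thesis by blast
qed

definition smooth_step :: "real \<Rightarrow> real" where
  "smooth_step = (SOME s. smooth1 s \<and> (\<forall>t. 0 \<le> s t \<and> s t \<le> 1) \<and> (\<forall>t\<le>0. s t = 0) \<and> (\<forall>t\<ge>1. s t = 1) \<and> mono s)"

lemma smooth1_smooth_step: "smooth1 smooth_step"
  and smooth_step_nonneg: "0 \<le> smooth_step t"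
  and smooth_step_le_1: "smooth_step t \<le> 1"
  and smooth_step_0: "t \<le> 0 \<Longrightarrow> smooth_step t = 0"
  and smooth_step_1: "t \<ge> 1 \<Longrightarrow> smooth_step t = 1"
  and smooth_step_mono: "mono smooth_step"
  using someI_ex[OF smooth_step_ex] unfolding smooth_step_def[symmetric] by auto

lemma smooth_step_scaled_limit: "(\<lambda>k. smooth_step (real (Suc k) * t)) \<longlonglongrightarrow> of_bool (0 < t)"
proof (cases "t \<le> 0")
  case True
  then show ?thesis by (simp add: smooth_step_0 mult_nonneg_nonpos del: of_nat_Suc)
next
  case False
  obtain n where n: "inverse (real (Suc n)) < t" using reals_Archimedean[of t] False by auto
  have "smooth_step (real (Suc k) * t) = 1" if "n \<le> k" for k
  proof -
    have "1 \<le> real (Suc n) * t" using n by (simp add: field_simps)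
    also have "\<dots> \<le> real (Suc k) * t" using that False by (intro mult_right_mono) auto
    finally show ?thesis by (rule smooth_step_1)
  qed
  then have "\<forall>\<^sub>F k in sequentially. (1::real) = smooth_step (real (Suc k) * t)"
    unfolding eventually_sequentially by metis
  from Lim_transform_eventually[OF tendsto_const this] show ?thesis using False by simp
qed

lemma smooth_norm_sq [smooth_intros]: "smooth (\<lambda>x. (norm (x - a))\<^sup>2)"
proof -
  have "(norm (x - a))\<^sup>2 = (\<Sum>j\<in>UNIV. (x $ j - a $ j) * (x $ j - a $ j))" for x
    by (simp add: power2_norm_eq_inner inner_vec_def)
  then show ?thesis by (simp only:) (intro smooth_intros)
qed

lemma partial_deriv_norm_sq: "partial_deriv i (\<lambda>x. (norm (x - a))\<^sup>2) x = 2 * (x $ i - a $ i)"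
proof -
  have "((\<lambda>x. (norm (x - a))\<^sup>2) has_derivative (\<lambda>h. 2 * ((x - a) \<bullet> h))) (at x)"
    unfolding power2_norm_eq_inner by (auto intro!: derivative_eq_intros simp: inner_commute)
  from partial_deriv_eqI[OF this] show ?thesis by (simp add: inner_axis)
qed

lemma partial_deriv_radial:
  assumes "\<And>t. (Q has_real_derivative Q' t) (at t)"
  shows "partial_deriv i (\<lambda>x. Q ((norm (x - a))\<^sup>2)) = (\<lambda>x. Q' ((norm (x - a))\<^sup>2) * (2 * (x $ i - a $ i)))"
  by (rule ext, subst partial_deriv_compose[OF assms])
    (auto simp: partial_deriv_norm_sq intro!: smooth_differentiable smooth_norm_sq)

text \<open>
  The Laplacian of \<open>Q(|x - a|\<^sup>2)\<close> is \<open>4 r Q'' + 2 n Q'\<close> in the variable \<open>r = |x - a|\<^sup>2\<close>. Using the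
  squared distance keeps radial functions smooth at the centre.
\<close>
lemma laplacian_radial:
  assumes Q: "\<And>t. (Q has_real_derivative Q' t) (at t)" "\<And>t. (Q' has_real_derivative Q'' t) (at t)"
    and sm: "smooth1 Q'"
  shows "laplacian (\<lambda>x::real^'n::finite. Q ((norm (x - a))\<^sup>2)) x =
    4 * (norm (x - a))\<^sup>2 * Q'' ((norm (x - a))\<^sup>2) + 2 * real CARD('n) * Q' ((norm (x - a))\<^sup>2)"
proof -
  let ?q = "(norm (x - a))\<^sup>2"
  have sd: "smooth (\<lambda>x::real^'n. 2 * (x $ i - a $ i))" for i by (intro smooth_intros)
  have pd2: "partial_deriv i (\<lambda>x::real^'n. 2 * (x $ i - a $ i)) x = 2" for i
  proof -
    have "((\<lambda>x::real^'n. 2 * (x $ i - a $ i)) has_derivative (\<lambda>h. 2 * h $ i)) (at x)"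
      by (auto intro!: derivative_eq_intros bounded_linear.has_derivative[OF bounded_linear_vec_nth])
    from partial_deriv_eqI[OF this] show ?thesis by simp
  qed
  have "partial_deriv i (partial_deriv i (\<lambda>x::real^'n. Q ((norm (x - a))\<^sup>2))) x
      = 2 * Q' ?q + 4 * Q'' ?q * ((x $ i - a $ i) * (x $ i - a $ i))" for i
  proof -
    have "partial_deriv i (\<lambda>x. Q' ((norm (x - a))\<^sup>2) * (2 * (x $ i - a $ i)))
      = (\<lambda>x. Q' ((norm (x - a))\<^sup>2) * partial_deriv i (\<lambda>x. 2 * (x $ i - a $ i)) x
          + partial_deriv i (\<lambda>x. Q' ((norm (x - a))\<^sup>2)) x * (2 * (x $ i - a $ i)))"
      by (rule partial_deriv_mult[OF smooth_compose[OF sm smooth_norm_sq] sd])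
    then show ?thesis
      by (simp only: partial_deriv_radial[OF Q(1)] partial_deriv_radial[OF Q(2)] pd2 mult_ac) (simp add: algebra_simps)?
  qed
  then have "laplacian (\<lambda>x::real^'n. Q ((norm (x - a))\<^sup>2)) x
     = 2 * real CARD('n) * Q' ?q + 4 * Q'' ?q * (\<Sum>i\<in>UNIV. (x $ i - a $ i) * (x $ i - a $ i))"
    by (simp add: laplacian_def sum.distrib flip: sum_distrib_left)
  also have "(\<Sum>i\<in>UNIV. (x $ i - a $ i) * (x $ i - a $ i)) = ?q"
    by (simp add: power2_norm_eq_inner inner_vec_def)
  finally show ?thesis by simp
qed

text \<open>
  Supports are handled through any compact set off which the function vanishes.
\<close>
lemma test_functionI:
  assumes "smooth \<phi>" "compact K" "K \<subseteq> U" "\<And>x. x \<notin> K \<Longrightarrow> \<phi> x = 0"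
  shows "test_function U \<phi>"
proof -
  have "closure {x. \<phi> x \<noteq> 0} \<subseteq> K"
    using assms by (intro closure_minimal) (auto intro: compact_imp_closed)
  moreover from this have "compact (closure {x. \<phi> x \<noteq> 0})"
    using compact_Int_closed[OF assms(2) closed_closure, of "{x. \<phi> x \<noteq> 0}"] by (simp add: Int_absorb1)
  ultimately show ?thesis using assms(1,3) unfolding test_function_def smooth_def by blast
qed

lemma test_function_smooth: "test_function U \<phi> \<Longrightarrow> smooth \<phi>"
  by (simp add: test_function_def smooth_def)

lemma test_function_support:
  assumes "test_function U \<phi>"
  obtains K where "compact K" "K \<subseteq> U" "\<And>x. x \<notin> K \<Longrightarrow> \<phi> x = 0"
proof (rule that[of "closure {x. \<phi> x \<noteq> 0}"])
  show "\<phi> x = 0" if "x \<notin> closure {x. \<phi> x \<noteq> 0}" for x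
    using that closure_subset[of "{x. \<phi> x \<noteq> 0}"] by blast
qed (use assms in \<open>auto simp: test_function_def\<close>)

lemma test_function_mono: "test_function U \<phi> \<Longrightarrow> U \<subseteq> V \<Longrightarrow> test_function V \<phi>"
  by (auto simp: test_function_def)

lemma test_function_mult:
  assumes "test_function U \<phi>" "smooth \<psi>" shows "test_function U (\<lambda>x. \<phi> x * \<psi> x)"
proof -
  obtain K where K: "compact K" "K \<subseteq> U" "\<And>x. x \<notin> K \<Longrightarrow> \<phi> x = 0"
    by (rule test_function_support[OF assms(1)]) blast
  show ?thesis
    by (rule test_functionI[OF smooth_mult[OF test_function_smooth[OF assms(1)] assms(2)] K(1,2)]) (simp add: K(3))
qed

lemma test_function_cmult: "test_function U \<phi> \<Longrightarrow> test_function U (\<lambda>x. c * \<phi> x)"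
  using test_function_mult[of U \<phi> "\<lambda>x. c"] by (simp add: smooth_const mult.commute)

lemma test_function_zero: "test_function U (\<lambda>x. 0)"
  by (rule test_functionI[of _ "{}"]) (auto intro: smooth_const)

lemma test_function_add:
  assumes "test_function U \<phi>" "test_function U \<psi>" shows "test_function U (\<lambda>x. \<phi> x + \<psi> x)"
proof -
  obtain K where K: "compact K" "K \<subseteq> U" "\<And>x. x \<notin> K \<Longrightarrow> \<phi> x = 0"
    by (rule test_function_support[OF assms(1)]) blast
  obtain L where L: "compact L" "L \<subseteq> U" "\<And>x. x \<notin> L \<Longrightarrow> \<psi> x = 0"
    by (rule test_function_support[OF assms(2)]) blast
  show ?thesis
    by (rule test_functionI[of _ "K \<union> L"])
      (simp_all add: smooth_add assms[THEN test_function_smooth] compact_Un K L)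
qed

lemma test_function_diff:
  "test_function U \<phi> \<Longrightarrow> test_function U \<psi> \<Longrightarrow> test_function U (\<lambda>x. \<phi> x - \<psi> x)"
  using test_function_add[OF _ test_function_cmult[of U \<psi> "-1"]] by simp

lemma test_function_sum:
  "(\<And>j. j \<in> S \<Longrightarrow> test_function U (\<phi> j)) \<Longrightarrow> test_function U (\<lambda>x. \<Sum>j\<in>S. \<phi> j x)"
  by (induction S rule: infinite_finite_induct) (auto simp: test_function_zero intro: test_function_add)

lemma partial_deriv_outside:
  assumes "closed K" "\<And>x. x \<notin> K \<Longrightarrow> \<phi> x = 0" "x \<notin> K"
  shows "partial_deriv i \<phi> x = 0"
proof -
  have "((\<lambda>x. 0) has_derivative (\<lambda>h. 0)) (at x)" by (rule has_derivative_const)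
  then have "(\<phi> has_derivative (\<lambda>h. 0)) (at x)"
    by (rule has_derivative_transform_within_open[of _ _ _ _ "-K"]) (use assms in auto)
  from partial_deriv_eqI[OF this] show ?thesis .
qed

lemma test_function_partial_deriv:
  assumes "test_function U \<phi>" shows "test_function U (partial_deriv i \<phi>)"
proof -
  obtain K where K: "compact K" "K \<subseteq> U" "\<And>x. x \<notin> K \<Longrightarrow> \<phi> x = 0"
    by (rule test_function_support[OF assms]) blast
  show ?thesis
    by (rule test_functionI[OF smooth_partial_deriv[OF test_function_smooth[OF assms]] K(1,2)])
      (rule partial_deriv_outside[OF compact_imp_closed[OF K(1)] K(3)])
qed

lemma test_function_laplacian:
  assumes "test_function U \<phi>" shows "test_function U (laplacian \<phi>)"
  unfolding laplacian_def[abs_def]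
  by (intro test_function_sum test_function_partial_deriv assms)

lemma test_function_bounded:
  assumes "test_function U \<phi>"
  obtains M where "M > 0" "\<And>x. \<bar>\<phi> x\<bar> \<le> M"
proof -
  obtain K where K: "compact K" "K \<subseteq> U" "\<And>x. x \<notin> K \<Longrightarrow> \<phi> x = 0"
    by (rule test_function_support[OF assms]) blast
  have "bounded (\<phi> ` K)"
    by (intro compact_imp_bounded compact_continuous_image K smooth_continuous test_function_smooth[OF assms])
  then obtain M where M: "M > 0" "\<And>x. x \<in> K \<Longrightarrow> \<bar>\<phi> x\<bar> \<le> M"
    by (auto simp: bounded_pos)
  have "\<bar>\<phi> x\<bar> \<le> M" for x
    using M K(3)[of x] by (cases "x \<in> K") auto
  with M that show thesis by blast
qed

definition radial_bump :: "real^'n::finite \<Rightarrow> real \<Rightarrow> real^'n \<Rightarrow> real" where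
  "radial_bump a s x = bump_exp (1 - (norm (x - a))\<^sup>2 / s\<^sup>2)"

lemma smooth_radial_bump: "smooth (radial_bump a s)"
proof -
  have "smooth1 (\<lambda>t. bump_exp ((- inverse (s\<^sup>2)) * t + 1))"
    by (rule smooth1_affine[OF smooth1_bump_exp])
  from smooth_compose[OF this smooth_norm_sq[of a]] show ?thesis
    by (simp add: radial_bump_def[abs_def] divide_inverse mult.commute)
qed

lemma radial_bump_nonneg: "0 \<le> radial_bump a s x"
  by (simp add: radial_bump_def bump_exp_nonneg)

lemma radial_bump_outside: "s > 0 \<Longrightarrow> s \<le> norm (x - a) \<Longrightarrow> radial_bump a s x = 0"
  unfolding radial_bump_def by (rule bump_exp_zero) (simp add: power_mono)

lemma test_function_radial_bump:
  assumes "s > 0" "cball a s \<subseteq> U" shows "test_function U (radial_bump a s)"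
proof (rule test_functionI[of _ "cball a s"])
  show "radial_bump a s x = 0" if "x \<notin> cball a s" for x
    using that assms(1) by (intro radial_bump_outside) (auto simp: dist_norm norm_minus_commute)
qed (use assms smooth_radial_bump in auto)

text \<open>
  Finitely many bumps cover the compact set with a sum that is at least \<open>1\<close> on a neighbourhood;
  composing with the step flattens it to \<open>1\<close> there.
\<close>
lemma smooth_Urysohn:
  fixes K :: "(real^'n::finite) set"
  assumes "compact K" "open U" "K \<subseteq> U"
  obtains b V where "test_function U b" "\<And>x. 0 \<le> b x" "\<And>x. b x \<le> 1"
    "open V" "K \<subseteq> V" "\<And>x. x \<in> V \<Longrightarrow> b x = 1"
proof -
  have "\<forall>x\<in>K. \<exists>e>0. cball x e \<subseteq> U"
    using assms open_contains_cball by blast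
  then obtain e where e: "\<And>x. x \<in> K \<Longrightarrow> e x > 0 \<and> cball x (e x) \<subseteq> U" by metis
  have "K \<subseteq> (\<Union>x\<in>K. ball x (e x / 2))" using e by fastforce
  then obtain F where F: "F \<subseteq> K" "finite F" "K \<subseteq> (\<Union>x\<in>F. ball x (e x / 2))"
    using compactE_image[OF assms(1), of K "\<lambda>x. ball x (e x / 2)"] by (metis open_ball)
  define c where "c = inverse (bump_exp (3/4))"
  have c: "c > 0" by (simp add: c_def bump_exp_pos)
  define g where "g y = c * (\<Sum>x\<in>F. radial_bump x (e x) y)" for y
  have g: "smooth g" unfolding g_def[abs_def] by (intro smooth_intros smooth_radial_bump)
  have gn: "0 \<le> g y" for y using c by (auto simp: g_def intro!: mult_nonneg_nonneg sum_nonneg radial_bump_nonneg)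
  have g1: "1 \<le> g y" if y: "y \<in> (\<Union>x\<in>F. ball x (e x / 2))" for y
  proof -
    from y obtain x where x: "x \<in> F" "norm (y - x) < e x / 2" by (auto simp: dist_norm norm_minus_commute)
    have ex: "e x > 0" using e x F by auto
    have "(norm (y - x))\<^sup>2 \<le> (e x / 2)\<^sup>2" using x by (intro power_mono) auto
    then have "(norm (y - x))\<^sup>2 / (e x)\<^sup>2 \<le> 1/4" using ex by (simp add: field_simps power2_eq_square)
    then have "bump_exp (3/4) \<le> radial_bump x (e x) y"
      unfolding radial_bump_def by (intro bump_exp_mono) auto
    also have "\<dots> \<le> (\<Sum>x\<in>F. radial_bump x (e x) y)"
      using x F radial_bump_nonneg by (intro member_le_sum) auto
    finally show ?thesis using c by (simp add: g_def c_def field_simps bump_exp_pos)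
  qed
  have g0: "g y = 0" if "y \<notin> (\<Union>x\<in>F. cball x (e x))" for y
    unfolding g_def using that e F
    by (force intro!: sum.neutral radial_bump_outside simp: dist_norm norm_minus_commute)
  have "test_function U (\<lambda>y. smooth_step (g y))"
  proof (rule test_functionI[of _ "\<Union>x\<in>F. cball x (e x)"])
    show "smooth (\<lambda>y. smooth_step (g y))" by (rule smooth_compose[OF smooth1_smooth_step g])
    show "compact (\<Union>x\<in>F. cball x (e x))" using F by (intro compact_UN) auto
    show "(\<Union>x\<in>F. cball x (e x)) \<subseteq> U" using e F by blast
  qed (use g0 in \<open>auto intro!: smooth_step_0\<close>)
  then show thesis
  proof (rule that[where V="\<Union>x\<in>F. ball x (e x / 2)"])
    show "smooth_step (g y) = 1" if "y \<in> (\<Union>x\<in>F. ball x (e x / 2))" for y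
      by (rule smooth_step_1[OF g1[OF that]])
  qed (use F(3) in \<open>auto intro: smooth_step_nonneg smooth_step_le_1\<close>)
qed

section \<open>Positive distributions are measures\<close>
text \<open>
  Both counting lemmas compare a number \<open>t\<close> with the number of integer levels below it; they are
  the discrete layer-cake formula, with bounded error.
\<close>
lemma layer_count_upper: "(\<Sum>j<m. of_bool (real j < t)) \<le> max 0 (t + 1)"
proof (cases "t \<le> 0")
  case True
  then have "(\<Sum>j<m. of_bool (real j < t)) = (\<Sum>j<m. 0 :: real)" by (intro sum.cong) auto
  then show ?thesis by simp
next
  case False
  have "(\<Sum>j<m. of_bool (real j < t)) \<le> t + 1"
  proof (induction m)
    case (Suc m)
    have "(\<Sum>j<m. of_bool (real j < t)) \<le> (\<Sum>j<m. 1 :: real)" by (intro sum_mono) auto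
    then show ?case using Suc by auto
  qed (use False in auto)
  then show ?thesis by simp
qed

lemma layer_count_lower: "min (real m) (t - 2) \<le> (\<Sum>j<m. of_bool (real j + 2 < t))"
proof (induction m)
  case 0 show ?case by simp
next
  case (Suc m)
  show ?case
  proof (cases "real m + 2 < t")
    case True
    have "(\<Sum>j<Suc m. of_bool (real j + 2 < t)) = (\<Sum>j<Suc m. 1 :: real)"
      using True by (intro sum.cong) auto
    then show ?thesis by simp
  next
    case False
    then show ?thesis using Suc by auto
  qed
qed

text \<open>
  A smooth substitute for \<open>max 0 t\<close>. Its unit increments \<open>S t - S (t - 1)\<close> are \<open>0\<close> below \<open>0\<close> and \<open>1\<close>
  above \<open>2\<close>, so that \<open>S(\<phi>)\<close> telescopes into smooth layers, each comparable with the indicator of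
  a superlevel set of \<open>\<phi>\<close>.
\<close>
lemma smooth_ramp:
  obtains S where "smooth1 S" "\<And>t. t \<le> 0 \<Longrightarrow> S t = 0" "\<And>t. S t \<le> max 0 t" "\<And>t. t - 1 \<le> S t"
    "\<And>t. 0 \<le> S t - S (t - 1)" "\<And>t. S t - S (t - 1) \<le> 1" "\<And>t. 2 \<le> t \<Longrightarrow> S t - S (t - 1) = 1"
    "\<And>t. (S has_real_derivative smooth_step t) (at t)"
proof -
  obtain S where S: "smooth1 S" "\<And>t. (S has_real_derivative smooth_step t) (at t)" "\<And>t. t \<le> 0 \<Longrightarrow> S t = 0"
    using smooth1_antideriv_ex[OF smooth1_smooth_step] smooth_step_0 by metis
  have mvt: "\<exists>z. a < z \<and> z < b \<and> S b - S a = (b - a) * smooth_step z" if "a < b" for a b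
    using MVT2[OF that, of S smooth_step] S(2) by blast
  have up: "0 \<le> S b - S a \<and> S b - S a \<le> b - a" if "a \<le> b" for a b
  proof (cases "a = b")
    case False
    with that obtain z where "S b - S a = (b - a) * smooth_step z" using mvt[of a b] by auto
    then show ?thesis using that smooth_step_nonneg[of z] smooth_step_le_1[of z]
      by (auto simp: mult_left_le)
  qed simp
  have one: "S b - S a = b - a" if "1 \<le> a" "a \<le> b" for a b
  proof (cases "a = b")
    case False
    with that obtain z where "a < z" "S b - S a = (b - a) * smooth_step z" using mvt[of a b] by auto
    then show ?thesis using that smooth_step_1[of z] by auto
  qed simp
  show thesis
  proof (rule that[of S])
    show "S t \<le> max 0 t" for t using up[of 0 t] S(3)[of t] S(3)[of 0] by (cases "t \<le> 0") auto
    show "t - 1 \<le> S t" for t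
    proof (cases "1 \<le> t")
      case True then show ?thesis using one[of 1 t] up[of 0 1] S(3)[of 0] by simp
    next
      case False
      have "0 \<le> S t" using up[of 0 t] S(3)[of t] S(3)[of 0] by (cases "t \<le> 0") auto
      then show ?thesis using False by simp
    qed
    show "S t - S (t - 1) = 1" if "2 \<le> t" for t using one[of "t - 1" t] that by simp
    show "0 \<le> S t - S (t - 1)" "S t - S (t - 1) \<le> 1" for t using up[of "t - 1" t] by simp_all
  qed (use S in simp_all)
qed

locale positive_distribution =
  fixes U :: "(real^'n::finite) set" and T :: "(real^'n \<Rightarrow> real) \<Rightarrow> real"
  assumes open_U: "open U"
    and T_add: "\<And>\<phi> \<psi>. test_function U \<phi> \<Longrightarrow> test_function U \<psi> \<Longrightarrow> T (\<lambda>x. \<phi> x + \<psi> x) = T \<phi> + T \<psi>"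
    and T_cmult: "\<And>c \<phi>. test_function U \<phi> \<Longrightarrow> T (\<lambda>x. c * \<phi> x) = c * T \<phi>"
    and T_nonneg: "\<And>\<phi>. test_function U \<phi> \<Longrightarrow> (\<And>x. 0 \<le> \<phi> x) \<Longrightarrow> 0 \<le> T \<phi>"
begin

lemma T_zero: "T (\<lambda>x. 0) = 0"
  using T_cmult[OF test_function_zero, of 0] by simp

lemma T_diff:
  assumes "test_function U \<phi>" "test_function U \<psi>"
  shows "T (\<lambda>x. \<phi> x - \<psi> x) = T \<phi> - T \<psi>"
  using T_add[OF assms(1) test_function_cmult[OF assms(2), of "-1"]] T_cmult[OF assms(2), of "-1"] by simp

lemma T_mono:
  assumes "test_function U \<phi>" "test_function U \<psi>" "\<And>x. \<phi> x \<le> \<psi> x"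
  shows "T \<phi> \<le> T \<psi>"
  using T_nonneg[OF test_function_diff[OF assms(2,1)]] assms(3) T_diff[OF assms(2,1)] by simp

lemma T_sum:
  assumes "finite S" "\<And>j. j \<in> S \<Longrightarrow> test_function U (\<phi> j)"
  shows "T (\<lambda>x. \<Sum>j\<in>S. \<phi> j x) = (\<Sum>j\<in>S. T (\<phi> j))"
  using assms
proof (induction S rule: finite_induct)
  case (insert a S)
  have "T (\<lambda>x. \<phi> a x + (\<Sum>j\<in>S. \<phi> j x)) = T (\<phi> a) + T (\<lambda>x. \<Sum>j\<in>S. \<phi> j x)"
    using insert.prems by (intro T_add test_function_sum) auto
  with insert show ?case by simp
qed (simp add: T_zero)

definition tests :: "(real^'n) set \<Rightarrow> (real^'n \<Rightarrow> real) set" where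
  "tests V = {\<phi>. test_function (U \<inter> V) \<phi> \<and> (\<forall>x. 0 \<le> \<phi> x \<and> \<phi> x \<le> 1)}"

definition tau :: "(real^'n) set \<Rightarrow> ennreal" where
  "tau V = (SUP \<phi>\<in>tests V. ennreal (T \<phi>))"

text \<open>
  Intersecting with \<open>U\<close> makes the complement of \<open>U\<close> a null set from the start.
\<close>
definition outer :: "(real^'n) set \<Rightarrow> ennreal" where
  "outer E = (INF V\<in>{V. open V \<and> E \<inter> U \<subseteq> V}. tau V)"

lemma tests_U: "\<phi> \<in> tests V \<Longrightarrow> test_function U \<phi>"
  unfolding tests_def using test_function_mono[of "U \<inter> V" \<phi> U] by auto

lemma zero_in_tests: "(\<lambda>x. 0) \<in> tests V"
  by (simp add: tests_def test_function_zero)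

lemma tests_mono: "U \<inter> V \<subseteq> V' \<Longrightarrow> \<phi> \<in> tests V \<Longrightarrow> \<phi> \<in> tests V'"
  unfolding tests_def using test_function_mono[of "U \<inter> V" \<phi> "U \<inter> V'"] by auto

lemma le_tau: "\<phi> \<in> tests V \<Longrightarrow> ennreal (T \<phi>) \<le> tau V"
  unfolding tau_def by (rule SUP_upper)

lemma tau_le: "(\<And>\<phi>. \<phi> \<in> tests V \<Longrightarrow> ennreal (T \<phi>) \<le> c) \<Longrightarrow> tau V \<le> c"
  unfolding tau_def by (rule SUP_least)

lemma tau_mono: "U \<inter> V \<subseteq> V' \<Longrightarrow> tau V \<le> tau V'"
  by (rule tau_le, rule le_tau, rule tests_mono)

lemma tau_empty: "tau {} = 0"
proof -
  have "T \<phi> = 0" if "\<phi> \<in> tests {}" for \<phi>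
  proof -
    have "{x. \<phi> x \<noteq> 0} = {}"
      using that closure_subset[of "{x. \<phi> x \<noteq> 0}"] by (auto simp: tests_def test_function_def)
    then have "\<phi> = (\<lambda>x. 0)" by auto
    then show ?thesis by (simp add: T_zero)
  qed
  then have "tau {} \<le> 0" by (intro tau_le) auto
  then show ?thesis by simp
qed

lemma outer_open: "open V \<Longrightarrow> outer V = tau V"
  unfolding outer_def
  by (rule antisym) (auto intro!: INF_lower INF_greatest tau_mono)

lemma outer_mono: "E \<subseteq> E' \<Longrightarrow> outer E \<le> outer E'"
  unfolding outer_def by (rule INF_superset_mono) auto

lemma outer_le_tau: "open V \<Longrightarrow> E \<inter> U \<subseteq> V \<Longrightarrow> outer E \<le> tau V"
  unfolding outer_def by (rule INF_lower) auto

text \<open>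
  A test function supported in the union is split by a cutoff that is \<open>1\<close> near the part of its
  support outside \<open>W\<close> and supported in \<open>V\<close>.
\<close>
lemma tau_Un:
  assumes "open V" "open W"
  shows "tau (V \<union> W) \<le> tau V + tau W"
proof (rule tau_le)
  fix \<phi> assume \<phi>: "\<phi> \<in> tests (V \<union> W)"
  then have tf: "test_function (U \<inter> (V \<union> W)) \<phi>" and b: "\<And>x. 0 \<le> \<phi> x" "\<And>x. \<phi> x \<le> 1" by (auto simp: tests_def)
  obtain K where K: "compact K" "K \<subseteq> U \<inter> (V \<union> W)" "\<And>x. x \<notin> K \<Longrightarrow> \<phi> x = 0"
    by (rule test_function_support[OF tf]) blast
  have cK: "compact (K - W)" using K(1) assms by (simp add: compact_diff)
  have sK: "K - W \<subseteq> U \<inter> V" using K(2) by blast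
  obtain \<psi> O' where \<psi>: "test_function (U \<inter> V) \<psi>" "\<And>x. 0 \<le> \<psi> x" "\<And>x. \<psi> x \<le> 1"
    "open O'" "K - W \<subseteq> O'" "\<And>x. x \<in> O' \<Longrightarrow> \<psi> x = 1"
    by (rule smooth_Urysohn[OF cK open_Int[OF open_U assms(1)] sK]) blast
  have sm: "smooth \<phi>" "smooth \<psi>" using tf \<psi>(1) by (auto intro: test_function_smooth)
  have 1: "(\<lambda>x. \<psi> x * \<phi> x) \<in> tests V"
    using test_function_mult[OF \<psi>(1) sm(1)] \<psi> b by (auto simp: tests_def mult_le_one)
  have "test_function (U \<inter> W) (\<lambda>x. \<phi> x * (1 - \<psi> x))"
  proof (rule test_functionI[of _ "K - O'"])
    show "smooth (\<lambda>x. \<phi> x * (1 - \<psi> x))" by (intro smooth_mult smooth_diff smooth_const sm)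
    show "compact (K - O')" using K(1) \<psi>(4) by (simp add: compact_diff)
  qed (use K \<psi> in auto)
  then have 2: "(\<lambda>x. \<phi> x * (1 - \<psi> x)) \<in> tests W"
    using \<psi> b by (auto simp: tests_def mult_le_one)
  have "T (\<lambda>x. \<psi> x * \<phi> x + \<phi> x * (1 - \<psi> x)) = T (\<lambda>x. \<psi> x * \<phi> x) + T (\<lambda>x. \<phi> x * (1 - \<psi> x))"
    by (intro T_add tests_U[OF 1] tests_U[OF 2])
  moreover have "(\<lambda>x. \<psi> x * \<phi> x + \<phi> x * (1 - \<psi> x)) = \<phi>" by (auto simp: algebra_simps)
  ultimately have "ennreal (T \<phi>) = ennreal (T (\<lambda>x. \<psi> x * \<phi> x)) + ennreal (T (\<lambda>x. \<phi> x * (1 - \<psi> x)))"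
    using T_nonneg[OF tests_U[OF 1]] T_nonneg[OF tests_U[OF 2]] b \<psi>
    by (simp add: ennreal_plus)
  also have "\<dots> \<le> tau V + tau W" by (intro add_mono le_tau 1 2)
  finally show "ennreal (T \<phi>) \<le> tau V + tau W" .
qed

lemma tau_UN_finite:
  fixes V :: "nat \<Rightarrow> (real^'n) set"
  assumes "\<And>i. open (V i)"
  shows "tau (\<Union>i<m. V i) \<le> (\<Sum>i<m. tau (V i))"
proof (induction m)
  case (Suc m)
  have "tau (\<Union>i<Suc m. V i) = tau ((\<Union>i<m. V i) \<union> V m)"
    by (simp add: lessThan_Suc Un_commute)
  also have "\<dots> \<le> tau (\<Union>i<m. V i) + tau (V m)"
    using assms by (intro tau_Un) auto
  finally show ?case using Suc add_right_mono order_trans by fastforce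
qed (simp add: tau_empty)

lemma tau_UN:
  fixes V :: "nat \<Rightarrow> (real^'n) set"
  assumes "\<And>i. open (V i)"
  shows "tau (\<Union>i. V i) \<le> (\<Sum>i. tau (V i))"
proof (rule tau_le)
  fix \<phi> assume \<phi>: "\<phi> \<in> tests (\<Union>i. V i)"
  then have tf: "test_function (U \<inter> (\<Union>i. V i)) \<phi>" and b: "\<And>x. 0 \<le> \<phi> x" "\<And>x. \<phi> x \<le> 1" by (auto simp: tests_def)
  obtain K where K: "compact K" "K \<subseteq> U \<inter> (\<Union>i. V i)" "\<And>x. x \<notin> K \<Longrightarrow> \<phi> x = 0"
    by (rule test_function_support[OF tf]) blast
  obtain C where C: "finite C" "K \<subseteq> (\<Union>i\<in>C. V i)"
    by (rule compactE_image[OF K(1), of UNIV V]) (use assms K(2) in auto)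
  obtain m where "C \<subseteq> {..<m}" using C(1) finite_nat_bounded by blast
  then have Km: "K \<subseteq> (\<Union>i<m. V i)" using C(2) by blast
  have "test_function (U \<inter> (\<Union>i<m. V i)) \<phi>"
    by (rule test_functionI[OF test_function_smooth[OF tf] K(1)]) (use K Km in auto)
  then have "\<phi> \<in> tests (\<Union>i<m. V i)" using b by (auto simp: tests_def)
  then have "ennreal (T \<phi>) \<le> tau (\<Union>i<m. V i)" by (rule le_tau)
  also have "\<dots> \<le> (\<Sum>i<m. tau (V i))" by (rule tau_UN_finite[OF assms])
  also have "\<dots> \<le> (\<Sum>i. tau (V i))" by (rule sum_le_suminf) auto
  finally show "ennreal (T \<phi>) \<le> (\<Sum>i. tau (V i))" .
qed

lemma outer_space: "outer_measure_space (Pow UNIV) outer"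
  unfolding outer_measure_space_def
proof (intro conjI)
  show "positive (Pow UNIV) outer"
    using outer_open[of "{}"] by (simp add: positive_def tau_empty)
  show "increasing (Pow UNIV) outer"
    by (simp add: increasing_def outer_mono)
  show "countably_subadditive (Pow UNIV) outer"
    unfolding countably_subadditive_def
  proof (intro allI impI)
    fix A :: "nat \<Rightarrow> (real^'n) set"
    show "outer (\<Union>i. A i) \<le> (\<Sum>i. outer (A i))"
    proof (rule ennreal_le_epsilon)
      fix e :: real assume e: "0 < e" and fin: "(\<Sum>i. outer (A i)) < top"
      have "\<exists>V. open V \<and> A n \<inter> U \<subseteq> V \<and> tau V \<le> outer (A n) + e * (1/2)^Suc n" for n
      proof -
        have "outer (A n) < outer (A n) + e * (1/2)^Suc n"
          using e ennreal_suminf_lessD[OF fin, of n] by (auto simp: less_top)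
        then obtain V where "open V" "A n \<inter> U \<subseteq> V" "tau V < outer (A n) + e * (1/2)^Suc n"
          unfolding outer_def[of "A n"] INF_less_iff by auto
        then show ?thesis by (intro exI[of _ V]) auto
      qed
      then obtain V where V: "\<And>n. open (V n)" "\<And>n. A n \<inter> U \<subseteq> V n"
        "\<And>n. tau (V n) \<le> outer (A n) + e * (1/2)^Suc n" by metis
      have "outer (\<Union>i. A i) \<le> tau (\<Union>i. V i)"
        using V by (intro outer_le_tau) auto
      also have "\<dots> \<le> (\<Sum>i. tau (V i))" by (rule tau_UN[OF V(1)])
      also have "\<dots> \<le> (\<Sum>n. outer (A n) + e * (1/2) ^ Suc n)"
        by (intro suminf_le V(3)) auto
      also have "... = (\<Sum>n. outer (A n)) + (\<Sum>n. ennreal e * ennreal ((1/2) ^ Suc n))"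
        using \<open>0 < e\<close> by (subst suminf_add[symmetric])
           (auto simp del: ennreal_suminf_cmult simp add: ennreal_mult[symmetric])
      also have "\<dots> = (\<Sum>n. outer (A n)) + e"
        unfolding ennreal_suminf_cmult
        by (subst suminf_ennreal_eq[OF zero_le_power power_half_series]) auto
      finally show "outer (\<Union>i. A i) \<le> (\<Sum>i. outer (A i)) + ennreal e" .
    qed
  qed
qed

text \<open>
  Caratheodory's criterion for open sets: a test function inside \<open>V\<close> and one outside its
  compact support can be added without exceeding \<open>1\<close>.
\<close>
lemma outer_open_split:
  assumes V: "open V"
  shows "outer (X \<inter> V) + outer (X - V) \<le> outer X"
  unfolding outer_def[of X]
proof (rule INF_greatest)
  fix W assume "W \<in> {W. open W \<and> X \<inter> U \<subseteq> W}"
  then have W: "open W" "X \<inter> U \<subseteq> W" by auto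
  have "ennreal (T \<phi>) + outer (X - V) \<le> tau W" if \<phi>: "\<phi> \<in> tests (W \<inter> V)" for \<phi>
  proof -
    from \<phi> have tf: "test_function (U \<inter> (W \<inter> V)) \<phi>" and b: "\<And>x. 0 \<le> \<phi> x" "\<And>x. \<phi> x \<le> 1" by (auto simp: tests_def)
    obtain K where K: "compact K" "K \<subseteq> U \<inter> (W \<inter> V)" "\<And>x. x \<notin> K \<Longrightarrow> \<phi> x = 0"
      by (rule test_function_support[OF tf]) blast
    have *: "ennreal (T \<psi>) + ennreal (T \<phi>) \<le> tau W" if \<psi>: "\<psi> \<in> tests (W - K)" for \<psi>
    proof -
      from \<psi> have tf': "test_function (U \<inter> (W - K)) \<psi>" and b': "\<And>x. 0 \<le> \<psi> x" "\<And>x. \<psi> x \<le> 1" by (auto simp: tests_def)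
      obtain L where L: "L \<subseteq> U \<inter> (W - K)" "\<And>x. x \<notin> L \<Longrightarrow> \<psi> x = 0"
        by (rule test_function_support[OF tf']) blast
      have "test_function (U \<inter> W) (\<lambda>x. \<psi> x + \<phi> x)"
        by (intro test_function_add test_function_mono[OF tf] test_function_mono[OF tf']) auto
      moreover have "\<psi> x + \<phi> x \<le> 1" for x
      proof (cases "x \<in> K")
        case True
        then have "\<psi> x = 0" using L by blast
        then show ?thesis using b(2)[of x] by simp
      qed (use K(3)[of x] b'(2)[of x] in simp)
      ultimately have "(\<lambda>x. \<psi> x + \<phi> x) \<in> tests W" using b b' by (auto simp: tests_def)
      from le_tau[OF this] show ?thesis
        using T_add[OF tests_U[OF \<psi>] tests_U[OF \<phi>]] T_nonneg[OF tests_U[OF \<psi>] b'(1)] T_nonneg[OF tests_U[OF \<phi>] b(1)]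
        by (simp add: ennreal_plus)
    qed
    have "outer (X - V) \<le> tau (W - K)"
      using W K by (intro outer_le_tau) (auto simp: compact_imp_closed open_Diff)
    then have "ennreal (T \<phi>) + outer (X - V) \<le> tau (W - K) + ennreal (T \<phi>)"
      by (simp add: add.commute add_left_mono)
    also have "\<dots> = (SUP \<psi>\<in>tests (W - K). ennreal (T \<psi>) + ennreal (T \<phi>))"
      unfolding tau_def using zero_in_tests by (intro ennreal_SUP_add_left[symmetric]) auto
    also have "\<dots> \<le> tau W" by (intro SUP_least *)
    finally show ?thesis .
  qed
  note * = this
  have "outer (X \<inter> V) \<le> tau (W \<inter> V)"
    using W V by (intro outer_le_tau) auto
  then have "outer (X \<inter> V) + outer (X - V) \<le> tau (W \<inter> V) + outer (X - V)"
    by (intro add_right_mono)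
  also have "\<dots> = (SUP \<phi>\<in>tests (W \<inter> V). ennreal (T \<phi>) + outer (X - V))"
    unfolding tau_def using zero_in_tests by (intro ennreal_SUP_add_left[symmetric]) auto
  also have "\<dots> \<le> tau W" by (intro SUP_least *)
  finally show "outer (X \<inter> V) + outer (X - V) \<le> tau W" .
qed

definition repr_measure :: "(real^'n) measure" where
  "repr_measure = measure_of UNIV (sets borel) outer"

lemma sets_repr_measure [simp, measurable_cong]: "sets repr_measure = sets borel"
  unfolding repr_measure_def using sets.sets_measure_of_eq[of "borel :: (real^'n) measure"] by simp

lemma space_repr_measure [simp]: "space repr_measure = UNIV"
  unfolding repr_measure_def by simp

lemma borel_lambda: "sets borel \<subseteq> lambda_system UNIV (Pow UNIV) outer"
proof -
  interpret P: sigma_algebra UNIV "Pow UNIV :: (real^'n) set set" by (rule sigma_algebra_Pow)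
  have ms: "measure_space UNIV (lambda_system UNIV (Pow UNIV) outer) outer"
    by (rule P.caratheodory_lemma[OF outer_space])
  have sub: "subadditive (Pow UNIV) outer"
    using outer_space unfolding outer_measure_space_def by (metis P.countably_subadditive_subadditive)
  have "V \<in> lambda_system UNIV (Pow UNIV) outer" if "open V" for V
    unfolding P.lambda_system_eq
  proof (intro CollectI conjI ballI)
    fix X :: "(real^'n) set"
    have "outer ((X \<inter> V) \<union> (X - V)) \<le> outer (X \<inter> V) + outer (X - V)"
      by (rule subadditiveD[OF sub]) auto
    moreover have "(X \<inter> V) \<union> (X - V) = X" by auto
    ultimately show "outer (X \<inter> V) + outer (X - V) = outer X"
      using outer_open_split[OF that, of X] by (simp add: antisym)
  qed simp
  then have "sigma_sets UNIV {V. open V} \<subseteq> lambda_system UNIV (Pow UNIV) outer"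
    using ms unfolding measure_space_def by (intro sigma_algebra.sigma_sets_subset) auto
  then show ?thesis by (simp add: borel_def)
qed

lemma emeasure_repr_measure: "A \<in> sets borel \<Longrightarrow> emeasure repr_measure A = outer A"
proof (rule emeasure_measure_of_sigma[of UNIV "sets borel" outer A, folded repr_measure_def])
  interpret P: sigma_algebra UNIV "Pow UNIV :: (real^'n) set set" by (rule sigma_algebra_Pow)
  have ms: "measure_space UNIV (lambda_system UNIV (Pow UNIV) outer) outer"
    by (rule P.caratheodory_lemma[OF outer_space])
  show "sigma_algebra UNIV (sets (borel :: (real^'n) measure))"
    using sets.sigma_algebra_axioms[of "borel :: (real^'n) measure"] by simp
  show "positive (sets borel) outer"
    using ms borel_lambda by (auto simp: measure_space_def positive_def)
  show "countably_additive (sets borel) outer"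
    unfolding countably_additive_def
  proof (intro allI impI)
    fix A :: "nat \<Rightarrow> (real^'n) set"
    assume A: "range A \<subseteq> sets borel" "disjoint_family A" "(\<Union>i. A i) \<in> sets borel"
    have "countably_additive (lambda_system UNIV (Pow UNIV) outer) outer"
      using ms by (simp add: measure_space_def)
    moreover have "range A \<subseteq> lambda_system UNIV (Pow UNIV) outer" "(\<Union>i. A i) \<in> lambda_system UNIV (Pow UNIV) outer"
      using A borel_lambda by blast+
    ultimately show "(\<Sum>i. outer (A i)) = outer (\<Union>i. A i)"
      using A(2) unfolding countably_additive_def by simp
  qed
qed

lemma emeasure_open: "open V \<Longrightarrow> emeasure repr_measure V = tau V"
  by (simp add: emeasure_repr_measure outer_open)

lemma emeasure_le_T:
  assumes "test_function U b" "\<And>x. 0 \<le> b x" "open V" "\<And>x. x \<in> V \<Longrightarrow> b x \<ge> 1"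
  shows "emeasure repr_measure V \<le> ennreal (T b)"
  unfolding emeasure_open[OF assms(3)]
proof (intro tau_le ennreal_leI)
  fix \<phi> assume \<phi>: "\<phi> \<in> tests V"
  show "T \<phi> \<le> T b"
  proof (rule T_mono[OF tests_U[OF \<phi>] assms(1)])
    fix x
    have "x \<in> V" if "\<phi> x \<noteq> 0"
      using \<phi> that closure_subset[of "{x. \<phi> x \<noteq> 0}"] by (auto simp: tests_def test_function_def)
    moreover have "\<phi> x \<le> 1" using \<phi> by (simp add: tests_def)
    ultimately show "\<phi> x \<le> b x" using assms(2)[of x] assms(4)[of x] by (cases "\<phi> x = 0") auto
  qed
qed

lemma finite_on_compact:
  assumes "compact K" "K \<subseteq> U" shows "emeasure repr_measure K < \<infinity>"
proof -
  obtain b V where b: "test_function U b" "\<And>x. 0 \<le> b x" "open V" "K \<subseteq> V" "\<And>x. x \<in> V \<Longrightarrow> b x = 1"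
    by (rule smooth_Urysohn[OF assms(1) open_U assms(2)]) blast
  have "emeasure repr_measure K \<le> emeasure repr_measure V"
    using b by (intro emeasure_mono) auto
  also have "\<dots> \<le> ennreal (T b)" using b by (intro emeasure_le_T) auto
  finally show ?thesis using le_less_trans by fastforce
qed

lemma outside_null: "emeasure repr_measure (- U) = 0"
proof -
  have "outer (-U) \<le> tau {}" by (intro outer_le_tau) auto
  then show ?thesis using open_U by (simp add: emeasure_repr_measure tau_empty)
qed

lemma integrable_test:
  assumes "test_function U \<phi>" shows "integrable repr_measure \<phi>"
proof -
  obtain K where K: "compact K" "K \<subseteq> U" "\<And>x. x \<notin> K \<Longrightarrow> \<phi> x = 0"
    by (rule test_function_support[OF assms]) blast
  obtain M where M: "\<And>x. \<bar>\<phi> x\<bar> \<le> M" using test_function_bounded[OF assms] by blast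
  have Kb: "K \<in> sets borel" using K(1) by (simp add: compact_imp_closed)
  have "integrable repr_measure (\<lambda>x. indicator K x *\<^sub>R M)"
    using finite_on_compact[OF K(1,2)] Kb by (intro integrable_scaleR_left integrable_real_indicator) auto
  then show ?thesis
  proof (rule Bochner_Integration.integrable_bound)
    have "\<phi> \<in> borel_measurable borel"
      by (rule borel_measurable_continuous_onI[OF smooth_continuous[OF test_function_smooth[OF assms]]])
    then show "\<phi> \<in> borel_measurable repr_measure" by simp
    show "AE x in repr_measure. norm (\<phi> x) \<le> norm (indicator K x *\<^sub>R M)"
    proof (rule AE_I2)
      fix x show "norm (\<phi> x) \<le> norm (indicator K x *\<^sub>R M)"
        using K(3)[of x] M[of x] by (cases "x \<in> K") auto
    qed
  qed
qed


text \<open>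
  Layer-cake comparison. The smooth layers \<open>\<theta> k\<close> of \<open>\<phi>\<close> lie between the indicators of
  superlevel sets of \<open>\<phi>\<close>, two unit levels apart, so \<open>T\<close> and the integral of \<open>\<phi>\<close> differ at most by a
  fixed number of unit layers over the support. The error does not grow with \<open>\<phi>\<close>, which
  is what \<open>T_eq_integral\<close> exploits by scaling.
\<close>
lemma T_eq_integral_layers:
  assumes \<phi>: "test_function U \<phi>" "\<And>x. 0 \<le> \<phi> x"
    and b: "test_function U b" "\<And>x. 0 \<le> b x" "\<And>x. \<phi> x \<noteq> 0 \<Longrightarrow> b x = 1"
  shows "\<bar>T \<phi> - (LINT x|repr_measure. \<phi> x)\<bar> \<le> 2 * T b + 2 * (LINT x|repr_measure. b x)"
proof -
  obtain S where S: "smooth1 S" "\<And>t. t \<le> 0 \<Longrightarrow> S t = 0" "\<And>t. S t \<le> max 0 t" "\<And>t. t - 1 \<le> S t"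
    "\<And>t. 0 \<le> S t - S (t - 1)" "\<And>t. S t - S (t - 1) \<le> 1" "\<And>t. 2 \<le> t \<Longrightarrow> S t - S (t - 1) = 1"
    by (rule smooth_ramp) blast
  obtain M where M: "\<And>x. \<bar>\<phi> x\<bar> \<le> M" using test_function_bounded[OF \<phi>(1)] by blast
  obtain m :: nat where m: "M \<le> real m" using real_arch_simple by blast
  have \<phi>m: "\<phi> x \<le> real m" for x using M[of x] m by simp
  have sm: "smooth \<phi>" by (rule test_function_smooth[OF \<phi>(1)])
  obtain K where K: "compact K" "K \<subseteq> U" "\<And>x. x \<notin> K \<Longrightarrow> \<phi> x = 0"
    by (rule test_function_support[OF \<phi>(1)]) blast
  \<comment> \<open>the part of \<open>\<phi>\<close> between the levels \<open>k\<close> and \<open>k + 2\<close>, smoothed\<close>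
  define \<theta> where "\<theta> k x = S (\<phi> x - real k) - S (\<phi> x - real k - 1)" for k x
  have smS: "smooth (\<lambda>x. S (\<phi> x - c))" for c
    by (rule smooth_compose[OF S(1) smooth_diff[OF sm smooth_const]])
  have sm\<theta>: "smooth (\<theta> k)" for k
  proof -
    have "smooth (\<lambda>x. S (\<phi> x - real k) - S (\<phi> x - (real k + 1)))" by (rule smooth_diff[OF smS smS])
    then show ?thesis unfolding \<theta>_def[abs_def] by (simp add: diff_diff_eq)
  qed
  have \<theta>b: "0 \<le> \<theta> k x" "\<theta> k x \<le> 1" for k x using S(5,6)[of "\<phi> x - real k"] by (auto simp: \<theta>_def)
  have \<theta>0: "\<theta> k x = 0" if "\<phi> x \<le> real k" for k x using that by (simp add: \<theta>_def S(2))
  have \<theta>1: "\<theta> k x = 1" if "real k + 2 \<le> \<phi> x" for k x using that by (simp add: \<theta>_def S(7))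
  define C where "C k = K \<inter> {x. real k \<le> \<phi> x}" for k :: nat
  have cC: "compact (C k)" for k
    unfolding C_def
    by (intro compact_Int_closed K(1) closed_Collect_le continuous_intros smooth_continuous[OF sm])
  have tfC: "test_function V (\<theta> k)" if "C k \<subseteq> V" for V k
  proof (rule test_functionI[OF sm\<theta> cC that])
    fix x assume "x \<notin> C k"
    then have "\<phi> x \<le> real k" using K(3)[of x] by (cases "x \<in> K") (auto simp: C_def)
    then show "\<theta> k x = 0" by (rule \<theta>0)
  qed
  have tf\<theta>: "test_function U (\<theta> k)" for k by (rule tfC) (use K in \<open>auto simp: C_def\<close>)
  define L where "L t = {x. t < \<phi> x}" for t
  have oL: "open (L t)" for t
    unfolding L_def by (intro open_Collect_less continuous_intros smooth_continuous[OF sm])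
  have LK: "L t \<subseteq> K" if "0 \<le> t" for t using K(3) that by (force simp: L_def)
  have Lfin: "emeasure repr_measure (L t) < \<infinity>" if "0 \<le> t" for t
    using le_less_trans[OF emeasure_mono[OF LK[OF that]] finite_on_compact[OF K(1,2)]] K(1)
    by (simp add: compact_imp_closed)
  have Lem: "emeasure repr_measure (L t) = ennreal (measure repr_measure (L t))" if "0 \<le> t" for t
    using Lfin[OF that] by (intro emeasure_eq_ennreal_measure) auto
  have up: "T (\<theta> (Suc k)) \<le> measure repr_measure (L (real k))" for k
  proof -
    have "\<theta> (Suc k) \<in> tests (L (real k))"
      unfolding tests_def using \<theta>b K by (auto intro!: tfC simp: C_def L_def)
    from le_tau[OF this] have "ennreal (T (\<theta> (Suc k))) \<le> ennreal (measure repr_measure (L (real k)))"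
      using emeasure_open[OF oL, of "real k"] Lem[of "real k"] by simp
    then show ?thesis by (simp add: ennreal_le_iff)
  qed
  have lo: "measure repr_measure (L (real k + 2)) \<le> T (\<theta> k)" for k
  proof -
    have "emeasure repr_measure (L (real k + 2)) \<le> ennreal (T (\<theta> k))"
      by (rule emeasure_le_T[OF tf\<theta> \<theta>b(1) oL]) (simp add: \<theta>1 L_def)
    then show ?thesis
      using Lem[of "real k + 2"] T_nonneg[OF tf\<theta> \<theta>b(1)] by (simp add: ennreal_le_iff)
  qed
  have tele: "(\<Sum>k<Suc m. \<theta> k x) = S (\<phi> x)" for x
  proof -
    have "(\<Sum>k<n. \<theta> k x) = S (\<phi> x) - S (\<phi> x - real n)" for n
      by (induction n) (auto simp: \<theta>_def diff_diff_eq add.commute)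
    from this[of "Suc m"] show ?thesis using \<phi>m[of x] by (simp add: S(2))
  qed
  have TS: "T (\<lambda>x. S (\<phi> x)) = (\<Sum>k<Suc m. T (\<theta> k))"
    using T_sum[of "{..<Suc m}" \<theta>] tf\<theta> unfolding tele by simp
  have tfS: "test_function U (\<lambda>x. S (\<phi> x))"
    using test_function_sum[of "{..<Suc m}" U \<theta>] tf\<theta> unfolding tele by simp
  have bphi: "\<phi> x - b x \<le> S (\<phi> x)" "S (\<phi> x) \<le> \<phi> x" for x
    using b(3)[of x] b(2)[of x] S(2)[of 0] S(3)[of "\<phi> x"] S(4)[of "\<phi> x"] \<phi>(2)[of x] by (cases "\<phi> x = 0"; force)+
  have T1: "T \<phi> - T b \<le> T (\<lambda>x. S (\<phi> x))"
    using T_mono[OF test_function_diff[OF \<phi>(1) b(1)] tfS bphi(1)] T_diff[OF \<phi>(1) b(1)] by simp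
  have T2: "T (\<lambda>x. S (\<phi> x)) \<le> T \<phi>"
    using T_mono[OF tfS \<phi>(1) bphi(2)] .
  have \<theta>0b: "T (\<theta> 0) \<le> T b"
  proof (rule T_mono[OF tf\<theta> b(1)])
    fix x show "\<theta> 0 x \<le> b x" using \<theta>b(2)[of 0 x] \<theta>0[of x 0] b(2,3)[of x] by (cases "\<phi> x = 0") auto
  qed
  have intL: "integrable repr_measure (\<lambda>x. of_bool (t < \<phi> x) :: real)"
    "(LINT x|repr_measure. of_bool (t < \<phi> x)) = measure repr_measure (L t)" if "0 \<le> t" for t
  proof -
    have eq: "(\<lambda>x. of_bool (t < \<phi> x)) = (indicator (L t) :: _ \<Rightarrow> real)"
      by (auto simp: L_def indicator_def)
    show "integrable repr_measure (\<lambda>x. of_bool (t < \<phi> x) :: real)"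
      unfolding eq using Lfin[OF that] oL[of t] by (intro integrable_real_indicator) auto
    show "(LINT x|repr_measure. of_bool (t < \<phi> x)) = measure repr_measure (L t)"
      unfolding eq by simp
  qed
  note ii = integrable_test[OF \<phi>(1)] integrable_test[OF b(1)]
  have "T \<phi> \<le> 2 * T b + (\<Sum>k<m. measure repr_measure (L (real k)))"
  proof -
    have "(\<Sum>k<Suc m. T (\<theta> k)) = T (\<theta> 0) + (\<Sum>k<m. T (\<theta> (Suc k)))"
      by (rule sum.lessThan_Suc_shift)
    also have "\<dots> \<le> T b + (\<Sum>k<m. measure repr_measure (L (real k)))"
      by (intro add_mono \<theta>0b sum_mono up)
    finally show ?thesis using T1 TS by simp
  qed
  also have "(\<Sum>k<m. measure repr_measure (L (real k))) = (LINT x|repr_measure. (\<Sum>k<m. of_bool (real k < \<phi> x)))"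
    using intL by (subst Bochner_Integration.integral_sum) auto
  also have "\<dots> \<le> (LINT x|repr_measure. \<phi> x + b x)"
  proof (rule integral_mono)
    show "integrable repr_measure (\<lambda>x. \<Sum>k<m. of_bool (real k < \<phi> x) :: real)"
      using intL by (intro Bochner_Integration.integrable_sum) auto
    fix x
    show "(\<Sum>k<m. of_bool (real k < \<phi> x)) \<le> \<phi> x + b x"
      using layer_count_upper[of "\<phi> x" m] \<phi>(2)[of x] b(2,3)[of x] by (cases "\<phi> x = 0") auto
  qed (use ii in auto)
  also have "\<dots> = (LINT x|repr_measure. \<phi> x) + (LINT x|repr_measure. b x)" using ii by simp
  finally have A: "T \<phi> \<le> 2 * T b + (LINT x|repr_measure. \<phi> x) + (LINT x|repr_measure. b x)" by simp
  have "(LINT x|repr_measure. \<phi> x) - 2 * (LINT x|repr_measure. b x) = (LINT x|repr_measure. \<phi> x - 2 * b x)"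
    using ii by simp
  also have "\<dots> \<le> (LINT x|repr_measure. (\<Sum>k<m. of_bool (real k + 2 < \<phi> x)))"
  proof (rule integral_mono)
    show "integrable repr_measure (\<lambda>x. \<Sum>k<m. of_bool (real k + 2 < \<phi> x) :: real)"
      using intL by (intro Bochner_Integration.integrable_sum) auto
    fix x
    show "\<phi> x - 2 * b x \<le> (\<Sum>k<m. of_bool (real k + 2 < \<phi> x))"
    proof (cases "\<phi> x = 0")
      case True
      have "0 \<le> (\<Sum>k<m. of_bool (real k + 2 < \<phi> x) :: real)" by (intro sum_nonneg) auto
      then show ?thesis using True b(2)[of x] by simp
    next
      case False
      then show ?thesis using layer_count_lower[of m "\<phi> x"] \<phi>m[of x] b(3)[of x] by simp
    qed
  qed (use ii in auto)
  also have "\<dots> = (\<Sum>k<m. measure repr_measure (L (real k + 2)))"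
    using intL by (subst Bochner_Integration.integral_sum) auto
  also have "\<dots> \<le> (\<Sum>k<m. T (\<theta> k))" by (intro sum_mono lo)
  also have "\<dots> \<le> (\<Sum>k<Suc m. T (\<theta> k))" using T_nonneg[OF tf\<theta> \<theta>b(1)] by simp
  also have "\<dots> \<le> T \<phi>" using T2 TS by simp
  finally have B: "(LINT x|repr_measure. \<phi> x) - 2 * (LINT x|repr_measure. b x) \<le> T \<phi>" .
  have "0 \<le> (LINT x|repr_measure. b x)" "0 \<le> T b" using b T_nonneg[OF b(1,2)] by auto
  then show ?thesis using A B by (simp add: abs_le_iff)
qed

text \<open>
  For nonnegative \<open>\<phi>\<close>, replace it by \<open>n \<phi>\<close>, divide by \<open>n\<close> and let \<open>n\<close> tend to infinity. A general \<open>\<phi>\<close>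
  becomes nonnegative by adding a multiple of a cutoff.
\<close>
lemma T_eq_integral:
  assumes \<phi>: "test_function U \<phi>"
  shows "T \<phi> = (LINT x|repr_measure. \<phi> x)"
proof -
  obtain K where K: "compact K" "K \<subseteq> U" "\<And>x. x \<notin> K \<Longrightarrow> \<phi> x = 0"
    by (rule test_function_support[OF \<phi>]) blast
  obtain b V where b: "test_function U b" "\<And>x. 0 \<le> b x" "\<And>x. b x \<le> 1" "open V" "K \<subseteq> V" "\<And>x. x \<in> V \<Longrightarrow> b x = 1"
    by (rule smooth_Urysohn[OF K(1) open_U K(2)]) blast
  obtain b' where b': "test_function U b'" "\<And>x. 0 \<le> b' x" "\<And>x. x \<in> closure {x. b x \<noteq> 0} \<Longrightarrow> b' x = 1"
  proof -
    have "compact (closure {x. b x \<noteq> 0})" "closure {x. b x \<noteq> 0} \<subseteq> U" using b(1) by (auto simp: test_function_def)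
    then obtain b' V' where b': "test_function U b'" "\<And>x. 0 \<le> b' x" "\<And>x. b' x \<le> 1" "open V'"
      "closure {x. b x \<noteq> 0} \<subseteq> V'" "\<And>x. x \<in> V' \<Longrightarrow> b' x = 1"
      by (rule smooth_Urysohn[OF _ open_U]) blast
    show thesis by (rule that[OF b'(1,2)]) (use b'(5,6) in blast)
  qed
  have b'1: "b' x = 1" if "b x \<noteq> 0" for x
    using b'(3)[of x] that closure_subset[of "{x. b x \<noteq> 0}"] by blast
  have pos: "T \<psi> = (LINT x|repr_measure. \<psi> x)" if \<psi>: "test_function U \<psi>" "\<And>x. 0 \<le> \<psi> x" "\<And>x. \<psi> x \<noteq> 0 \<Longrightarrow> b' x = 1" for \<psi>
  proof -
    let ?c = "2 * T b' + 2 * (LINT x|repr_measure. b' x)"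
    let ?d = "\<bar>T \<psi> - (LINT x|repr_measure. \<psi> x)\<bar>"
    have "real n * ?d \<le> ?c" for n :: nat
    proof -
      have "\<bar>T (\<lambda>x. real n * \<psi> x) - (LINT x|repr_measure. real n * \<psi> x)\<bar> \<le> ?c"
        by (rule T_eq_integral_layers[OF test_function_cmult[OF \<psi>(1)] _ b'(1,2)]) (use \<psi>(2,3) in auto)
      then show ?thesis by (simp add: T_cmult[OF \<psi>(1)] abs_mult flip: right_diff_distrib)
    qed
    then have "\<not> 0 < ?d" by (meson not_less reals_Archimedean3)
    then show ?thesis by simp
  qed
  obtain M where M: "M > 0" "\<And>x. \<bar>\<phi> x\<bar> \<le> M" using test_function_bounded[OF \<phi>] by blast
  have \<phi>b: "b x = 1" if "\<phi> x \<noteq> 0" for x using b(5,6) K(3)[of x] that by blast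
  have tMb: "test_function U (\<lambda>x. M * b x)" by (rule test_function_cmult[OF b(1)])
  have "T (\<lambda>x. \<phi> x + M * b x) = (LINT x|repr_measure. \<phi> x + M * b x)"
  proof (rule pos[OF test_function_add[OF \<phi> tMb]])
    fix x
    show "0 \<le> \<phi> x + M * b x" using M(1) M(2)[of x] b(2)[of x] \<phi>b[of x] by (cases "\<phi> x = 0") auto
    show "b' x = 1" if "\<phi> x + M * b x \<noteq> 0" using \<phi>b[of x] b'1[of x] that by (cases "\<phi> x = 0") auto
  qed
  moreover have "T (\<lambda>x. M * b x) = (LINT x|repr_measure. M * b x)"
    by (rule pos[OF tMb]) (use M(1) b(2) b'1 in auto)
  ultimately show ?thesis
    using T_add[OF \<phi> tMb] integrable_test[OF \<phi>] integrable_test[OF tMb] by simp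
qed

theorem representation: "is_positive_measure_in U T repr_measure"
  unfolding is_positive_measure_in_def
  using outside_null finite_on_compact T_eq_integral by auto

end

section \<open>Integration against test functions\<close>
lemma borel_imp_lebesgue: "h \<in> borel_measurable borel \<Longrightarrow> h \<in> borel_measurable lebesgue"
  by (rule measurable_completion) simp

lemma smooth_borel: "smooth \<phi> \<Longrightarrow> \<phi> \<in> borel_measurable borel"
  by (rule borel_measurable_continuous_onI[OF smooth_continuous])

lemma smooth_lebesgue: "smooth \<phi> \<Longrightarrow> \<phi> \<in> borel_measurable lebesgue"
  by (rule borel_imp_lebesgue[OF smooth_borel])

lemma integrable_bounded_support:
  fixes h :: "real^'n::finite \<Rightarrow> real"
  assumes "h \<in> borel_measurable lebesgue" "compact K" "AE x in lebesgue. \<bar>h x\<bar> \<le> M" "\<And>x. x \<notin> K \<Longrightarrow> h x = 0"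
  shows "integrable lebesgue h"
proof -
  have K: "K \<in> lmeasurable" using assms(2) by (rule lmeasurable_compact)
  have "integrable lebesgue (\<lambda>x. indicator K x * M)"
    using K by (intro integrable_mult_left integrable_real_indicator) (auto simp: fmeasurable_def)
  then show ?thesis
  proof (rule Bochner_Integration.integrable_bound)
    show "AE x in lebesgue. norm (h x) \<le> norm (indicator K x * M)"
      using assms(3)
    proof (rule AE_mp, intro AE_I2 impI)
      fix x assume "\<bar>h x\<bar> \<le> M" then show "norm (h x) \<le> norm (indicator K x * M)"
        using assms(4)[of x] by (cases "x \<in> K") auto
    qed
  qed (rule assms(1))
qed

lemma integrable_loc_mult:
  fixes h \<phi> :: "real^'n::finite \<Rightarrow> real"
  assumes "set_integrable lebesgue K h" "h \<in> borel_measurable lebesgue"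
    "\<phi> \<in> borel_measurable lebesgue" "\<And>x. \<bar>\<phi> x\<bar> \<le> M" "\<And>x. x \<notin> K \<Longrightarrow> \<phi> x = 0"
  shows "integrable lebesgue (\<lambda>x. h x * \<phi> x)"
proof -
  have "integrable lebesgue (\<lambda>x. M * (indicator K x *\<^sub>R h x))"
    using assms(1) unfolding set_integrable_def by (rule integrable_mult_right)
  then show ?thesis
  proof (rule Bochner_Integration.integrable_bound)
    show "AE x in lebesgue. norm (h x * \<phi> x) \<le> norm (M * (indicator K x *\<^sub>R h x))"
    proof (rule AE_I2)
      fix x show "norm (h x * \<phi> x) \<le> norm (M * (indicator K x *\<^sub>R h x))"
        using assms(4)[of x] assms(5)[of x] by (cases "x \<in> K") (auto simp: abs_mult mult.commute intro!: mult_right_mono)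
    qed
  qed (intro borel_measurable_times assms)
qed

lemma integrable_test_mult:
  assumes "\<And>K. compact K \<Longrightarrow> K \<subseteq> U \<Longrightarrow> set_integrable lebesgue K h" "h \<in> borel_measurable lebesgue"
    "test_function U \<phi>"
  shows "integrable lebesgue (\<lambda>x. h x * \<phi> x)"
proof -
  obtain K where K: "compact K" "K \<subseteq> U" "\<And>x. x \<notin> K \<Longrightarrow> \<phi> x = 0"
    by (rule test_function_support[OF assms(3)]) blast
  obtain M where M: "\<And>x. \<bar>\<phi> x\<bar> \<le> M" using test_function_bounded[OF assms(3)] by blast
  show ?thesis
    by (rule integrable_loc_mult[OF assms(1)[OF K(1,2)] assms(2) smooth_lebesgue[OF test_function_smooth[OF assms(3)]] M K(3)])
qed

lemma locally_integrable_measurable: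
  fixes h :: "real^'n::finite \<Rightarrow> 'b::euclidean_space"
  assumes "locally_integrable h" shows "h \<in> borel_measurable lebesgue"
proof (rule borel_measurable_LIMSEQ_metric)
  show "(\<lambda>x. indicator (cball 0 (real n)) x *\<^sub>R h x) \<in> borel_measurable lebesgue" for n :: nat
    using assms unfolding locally_integrable_def set_integrable_def by (meson borel_measurable_integrable compact_cball)
  fix x :: "real^'n"
  obtain n0 where n0: "norm x \<le> real n0" using real_arch_simple by blast
  have "\<forall>\<^sub>F n in sequentially. h x = indicator (cball 0 (real n)) x *\<^sub>R h x"
    using eventually_ge_at_top[of n0] by eventually_elim (use n0 in auto)
  then show "(\<lambda>n. indicator (cball 0 (real n)) x *\<^sub>R h x) \<longlonglongrightarrow> h x"
    by (rule Lim_transform_eventually[OF tendsto_const])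
qed

text \<open>
  The indicator of a compact set is a dominated pointwise limit of smooth cutoffs supported in
  shrinking neighbourhoods.
\<close>
lemma integral_compact_nonneg:
  fixes h :: "real^'n::finite \<Rightarrow> real"
  assumes U: "open U" and h: "\<And>K. compact K \<Longrightarrow> K \<subseteq> U \<Longrightarrow> set_integrable lebesgue K h" "h \<in> borel_measurable lebesgue"
    and pos: "\<And>\<phi>. test_function U \<phi> \<Longrightarrow> (\<And>x. 0 \<le> \<phi> x) \<Longrightarrow> 0 \<le> (LINT x|lebesgue. h x * \<phi> x)"
    and K: "compact K" "K \<subseteq> U"
  shows "0 \<le> (LINT x|lebesgue. h x * indicator K x)"
proof (cases "K = {}")
  case False
  obtain b V where b: "test_function U b" "\<And>x. 0 \<le> b x" "\<And>x. b x \<le> 1" "open V" "K \<subseteq> V" "\<And>x. x \<in> V \<Longrightarrow> b x = 1"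
    by (rule smooth_Urysohn[OF K(1) U K(2)]) blast
  obtain L where L: "compact L" "L \<subseteq> U" "\<And>x. x \<notin> L \<Longrightarrow> b x = 0"
    by (rule test_function_support[OF b(1)]) blast
  have "\<exists>c. smooth c \<and> (\<forall>x. 0 \<le> c x \<and> c x \<le> 1) \<and> (\<forall>x\<in>K. c x = 1) \<and> (\<forall>x. inverse (real (Suc n)) \<le> infdist x K \<longrightarrow> c x = 0)" for n
  proof -
    have o: "open {x. infdist x K < inverse (real (Suc n))}"
      by (intro open_Collect_less continuous_intros)
    have s: "K \<subseteq> {x. infdist x K < inverse (real (Suc n))}" by auto
    obtain c W where c: "test_function {x. infdist x K < inverse (real (Suc n))} c" "\<And>x. 0 \<le> c x" "\<And>x. c x \<le> 1"
      "open W" "K \<subseteq> W" "\<And>x. x \<in> W \<Longrightarrow> c x = 1"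
      by (rule smooth_Urysohn[OF K(1) o s]) blast
    obtain C where C: "C \<subseteq> {x. infdist x K < inverse (real (Suc n))}" "\<And>x. x \<notin> C \<Longrightarrow> c x = 0"
      by (rule test_function_support[OF c(1)]) blast
    have "c x = 0" if "inverse (real (Suc n)) \<le> infdist x K" for x
    proof (rule C(2))
      show "x \<notin> C" using C(1) that by force
    qed
    then show ?thesis using c test_function_smooth[OF c(1)] by (intro exI[of _ c]) blast
  qed
  then obtain c where c: "\<And>n. smooth (c n)" "\<And>n x. 0 \<le> c n x" "\<And>n x. c n x \<le> 1" "\<And>n x. x \<in> K \<Longrightarrow> c n x = 1"
    "\<And>n x. inverse (real (Suc n)) \<le> infdist x K \<Longrightarrow> c n x = 0" by metis
  have tf: "test_function U (\<lambda>x. b x * c n x)" for n by (rule test_function_mult[OF b(1) c(1)])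
  have "(\<lambda>n. LINT x|lebesgue. h x * (b x * c n x)) \<longlonglongrightarrow> (LINT x|lebesgue. h x * indicator K x)"
  proof (rule integral_dominated_convergence[where w="\<lambda>x. \<bar>h x * b x\<bar>"])
    show "(\<lambda>x. h x * indicator K x) \<in> borel_measurable lebesgue"
      using K(1) h(2) by (intro borel_measurable_times borel_measurable_indicator) (auto simp: lmeasurable_compact fmeasurableD)
    show "(\<lambda>x. h x * (b x * c n x)) \<in> borel_measurable lebesgue" for n
      by (intro borel_measurable_times h(2) smooth_lebesgue test_function_smooth[OF b(1)] c(1))
    show "integrable lebesgue (\<lambda>x. \<bar>h x * b x\<bar>)"
      by (intro integrable_abs integrable_test_mult[OF h b(1)])
    show "AE x in lebesgue. norm (h x * (b x * c n x)) \<le> \<bar>h x * b x\<bar>" for n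
      using b(2) c(2,3) by (intro AE_I2) (auto simp: abs_mult intro!: mult_left_mono mult_left_le)
    show "AE x in lebesgue. (\<lambda>n. h x * (b x * c n x)) \<longlonglongrightarrow> h x * indicator K x"
    proof (rule AE_I2)
      fix x
      show "(\<lambda>n. h x * (b x * c n x)) \<longlonglongrightarrow> h x * indicator K x"
      proof (cases "x \<in> K")
        case True
        then show ?thesis using c(4) b(5,6) by (auto simp: subset_iff)
      next
        case nK: False
        have "0 < infdist x K" using nK False K(1) by (simp add: infdist_pos_not_in_closed compact_imp_closed)
        then obtain n0 where "inverse (real (Suc n0)) < infdist x K" using reals_Archimedean by blast
        moreover have "inverse (real (Suc n)) \<le> inverse (real (Suc n0))" if "n0 \<le> n" for n
          using that by (intro le_imp_inverse_le) auto
        ultimately have "c n x = 0" if "n0 \<le> n" for n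
          using that by (intro c(5)) (meson less_imp_le order_trans)
        then have "h x * indicator K x = h x * (b x * c n x)" if "n0 \<le> n" for n
          using that nK by simp
        then have "\<forall>\<^sub>F n in sequentially. h x * indicator K x = h x * (b x * c n x)"
          unfolding eventually_sequentially by blast
        then show ?thesis by (rule Lim_transform_eventually[OF tendsto_const])
      qed
    qed
  qed
  then show ?thesis
    by (rule LIMSEQ_le_const) (use pos[OF tf] b(2) c(2) in \<open>auto intro!: mult_nonneg_nonneg\<close>)
qed simp

text \<open>
  Otherwise, by inner regularity, the set where \<open>h\<close> is negative contains a compact set of positive
  measure, over which the integral of \<open>h\<close> would be both negative and nonnegative.
\<close>
theorem AE_nonneg_of_test:
  fixes h :: "real^'n::finite \<Rightarrow> real"
  assumes U: "open U" and h: "\<And>K. compact K \<Longrightarrow> K \<subseteq> U \<Longrightarrow> set_integrable lebesgue K h" "h \<in> borel_measurable lebesgue"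
    and pos: "\<And>\<phi>. test_function U \<phi> \<Longrightarrow> (\<And>x. 0 \<le> \<phi> x) \<Longrightarrow> 0 \<le> (LINT x|lebesgue. h x * \<phi> x)"
  shows "AE x in lebesgue. x \<in> U \<longrightarrow> 0 \<le> h x"
proof -
  define N where "N = {x. h x < 0} \<inter> U"
  have "{x \<in> space lebesgue. h x < 0} \<in> sets lebesgue"
    by (rule borel_measurable_less[OF h(2) borel_measurable_const])
  then have Nm: "N \<in> sets lebesgue" using U unfolding N_def by auto
  have cnull: "emeasure lebesgue K = 0" if K: "compact K" "K \<subseteq> N" for K
  proof -
    have Km: "K \<in> lmeasurable" using K(1) by (rule lmeasurable_compact)
    have KU: "K \<subseteq> U" using K by (auto simp: N_def)
    have i: "integrable lebesgue (\<lambda>x. - (h x * indicator K x))"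
      using h(1)[OF K(1) KU] by (simp add: set_integrable_def mult.commute)
    have ge: "AE x in lebesgue. 0 \<le> - (h x * indicator K x)"
    proof (rule AE_I2)
      fix x show "0 \<le> - (h x * indicator K x)"
        using K(2) by (cases "x \<in> K") (auto simp: N_def)
    qed
    have "0 \<le> (LINT x|lebesgue. h x * indicator K x)"
      by (rule integral_compact_nonneg[OF U h pos K(1) KU])
    then have "(LINT x|lebesgue. - (h x * indicator K x)) \<le> 0" by simp
    moreover have "0 \<le> (LINT x|lebesgue. - (h x * indicator K x))" by (rule integral_nonneg_AE[OF ge])
    ultimately have "(LINT x|lebesgue. - (h x * indicator K x)) = 0" by linarith
    then have "AE x in lebesgue. - (h x * indicator K x) = 0"
      using integral_nonneg_eq_0_iff_AE[OF i ge] by simp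
    then have "AE x in lebesgue. x \<notin> K"
    proof (rule AE_mp, intro AE_I2 impI)
      fix x assume "- (h x * indicator K x) = 0" then show "x \<notin> K" using K(2) by (auto simp: N_def)
    qed
    then show ?thesis using Km by (subst (asm) AE_iff_measurable[OF _ refl]) (auto simp: fmeasurableD)
  qed
  have "emeasure lebesgue N \<le> 0"
  proof (rule ennreal_le_epsilon)
    fix e :: real assume e: "0 < e"
    obtain C where C: "closed C" "C \<subseteq> N" "N - C \<in> lmeasurable" "emeasure lebesgue (N - C) < ennreal e"
      by (rule sets_lebesgue_inner_closed[OF Nm e])
    have "emeasure lebesgue (\<Union>n. C \<inter> cball 0 (real n)) = 0"
    proof (rule emeasure_UN_eq_0)
      have c: "compact (C \<inter> cball 0 (real n))" for n using C(1) by (intro closed_Int_compact) auto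
      show "emeasure lebesgue (C \<inter> cball 0 (real n)) = 0" for n using C(2) by (intro cnull c) auto
      show "range (\<lambda>n. C \<inter> cball 0 (real n)) \<subseteq> sets lebesgue" using lmeasurable_compact[OF c] by (auto simp: fmeasurableD)
    qed
    moreover have "(\<Union>n. C \<inter> cball 0 (real n)) = C" using real_arch_simple by auto
    ultimately have C0: "emeasure lebesgue C = 0" by simp
    have "emeasure lebesgue N = emeasure lebesgue (C \<union> (N - C))" using C(2) by (simp add: Un_absorb1)
    also have "\<dots> \<le> emeasure lebesgue C + emeasure lebesgue (N - C)"
      using C by (intro emeasure_subadditive) (auto simp: fmeasurableD)
    also have "\<dots> \<le> 0 + ennreal e" using C0 C(4) by simp
    finally show "emeasure lebesgue N \<le> 0 + ennreal e" .
  qed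
  then have "N \<in> null_sets lebesgue" using Nm by (auto simp: null_sets_def)
  from AE_not_in[OF this] show ?thesis by (rule AE_mp) (auto simp: N_def)
qed

corollary AE_zero_of_test:
  fixes h :: "real^'n::finite \<Rightarrow> real"
  assumes U: "open U" and h: "\<And>K. compact K \<Longrightarrow> K \<subseteq> U \<Longrightarrow> set_integrable lebesgue K h" "h \<in> borel_measurable lebesgue"
    and zero: "\<And>\<phi>. test_function U \<phi> \<Longrightarrow> (LINT x|lebesgue. h x * \<phi> x) = 0"
  shows "AE x in lebesgue. x \<in> U \<longrightarrow> h x = 0"
proof -
  have 1: "AE x in lebesgue. x \<in> U \<longrightarrow> 0 \<le> h x"
    by (rule AE_nonneg_of_test[OF U h]) (simp_all add: zero)
  have "AE x in lebesgue. x \<in> U \<longrightarrow> 0 \<le> - h x"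
  proof (rule AE_nonneg_of_test[OF U])
    show "set_integrable lebesgue K (\<lambda>x. - h x)" if "compact K" "K \<subseteq> U" for K
      using h(1)[OF that] unfolding set_integrable_def by simp
  qed (use h(2) zero in simp_all)
  with 1 show ?thesis by eventually_elim auto
qed

text \<open>
  Stone-Weierstrass for the algebra of smooth functions, followed by a cutoff; the supports stay
  in one compact set \<open>L\<close>, which controls the integrals of the error.
\<close>
lemma smooth_approx:
  fixes g :: "real^'n::finite \<Rightarrow> real"
  assumes U: "open U" and K: "compact K" "K \<subseteq> U" and g: "continuous_on UNIV g" "\<And>x. x \<notin> K \<Longrightarrow> g x = 0"
  obtains L where "compact L" "L \<subseteq> U" "K \<subseteq> L"
    "\<And>e. e > 0 \<Longrightarrow> \<exists>\<xi>. test_function U \<xi> \<and> (\<forall>x. \<bar>\<xi> x - g x\<bar> \<le> e) \<and> (\<forall>x. x \<notin> L \<longrightarrow> \<xi> x = 0)"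
proof -
  obtain b V where b: "test_function U b" "\<And>x. 0 \<le> b x" "\<And>x. b x \<le> 1" "open V" "K \<subseteq> V" "\<And>x. x \<in> V \<Longrightarrow> b x = 1"
    by (rule smooth_Urysohn[OF K(1) U K(2)]) blast
  obtain L where L: "compact L" "L \<subseteq> U" "\<And>x. x \<notin> L \<Longrightarrow> b x = 0"
    by (rule test_function_support[OF b(1)]) blast
  have KL: "K \<subseteq> L" using b(5,6) L(3) by fastforce
  show thesis
  proof (rule that[OF L(1,2) KL])
    fix e :: real assume e: "e > 0"
    have "\<exists>p. smooth p \<and> (\<forall>x\<in>L. \<bar>g x - p x\<bar> < e)"
    proof (rule Stone_Weierstrass_HOL[of L smooth])
      show "\<exists>f. smooth f \<and> f x \<noteq> f y" if "x \<in> L \<and> y \<in> L \<and> x \<noteq> y" for x y :: "real^'n"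
      proof -
        from that obtain i where "x $ i \<noteq> y $ i" by (auto simp: vec_eq_iff)
        then show ?thesis using smooth_nth by blast
      qed
      show "continuous_on L g" using g(1) continuous_on_subset by blast
    qed (use L e in \<open>auto intro: smooth_continuous smooth_const smooth_add smooth_mult\<close>)
    then obtain p where p: "smooth p" "\<And>x. x \<in> L \<Longrightarrow> \<bar>g x - p x\<bar> < e" by blast
    have "\<bar>b x * p x - g x\<bar> \<le> e" for x
    proof -
      have "b x * g x = g x" using g(2)[of x] b(5,6) by (cases "x \<in> K") auto
      then have "\<bar>b x * p x - g x\<bar> = b x * \<bar>g x - p x\<bar>"
        using b(2)[of x] by (metis abs_minus_commute abs_mult abs_of_nonneg right_diff_distrib)
      also have "\<dots> \<le> e"
      proof (cases "x \<in> L")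
        case True
        have "b x * \<bar>g x - p x\<bar> \<le> 1 * \<bar>g x - p x\<bar>" using b(3)[of x] by (intro mult_right_mono) auto
        then show ?thesis using p(2)[OF True] by simp
      qed (use L(3) e in simp)
      finally show ?thesis .
    qed
    then show "\<exists>\<xi>. test_function U \<xi> \<and> (\<forall>x. \<bar>\<xi> x - g x\<bar> \<le> e) \<and> (\<forall>x. x \<notin> L \<longrightarrow> \<xi> x = 0)"
      using test_function_mult[OF b(1) p(1)] L(3) by (intro exI[of _ "\<lambda>x. b x * p x"]) auto
  qed
qed

lemma DERIV_along_axis:
  assumes "smooth \<phi>"
  shows "((\<lambda>s. \<phi> (x + s *\<^sub>R axis i 1)) has_real_derivative partial_deriv i \<phi> (x + s *\<^sub>R axis i 1)) (at s)"
proof -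
  have "((\<lambda>s. x + s *\<^sub>R axis i 1) has_derivative (\<lambda>h. h *\<^sub>R axis i 1)) (at s)"
    by (auto intro!: derivative_eq_intros)
  moreover have "(\<phi> has_derivative frechet_derivative \<phi> (at (x + s *\<^sub>R axis i 1))) (at (x + s *\<^sub>R axis i 1))"
    using smooth_differentiable[OF assms] by (simp add: frechet_derivative_works)
  ultimately have d: "((\<lambda>s. \<phi> (x + s *\<^sub>R axis i 1)) has_derivative (\<lambda>h. frechet_derivative \<phi> (at (x + s *\<^sub>R axis i 1)) (h *\<^sub>R axis i 1))) (at s)"
    by (rule has_derivative_compose)
  have "linear (frechet_derivative \<phi> (at (x + s *\<^sub>R axis i 1)))"
    using smooth_differentiable[OF assms] by (simp add: linear_frechet_derivative)
  then have "(\<lambda>h. frechet_derivative \<phi> (at (x + s *\<^sub>R axis i 1)) (h *\<^sub>R axis i 1)) = (*) (partial_deriv i \<phi> (x + s *\<^sub>R axis i 1))"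
    by (auto simp: linear_scale partial_deriv_def)
  with d show ?thesis unfolding has_field_derivative_def by (simp only:)
qed

lemma test_function_axis_Lipschitz:
  assumes "test_function U \<phi>"
  obtains L where "L > 0" "\<And>x s i. \<bar>\<phi> (x + s *\<^sub>R axis i 1) - \<phi> x\<bar> \<le> L * \<bar>s\<bar>"
proof -
  have "\<exists>M>0. \<forall>x. \<bar>partial_deriv i \<phi> x\<bar> \<le> M" for i
    using test_function_bounded[OF test_function_partial_deriv[OF assms, of i]] by metis
  then obtain M where M: "\<And>i. M i > 0" "\<And>i x. \<bar>partial_deriv i \<phi> x\<bar> \<le> M i" by metis
  define L where "L = (\<Sum>i\<in>UNIV. M i)"
  have MleL: "M i \<le> L" for i unfolding L_def using M(1) by (intro member_le_sum) (auto intro: less_imp_le)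
  have "\<bar>\<phi> (x + s *\<^sub>R axis i 1) - \<phi> x\<bar> \<le> L * \<bar>s\<bar>" for x s i
  proof -
    have "norm (\<phi> (x + s *\<^sub>R axis i 1) - \<phi> (x + 0 *\<^sub>R axis i 1)) \<le> L * norm (s - 0)"
    proof (rule field_differentiable_bound[of UNIV "\<lambda>s. \<phi> (x + s *\<^sub>R axis i 1)"])
      show "norm (partial_deriv i \<phi> (x + z *\<^sub>R axis i 1)) \<le> L" for z
        using M(2)[of i "x + z *\<^sub>R axis i 1"] MleL[of i] by simp
    qed (auto intro: DERIV_along_axis[OF test_function_smooth[OF assms]])
    then show ?thesis by simp
  qed
  moreover have "L > 0" using M(1) MleL less_le_trans by blast
  ultimately show thesis using that by blast
qed

text \<open>
  The quotient is put on the test function, where it is bounded and converges pointwise;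
  this is why local integrability of \<open>h\<close> suffices.
\<close>
lemma difference_quotient_limit:
  fixes h \<phi> :: "real^'n::finite \<Rightarrow> real"
  assumes h: "locally_integrable h" and \<phi>: "test_function UNIV \<phi>"
    and t: "t \<longlonglongrightarrow> 0" "\<And>k. t k \<noteq> 0"
  shows "(\<lambda>k. LINT x|lebesgue. h x * ((\<phi> (x - t k *\<^sub>R axis i 1) - \<phi> x) / t k))
     \<longlonglongrightarrow> - (LINT x|lebesgue. h x * partial_deriv i \<phi> x)"
proof -
  obtain K where K: "compact K" "\<And>x. x \<notin> K \<Longrightarrow> \<phi> x = 0"
    by (rule test_function_support[OF \<phi>]) blast
  obtain L where L: "L > 0" "\<And>x s i. \<bar>\<phi> (x + s *\<^sub>R axis i 1) - \<phi> x\<bar> \<le> L * \<bar>s\<bar>"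
    using test_function_axis_Lipschitz[OF \<phi>] by metis
  obtain R where R: "\<And>k. \<bar>t k\<bar> \<le> R"
    using convergent_imp_Bseq[OF convergentI[OF t(1)]] by (auto simp: Bseq_def)
  define K' where "K' = {x + y | x y. x \<in> K \<and> y \<in> cball (0::real^'n) R}"
  have R0: "0 \<le> R" using R[of 0] by linarith
  have K': "compact K'" unfolding K'_def by (rule compact_sums[OF K(1) compact_cball])
  have hm: "h \<in> borel_measurable lebesgue" by (rule locally_integrable_measurable[OF h])
  have sm: "smooth \<phi>" by (rule test_function_smooth[OF \<phi>])
  have msh: "(\<lambda>x. \<phi> (x - c)) \<in> borel_measurable lebesgue" for c
  proof (rule borel_imp_lebesgue, rule borel_measurable_continuous_onI)
    show "continuous_on UNIV (\<lambda>x. \<phi> (x - c))"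
      using smooth_continuous[OF sm, of UNIV] by (auto intro!: continuous_on_compose2[of UNIV \<phi>] continuous_intros)
  qed
  have "(\<lambda>k. LINT x|lebesgue. h x * ((\<phi> (x - t k *\<^sub>R axis i 1) - \<phi> x) / t k))
     \<longlonglongrightarrow> (LINT x|lebesgue. h x * - partial_deriv i \<phi> x)"
  proof (rule integral_dominated_convergence[where w="\<lambda>x. L * norm (indicator K' x *\<^sub>R h x)"])
    show "(\<lambda>x. h x * - partial_deriv i \<phi> x) \<in> borel_measurable lebesgue"
      by (intro borel_measurable_times borel_measurable_uminus hm smooth_lebesgue smooth_partial_deriv sm)
    show "(\<lambda>x. h x * ((\<phi> (x - t k *\<^sub>R axis i 1) - \<phi> x) / t k)) \<in> borel_measurable lebesgue" for k
      by (intro borel_measurable_times borel_measurable_divide borel_measurable_diff borel_measurable_const hm msh smooth_lebesgue sm)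
    show "integrable lebesgue (\<lambda>x. L * norm (indicator K' x *\<^sub>R h x))"
      using h K' unfolding locally_integrable_def set_integrable_def
      by (intro integrable_mult_right integrable_norm) auto
    show "AE x in lebesgue. norm (h x * ((\<phi> (x - t k *\<^sub>R axis i 1) - \<phi> x) / t k)) \<le> L * norm (indicator K' x *\<^sub>R h x)" for k
    proof (rule AE_I2)
      fix x
      have "\<bar>\<phi> (x + (- t k) *\<^sub>R axis i 1) - \<phi> x\<bar> \<le> L * \<bar>- t k\<bar>" by (rule L(2))
      then have q: "\<bar>(\<phi> (x - t k *\<^sub>R axis i 1) - \<phi> x) / t k\<bar> \<le> L"
        using t(2)[of k] by (simp add: field_simps)
      show "norm (h x * ((\<phi> (x - t k *\<^sub>R axis i 1) - \<phi> x) / t k)) \<le> L * norm (indicator K' x *\<^sub>R h x)"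
      proof (cases "x \<in> K'")
        case True
        have "\<bar>h x\<bar> * \<bar>(\<phi> (x - t k *\<^sub>R axis i 1) - \<phi> x) / t k\<bar> \<le> \<bar>h x\<bar> * L" by (rule mult_left_mono[OF q]) simp
        then show ?thesis using True by (simp add: abs_mult mult.commute)
      next
        case False
        have a: "x \<notin> K"
        proof
          assume "x \<in> K"
          then have "x + 0 \<in> K'" unfolding K'_def using R0 by fastforce
          then show False using False by simp
        qed
        have b: "x - t k *\<^sub>R axis i 1 \<notin> K"
        proof
          assume "x - t k *\<^sub>R axis i 1 \<in> K"
          then have "(x - t k *\<^sub>R axis i 1) + t k *\<^sub>R axis i 1 \<in> K'"
            unfolding K'_def using R[of k] by (force simp: norm_axis_1)
          then show False using False by simp
        qed
        show ?thesis using False K(2)[OF a] K(2)[OF b] by simp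
      qed
    qed
    show "AE x in lebesgue. (\<lambda>k. h x * ((\<phi> (x - t k *\<^sub>R axis i 1) - \<phi> x) / t k)) \<longlonglongrightarrow> h x * - partial_deriv i \<phi> x"
    proof (intro AE_I2 tendsto_mult tendsto_const)
      fix x
      have "((\<lambda>s. \<phi> (x + s *\<^sub>R axis i 1)) has_real_derivative partial_deriv i \<phi> x) (at 0)"
        using DERIV_along_axis[OF sm, of x i 0] by simp
      then have l: "((\<lambda>s. (\<phi> (x + s *\<^sub>R axis i 1) - \<phi> x) / s) \<longlongrightarrow> partial_deriv i \<phi> x) (at 0)"
        by (simp add: DERIV_def)
      have "(\<lambda>k. (\<phi> (x + (- t k) *\<^sub>R axis i 1) - \<phi> x) / (- t k)) \<longlonglongrightarrow> partial_deriv i \<phi> x"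
      proof (rule filterlim_compose[OF l])
        show "filterlim (\<lambda>k. - t k) (at 0) sequentially"
          using tendsto_minus[OF t(1)] t(2) by (auto simp: filterlim_at)
      qed
      from tendsto_minus[OF this] show "(\<lambda>k. (\<phi> (x - t k *\<^sub>R axis i 1) - \<phi> x) / t k) \<longlonglongrightarrow> - partial_deriv i \<phi> x"
        by simp
    qed
  qed
  then show ?thesis by simp
qed

lemma lebesgue_integral_translate:
  fixes h :: "real^'n::finite \<Rightarrow> real"
  assumes "h \<in> borel_measurable borel"
  shows "(LINT x|lebesgue. h (x + c)) = (LINT x|lebesgue. h x)"
    "integrable lebesgue (\<lambda>x. h (x + c)) \<longleftrightarrow> integrable lebesgue h"
proof -
  have m: "(\<lambda>x. h (c + x)) \<in> borel_measurable borel" using assms by measurable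
  have "integral\<^sup>L lborel h = integral\<^sup>L (distr lborel borel ((+) c)) h" by (simp add: lborel_distr_plus)
  also have "\<dots> = (LINT x|lborel. h (c + x))" using assms by (intro integral_distr) auto
  finally show "(LINT x|lebesgue. h (x + c)) = (LINT x|lebesgue. h x)"
    using m assms by (simp add: integral_completion add.commute)
  have "integrable lborel h = integrable (distr lborel borel ((+) c)) h" by (simp add: lborel_distr_plus)
  also have "\<dots> = integrable lborel (\<lambda>x. h (c + x))" using assms by (intro integrable_distr_eq) auto
  finally show "integrable lebesgue (\<lambda>x. h (x + c)) \<longleftrightarrow> integrable lebesgue h"
    using m assms by (simp add: integrable_completion add.commute)
qed

section \<open>Lipschitz functions with a weak gradient\<close>
lemma integrable_bounded_support_vec:
  fixes h :: "real^'n::finite \<Rightarrow> 'b::euclidean_space"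
  assumes "h \<in> borel_measurable lebesgue" "compact K" "AE x in lebesgue. norm (h x) \<le> M" "\<And>x. x \<notin> K \<Longrightarrow> h x = 0"
  shows "integrable lebesgue h"
proof -
  have "integrable lebesgue (\<lambda>x. norm (h x))"
    by (rule integrable_bounded_support[OF _ assms(2), where M=M]) (use assms in auto)
  then show ?thesis using assms(1) by (rule Bochner_Integration.integrable_bound) auto
qed

lemma locally_integrable_bounded:
  fixes h :: "real^'n::finite \<Rightarrow> 'b::euclidean_space"
  assumes "h \<in> borel_measurable lebesgue" "AE x in lebesgue. norm (h x) \<le> M"
  shows "locally_integrable h"
  unfolding locally_integrable_def set_integrable_def
proof (intro allI impI)
  fix K :: "(real^'n) set" assume K: "compact K"
  show "integrable lebesgue (\<lambda>x. indicator K x *\<^sub>R h x)"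
  proof (rule integrable_bounded_support_vec[OF _ K, where M=M])
    show "(\<lambda>x. indicator K x *\<^sub>R h x) \<in> borel_measurable lebesgue"
      using K assms(1) by (intro borel_measurable_scaleR borel_measurable_indicator) (auto simp: lmeasurable_compact fmeasurableD)
    show "AE x in lebesgue. norm (indicator K x *\<^sub>R h x) \<le> M"
      using assms(2)
    proof eventually_elim
      case (elim x)
      have "0 \<le> M" using elim norm_ge_zero order_trans by blast
      with elim show ?case by (cases "x \<in> K") auto
    qed
  qed simp
qed

lemma integral_abs_le:
  fixes f w :: "'a \<Rightarrow> real"
  assumes "integrable M f" "integrable M w" "AE x in M. \<bar>f x\<bar> \<le> w x"
  shows "\<bar>integral\<^sup>L M f\<bar> \<le> integral\<^sup>L M w"
proof -
  have "\<bar>integral\<^sup>L M f\<bar> \<le> (\<integral>x. \<bar>f x\<bar> \<partial>M)" by (rule integral_abs_bound)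
  also have "\<dots> \<le> integral\<^sup>L M w" by (rule integral_mono_AE) (use assms in auto)
  finally show ?thesis .
qed

lemma integral_abs_le_const:
  fixes f :: "real^'n::finite \<Rightarrow> real"
  assumes "f \<in> borel_measurable lebesgue" "compact K" "AE x in lebesgue. \<bar>f x\<bar> \<le> c" "\<And>x. x \<notin> K \<Longrightarrow> f x = 0"
  shows "\<bar>LINT x|lebesgue. f x\<bar> \<le> c * measure lebesgue K"
proof -
  have K: "K \<in> lmeasurable" using assms(2) by (rule lmeasurable_compact)
  have "\<bar>LINT x|lebesgue. f x\<bar> \<le> (LINT x|lebesgue. indicator K x * c)"
  proof (rule integral_abs_le)
    show "integrable lebesgue f" by (rule integrable_bounded_support[OF assms])
    show "integrable lebesgue (\<lambda>x. indicator K x * c)"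
      using K by (intro integrable_mult_left integrable_real_indicator) (auto simp: fmeasurable_def)
    show "AE x in lebesgue. \<bar>f x\<bar> \<le> indicator K x * c"
      using assms(3)
    proof eventually_elim
      case (elim x) then show ?case using assms(4)[of x] by (cases "x \<in> K") auto
    qed
  qed
  then show ?thesis by (simp add: mult.commute)
qed

lemma locally_integrable_nth:
  fixes G :: "real^'n::finite \<Rightarrow> real^'m::finite"
  assumes "locally_integrable G" shows "locally_integrable (\<lambda>x. G x $ i)"
  unfolding locally_integrable_def set_integrable_def
proof (intro allI impI)
  fix K :: "(real^'n) set" assume K: "compact K"
  have i: "integrable lebesgue (\<lambda>x. indicator K x *\<^sub>R G x)"
    using assms K by (simp add: locally_integrable_def set_integrable_def)
  from integrable_bounded_linear[OF bounded_linear_vec_nth i, of i]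
  show "integrable lebesgue (\<lambda>x. indicator K x *\<^sub>R (G x $ i))" by simp
qed

lemma continuous_on_extend_zero:
  fixes g :: "'a::t2_space \<Rightarrow> real"
  assumes "open B" "compact K" "K \<subseteq> B" "continuous_on B g" "\<And>x. x \<notin> K \<Longrightarrow> g x = 0"
  shows "continuous_on UNIV g"
proof -
  have "continuous_on (- K) g"
    using assms(5) by (subst continuous_on_cong[of "-K" "-K" g "\<lambda>x. 0"]) auto
  then have "continuous_on (B \<union> - K) g"
    using assms by (intro continuous_on_open_Un) (auto simp: compact_imp_closed open_Compl)
  moreover have "B \<union> - K = UNIV" using assms(3) by auto
  ultimately show ?thesis by simp
qed

text \<open>
  The function \<open>u\<close> is arbitrary outside \<open>B\<close>. All statements test with functions supported in \<open>B\<close>,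
  and \<open>cut H\<close> below replaces \<open>H \<circ> u\<close> by a bounded Borel function on the whole space.
\<close>
locale weak_lipschitz =
  fixes B :: "(real^'n::finite) set" and u :: "real^'n \<Rightarrow> real" and G :: "real^'n \<Rightarrow> real^'n" and C0 :: real
  assumes open_B: "open B" and bounded_B: "bounded B"
    and lip: "C0-lipschitz_on B u"
    and G_loc: "locally_integrable G"
    and weak: "\<And>\<phi> i. test_function B \<phi> \<Longrightarrow>
      (LINT x|lebesgue. u x * partial_deriv i \<phi> x) = - (LINT x|lebesgue. G x $ i * \<phi> x)"
begin

lemma C0_nonneg: "0 \<le> C0" using lip by (rule lipschitz_on_nonneg)

lemma u_cont: "continuous_on B u" by (rule lipschitz_on_continuous_on[OF lip])

lemma u_lip: "x \<in> B \<Longrightarrow> y \<in> B \<Longrightarrow> \<bar>u x - u y\<bar> \<le> C0 * norm (x - y)"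
  using lipschitz_onD[OF lip, of x y] by (simp add: dist_norm)

lemma u_bounded: obtains M where "M > 0" "\<And>x. x \<in> B \<Longrightarrow> \<bar>u x\<bar> \<le> M"
proof -
  have "bounded (u ` B)"
    by (rule bounded_uniformly_continuous_image[OF lipschitz_on_uniformly_continuous[OF lip] bounded_B])
  then show thesis using that by (auto simp: bounded_pos)
qed

lemma comp_bounded:
  assumes "continuous_on UNIV H" obtains c where "c > 0" "\<And>x. x \<in> B \<Longrightarrow> \<bar>H (u x)\<bar> \<le> (c::real)"
proof -
  obtain M where M: "M > 0" "\<And>x. x \<in> B \<Longrightarrow> \<bar>u x\<bar> \<le> M" using u_bounded by blast
  have "compact (H ` {-M..M})"
    by (rule compact_continuous_image[OF continuous_on_subset[OF assms] compact_Icc]) simp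
  from compact_imp_bounded[OF this] obtain c where c: "c > 0" "\<forall>y\<in>H ` {-M..M}. norm y \<le> c"
    unfolding bounded_pos by blast
  show thesis
  proof (rule that[OF c(1)])
    show "\<bar>H (u x)\<bar> \<le> c" if "x \<in> B" for x using M(2)[OF that] c(2) by (auto simp: abs_le_iff)
  qed
qed

definition cut :: "(real \<Rightarrow> real) \<Rightarrow> real^'n \<Rightarrow> real" where
  "cut H x = indicator B x * H (u x)"

lemma cut_borel:
  assumes "H \<in> borel_measurable borel" shows "cut H \<in> borel_measurable borel"
proof -
  have "(\<lambda>x. indicator B x *\<^sub>R u x) \<in> borel_measurable borel"
    by (rule borel_measurable_continuous_on_indicator[OF _ u_cont]) (use open_B in auto)
  then have "(\<lambda>x. H (indicator B x *\<^sub>R u x)) \<in> borel_measurable borel"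
    by (rule measurable_compose[OF _ assms])
  then have "(\<lambda>x. indicator B x * H (indicator B x *\<^sub>R u x)) \<in> borel_measurable borel"
    by (rule borel_measurable_times[rotated]) (use open_B in auto)
  moreover have "cut H = (\<lambda>x. indicator B x * H (indicator B x *\<^sub>R u x))"
    by (auto simp: cut_def indicator_def)
  ultimately show ?thesis by simp
qed

lemma cut_bounded:
  assumes "continuous_on UNIV H" obtains c where "c > 0" "\<And>x. \<bar>cut H x\<bar> \<le> (c::real)"
  using comp_bounded[OF assms] unfolding cut_def
  by (metis abs_zero indicator_simps less_imp_le mult_1 mult_zero_left)

lemma G_nth: "locally_integrable (\<lambda>x. G x $ i)" by (rule locally_integrable_nth[OF G_loc])

definition h_seq :: "nat \<Rightarrow> real" where "h_seq k = inverse (real (Suc k))"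

lemma h_seq_pos: "0 < h_seq k" and h_seq_tendsto: "h_seq \<longlonglongrightarrow> 0"
  using LIMSEQ_inverse_real_of_nat by (simp_all add: h_seq_def[abs_def])

definition dquot :: "(real^'n \<Rightarrow> real) \<Rightarrow> 'n \<Rightarrow> nat \<Rightarrow> real^'n \<Rightarrow> real" where
  "dquot w i k x = (w (x + h_seq k *\<^sub>R axis i 1) - w x) / h_seq k"

lemma dquot_borel: 
  assumes "w \<in> borel_measurable borel" shows "dquot w i k \<in> borel_measurable borel"
  unfolding dquot_def[abs_def] using assms by measurable

lemma dquot_limit:
  assumes w: "w \<in> borel_measurable borel" "\<And>x. \<bar>w x\<bar> \<le> c" and \<phi>: "test_function B \<phi>"
  shows "(\<lambda>k. LINT x|lebesgue. dquot w i k x * \<phi> x) \<longlonglongrightarrow> - (LINT x|lebesgue. w x * partial_deriv i \<phi> x)"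
proof -
  have \<phi>U: "test_function UNIV \<phi>" by (rule test_function_mono[OF \<phi>]) simp
  have li: "locally_integrable w"
    by (rule locally_integrable_bounded[OF borel_imp_lebesgue[OF w(1)], where M=c]) (use w(2) in simp)
  have sm: "smooth \<phi>" by (rule test_function_smooth[OF \<phi>])
  have bs: "\<And>a. (\<lambda>x. \<phi> (x - a)) \<in> borel_measurable borel"
    using smooth_borel[OF sm] by measurable
  have eq: "(LINT x|lebesgue. dquot w i k x * \<phi> x)
      = (LINT x|lebesgue. w x * ((\<phi> (x - h_seq k *\<^sub>R axis i 1) - \<phi> x) / h_seq k))" for k
  proof -
    let ?e = "h_seq k *\<^sub>R axis i 1 :: real^'n"
    let ?F = "\<lambda>x. w x * \<phi> (x - ?e)"
    have Fb: "?F \<in> borel_measurable borel" using w(1) bs by (intro borel_measurable_times) auto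
    have wb: "(\<lambda>x. w (x + ?e)) \<in> borel_measurable borel" using w(1) by measurable
    have li': "locally_integrable (\<lambda>x. w (x + ?e))"
      by (rule locally_integrable_bounded[OF borel_imp_lebesgue[OF wb], where M=c]) (use w(2) in simp)
    have i1: "integrable lebesgue (\<lambda>x. w (x + ?e) * \<phi> x)"
      by (rule integrable_test_mult[OF _ borel_imp_lebesgue[OF wb] \<phi>U]) (use li' in \<open>auto simp: locally_integrable_def\<close>)
    have i2: "integrable lebesgue (\<lambda>x. w x * \<phi> x)"
      by (rule integrable_test_mult[OF _ borel_imp_lebesgue[OF w(1)] \<phi>U]) (use li in \<open>auto simp: locally_integrable_def\<close>)
    have tr: "(LINT x|lebesgue. w (x + ?e) * \<phi> x) = (LINT x|lebesgue. ?F x)" "integrable lebesgue ?F"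
      using lebesgue_integral_translate[OF Fb, of ?e] i1 by simp_all
    have "(LINT x|lebesgue. dquot w i k x * \<phi> x) = (LINT x|lebesgue. (w (x + ?e) * \<phi> x - w x * \<phi> x) / h_seq k)"
      by (intro Bochner_Integration.integral_cong) (auto simp: dquot_def field_simps)
    also have "\<dots> = ((LINT x|lebesgue. ?F x) - (LINT x|lebesgue. w x * \<phi> x)) / h_seq k"
      using i1 i2 tr by simp
    also have "\<dots> = (LINT x|lebesgue. (?F x - w x * \<phi> x) / h_seq k)" using i2 tr by simp
    also have "\<dots> = (LINT x|lebesgue. w x * ((\<phi> (x - ?e) - \<phi> x) / h_seq k))"
      by (intro Bochner_Integration.integral_cong) (auto simp: field_simps)
    finally show ?thesis .
  qed
  show ?thesis unfolding eq
    by (rule difference_quotient_limit[OF li \<phi>U h_seq_tendsto]) (use h_seq_pos in \<open>auto simp: less_imp_neq[symmetric]\<close>)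
qed

lemma cut_test:
  assumes "test_function B \<phi>" shows "cut H x * \<phi> x = H (u x) * \<phi> x"
proof (cases "x \<in> B")
  case False
  then have "\<phi> x = 0" using test_function_support[OF assms] by (metis subsetD)
  then show ?thesis by simp
qed (simp add: cut_def)

lemma dquot_bound:
  assumes "x \<in> B" "x + h_seq k *\<^sub>R axis i 1 \<in> B"
  shows "\<bar>dquot (cut (\<lambda>s. s)) i k x\<bar> \<le> C0"
proof -
  have "\<bar>u (x + h_seq k *\<^sub>R axis i 1) - u x\<bar> \<le> C0 * norm (h_seq k *\<^sub>R (axis i 1 :: real^'n))"
    using u_lip[OF assms(2,1)] by simp
  then show ?thesis using assms h_seq_pos[of k]
    by (simp add: dquot_def cut_def norm_axis_1 pos_divide_le_eq)
qed

lemma eventually_shift_in_B: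
  assumes "compact K" "K \<subseteq> B"
  shows "\<forall>\<^sub>F k in sequentially. \<forall>x\<in>K. x + h_seq k *\<^sub>R axis i 1 \<in> B"
proof -
  obtain e where e: "e > 0" "(\<Union>x\<in>K. ball x e) \<subseteq> B"
    using compact_subset_open_imp_ball_epsilon_subset[OF assms(1) open_B assms(2)] by blast
  have "\<forall>\<^sub>F k in sequentially. h_seq k < e" by (rule order_tendstoD(2)[OF h_seq_tendsto e(1)])
  then show ?thesis
  proof eventually_elim
    case (elim k)
    show ?case
    proof
      fix x assume "x \<in> K"
      moreover have "x + h_seq k *\<^sub>R axis i 1 \<in> ball x e"
        using elim h_seq_pos[of k] by (simp add: dist_norm norm_axis_1)
      ultimately show "x + h_seq k *\<^sub>R axis i 1 \<in> B" using e(2) by blast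
    qed
  qed
qed

abbreviation uB :: "real^'n \<Rightarrow> real" where "uB \<equiv> cut (\<lambda>s. s)"

lemma uB_borel: "uB \<in> borel_measurable borel" by (rule cut_borel) simp

lemma dquot_test_limit:
  assumes "test_function B \<phi>"
  shows "(\<lambda>k. LINT x|lebesgue. dquot uB i k x * \<phi> x) \<longlonglongrightarrow> (LINT x|lebesgue. G x $ i * \<phi> x)"
proof -
  obtain c where c: "\<And>x. \<bar>uB x\<bar> \<le> c" using cut_bounded[of "\<lambda>s. s"] by auto
  have "(LINT x|lebesgue. uB x * partial_deriv i \<phi> x) = - (LINT x|lebesgue. G x $ i * \<phi> x)"
    using weak[OF assms] by (simp add: cut_test[OF test_function_partial_deriv[OF assms]])
  with dquot_limit[OF uB_borel c assms, of i] show ?thesis by simp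
qed

lemma integrable_G_test:
  assumes "\<And>x. \<bar>g x\<bar> \<le> M" "g \<in> borel_measurable lebesgue" "compact K" "\<And>x. x \<notin> K \<Longrightarrow> g x = 0"
  shows "integrable lebesgue (\<lambda>x. G x $ i * g x)"
  using G_nth[of i] assms(3)
  by (intro integrable_loc_mult[where K=K and M=M] assms locally_integrable_measurable) (auto simp: locally_integrable_def)

text \<open>
  Inside \<open>B\<close> the difference quotients of \<open>u\<close> are bounded by the Lipschitz constant. Convergence
  against test functions therefore extends to the uniform closure, which contains all
  continuous functions with compact support in \<open>B\<close>. This stands in for Rademacher's theorem.
\<close>
lemma dquot_weak_limit:
  assumes K: "compact K" "K \<subseteq> B" and g: "continuous_on UNIV g" "\<And>x. x \<notin> K \<Longrightarrow> g x = 0"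
  shows "(\<lambda>k. LINT x|lebesgue. dquot uB i k x * g x) \<longlonglongrightarrow> (LINT x|lebesgue. G x $ i * g x)"
proof (rule LIMSEQ_I)
  fix r :: real assume r: "0 < r"
  obtain L where L: "compact L" "L \<subseteq> B" "K \<subseteq> L"
    "\<And>e. e > 0 \<Longrightarrow> \<exists>\<xi>. test_function B \<xi> \<and> (\<forall>x. \<bar>\<xi> x - g x\<bar> \<le> e) \<and> (\<forall>x. x \<notin> L \<longrightarrow> \<xi> x = 0)"
    by (rule smooth_approx[OF open_B K g(1)]) (erule g(2), blast)
  have gb: "g \<in> borel_measurable borel" by (rule borel_measurable_continuous_onI[OF g(1)])
  have "compact (g ` L)" by (rule compact_continuous_image[OF continuous_on_subset[OF g(1)] L(1)]) simp
  from compact_imp_bounded[OF this] obtain Mg where Mg: "Mg > 0" "\<forall>y\<in>g ` L. norm y \<le> Mg"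
    unfolding bounded_pos by blast
  have gM: "\<bar>g x\<bar> \<le> Mg" for x using Mg g(2)[of x] L(3) by (cases "x \<in> K") auto
  obtain cu where cu: "\<And>x. \<bar>uB x\<bar> \<le> cu" using cut_bounded[of "\<lambda>s. s"] by auto
  define I where "I = (LINT x|lebesgue. \<bar>G x $ i * indicator L x\<bar>)"
  define c where "c = C0 * measure lebesgue L + I + 1"
  have "I \<ge> 0" unfolding I_def by simp
  then have c: "c > 0" using C0_nonneg unfolding c_def by (simp add: add_nonneg_pos)
  \<comment> \<open>approximating \<open>g\<close> within \<open>e\<close> costs at most \<open>e * c\<close>, half of the error budget\<close>
  define e where "e = r / (2 * c)"
  have e: "e > 0" using r c by (simp add: e_def)
  obtain \<xi> where \<xi>: "test_function B \<xi>" "\<And>x. \<bar>\<xi> x - g x\<bar> \<le> e" "\<And>x. x \<notin> L \<Longrightarrow> \<xi> x = 0"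
    using L(4)[OF e] by blast
  obtain M\<xi> where M\<xi>: "\<And>x. \<bar>\<xi> x\<bar> \<le> M\<xi>" using test_function_bounded[OF \<xi>(1)] by blast
  have \<xi>b: "\<xi> \<in> borel_measurable borel" by (rule smooth_borel[OF test_function_smooth[OF \<xi>(1)]])
  have g0: "g x = 0" if "x \<notin> L" for x using g(2)[of x] L(3) that by blast
  have Gi: "\<bar>(LINT x|lebesgue. G x $ i * (\<xi> x - g x))\<bar> \<le> e * I"
  proof -
    have "\<bar>(LINT x|lebesgue. G x $ i * (\<xi> x - g x))\<bar> \<le> (LINT x|lebesgue. e * \<bar>G x $ i * indicator L x\<bar>)"
    proof (rule integral_abs_le)
      show "integrable lebesgue (\<lambda>x. G x $ i * (\<xi> x - g x))"
        using \<xi>(2,3) g0 \<xi>b gb L(1) by (intro integrable_G_test[where M=e and K=L] borel_imp_lebesgue) auto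
      have "integrable lebesgue (\<lambda>x. G x $ i * indicator L x)"
        using L(1) by (intro integrable_G_test[where M=1 and K=L] borel_measurable_indicator)
          (auto simp: lmeasurable_compact fmeasurableD)
      then show "integrable lebesgue (\<lambda>x. e * \<bar>G x $ i * indicator L x\<bar>)" by simp
      show "AE x in lebesgue. \<bar>G x $ i * (\<xi> x - g x)\<bar> \<le> e * \<bar>G x $ i * indicator L x\<bar>"
      proof (rule AE_I2)
        fix x show "\<bar>G x $ i * (\<xi> x - g x)\<bar> \<le> e * \<bar>G x $ i * indicator L x\<bar>"
          using mult_left_mono[OF \<xi>(2)[of x], of "\<bar>G x $ i\<bar>"] \<xi>(3)[of x] g0[of x]
          by (cases "x \<in> L") (auto simp: abs_mult mult.commute)
      qed
    qed
    then show ?thesis by (simp add: I_def)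
  qed
  have dq: "\<forall>\<^sub>F k in sequentially. \<bar>(LINT x|lebesgue. dquot uB i k x * (g x - \<xi> x))\<bar> \<le> C0 * e * measure lebesgue L"
    using eventually_shift_in_B[OF L(1,2), where i=i]
  proof eventually_elim
    case (elim k)
    show ?case
    proof (rule integral_abs_le_const[OF _ L(1)])
      show "(\<lambda>x. dquot uB i k x * (g x - \<xi> x)) \<in> borel_measurable lebesgue"
        by (intro borel_imp_lebesgue borel_measurable_times borel_measurable_diff gb \<xi>b dquot_borel uB_borel)
      show "AE x in lebesgue. \<bar>dquot uB i k x * (g x - \<xi> x)\<bar> \<le> C0 * e"
      proof (rule AE_I2)
        fix x show "\<bar>dquot uB i k x * (g x - \<xi> x)\<bar> \<le> C0 * e"
        proof (cases "x \<in> L")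
          case True
          then have "\<bar>dquot uB i k x\<bar> \<le> C0" using elim L(2) by (intro dquot_bound) auto
          moreover have "\<bar>g x - \<xi> x\<bar> \<le> e" using \<xi>(2)[of x] by (simp add: abs_minus_commute)
          ultimately show ?thesis unfolding abs_mult using C0_nonneg by (intro mult_mono) auto
        qed (use g0 \<xi>(3) C0_nonneg e in auto)
      qed
    qed (use g0 \<xi>(3) in auto)
  qed
  have "\<forall>\<^sub>F k in sequentially. \<bar>(LINT x|lebesgue. dquot uB i k x * \<xi> x) - (LINT x|lebesgue. G x $ i * \<xi> x)\<bar> < r / 2"
    using dquot_test_limit[OF \<xi>(1), of i] r unfolding tendsto_iff dist_real_def by (meson half_gt_zero)
  with dq have "\<forall>\<^sub>F k in sequentially. norm ((LINT x|lebesgue. dquot uB i k x * g x) - (LINT x|lebesgue. G x $ i * g x)) < r"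
  proof eventually_elim
    case (elim k)
    have dM: "\<bar>dquot uB i k x\<bar> \<le> (cu + cu) / h_seq k" for x
    proof -
      have "\<bar>uB (x + h_seq k *\<^sub>R axis i 1) - uB x\<bar> \<le> cu + cu"
        using cu[of x] cu[of "x + h_seq k *\<^sub>R axis i 1"] by linarith
      then show ?thesis using h_seq_pos[of k] by (simp add: dquot_def divide_right_mono)
    qed
    have dli: "locally_integrable (dquot uB i k)"
      by (rule locally_integrable_bounded[OF borel_imp_lebesgue[OF dquot_borel[OF uB_borel]], where M="(cu + cu) / h_seq k"])
        (use dM in simp)
    have i1: "integrable lebesgue (\<lambda>x. dquot uB i k x * g x)"
      using dli L(1) gM g0 gb
      by (intro integrable_loc_mult[where K=L and M=Mg] borel_imp_lebesgue dquot_borel uB_borel) (auto simp: locally_integrable_def)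
    have i2: "integrable lebesgue (\<lambda>x. dquot uB i k x * \<xi> x)"
      using dli L(1) M\<xi> \<xi>(3) \<xi>b
      by (intro integrable_loc_mult[where K=L and M=M\<xi>] borel_imp_lebesgue dquot_borel uB_borel) (auto simp: locally_integrable_def)
    have i3: "integrable lebesgue (\<lambda>x. G x $ i * g x)"
      using gM gb g0 L(1) by (intro integrable_G_test[where M=Mg and K=L] borel_imp_lebesgue)
    have i4: "integrable lebesgue (\<lambda>x. G x $ i * \<xi> x)"
      using M\<xi> \<xi>b \<xi>(3) L(1) by (intro integrable_G_test[where M=M\<xi> and K=L] borel_imp_lebesgue)
    have e1: "(LINT x|lebesgue. dquot uB i k x * (g x - \<xi> x)) = (LINT x|lebesgue. dquot uB i k x * g x) - (LINT x|lebesgue. dquot uB i k x * \<xi> x)"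
      using i1 i2 by (simp add: right_diff_distrib)
    have e2: "(LINT x|lebesgue. G x $ i * (\<xi> x - g x)) = (LINT x|lebesgue. G x $ i * \<xi> x) - (LINT x|lebesgue. G x $ i * g x)"
      using i3 i4 by (simp add: right_diff_distrib)
    have "\<bar>(LINT x|lebesgue. dquot uB i k x * g x) - (LINT x|lebesgue. G x $ i * g x)\<bar> < C0 * e * measure lebesgue L + r / 2 + e * I"
      using elim Gi e1 e2 by linarith
    also have "\<dots> \<le> e * c + r / 2" unfolding c_def using e by (simp add: algebra_simps)
    also have "\<dots> = r" using c by (simp add: e_def)
    finally show ?case by simp
  qed
  then show "\<exists>no. \<forall>n\<ge>no. norm ((LINT x|lebesgue. dquot uB i n x * g x) - (LINT x|lebesgue. G x $ i * g x)) < r"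
    by (simp add: eventually_sequentially)
qed

text \<open>
  Weak limits inherit the bound on the difference quotients.
\<close>
lemma G_bound: "AE x in lebesgue. x \<in> B \<longrightarrow> \<bar>G x $ i\<bar> \<le> C0"
proof -
  have main: "\<bar>LINT x|lebesgue. G x $ i * \<phi> x\<bar> \<le> C0 * (LINT x|lebesgue. \<phi> x)"
    if \<phi>: "test_function B \<phi>" "\<And>x. 0 \<le> \<phi> x" for \<phi>
  proof -
    obtain K where K: "compact K" "K \<subseteq> B" "\<And>x. x \<notin> K \<Longrightarrow> \<phi> x = 0"
      by (rule test_function_support[OF \<phi>(1)]) blast
    obtain M where M: "\<And>x. \<bar>\<phi> x\<bar> \<le> M" using test_function_bounded[OF \<phi>(1)] by blast
    have sb: "\<phi> \<in> borel_measurable borel" by (rule smooth_borel[OF test_function_smooth[OF \<phi>(1)]])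
    have i\<phi>: "integrable lebesgue \<phi>"
      by (rule integrable_bounded_support[OF borel_imp_lebesgue[OF sb] K(1), where M=M]) (use M K in auto)
    have "\<forall>\<^sub>F k in sequentially. \<bar>LINT x|lebesgue. dquot uB i k x * \<phi> x\<bar> \<le> C0 * (LINT x|lebesgue. \<phi> x)"
      using eventually_shift_in_B[OF K(1,2), where i=i]
    proof eventually_elim
      case (elim k)
      have b: "\<bar>dquot uB i k x * \<phi> x\<bar> \<le> C0 * \<phi> x" for x
      proof (cases "x \<in> K")
        case True
        then have "\<bar>dquot uB i k x\<bar> \<le> C0" using elim K(2) by (intro dquot_bound) auto
        then show ?thesis using \<phi>(2)[of x] by (simp add: abs_mult mult_right_mono)
      qed (simp add: K(3))
      have "\<bar>LINT x|lebesgue. dquot uB i k x * \<phi> x\<bar> \<le> (LINT x|lebesgue. C0 * \<phi> x)"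
      proof (rule integral_abs_le)
        show "integrable lebesgue (\<lambda>x. dquot uB i k x * \<phi> x)"
        proof (rule integrable_bounded_support[OF _ K(1), where M="C0 * M"])
          show "AE x in lebesgue. \<bar>dquot uB i k x * \<phi> x\<bar> \<le> C0 * M"
          proof (rule AE_I2)
            fix x show "\<bar>dquot uB i k x * \<phi> x\<bar> \<le> C0 * M"
              using b[of x] mult_left_mono[OF M[of x] C0_nonneg] \<phi>(2)[of x] by simp
          qed
        qed (use K(3) in \<open>auto intro!: borel_imp_lebesgue borel_measurable_times dquot_borel uB_borel sb\<close>)
      qed (use i\<phi> b in auto)
      then show ?case by simp
    qed
    then show ?thesis
      using tendsto_rabs[OF dquot_test_limit[OF \<phi>(1), of i]] by (intro tendsto_upperbound) auto
  qed
  have aux: "AE x in lebesgue. x \<in> B \<longrightarrow> 0 \<le> C0 - s * (G x $ i)" if s: "s = 1 \<or> s = -1" for s :: real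
  proof (rule AE_nonneg_of_test[OF open_B])
    have Gm: "(\<lambda>x. G x $ i) \<in> borel_measurable lebesgue" by (rule locally_integrable_measurable[OF G_nth])
    show "(\<lambda>x. C0 - s * (G x $ i)) \<in> borel_measurable lebesgue" using Gm by measurable
    show "set_integrable lebesgue K (\<lambda>x. C0 - s * (G x $ i))" if K: "compact K" for K
    proof (rule set_integral_diff(1))
      have "locally_integrable (\<lambda>x::real^'n. C0)" by (rule locally_integrable_bounded[where M=C0]) (use C0_nonneg in auto)
      then show "set_integrable lebesgue K (\<lambda>x. C0)" using K by (simp add: locally_integrable_def)
      show "set_integrable lebesgue K (\<lambda>x. s * (G x $ i))"
        using G_nth[of i] K by (intro set_integrable_mult_right) (simp add: locally_integrable_def)
    qed
    fix \<phi> assume \<phi>: "test_function B \<phi>" "\<And>x. 0 \<le> \<phi> x"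
    obtain K where K: "compact K" "K \<subseteq> B" "\<And>x. x \<notin> K \<Longrightarrow> \<phi> x = 0"
      by (rule test_function_support[OF \<phi>(1)]) blast
    obtain M where M: "\<And>x. \<bar>\<phi> x\<bar> \<le> M" using test_function_bounded[OF \<phi>(1)] by blast
    have sb: "\<phi> \<in> borel_measurable lebesgue" by (rule smooth_lebesgue[OF test_function_smooth[OF \<phi>(1)]])
    have i\<phi>: "integrable lebesgue \<phi>"
      by (rule integrable_bounded_support[OF sb K(1), where M=M]) (use M K in auto)
    have iG: "integrable lebesgue (\<lambda>x. G x $ i * \<phi> x)" by (rule integrable_G_test[OF M sb K(1,3)])
    have "(LINT x|lebesgue. (C0 - s * (G x $ i)) * \<phi> x) = (LINT x|lebesgue. C0 * \<phi> x - s * (G x $ i * \<phi> x))"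
      by (intro Bochner_Integration.integral_cong) (auto simp: algebra_simps)
    also have "\<dots> = C0 * (LINT x|lebesgue. \<phi> x) - s * (LINT x|lebesgue. G x $ i * \<phi> x)"
      using i\<phi> iG by simp
    finally show "0 \<le> (LINT x|lebesgue. (C0 - s * (G x $ i)) * \<phi> x)"
      using main[OF \<phi>] s by auto
  qed
  show ?thesis
    using aux[of 1, simplified] aux[of "-1", simplified] by eventually_elim auto
qed

end

context weak_lipschitz
begin

text \<open>
  By Taylor's formula the difference quotient of \<open>H(u)\<close> is \<open>H'(u)\<close> times that of \<open>u\<close>, up to an
  error of the order of the step, because \<open>u\<close> is Lipschitz. The product \<open>H'(u) \<phi>\<close> is continuous, so
  weak convergence of the difference quotients of \<open>u\<close> applies.
\<close>
lemma chain_rule_smooth: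
  assumes H: "smooth1 H" "\<And>t. (H has_real_derivative H' t) (at t)" and \<phi>: "test_function B \<phi>"
  shows "(LINT x|lebesgue. H (u x) * partial_deriv i \<phi> x) = - (LINT x|lebesgue. H' (u x) * (G x $ i) * \<phi> x)"
proof -
  obtain H'' where H'': "\<And>t. (H' has_real_derivative H'' t) (at t)" "smooth1 H''"
  proof -
    obtain F F' where F: "\<And>x. (H has_real_derivative F x) (at x)" "smooth1 F"
      "\<And>x. (F has_real_derivative F' x) (at x)" "smooth1 F'"
      using smooth1_obtain_deriv[OF H(1)] smooth1_obtain_deriv by metis
    have "F = H'" using DERIV_unique[OF F(1) H(2)] by (intro ext)
    with F that show thesis by metis
  qed
  have H'c: "continuous_on UNIV H'" using H''(1) by (auto simp: continuous_on_eq_continuous_at intro: DERIV_isCont)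
  have Hc: "continuous_on UNIV H" by (rule smooth1_continuous[OF H(1)])
  obtain M where M: "M > 0" "\<And>x. x \<in> B \<Longrightarrow> \<bar>u x\<bar> \<le> M" using u_bounded by blast
  have "compact (H'' ` {-M..M})"
    by (rule compact_continuous_image[OF smooth1_continuous[OF H''(2)] compact_Icc])
  from compact_imp_bounded[OF this] obtain L where L: "L > 0" "\<forall>y\<in>H'' ` {-M..M}. norm y \<le> L"
    unfolding bounded_pos by blast
  have taylor: "\<bar>H b - H a - H' a * (b - a)\<bar> \<le> L * \<bar>b - a\<bar> * \<bar>b - a\<bar>" if ab: "\<bar>a\<bar> \<le> M" "\<bar>b\<bar> \<le> M" for a b
  proof -
    have seg: "closed_segment a b \<subseteq> {-M..M}"
      using ab by (intro closed_segment_subset) auto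
    have segab: "\<bar>z - a\<bar> \<le> \<bar>b - a\<bar>" if "z \<in> closed_segment a b" for z
      using segment_bound1[OF that] by (simp add: abs_minus_commute)
    have l: "\<bar>H' z - H' a\<bar> \<le> L * \<bar>z - a\<bar>" if z: "z \<in> closed_segment a b" for z
    proof -
      have "norm (H' z - H' a) \<le> L * norm (z - a)"
      proof (rule field_differentiable_bound[of "closed_segment a b" H' H''])
        show "norm (H'' w) \<le> L" if "w \<in> closed_segment a b" for w using that seg L(2) by blast
        show "(H' has_real_derivative H'' w) (at w within closed_segment a b)" for w
          by (rule has_field_derivative_at_within[OF H''(1)])
      qed (use z in auto)
      then show ?thesis by simp
    qed
    have "norm ((H b - H' a * b) - (H a - H' a * a)) \<le> (L * \<bar>b - a\<bar>) * norm (b - a)"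
    proof (rule field_differentiable_bound[of "closed_segment a b" "\<lambda>z. H z - H' a * z" "\<lambda>z. H' z - H' a"])
      show "norm (H' z - H' a) \<le> L * \<bar>b - a\<bar>" if z: "z \<in> closed_segment a b" for z
        using l[OF z] mult_left_mono[OF segab[OF z] less_imp_le[OF L(1)]] unfolding real_norm_def by linarith
      show "((\<lambda>z. H z - H' a * z) has_real_derivative H' z - H' a) (at z within closed_segment a b)" for z
        by (auto intro!: derivative_eq_intros has_field_derivative_at_within[OF H(2)])
    qed auto
    then show ?thesis by (simp add: algebra_simps)
  qed
  obtain K where K: "compact K" "K \<subseteq> B" "\<And>x. x \<notin> K \<Longrightarrow> \<phi> x = 0"
    by (rule test_function_support[OF \<phi>]) blast
  obtain M\<phi> where M\<phi>: "\<And>x. \<bar>\<phi> x\<bar> \<le> M\<phi>" using test_function_bounded[OF \<phi>] by blast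
  have M\<phi>0: "0 \<le> M\<phi>" using M\<phi>[of undefined] by linarith
  have \<phi>b: "\<phi> \<in> borel_measurable borel" by (rule smooth_borel[OF test_function_smooth[OF \<phi>]])
  define g where "g x = H' (u x) * \<phi> x" for x
  have gc: "continuous_on UNIV g"
  proof (rule continuous_on_extend_zero[OF open_B K(1,2)])
    show "continuous_on B g" unfolding g_def[abs_def]
      by (intro continuous_on_mult smooth_continuous test_function_smooth[OF \<phi>] continuous_on_compose2[OF H'c u_cont]) auto
  qed (simp add: g_def K(3))
  have g0: "g x = 0" if "x \<notin> K" for x using K(3)[OF that] by (simp add: g_def)
  have lim1: "(\<lambda>k. LINT x|lebesgue. dquot uB i k x * g x) \<longlonglongrightarrow> (LINT x|lebesgue. G x $ i * g x)"
    by (rule dquot_weak_limit[OF K(1,2) gc g0])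
  have Hb: "H \<in> borel_measurable borel" by (rule borel_measurable_continuous_onI[OF Hc])
  have cb: "cut H \<in> borel_measurable borel" by (rule cut_borel[OF Hb])
  obtain cH where cH: "\<And>x. \<bar>cut H x\<bar> \<le> cH" using cut_bounded[OF Hc] by blast
  obtain cu where cu: "\<And>x. \<bar>uB x\<bar> \<le> cu" using cut_bounded[of "\<lambda>s. s"] by auto
  have lim2: "(\<lambda>k. LINT x|lebesgue. dquot (cut H) i k x * \<phi> x) \<longlonglongrightarrow> - (LINT x|lebesgue. cut H x * partial_deriv i \<phi> x)"
    by (rule dquot_limit[OF cb cH \<phi>])
  have gb: "g \<in> borel_measurable borel" by (rule borel_measurable_continuous_onI[OF gc])
  obtain Mg where Mg: "\<And>x. \<bar>g x\<bar> \<le> Mg"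
  proof -
    obtain c where c: "c > 0" "\<And>x. x \<in> B \<Longrightarrow> \<bar>H' (u x)\<bar> \<le> c" using comp_bounded[OF H'c] by blast
    have "\<bar>g x\<bar> \<le> c * M\<phi>" for x
    proof (cases "x \<in> K")
      case True then show ?thesis unfolding g_def abs_mult using c(2)[of x] K(2) M\<phi>[of x] c(1) by (intro mult_mono) auto
    next
      case False then show ?thesis using g0 M\<phi>0 c(1) by simp
    qed
    then show thesis by (rule that)
  qed
  have dbd: "\<bar>dquot w i k x\<bar> \<le> (c + c) / h_seq k" if w: "\<And>x. \<bar>w x\<bar> \<le> c" for w c k x
  proof -
    have "\<bar>w (x + h_seq k *\<^sub>R axis i 1) - w x\<bar> \<le> c + c"
      using w[of x] w[of "x + h_seq k *\<^sub>R axis i 1"] by linarith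
    then show ?thesis using h_seq_pos[of k] by (simp add: dquot_def divide_right_mono)
  qed
  have dint: "integrable lebesgue (\<lambda>x. dquot w i k x * \<psi> x)"
    if w: "w \<in> borel_measurable borel" "\<And>x. \<bar>w x\<bar> \<le> c" and \<psi>: "\<psi> \<in> borel_measurable borel" "\<And>x. \<bar>\<psi> x\<bar> \<le> m" "\<And>x. x \<notin> K \<Longrightarrow> \<psi> x = 0"
    for w c k \<psi> m
  proof -
    have "locally_integrable (dquot w i k)"
      by (rule locally_integrable_bounded[OF borel_imp_lebesgue[OF dquot_borel[OF w(1)]], where M="(c + c) / h_seq k"])
        (use dbd[OF w(2)] in simp)
    then have "set_integrable lebesgue K (dquot w i k)" using K(1) by (simp add: locally_integrable_def)
    then show ?thesis
      by (rule integrable_loc_mult[OF _ borel_imp_lebesgue[OF dquot_borel[OF w(1)]] borel_imp_lebesgue[OF \<psi>(1)] \<psi>(2,3)])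
  qed
  have "(\<lambda>k. (LINT x|lebesgue. dquot (cut H) i k x * \<phi> x) - (LINT x|lebesgue. dquot uB i k x * g x)) \<longlonglongrightarrow> 0"
  proof (rule Lim_null_comparison)
    show "(\<lambda>k. h_seq k * (M\<phi> * L * C0 * C0 * measure lebesgue K)) \<longlonglongrightarrow> 0"
      by (rule tendsto_mult_left_zero[OF h_seq_tendsto])
    show "\<forall>\<^sub>F k in sequentially. norm ((LINT x|lebesgue. dquot (cut H) i k x * \<phi> x) - (LINT x|lebesgue. dquot uB i k x * g x))
        \<le> h_seq k * (M\<phi> * L * C0 * C0 * measure lebesgue K)"
      using eventually_shift_in_B[OF K(1,2), where i=i]
    proof eventually_elim
      case (elim k)
      have i1: "integrable lebesgue (\<lambda>x. dquot (cut H) i k x * \<phi> x)" by (rule dint[OF cb cH \<phi>b M\<phi> K(3)])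
      have i2: "integrable lebesgue (\<lambda>x. dquot uB i k x * g x)" by (rule dint[OF uB_borel cu gb Mg g0])
      have "\<bar>LINT x|lebesgue. dquot (cut H) i k x * \<phi> x - dquot uB i k x * g x\<bar> \<le> (M\<phi> * L * C0 * C0 * h_seq k) * measure lebesgue K"
      proof (rule integral_abs_le_const[OF _ K(1)])
        show "(\<lambda>x. dquot (cut H) i k x * \<phi> x - dquot uB i k x * g x) \<in> borel_measurable lebesgue"
          using i1 i2 by (intro borel_measurable_diff) auto
        show "dquot (cut H) i k x * \<phi> x - dquot uB i k x * g x = 0" if "x \<notin> K" for x
          using K(3)[OF that] g0[OF that] by simp
        show "AE x in lebesgue. \<bar>dquot (cut H) i k x * \<phi> x - dquot uB i k x * g x\<bar> \<le> M\<phi> * L * C0 * C0 * h_seq k"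
        proof (rule AE_I2)
          fix x
          show "\<bar>dquot (cut H) i k x * \<phi> x - dquot uB i k x * g x\<bar> \<le> M\<phi> * L * C0 * C0 * h_seq k"
          proof (cases "x \<in> K")
            case True
            let ?b = "u (x + h_seq k *\<^sub>R axis i 1)" and ?a = "u x"
            have xB: "x \<in> B" "x + h_seq k *\<^sub>R axis i 1 \<in> B" using True elim K(2) by auto
            have eq: "dquot (cut H) i k x * \<phi> x - dquot uB i k x * g x = \<phi> x * ((H ?b - H ?a - H' ?a * (?b - ?a)) / h_seq k)"
              using xB h_seq_pos[of k] by (simp add: dquot_def cut_def g_def field_simps)
            have ba: "\<bar>?b - ?a\<bar> \<le> C0 * h_seq k"
              using u_lip[OF xB(2,1)] h_seq_pos[of k] by (simp add: norm_axis_1)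
            have "\<bar>H ?b - H ?a - H' ?a * (?b - ?a)\<bar> \<le> L * \<bar>?b - ?a\<bar> * \<bar>?b - ?a\<bar>"
              by (rule taylor) (use M(2) xB in auto)
            also have "\<dots> \<le> L * (C0 * h_seq k) * (C0 * h_seq k)"
              using ba L(1) C0_nonneg h_seq_pos[of k] by (intro mult_mono) auto
            finally have "\<bar>(H ?b - H ?a - H' ?a * (?b - ?a)) / h_seq k\<bar> \<le> L * C0 * C0 * h_seq k"
              using h_seq_pos[of k] by (simp add: field_simps)
            then have "\<bar>\<phi> x\<bar> * \<bar>(H ?b - H ?a - H' ?a * (?b - ?a)) / h_seq k\<bar> \<le> M\<phi> * (L * C0 * C0 * h_seq k)"
              using M\<phi>[of x] M\<phi>0 by (intro mult_mono) auto
            then show ?thesis unfolding eq abs_mult by (simp add: mult.assoc)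
          next
            case False
            have "0 \<le> M\<phi> * L * C0 * C0 * h_seq k"
              using M\<phi>0 L(1) C0_nonneg h_seq_pos[of k] by (intro mult_nonneg_nonneg) auto
            then show ?thesis using K(3)[OF False] g0[OF False] by simp
          qed
        qed
      qed
      then show ?case using i1 i2 by (simp add: ac_simps)
    qed
  qed
  from tendsto_diff[OF lim2 this]
  have "(\<lambda>k. LINT x|lebesgue. dquot uB i k x * g x) \<longlonglongrightarrow> - (LINT x|lebesgue. cut H x * partial_deriv i \<phi> x)"
    by simp
  from LIMSEQ_unique[OF this lim1]
  have "(LINT x|lebesgue. G x $ i * g x) = - (LINT x|lebesgue. cut H x * partial_deriv i \<phi> x)" by simp
  then have "(LINT x|lebesgue. G x $ i * g x) = - (LINT x|lebesgue. H (u x) * partial_deriv i \<phi> x)"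
    by (simp only: cut_test[OF test_function_partial_deriv[OF \<phi>]])
  then show ?thesis by (simp add: g_def ac_simps)
qed

lemma integrable_cut_G_test:
  assumes h: "h \<in> borel_measurable borel" "\<And>x. x \<in> B \<Longrightarrow> \<bar>h (u x)\<bar> \<le> c" and \<phi>: "test_function B \<phi>"
  shows "integrable lebesgue (\<lambda>x. h (u x) * (G x $ i) * \<phi> x)"
proof -
  obtain K where K: "compact K" "K \<subseteq> B" "\<And>x. x \<notin> K \<Longrightarrow> \<phi> x = 0"
    by (rule test_function_support[OF \<phi>]) blast
  obtain M where M: "\<And>x. \<bar>\<phi> x\<bar> \<le> M" using test_function_bounded[OF \<phi>] by blast
  have M0: "0 \<le> M" using M[of undefined] by linarith
  have "integrable lebesgue (\<lambda>x. G x $ i * (cut h x * \<phi> x))"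
  proof (rule integrable_G_test[OF _ _ K(1), where M="\<bar>c\<bar> * M"])
    show "\<bar>cut h x * \<phi> x\<bar> \<le> \<bar>c\<bar> * M" for x
    proof (cases "x \<in> B")
      case True
      then show ?thesis unfolding cut_def abs_mult using h(2)[OF True] M[of x] M0 by (intro mult_mono) auto
    qed (use M0 in \<open>simp add: cut_def\<close>)
    show "(\<lambda>x. cut h x * \<phi> x) \<in> borel_measurable lebesgue"
      by (intro borel_imp_lebesgue borel_measurable_times cut_borel h(1) smooth_borel test_function_smooth[OF \<phi>])
  qed (simp add: K(3))
  then have "integrable lebesgue (\<lambda>x. G x $ i * (h (u x) * \<phi> x))" by (simp only: cut_test[OF \<phi>])
  then show ?thesis by (simp add: ac_simps)
qed

lemma integrable_cut_test:
  assumes h: "h \<in> borel_measurable borel" "\<And>x. x \<in> B \<Longrightarrow> \<bar>h (u x)\<bar> \<le> c" and \<phi>: "test_function B \<phi>"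
  shows "integrable lebesgue (\<lambda>x. h (u x) * \<phi> x)"
proof -
  obtain K where K: "compact K" "K \<subseteq> B" "\<And>x. x \<notin> K \<Longrightarrow> \<phi> x = 0"
    by (rule test_function_support[OF \<phi>]) blast
  obtain M where M: "\<And>x. \<bar>\<phi> x\<bar> \<le> M" using test_function_bounded[OF \<phi>] by blast
  have M0: "0 \<le> M" using M[of undefined] by linarith
  have "integrable lebesgue (\<lambda>x. cut h x * \<phi> x)"
  proof (rule integrable_bounded_support[OF _ K(1), where M="\<bar>c\<bar> * M"])
    have "\<bar>cut h x * \<phi> x\<bar> \<le> \<bar>c\<bar> * M" for x
    proof (cases "x \<in> B")
      case True
      then show ?thesis unfolding cut_def abs_mult using h(2)[OF True] M[of x] M0 by (intro mult_mono) auto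
    qed (use M0 in \<open>simp add: cut_def\<close>)
    then show "AE x in lebesgue. \<bar>cut h x * \<phi> x\<bar> \<le> \<bar>c\<bar> * M" by simp
    show "(\<lambda>x. cut h x * \<phi> x) \<in> borel_measurable lebesgue"
      by (intro borel_imp_lebesgue borel_measurable_times cut_borel h(1) smooth_borel test_function_smooth[OF \<phi>])
  qed (simp add: K(3))
  then show ?thesis by (simp add: cut_test[OF \<phi>])
qed

text \<open>
  Approximate \<open>max 0 t\<close> by \<open>S(k t)/k\<close>, whose derivatives \<open>\<eta>(k t)\<close> increase to the indicator of
  the positive numbers; dominated convergence does the rest.
\<close>
lemma chain_rule_pos:
  assumes \<phi>: "test_function B \<phi>"
  shows "(LINT x|lebesgue. max 0 (u x) * partial_deriv i \<phi> x) = - (LINT x|lebesgue. of_bool (0 < u x) * (G x $ i) * \<phi> x)"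
proof -
  obtain S where S: "smooth1 S" "\<And>t. t \<le> 0 \<Longrightarrow> S t = 0" "\<And>t. S t \<le> max 0 t" "\<And>t. t - 1 \<le> S t"
    "\<And>t. (S has_real_derivative smooth_step t) (at t)"
    by (rule smooth_ramp) blast
  define H where "H k t = S (real (Suc k) * t) / real (Suc k)" for k t
  define H' where "H' k t = smooth_step (real (Suc k) * t)" for k t
  have sH: "smooth1 (H k)" for k
    using smooth1_mult[OF smooth1_affine[OF S(1), of "real (Suc k)" 0] smooth1_const[of "inverse (real (Suc k))"]]
    by (simp add: H_def[abs_def] divide_inverse)
  have dH: "(H k has_real_derivative H' k t) (at t)" for k t
  proof -
    have "((\<lambda>t. S (real (Suc k) * t)) has_real_derivative smooth_step (real (Suc k) * t) * real (Suc k)) (at t)"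
      by (rule DERIV_chain2[OF S(5)]) (auto intro!: derivative_eq_intros)
    from DERIV_cdivide[OF this, of "real (Suc k)"] show ?thesis by (simp add: H_def[abs_def] H'_def)
  qed
  have Hle: "H k t \<le> max 0 t" for k t
  proof -
    have "S (real (Suc k) * t) \<le> max 0 t * real (Suc k)"
      using S(3)[of "real (Suc k) * t"] by (auto simp: max_def zero_le_mult_iff mult.commute split: if_splits)
    then show ?thesis unfolding H_def by (simp add: pos_divide_le_eq del: of_nat_Suc)
  qed
  have Hge: "t - inverse (real (Suc k)) \<le> H k t" for k t
  proof -
    have "(real (Suc k) * t - 1) / real (Suc k) \<le> H k t"
      unfolding H_def by (intro divide_right_mono S(4)) simp
    then show ?thesis by (simp add: diff_divide_distrib inverse_eq_divide del: of_nat_Suc)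
  qed
  have H0: "H k t = 0" if "t \<le> 0" for k t using that by (simp add: H_def S(2) mult_nonneg_nonpos del: of_nat_Suc)
  have Hb: "\<bar>H k t\<bar> \<le> \<bar>t\<bar> + 1" for k t
  proof (cases "t \<le> 0")
    case False
    have "inverse (real (Suc k)) \<le> 1" by (simp add: field_simps)
    then show ?thesis using Hle[of k t] Hge[of t k] False by (auto simp: abs_if)
  qed (use H0 in simp)
  have limH: "(\<lambda>k. H k t) \<longlonglongrightarrow> max 0 t" for t
  proof (cases "t \<le> 0")
    case False
    have "(\<lambda>k. H k t) \<longlonglongrightarrow> t"
    proof (rule tendsto_sandwich)
      show "\<forall>\<^sub>F k in sequentially. t - inverse (real (Suc k)) \<le> H k t" using Hge by simp
      show "\<forall>\<^sub>F k in sequentially. H k t \<le> t" using Hle[of _ t] False by simp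
      have "(\<lambda>k. t - inverse (real (Suc k))) \<longlonglongrightarrow> t - 0"
        by (intro tendsto_diff tendsto_const LIMSEQ_inverse_real_of_nat)
      then show "(\<lambda>k. t - inverse (real (Suc k))) \<longlonglongrightarrow> t" by simp
    qed (rule tendsto_const)
    then show ?thesis using False by simp
  qed (use H0 in simp)
  have limH': "(\<lambda>k. H' k t) \<longlonglongrightarrow> of_bool (0 < t)" for t
    unfolding H'_def by (rule smooth_step_scaled_limit)
  obtain M where M: "M > 0" "\<And>x. x \<in> B \<Longrightarrow> \<bar>u x\<bar> \<le> M" using u_bounded by blast
  have pd: "test_function B (partial_deriv i \<phi>)" by (rule test_function_partial_deriv[OF \<phi>])
  have pm: "(max 0 :: real \<Rightarrow> real) \<in> borel_measurable borel" by simp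
  have bm: "(\<lambda>t::real. of_bool (0 < t) :: real) \<in> borel_measurable borel" by measurable
  have Hm: "H k \<in> borel_measurable borel" for k
    by (rule borel_measurable_continuous_onI[OF smooth1_continuous[OF sH]])
  have H'm: "H' k \<in> borel_measurable borel" for k
  proof (rule borel_measurable_continuous_onI)
    show "continuous_on UNIV (H' k)"
      unfolding H'_def[abs_def] using smooth1_continuous[OF smooth1_smooth_step, of UNIV]
      by (auto intro!: continuous_on_compose2[of UNIV smooth_step] continuous_intros)
  qed
  have H'b: "\<bar>H' k t\<bar> \<le> 1" for k t by (simp add: H'_def smooth_step_nonneg smooth_step_le_1)
  have l1: "(\<lambda>k. LINT x|lebesgue. H k (u x) * partial_deriv i \<phi> x) \<longlonglongrightarrow> (LINT x|lebesgue. max 0 (u x) * partial_deriv i \<phi> x)"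
  proof (rule integral_dominated_convergence[where w="\<lambda>x. \<bar>(M + 1) * partial_deriv i \<phi> x\<bar>"])
    show "integrable lebesgue (\<lambda>x. \<bar>(M + 1) * partial_deriv i \<phi> x\<bar>)"
      using integrable_cut_test[where h="\<lambda>_. M + 1" and c="M + 1", OF _ _ pd] M(1) by (intro integrable_abs) auto
    show "(\<lambda>x. max 0 (u x) * partial_deriv i \<phi> x) \<in> borel_measurable lebesgue"
      by (rule borel_measurable_integrable[OF integrable_cut_test[OF pm _ pd, where c=M]]) (use M in fastforce)
    show "(\<lambda>x. H k (u x) * partial_deriv i \<phi> x) \<in> borel_measurable lebesgue" for k
    proof (rule borel_measurable_integrable[OF integrable_cut_test[OF Hm _ pd, where c="M+1"]])
      show "\<bar>H k (u x)\<bar> \<le> M + 1" if "x \<in> B" for x using Hb[of k "u x"] M(2)[OF that] by linarith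
    qed
    show "AE x in lebesgue. (\<lambda>k. H k (u x) * partial_deriv i \<phi> x) \<longlonglongrightarrow> max 0 (u x) * partial_deriv i \<phi> x"
      by (intro AE_I2 tendsto_mult limH tendsto_const)
    show "AE x in lebesgue. norm (H k (u x) * partial_deriv i \<phi> x) \<le> \<bar>(M + 1) * partial_deriv i \<phi> x\<bar>" for k
    proof (rule AE_I2)
      fix x show "norm (H k (u x) * partial_deriv i \<phi> x) \<le> \<bar>(M + 1) * partial_deriv i \<phi> x\<bar>"
      proof (cases "x \<in> B")
        case True
        have "\<bar>H k (u x)\<bar> \<le> \<bar>M + 1\<bar>" using Hb[of k "u x"] M(2)[OF True] by linarith
        then show ?thesis by (simp add: abs_mult mult_right_mono)
      next
        case False
        then have "partial_deriv i \<phi> x = 0" using cut_test[OF pd, of "\<lambda>_. 1" x] by (simp add: cut_def)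
        then show ?thesis by simp
      qed
    qed
  qed
  have l2: "(\<lambda>k. LINT x|lebesgue. H' k (u x) * (G x $ i) * \<phi> x) \<longlonglongrightarrow> (LINT x|lebesgue. of_bool (0 < u x) * (G x $ i) * \<phi> x)"
  proof (rule integral_dominated_convergence[where w="\<lambda>x. \<bar>1 * (G x $ i) * \<phi> x\<bar>"])
    show "integrable lebesgue (\<lambda>x. \<bar>1 * (G x $ i) * \<phi> x\<bar>)"
      using integrable_cut_G_test[where h="\<lambda>_. 1" and c=1, OF _ _ \<phi>] by (intro integrable_abs) auto
    show "(\<lambda>x. of_bool (0 < u x) * (G x $ i) * \<phi> x) \<in> borel_measurable lebesgue"
      by (rule borel_measurable_integrable[OF integrable_cut_G_test[OF bm _ \<phi>, where c=1]]) auto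
    show "(\<lambda>x. H' k (u x) * (G x $ i) * \<phi> x) \<in> borel_measurable lebesgue" for k
      by (rule borel_measurable_integrable[OF integrable_cut_G_test[OF H'm _ \<phi>, where c=1]]) (rule H'b)
    show "AE x in lebesgue. (\<lambda>k. H' k (u x) * (G x $ i) * \<phi> x) \<longlonglongrightarrow> of_bool (0 < u x) * (G x $ i) * \<phi> x"
      by (intro AE_I2 tendsto_mult limH' tendsto_const)
    show "AE x in lebesgue. norm (H' k (u x) * (G x $ i) * \<phi> x) \<le> \<bar>1 * (G x $ i) * \<phi> x\<bar>" for k
    proof (rule AE_I2)
      fix x show "norm (H' k (u x) * (G x $ i) * \<phi> x) \<le> \<bar>1 * (G x $ i) * \<phi> x\<bar>"
        using mult_right_mono[OF H'b[of k "u x"], of "\<bar>G x $ i * \<phi> x\<bar>"] by (simp add: abs_mult mult.assoc)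
    qed
  qed
  have "(\<lambda>k. - (LINT x|lebesgue. H' k (u x) * (G x $ i) * \<phi> x)) \<longlonglongrightarrow> (LINT x|lebesgue. max 0 (u x) * partial_deriv i \<phi> x)"
    using l1 by (simp add: chain_rule_smooth[OF sH dH \<phi>])
  from LIMSEQ_unique[OF this tendsto_minus[OF l2]] show ?thesis .
qed

text \<open>
  The pairs for which the chain rule holds: smooth functions with their derivatives, and the
  positive part with the indicator of the positive numbers.
\<close>
definition chain_pair :: "(real \<Rightarrow> real) \<Rightarrow> (real \<Rightarrow> real) \<Rightarrow> bool" where
  "chain_pair H h \<longleftrightarrow> continuous_on UNIV H \<and> h \<in> borel_measurable borel \<and> (\<exists>c. \<forall>x\<in>B. \<bar>h (u x)\<bar> \<le> c) \<and>
     (\<forall>\<phi> i. test_function B \<phi> \<longrightarrow>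
       (LINT x|lebesgue. H (u x) * partial_deriv i \<phi> x) = - (LINT x|lebesgue. h (u x) * (G x $ i) * \<phi> x))"

lemma chain_pair_smooth:
  assumes "smooth1 H" "\<And>t. (H has_real_derivative H' t) (at t)"
  shows "chain_pair H H'"
proof -
  have H': "smooth1 H'"
    using smooth1_obtain_deriv[OF assms(1)] assms(2) DERIV_unique by (metis ext)
  have H'c: "continuous_on UNIV H'" by (rule smooth1_continuous[OF H'])
  have "\<exists>c. \<forall>x\<in>B. \<bar>H' (u x)\<bar> \<le> c" using comp_bounded[OF H'c] by metis
  then show ?thesis unfolding chain_pair_def
    using chain_rule_smooth[OF assms] smooth1_continuous[OF assms(1)] borel_measurable_continuous_onI[OF H'c] by blast
qed

lemma chain_pair_pos: "chain_pair (max 0) (\<lambda>t. of_bool (0 < t))"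
  unfolding chain_pair_def
proof (intro conjI allI impI)
  show "\<exists>c. \<forall>x\<in>B. \<bar>of_bool (0 < u x) :: real\<bar> \<le> c" by (intro exI[of _ 1]) auto
qed (auto intro!: chain_rule_pos continuous_intros)

text \<open>
  Variations of \<open>u\<close>: a function of \<open>u\<close> times a cutoff, with its weak gradient by the product rule.
\<close>
definition comp_fun :: "(real \<Rightarrow> real) \<Rightarrow> (real^'n \<Rightarrow> real) \<Rightarrow> real^'n \<Rightarrow> real" where
  "comp_fun H \<zeta> x = H (u x) * \<zeta> x"

definition comp_grad :: "(real \<Rightarrow> real) \<Rightarrow> (real \<Rightarrow> real) \<Rightarrow> (real^'n \<Rightarrow> real) \<Rightarrow> real^'n \<Rightarrow> real^'n" where
  "comp_grad H h \<zeta> x = H (u x) *\<^sub>R (\<chi> i. partial_deriv i \<zeta> x) + (h (u x) * \<zeta> x) *\<^sub>R G x"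

lemma G_norm_bound: "AE x in lebesgue. x \<in> B \<longrightarrow> norm (G x) \<le> real CARD('n) * C0"
proof -
  have "AE x in lebesgue. \<forall>i. x \<in> B \<longrightarrow> \<bar>G x $ i\<bar> \<le> C0" using G_bound by (subst AE_all_countable) auto
  then show ?thesis
  proof eventually_elim
    case (elim x)
    have "norm (G x) \<le> real CARD('n) * C0" if "x \<in> B"
    proof -
      have "norm (G x) \<le> (\<Sum>i\<in>UNIV. \<bar>G x $ i\<bar>)" by (rule norm_le_l1_cart)
      also have "\<dots> \<le> (\<Sum>i\<in>(UNIV::'n set). C0)" using elim that by (intro sum_mono) auto
      finally show ?thesis by simp
    qed
    then show ?case by blast
  qed
qed

lemma comp_props:
  assumes ch: "chain_pair H h" and \<zeta>: "test_function B \<zeta>"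
  obtains K c where "compact K" "K \<subseteq> B" "c \<ge> 0"
    "comp_fun H \<zeta> \<in> borel_measurable lebesgue" "comp_grad H h \<zeta> \<in> borel_measurable lebesgue"
    "\<And>x. x \<notin> K \<Longrightarrow> comp_fun H \<zeta> x = 0" "\<And>x. x \<notin> K \<Longrightarrow> comp_grad H h \<zeta> x = 0"
    "\<And>x. \<bar>comp_fun H \<zeta> x\<bar> \<le> c" "AE x in lebesgue. norm (comp_grad H h \<zeta> x) \<le> c"
proof -
  obtain K where K: "compact K" "K \<subseteq> B" "\<And>x. x \<notin> K \<Longrightarrow> \<zeta> x = 0"
    by (rule test_function_support[OF \<zeta>]) blast
  have pd0: "partial_deriv i \<zeta> x = 0" if "x \<notin> K" for i x
    by (rule partial_deriv_outside[OF compact_imp_closed[OF K(1)] K(3) that])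
  obtain M where M: "\<And>x. \<bar>\<zeta> x\<bar> \<le> M" using test_function_bounded[OF \<zeta>] by blast
  have M0: "0 \<le> M" using M[of undefined] by linarith
  have Hc: "continuous_on UNIV H" and hm: "h \<in> borel_measurable borel" using ch by (auto simp: chain_pair_def)
  obtain cH where cH: "cH > 0" "\<And>x. x \<in> B \<Longrightarrow> \<bar>H (u x)\<bar> \<le> cH" using comp_bounded[OF Hc] by blast
  obtain ch' where ch': "\<And>x. x \<in> B \<Longrightarrow> \<bar>h (u x)\<bar> \<le> ch'" using ch by (auto simp: chain_pair_def)
  have "\<exists>m. \<forall>x. \<bar>partial_deriv i \<zeta> x\<bar> \<le> m" for i
    using test_function_bounded[OF test_function_partial_deriv[OF \<zeta>, of i]] by metis
  then obtain m where m: "\<And>i x. \<bar>partial_deriv i \<zeta> x\<bar> \<le> m i" by metis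
  define P where "P x = (\<chi> i. partial_deriv i \<zeta> x)" for x
  have Pn: "norm (P x) \<le> (\<Sum>i\<in>UNIV. m i)" for x
  proof -
    have "norm (P x) \<le> (\<Sum>i\<in>UNIV. \<bar>P x $ i\<bar>)" by (rule norm_le_l1_cart)
    also have "\<dots> \<le> (\<Sum>i\<in>UNIV. m i)" using m by (intro sum_mono) (simp add: P_def)
    finally show ?thesis .
  qed
  have P0: "P x = 0" if "x \<notin> K" for x using pd0[OF that] by (simp add: P_def vec_eq_iff)
  have Pm: "P \<in> borel_measurable borel"
  proof (rule borel_measurable_continuous_onI)
    show "continuous_on UNIV P" unfolding P_def[abs_def]
      by (intro continuous_on_vec_lambda smooth_continuous smooth_partial_deriv test_function_smooth[OF \<zeta>])
  qed
  have Gm: "G \<in> borel_measurable lebesgue" by (rule locally_integrable_measurable[OF G_loc])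
  have w: "comp_fun H \<zeta> = (\<lambda>x. cut H x * \<zeta> x)" by (auto simp: comp_fun_def cut_test[OF \<zeta>])
  have d: "comp_grad H h \<zeta> = (\<lambda>x. cut H x *\<^sub>R P x + (cut h x * \<zeta> x) *\<^sub>R G x)"
  proof
    fix x show "comp_grad H h \<zeta> x = cut H x *\<^sub>R P x + (cut h x * \<zeta> x) *\<^sub>R G x"
    proof (cases "x \<in> K")
      case True then show ?thesis using K(2) by (auto simp: comp_grad_def cut_def P_def)
    next
      case False then show ?thesis using P0[OF False] K(3)[OF False] by (simp add: comp_grad_def P_def)
    qed
  qed
  have cHm: "cut H \<in> borel_measurable lebesgue" and chm: "cut h \<in> borel_measurable lebesgue"
    using hm borel_measurable_continuous_onI[OF Hc] by (auto intro!: borel_imp_lebesgue cut_borel)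
  have \<zeta>m: "\<zeta> \<in> borel_measurable lebesgue" by (rule smooth_lebesgue[OF test_function_smooth[OF \<zeta>]])
  define c where "c = cH * M + cH * (\<Sum>i\<in>UNIV. m i) + \<bar>ch'\<bar> * M * (real CARD('n) * C0)"
  have S0: "0 \<le> (\<Sum>i\<in>UNIV. m i)" using Pn[of undefined] norm_ge_zero order_trans by blast
  have c1: "cH * M \<le> c" unfolding c_def using cH(1) S0 M0 C0_nonneg by simp
  have c2: "cH * (\<Sum>i\<in>UNIV. m i) + \<bar>ch'\<bar> * M * (real CARD('n) * C0) \<le> c" unfolding c_def using cH(1) M0 by simp
  have c0: "0 \<le> c" using c1 mult_nonneg_nonneg[of cH M] cH(1) M0 by linarith
  show thesis
  proof (rule that[OF K(1,2) c0])
    show "comp_fun H \<zeta> \<in> borel_measurable lebesgue" unfolding w by (intro borel_measurable_times cHm \<zeta>m)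
    show "comp_grad H h \<zeta> \<in> borel_measurable lebesgue" unfolding d
      by (intro borel_measurable_add borel_measurable_scaleR borel_measurable_times cHm chm \<zeta>m Gm borel_imp_lebesgue[OF Pm])
    show "comp_fun H \<zeta> x = 0" if "x \<notin> K" for x by (simp add: comp_fun_def K(3)[OF that])
    show "comp_grad H h \<zeta> x = 0" if "x \<notin> K" for x using P0[OF that] by (simp add: d K(3)[OF that])
    show "\<bar>comp_fun H \<zeta> x\<bar> \<le> c" for x
    proof (cases "x \<in> K")
      case True
      have "\<bar>H (u x)\<bar> * \<bar>\<zeta> x\<bar> \<le> cH * M" using cH True K(2) M[of x] by (intro mult_mono) auto
      then show ?thesis using c1 by (simp add: comp_fun_def abs_mult)
    qed (simp add: comp_fun_def K(3) c0)
    show "AE x in lebesgue. norm (comp_grad H h \<zeta> x) \<le> c"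
      using G_norm_bound
    proof eventually_elim
      case (elim x)
      show ?case
      proof (cases "x \<in> K")
        case True
        then have xB: "x \<in> B" using K(2) by blast
        have "norm (comp_grad H h \<zeta> x) \<le> \<bar>cut H x\<bar> * norm (P x) + \<bar>cut h x\<bar> * \<bar>\<zeta> x\<bar> * norm (G x)"
          unfolding d by (rule order_trans[OF norm_triangle_ineq]) (simp add: abs_mult)
        also have "\<dots> \<le> cH * (\<Sum>i\<in>UNIV. m i) + \<bar>ch'\<bar> * M * (real CARD('n) * C0)"
          using cH(1) cH(2)[OF xB] ch'[OF xB] Pn[of x] M[of x] elim xB M0 S0
          by (intro add_mono mult_mono) (auto simp: cut_def intro: mult_nonneg_nonneg)
        finally show ?thesis using c2 by linarith
      qed (simp add: d P0 K(3) c0)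
    qed
  qed
qed

lemma has_weak_gradient_comp:
  assumes ch: "chain_pair H h" and \<zeta>: "test_function B \<zeta>"
  shows "has_weak_gradient (comp_fun H \<zeta>) (comp_grad H h \<zeta>)"
  unfolding has_weak_gradient_def
proof (intro conjI allI impI)
  obtain K c where Kc: "compact K" "K \<subseteq> B" "c \<ge> 0"
    "comp_fun H \<zeta> \<in> borel_measurable lebesgue" "comp_grad H h \<zeta> \<in> borel_measurable lebesgue"
    "\<And>x. x \<notin> K \<Longrightarrow> comp_fun H \<zeta> x = 0" "\<And>x. x \<notin> K \<Longrightarrow> comp_grad H h \<zeta> x = 0"
    "\<And>x. \<bar>comp_fun H \<zeta> x\<bar> \<le> c" "AE x in lebesgue. norm (comp_grad H h \<zeta> x) \<le> c"
    by (rule comp_props[OF ch \<zeta>]) blast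
  show "locally_integrable (comp_fun H \<zeta>)"
    by (rule locally_integrable_bounded[OF Kc(4), where M=c]) (use Kc(8) in simp)
  show "locally_integrable (comp_grad H h \<zeta>)"
    by (rule locally_integrable_bounded[OF Kc(5,9)])
  fix \<phi> :: "real^'n \<Rightarrow> real" and i assume \<phi>: "test_function UNIV \<phi>"
  have sm: "smooth \<phi>" "smooth \<zeta>" using \<phi> \<zeta> by (auto intro: test_function_smooth)
  have t1: "test_function B (\<lambda>x. \<zeta> x * \<phi> x)" by (rule test_function_mult[OF \<zeta> sm(1)])
  have t2: "test_function B (\<lambda>x. \<zeta> x * partial_deriv i \<phi> x)"
    by (rule test_function_mult[OF \<zeta> smooth_partial_deriv[OF sm(1)]])
  have t3: "test_function B (\<lambda>x. partial_deriv i \<zeta> x * \<phi> x)"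
    by (rule test_function_mult[OF test_function_partial_deriv[OF \<zeta>] sm(1)])
  have Hc: "continuous_on UNIV H" and hm: "h \<in> borel_measurable borel" using ch by (auto simp: chain_pair_def)
  have Hm: "H \<in> borel_measurable borel" by (rule borel_measurable_continuous_onI[OF Hc])
  obtain cH where cH: "\<And>x. x \<in> B \<Longrightarrow> \<bar>H (u x)\<bar> \<le> cH" using comp_bounded[OF Hc] by blast
  obtain ch' where ch': "\<And>x. x \<in> B \<Longrightarrow> \<bar>h (u x)\<bar> \<le> ch'" using ch by (auto simp: chain_pair_def)
  have i2: "integrable lebesgue (\<lambda>x. H (u x) * (\<zeta> x * partial_deriv i \<phi> x))"
    by (rule integrable_cut_test[OF Hm cH t2])
  have i3: "integrable lebesgue (\<lambda>x. H (u x) * (partial_deriv i \<zeta> x * \<phi> x))"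
    by (rule integrable_cut_test[OF Hm cH t3])
  have i4: "integrable lebesgue (\<lambda>x. h (u x) * (G x $ i) * (\<zeta> x * \<phi> x))"
    by (rule integrable_cut_G_test[OF hm ch' t1])
  have "(LINT x|lebesgue. H (u x) * partial_deriv i (\<lambda>x. \<zeta> x * \<phi> x) x)
      = - (LINT x|lebesgue. h (u x) * (G x $ i) * (\<zeta> x * \<phi> x))"
    using ch t1 by (auto simp: chain_pair_def)
  moreover have "(LINT x|lebesgue. H (u x) * partial_deriv i (\<lambda>x. \<zeta> x * \<phi> x) x)
     = (LINT x|lebesgue. H (u x) * (\<zeta> x * partial_deriv i \<phi> x)) + (LINT x|lebesgue. H (u x) * (partial_deriv i \<zeta> x * \<phi> x))"
    using i2 i3 by (simp add: partial_deriv_mult[OF sm(2,1)] distrib_left)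
  moreover have "(LINT x|lebesgue. comp_grad H h \<zeta> x $ i * \<phi> x)
     = (LINT x|lebesgue. H (u x) * (partial_deriv i \<zeta> x * \<phi> x)) + (LINT x|lebesgue. h (u x) * (G x $ i) * (\<zeta> x * \<phi> x))"
    using i3 i4 by (subst Bochner_Integration.integral_add[symmetric]) (auto simp: comp_grad_def algebra_simps)
  moreover have "(LINT x|lebesgue. comp_fun H \<zeta> x * partial_deriv i \<phi> x) = (LINT x|lebesgue. H (u x) * (\<zeta> x * partial_deriv i \<phi> x))"
    by (simp add: comp_fun_def mult.assoc)
  ultimately show "(LINT x|lebesgue. comp_fun H \<zeta> x * partial_deriv i \<phi> x) = - (LINT x|lebesgue. comp_grad H h \<zeta> x $ i * \<phi> x)"
    by simp
qed

end

section \<open>Uniqueness and vanishing of weak gradients\<close>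
lemma has_weak_gradient_measurable:
  assumes "has_weak_gradient u G"
  shows "u \<in> borel_measurable lebesgue" "G \<in> borel_measurable lebesgue"
  using assms by (auto simp: has_weak_gradient_def intro: locally_integrable_measurable)

lemma has_weak_gradient_unique:
  assumes "has_weak_gradient u G" "has_weak_gradient u G'"
  shows "AE x in lebesgue. G x = G' x"
proof -
  have "AE x in lebesgue. G x $ i - G' x $ i = 0" for i
  proof -
    have li: "locally_integrable (\<lambda>x. G x $ i)" "locally_integrable (\<lambda>x. G' x $ i)"
      using assms by (auto simp: has_weak_gradient_def intro: locally_integrable_nth)
    have "AE x in lebesgue. x \<in> UNIV \<longrightarrow> G x $ i - G' x $ i = 0"
    proof (rule AE_zero_of_test[OF open_UNIV])
      show "set_integrable lebesgue K (\<lambda>x. G x $ i - G' x $ i)" if "compact K" for K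
        using li that by (intro set_integral_diff(1)) (auto simp: locally_integrable_def)
      show "(\<lambda>x. G x $ i - G' x $ i) \<in> borel_measurable lebesgue"
        by (intro borel_measurable_diff locally_integrable_measurable li)
      fix \<phi> :: "real^'a \<Rightarrow> real" assume \<phi>: "test_function UNIV \<phi>"
      have 1: "integrable lebesgue (\<lambda>x. G x $ i * \<phi> x)"
        by (rule integrable_test_mult[OF _ locally_integrable_measurable[OF li(1)] \<phi>]) (use li in \<open>auto simp: locally_integrable_def\<close>)
      have 2: "integrable lebesgue (\<lambda>x. G' x $ i * \<phi> x)"
        by (rule integrable_test_mult[OF _ locally_integrable_measurable[OF li(2)] \<phi>]) (use li in \<open>auto simp: locally_integrable_def\<close>)
      have "(LINT x|lebesgue. G x $ i * \<phi> x) = (LINT x|lebesgue. G' x $ i * \<phi> x)"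
      proof -
        have "(LINT x|lebesgue. u x * partial_deriv i \<phi> x) = - (LINT x|lebesgue. D x $ i * \<phi> x)"
          if "has_weak_gradient u D" for D using that \<phi> by (simp add: has_weak_gradient_def)
        from this[OF assms(1)] this[OF assms(2)] show ?thesis by simp
      qed
      then show "(LINT x|lebesgue. (G x $ i - G' x $ i) * \<phi> x) = 0"
        using 1 2 by (simp add: left_diff_distrib)
    qed
    then show ?thesis by simp
  qed
  then have "AE x in lebesgue. \<forall>i. G x $ i - G' x $ i = 0" by (subst AE_all_countable) auto
  then show ?thesis by eventually_elim (simp add: vec_eq_iff)
qed

lemma has_weak_gradient_weak_gradient:
  "has_weak_gradient u G \<Longrightarrow> has_weak_gradient u (weak_gradient u)"
  unfolding weak_gradient_def by (rule someI[of "has_weak_gradient u"])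

text \<open>
  Makes the energy independent of the choice in the definition of \<open>weak_gradient\<close>.
\<close>
lemma weak_gradient_energy:
  assumes "has_weak_gradient u G"
  shows "(LINT x|lebesgue. (norm (weak_gradient u x))\<^sup>2) = (LINT x|lebesgue. (norm (G x))\<^sup>2)"
proof (rule integral_cong_AE)
  have h: "has_weak_gradient u (weak_gradient u)" by (rule has_weak_gradient_weak_gradient[OF assms])
  show "(\<lambda>x. (norm (weak_gradient u x))\<^sup>2) \<in> borel_measurable lebesgue" "(\<lambda>x. (norm (G x))\<^sup>2) \<in> borel_measurable lebesgue"
    using has_weak_gradient_measurable(2)[OF h] has_weak_gradient_measurable(2)[OF assms] by measurable
  show "AE x in lebesgue. (norm (weak_gradient u x))\<^sup>2 = (norm (G x))\<^sup>2"
    using has_weak_gradient_unique[OF h assms] by eventually_elim simp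
qed

lemma has_weak_gradient_diff:
  assumes "has_weak_gradient u G" "has_weak_gradient w D"
  shows "has_weak_gradient (\<lambda>x. u x - w x) (\<lambda>x. G x - D x)"
  unfolding has_weak_gradient_def
proof (intro conjI allI impI)
  note a = assms[unfolded has_weak_gradient_def]
  show "locally_integrable (\<lambda>x. u x - w x)" "locally_integrable (\<lambda>x. G x - D x)"
    using a unfolding locally_integrable_def by (auto intro: set_integral_diff(1))
  fix \<phi> :: "real^'a \<Rightarrow> real" and i assume \<phi>: "test_function UNIV \<phi>"
  have pd: "test_function UNIV (partial_deriv i \<phi>)" by (rule test_function_partial_deriv[OF \<phi>])
  have int: "integrable lebesgue (\<lambda>x. h x * \<psi> x)" if "locally_integrable h" "test_function UNIV \<psi>" for h \<psi> :: "real^'a \<Rightarrow> real"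
    by (rule integrable_test_mult[OF _ locally_integrable_measurable[OF that(1)] that(2)]) (use that in \<open>auto simp: locally_integrable_def\<close>)
  have "integrable lebesgue (\<lambda>x. u x * partial_deriv i \<phi> x)" "integrable lebesgue (\<lambda>x. w x * partial_deriv i \<phi> x)"
    "integrable lebesgue (\<lambda>x. G x $ i * \<phi> x)" "integrable lebesgue (\<lambda>x. D x $ i * \<phi> x)"
    using a by (auto intro!: int locally_integrable_nth pd \<phi>)
  then show "(LINT x|lebesgue. (u x - w x) * partial_deriv i \<phi> x) = - (LINT x|lebesgue. (G x - D x) $ i * \<phi> x)"
    using a \<phi> by (simp add: left_diff_distrib)
qed

lemma has_weak_gradient_scale:
  assumes "has_weak_gradient w D"
  shows "has_weak_gradient (\<lambda>x. t * w x) (\<lambda>x. t *\<^sub>R D x)"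
  unfolding has_weak_gradient_def
proof (intro conjI allI impI)
  note a = assms[unfolded has_weak_gradient_def]
  show "locally_integrable (\<lambda>x. t * w x)" using a unfolding locally_integrable_def by auto
  show "locally_integrable (\<lambda>x. t *\<^sub>R D x)"
    unfolding locally_integrable_def set_integrable_def
  proof (intro allI impI)
    fix K :: "(real^'a) set" assume "compact K"
    then have "integrable lebesgue (\<lambda>x. indicator K x *\<^sub>R D x)"
      using a by (simp add: locally_integrable_def set_integrable_def)
    then have "integrable lebesgue (\<lambda>x. t *\<^sub>R (indicator K x *\<^sub>R D x))" by (rule integrable_scaleR_right)
    then show "integrable lebesgue (\<lambda>x. indicator K x *\<^sub>R t *\<^sub>R D x)" by (simp add: mult.commute)
  qed
  fix \<phi> :: "real^'a \<Rightarrow> real" and i assume \<phi>: "test_function UNIV \<phi>"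
  then have "(LINT x|lebesgue. w x * partial_deriv i \<phi> x) = - (LINT x|lebesgue. D x $ i * \<phi> x)" using a by blast
  then show "(LINT x|lebesgue. t * w x * partial_deriv i \<phi> x) = - (LINT x|lebesgue. (t *\<^sub>R D x) $ i * \<phi> x)"
    by (simp add: mult.assoc)
qed

lemma has_weak_gradient_zero: "has_weak_gradient (\<lambda>x. 0) (\<lambda>x. 0)"
  by (simp add: has_weak_gradient_def locally_integrable_def set_integrable_def)

lemma smooth_translate:
  fixes \<phi> :: "real^'n::finite \<Rightarrow> real"
  assumes "smooth \<phi>" shows "smooth (\<lambda>x. \<phi> (x - a))"
proof -
  have "C_k k \<phi> \<Longrightarrow> C_k k (\<lambda>x. \<phi> (x - a))" for k and \<phi> :: "real^'n \<Rightarrow> real"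
  proof (induction k arbitrary: \<phi>)
    case 0 then show ?case by (auto intro!: continuous_on_compose2[of UNIV \<phi>] continuous_intros)
  next
    case (Suc k)
    have d: "((\<lambda>x. \<phi> (x - a)) has_derivative frechet_derivative \<phi> (at (x - a))) (at x)" for x
    proof -
      have "((\<lambda>x. x - a) has_derivative (\<lambda>h. h)) (at x)" by (auto intro!: derivative_eq_intros)
      moreover have "(\<phi> has_derivative frechet_derivative \<phi> (at (x - a))) (at (x - a))"
        using Suc.prems by (simp add: frechet_derivative_works)
      ultimately show ?thesis by (rule has_derivative_compose)
    qed
    have "partial_deriv i (\<lambda>x. \<phi> (x - a)) = (\<lambda>x. partial_deriv i \<phi> (x - a))" for i
      by (rule ext, subst partial_deriv_eqI[OF d]) (simp add: partial_deriv_def)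
    then show ?case using Suc d by (auto simp: differentiable_def)
  qed
  then show ?thesis using assms by (auto simp: smooth_def)
qed

lemma test_function_translate:
  fixes \<phi> :: "real^'n::finite \<Rightarrow> real"
  assumes "test_function UNIV \<phi>" shows "test_function UNIV (\<lambda>x. \<phi> (x - a))"
proof -
  obtain K where K: "compact K" "\<And>x. x \<notin> K \<Longrightarrow> \<phi> x = 0"
    by (rule test_function_support[OF assms]) blast
  show ?thesis
  proof (rule test_functionI[OF smooth_translate[OF test_function_smooth[OF assms]] compact_translation[OF K(1), of a]])
    fix x assume "x \<notin> (+) a ` K"
    then have "x - a \<notin> K" by (metis add.commute diff_add_cancel image_eqI)
    then show "\<phi> (x - a) = 0" by (rule K(2))
  qed simp
qed

text \<open>
  The integral of \<open>w\<close> against a translated test function has derivative \<open>0\<close> in the translation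
  parameter, hence is constant.
\<close>
lemma translation_invariant_of_zero_gradient:
  fixes w :: "real^'n::finite \<Rightarrow> real"
  assumes w: "w \<in> borel_measurable borel" "locally_integrable w"
    and z: "\<And>\<phi>. test_function UNIV \<phi> \<Longrightarrow> (LINT x|lebesgue. w x * partial_deriv i \<phi> x) = 0"
  shows "AE x in lebesgue. w (x + s *\<^sub>R axis i 1) = w x"
proof -
  let ?e = "axis i 1 :: real^'n"
  have int: "integrable lebesgue (\<lambda>x. w x * \<psi> x)" if "test_function UNIV \<psi>" for \<psi>
    by (rule integrable_test_mult[OF _ locally_integrable_measurable[OF w(2)] that]) (use w in \<open>auto simp: locally_integrable_def\<close>)
  have const: "(LINT x|lebesgue. w x * \<phi> (x - s *\<^sub>R ?e)) = (LINT x|lebesgue. w x * \<phi> x)"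
    if \<phi>: "test_function UNIV \<phi>" for \<phi> s
  proof -
    define I where "I s = (LINT x|lebesgue. w x * \<phi> (x - s *\<^sub>R ?e))" for s
    have "(I has_real_derivative 0) (at s)" for s
    proof -
      let ?\<psi> = "\<lambda>x. \<phi> (x - s *\<^sub>R ?e)"
      have t\<psi>: "test_function UNIV ?\<psi>" by (rule test_function_translate[OF \<phi>])
      have "((\<lambda>h. (I (s + h) - I s) / h) \<longlongrightarrow> 0) (at 0)"
        unfolding tendsto_at_iff_sequentially
      proof (intro allI impI)
        fix t :: "nat \<Rightarrow> real" assume t: "\<forall>k. t k \<in> UNIV - {0}" "t \<longlonglongrightarrow> 0"
        have "(\<lambda>k. LINT x|lebesgue. w x * ((?\<psi> (x - t k *\<^sub>R ?e) - ?\<psi> x) / t k)) \<longlonglongrightarrow> - (LINT x|lebesgue. w x * partial_deriv i ?\<psi> x)"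
          by (rule difference_quotient_limit[OF w(2) t\<psi> t(2)]) (use t(1) in auto)
        moreover have "(LINT x|lebesgue. w x * ((?\<psi> (x - t k *\<^sub>R ?e) - ?\<psi> x) / t k)) = (I (s + t k) - I s) / t k" for k
        proof -
          have eqf: "?\<psi> (x - t k *\<^sub>R ?e) = \<phi> (x - (s + t k) *\<^sub>R ?e)" for x by (simp add: algebra_simps)
          have "(I (s + t k) - I s) / t k = (LINT x|lebesgue. (w x * \<phi> (x - (s + t k) *\<^sub>R ?e) - w x * ?\<psi> x) / t k)"
            unfolding I_def using int[OF test_function_translate[OF \<phi>]] by simp
          also have "\<dots> = (LINT x|lebesgue. w x * ((?\<psi> (x - t k *\<^sub>R ?e) - ?\<psi> x) / t k))"
            unfolding eqf by (intro Bochner_Integration.integral_cong) (auto simp: right_diff_distrib)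
          finally show ?thesis by (rule sym)
        qed
        ultimately have "(\<lambda>k. (I (s + t k) - I s) / t k) \<longlonglongrightarrow> - (LINT x|lebesgue. w x * partial_deriv i ?\<psi> x)"
          by (simp only:)
        then show "((\<lambda>h. (I (s + h) - I s) / h) \<circ> t) \<longlonglongrightarrow> 0" by (simp add: o_def z[OF t\<psi>])
      qed
      then show ?thesis by (simp add: DERIV_def)
    qed
    then have "I s = I 0" using DERIV_isconst_all by blast
    then show ?thesis by (simp add: I_def)
  qed
  have wt: "(\<lambda>x. w (x + s *\<^sub>R ?e)) \<in> borel_measurable borel" using w(1) by measurable
  have wtl: "set_integrable lebesgue K (\<lambda>x. w (x + s *\<^sub>R ?e))" if K: "compact K" for K
  proof -
    define K' where "K' = (+) (s *\<^sub>R ?e) ` K"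
    have K': "compact K'" unfolding K'_def by (rule compact_translation[OF K])
    have b: "(\<lambda>x. indicator K' x *\<^sub>R w x) \<in> borel_measurable borel"
      using w(1) K' by (intro borel_measurable_scaleR borel_measurable_indicator) (auto simp: compact_imp_closed)
    have "integrable lebesgue (\<lambda>x. indicator K' x *\<^sub>R w x)"
      using w(2) K' by (auto simp: locally_integrable_def set_integrable_def)
    then have "integrable lebesgue (\<lambda>x. indicator K' (x + s *\<^sub>R ?e) *\<^sub>R w (x + s *\<^sub>R ?e))"
      by (subst lebesgue_integral_translate(2)[OF b])
    moreover have "indicator K' (x + s *\<^sub>R ?e) = (indicator K x :: real)" for x
    proof -
      have "x + s *\<^sub>R ?e \<in> K' \<longleftrightarrow> x \<in> K" unfolding K'_def by (auto simp: add.commute)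
      then show ?thesis by (simp add: indicator_def)
    qed
    ultimately show ?thesis by (simp add: set_integrable_def)
  qed
  have "AE x in lebesgue. x \<in> UNIV \<longrightarrow> w (x + s *\<^sub>R ?e) - w x = 0"
  proof (rule AE_zero_of_test[OF open_UNIV])
    show "set_integrable lebesgue K (\<lambda>x. w (x + s *\<^sub>R ?e) - w x)" if "compact K" for K
      using wtl[OF that] w(2) that by (intro set_integral_diff(1)) (auto simp: locally_integrable_def)
    show "(\<lambda>x. w (x + s *\<^sub>R ?e) - w x) \<in> borel_measurable lebesgue"
      by (intro borel_imp_lebesgue borel_measurable_diff wt w(1))
    fix \<phi> :: "real^'n \<Rightarrow> real" assume \<phi>: "test_function UNIV \<phi>"
    have i1: "integrable lebesgue (\<lambda>x. w (x + s *\<^sub>R ?e) * \<phi> x)"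
      by (rule integrable_test_mult[OF _ borel_imp_lebesgue[OF wt] \<phi>]) (use wtl in auto)
    have b: "(\<lambda>x. w x * \<phi> (x - s *\<^sub>R ?e)) \<in> borel_measurable borel"
      by (intro borel_measurable_times w(1) smooth_borel test_function_smooth[OF test_function_translate[OF \<phi>]])
    have "(LINT x|lebesgue. w (x + s *\<^sub>R ?e) * \<phi> x) = (LINT x|lebesgue. w x * \<phi> (x - s *\<^sub>R ?e))"
      using lebesgue_integral_translate(1)[OF b, of "s *\<^sub>R ?e"] by simp
    then show "(LINT x|lebesgue. (w (x + s *\<^sub>R ?e) - w x) * \<phi> x) = 0"
      using i1 int[OF \<phi>] const[OF \<phi>, of s] by (simp add: left_diff_distrib)
  qed
  then show ?thesis by simp
qed

text \<open>
  The set \<open>P\<close> where the function is nonzero is invariant under translations up to null sets. Its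
  part in a fixed ball can thus be moved arbitrarily far away inside \<open>P\<close>; since \<open>P\<close> has finite
  measure, that part is null.
\<close>
lemma zero_of_zero_gradient:
  fixes u :: "real^'n::finite \<Rightarrow> real"
  assumes li: "locally_integrable u"
    and z: "\<And>\<phi> i. test_function UNIV \<phi> \<Longrightarrow> (LINT x|lebesgue. u x * partial_deriv i \<phi> x) = 0"
    and W: "AE x in lebesgue. x \<notin> W \<longrightarrow> u x = 0" "W \<in> sets lebesgue" "emeasure lebesgue W < \<infinity>"
  shows "AE x in lebesgue. u x = 0"
proof -
  have "\<exists>w\<in>borel_measurable lborel. AE x in lborel. u x = w x"
    by (rule completion_ex_borel_measurable_real[OF locally_integrable_measurable[OF li]])
  then obtain w where "w \<in> borel_measurable lborel" "AE x in lborel. u x = w x" by blast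
  then have w: "w \<in> borel_measurable borel" and uw: "AE x in lebesgue. u x = w x"
    by (auto intro: AE_completion)
  have um: "u \<in> borel_measurable lebesgue" by (rule locally_integrable_measurable[OF li])
  have wl: "locally_integrable w"
    unfolding locally_integrable_def set_integrable_def
  proof (intro allI impI)
    fix K :: "(real^'n) set" assume K: "compact K"
    have "integrable lebesgue (\<lambda>x. indicator K x *\<^sub>R u x)" using li K by (simp add: locally_integrable_def set_integrable_def)
    moreover have "(\<lambda>x. indicator K x *\<^sub>R w x) \<in> borel_measurable lebesgue"
      using K w by (intro borel_imp_lebesgue borel_measurable_scaleR borel_measurable_indicator) (auto simp: compact_imp_closed)
    ultimately show "integrable lebesgue (\<lambda>x. indicator K x *\<^sub>R w x)"
      by (rule integrable_cong_AE_imp) (use uw in \<open>eventually_elim, auto\<close>)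
  qed
  have wz: "(LINT x|lebesgue. w x * partial_deriv i \<phi> x) = 0" if \<phi>: "test_function UNIV \<phi>" for \<phi> i
  proof -
    have sb: "partial_deriv i \<phi> \<in> borel_measurable lebesgue"
      by (intro smooth_lebesgue smooth_partial_deriv test_function_smooth[OF \<phi>])
    have "(LINT x|lebesgue. w x * partial_deriv i \<phi> x) = (LINT x|lebesgue. u x * partial_deriv i \<phi> x)"
      by (rule integral_cong_AE) (use uw in \<open>auto intro!: borel_measurable_times borel_imp_lebesgue[OF w] um sb elim!: eventually_mono\<close>)
    then show ?thesis using z[OF \<phi>] by simp
  qed
  define P where "P = {x. w x \<noteq> 0}"
  have Pb: "P \<in> sets borel"
  proof -
    have "P = w -` (- {0}) \<inter> space borel" by (auto simp: P_def)
    also have "\<dots> \<in> sets borel" by (rule measurable_sets[OF w]) auto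
    finally show ?thesis .
  qed
  have Pfin: "emeasure lebesgue P < \<infinity>"
  proof -
    have "AE x in lebesgue. x \<in> P \<longrightarrow> x \<in> W" using W(1) uw by eventually_elim (auto simp: P_def)
    then have "emeasure lebesgue P \<le> emeasure lebesgue W" using W(2) by (intro emeasure_mono_AE)
    then show ?thesis using W(3) by (rule le_less_trans)
  qed
  \<comment> \<open>any coordinate direction will do\<close>
  obtain i :: 'n where True by simp
  have zero: "emeasure lebesgue (P \<inter> cball 0 (real R)) = 0" for R
  proof -
    let ?A = "\<lambda>n::nat. P \<inter> {x. real n \<le> norm x}"
    have An: "?A n \<in> sets lebesgue" for n
    proof -
      have "closed {x::real^'n. real n \<le> norm x}" by (intro closed_Collect_le continuous_intros)
      then show ?thesis using Pb by (auto intro!: sets.Int)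
    qed
    have "(\<lambda>n. emeasure lebesgue (?A n)) \<longlonglongrightarrow> emeasure lebesgue (\<Inter>n. ?A n)"
    proof (rule Lim_emeasure_decseq)
      show "range ?A \<subseteq> sets lebesgue" using An by blast
      show "decseq ?A" by (auto simp: decseq_def)
      have "emeasure lebesgue (?A n) \<le> emeasure lebesgue P" for n using Pb by (intro emeasure_mono) auto
      then show "emeasure lebesgue (?A n) \<noteq> \<infinity>" for n using Pfin by (metis infinity_ennreal_def not_le top.not_eq_extremum)
    qed
    moreover have "(\<Inter>n. ?A n) = {}"
    proof -
      have "\<exists>n::nat. \<not> real n \<le> norm x" for x :: "real^'n" using reals_Archimedean2[of "norm x"] by (auto simp: not_le)
      then show ?thesis by blast
    qed
    ultimately have lim: "(\<lambda>n. emeasure lebesgue (?A n)) \<longlonglongrightarrow> 0" by simp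
    have "emeasure lebesgue (P \<inter> cball 0 (real R)) \<le> emeasure lebesgue (?A n)" for n
    proof -
      define a where "a = (real n + real R) *\<^sub>R (axis i 1 :: real^'n)"
      have na: "norm a = real n + real R" by (simp add: a_def norm_axis_1)
      let ?E = "P \<inter> cball 0 (real R)"
      let ?S = "{x. a + x \<in> ?E}"
      have Eb: "?E \<in> sets borel" using Pb by auto
      have Sb: "?S \<in> sets borel"
      proof -
        have "?S = (\<lambda>x. a + x) -` ?E \<inter> space borel" by auto
        also have "\<dots> \<in> sets borel" by (rule measurable_sets[OF _ Eb]) measurable
        finally show ?thesis .
      qed
      have "emeasure lborel ?E = emeasure (distr lborel borel ((+) a)) ?E" by (simp add: lborel_distr_plus)
      also have "\<dots> = emeasure lborel ?S" using Eb by (subst emeasure_distr) (auto simp: vimage_def)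
      finally have "emeasure lebesgue ?E = emeasure lebesgue ?S" using Eb Sb by simp
      also have "\<dots> \<le> emeasure lebesgue (?A n)"
      proof (rule emeasure_mono_AE[OF _ An])
        have "AE x in lebesgue. w (x + (real n + real R) *\<^sub>R axis i 1) = w x"
          by (rule translation_invariant_of_zero_gradient[OF w wl wz])
        then show "AE x in lebesgue. x \<in> ?S \<longrightarrow> x \<in> ?A n"
        proof eventually_elim
          case (elim x)
          show ?case
          proof
            assume x: "x \<in> ?S"
            have "norm a - norm x \<le> norm (a + x)" using norm_diff_ineq[of a x] by simp
            moreover have "norm (a + x) \<le> real R" using x by simp
            ultimately have "real n \<le> norm x" using na by linarith
            moreover have "x \<in> P" using x elim by (simp add: P_def a_def add.commute)
            ultimately show "x \<in> ?A n" by simp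
          qed
        qed
      qed
      finally show ?thesis .
    qed
    then have "emeasure lebesgue (P \<inter> cball 0 (real R)) \<le> 0"
      by (intro tendsto_lowerbound[OF lim]) auto
    then show ?thesis by simp
  qed
  have "emeasure lebesgue (\<Union>R::nat. P \<inter> cball 0 (real R)) = 0"
    using zero Pb by (intro emeasure_UN_eq_0) auto
  moreover have "(\<Union>R::nat. P \<inter> cball 0 (real R)) = P" using real_arch_simple by auto
  ultimately have "P \<in> null_sets lebesgue" using Pb by (auto simp: null_sets_def)
  from AE_not_in[OF this] uw show ?thesis by eventually_elim (auto simp: P_def)
qed

section \<open>Energy comparison and the Euler-Lagrange equation\<close>
locale minimizer =
  fixes N :: nat and \<Omega> :: "(real^'n::finite) set"
    and f g :: "nat \<Rightarrow> real^'n \<Rightarrow> real" and F :: "(nat \<Rightarrow> (real^'n) set) \<Rightarrow> real"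
    and u :: "nat \<Rightarrow> real^'n \<Rightarrow> real" and W :: "nat \<Rightarrow> (real^'n) set" and Mf Mg :: real
  assumes N_ge_1: "1 \<le> N"
    and \<Omega>_borel: "\<Omega> \<in> sets borel" and \<Omega>_fin: "emeasure lebesgue \<Omega> < \<infinity>"
    and f_bd: "ess_bounded_by (f 1) Mf" and g_bd: "ess_bounded_by (g 1) Mg"
    and minimizer: "is_minimizer N \<Omega> f g F u W"
begin

abbreviation "u1 \<equiv> u 1"
abbreviation "f1 \<equiv> f 1"
abbreviation "g1 \<equiv> g 1"
abbreviation "G \<equiv> weak_gradient (u 1)"

lemma admissible: "(u, W) \<in> admissible N \<Omega>"
  using minimizer by (simp add: is_minimizer_def)

lemma one_in: "1 \<in> {1..N}" using N_ge_1 by simp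

lemma W1: "W 1 \<in> sets borel" "W 1 \<subseteq> \<Omega>"
  using admissible one_in by (auto simp: admissible_def disjoint_tuples_def PiE_def Pi_def)

lemma u1_W12: "u1 \<in> W12" and u1_zero: "AE x in lebesgue. x \<notin> W 1 \<longrightarrow> u1 x = 0"
  using admissible one_in by (auto simp: admissible_def)

lemma weak_G: "has_weak_gradient u1 G"
  using u1_W12 has_weak_gradient_weak_gradient unfolding W12_def by blast

lemma u1_meas: "u1 \<in> borel_measurable lebesgue" and G_meas: "G \<in> borel_measurable lebesgue"
  using has_weak_gradient_measurable[OF weak_G] by auto

lemma f1_meas: "f1 \<in> borel_measurable lebesgue" and g1_meas: "g1 \<in> borel_measurable lebesgue"
  and f1_bd: "AE x in lebesgue. \<bar>f1 x\<bar> \<le> Mf" and g1_bd: "AE x in lebesgue. \<bar>g1 x\<bar> \<le> Mg"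
  using f_bd g_bd by (auto simp: ess_bounded_by_def)

lemma G_square_integrable: "integrable lebesgue (\<lambda>x. (norm (G x))\<^sup>2)"
proof -
  obtain D where D: "has_weak_gradient u1 D" "integrable lebesgue (\<lambda>x. (norm (D x))\<^sup>2)"
    using u1_W12 unfolding W12_def by blast
  have m: "(\<lambda>x. (norm (G x))\<^sup>2) \<in> borel_measurable lebesgue" using G_meas by measurable
  show ?thesis
    by (rule integrable_cong_AE_imp[OF D(2) m])
      (use has_weak_gradient_unique[OF D(1) weak_G] in \<open>eventually_elim, simp\<close>)
qed

text \<open>
  The part of the functional that does not change when only \<open>u\<^sub>1\<close> and the partition do.
\<close>
definition rest :: "(nat \<Rightarrow> real^'n \<Rightarrow> real) \<Rightarrow> real" where
  "rest v = (\<Sum>i=2..N. LINT x|lebesgue. (norm (weak_gradient (v i) x))\<^sup>2) +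
     (\<Sum>i=2..N. LINT x|lebesgue. (v i x)\<^sup>2 * f i x - v i x * g i x)"

lemma sum_split: "(\<Sum>i=1..N. h i) = h 1 + (\<Sum>i=2..N. h i :: real)"
  using N_ge_1 by (simp add: sum.atLeast_Suc_atMost numeral_2_eq_2)

lemma J_split: "J_functional N f g F v V =
  (LINT x|lebesgue. (norm (weak_gradient (v 1) x))\<^sup>2) + (LINT x|lebesgue. (v 1 x)\<^sup>2 * f1 x - v 1 x * g1 x) + rest v + F V"
  by (simp only: J_functional_def sum_split rest_def)

lemma rest_upd: "rest (u(1 := v)) = rest u"
  unfolding rest_def by (intro arg_cong2[where f="(+)"] sum.cong) auto

lemma compare:
  assumes v: "v \<in> W12" "has_weak_gradient v D" "AE x in lebesgue. x \<notin> W' 1 \<longrightarrow> v x = 0"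
    and W': "W' \<in> disjoint_tuples N \<Omega>" "\<And>i. i \<in> {2..N} \<Longrightarrow> W i \<subseteq> W' i"
  shows "(LINT x|lebesgue. (norm (G x))\<^sup>2) + (LINT x|lebesgue. (u1 x)\<^sup>2 * f1 x - u1 x * g1 x) + F W
    \<le> (LINT x|lebesgue. (norm (D x))\<^sup>2) + (LINT x|lebesgue. (v x)\<^sup>2 * f1 x - v x * g1 x) + F W'"
proof -
  let ?u' = "u(1 := v)"
  have "(?u', W') \<in> admissible N \<Omega>"
    unfolding admissible_def mem_Collect_eq prod.case
  proof (intro conjI ballI)
    show "W' \<in> disjoint_tuples N \<Omega>" by (rule W')
    fix i assume i: "i \<in> {1..N}"
    show "?u' i \<in> W12" using v(1) admissible i by (auto simp: admissible_def)
    show "AE x in lebesgue. x \<notin> W' i \<longrightarrow> ?u' i x = 0"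
    proof (cases "i = 1")
      case True then show ?thesis using v(3) by simp
    next
      case False
      then have i2: "i \<in> {2..N}" using i by auto
      have "AE x in lebesgue. x \<notin> W i \<longrightarrow> u i x = 0" using admissible i by (auto simp: admissible_def)
      then show ?thesis by eventually_elim (use False W'(2)[OF i2] in auto)
    qed
  qed
  then have "J_functional N f g F u W \<le> J_functional N f g F ?u' W'"
    using minimizer by (auto simp: is_minimizer_def)
  then show ?thesis
    using weak_gradient_energy[OF v(2)] by (simp add: J_split rest_upd del: One_nat_def)
qed

lemma W_tuple: "W \<in> disjoint_tuples N \<Omega>" using admissible by (simp add: admissible_def)

lemma u1_locally_integrable: "locally_integrable u1"
  using weak_G by (simp add: has_weak_gradient_def)

text \<open>
  The definition of \<open>W12\<close> gives only local square integrability, and a non-integrable potential term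
  would count as \<open>0\<close> in the functional. But then replacing \<open>u\<^sub>1\<close> by \<open>0\<close> shows that its
  gradient vanishes, so \<open>u\<^sub>1\<close> itself vanishes, as it is supported in a set of finite measure.
\<close>
lemma potential_integrable: "integrable lebesgue (\<lambda>x. (u1 x)\<^sup>2 * f1 x - u1 x * g1 x)"
proof (rule ccontr)
  assume ni: "\<not> integrable lebesgue (\<lambda>x. (u1 x)\<^sup>2 * f1 x - u1 x * g1 x)"
  have "(\<lambda>x. 0) \<in> (W12 :: (real^'n \<Rightarrow> real) set)"
    unfolding W12_def using has_weak_gradient_zero
    by (auto intro!: exI[of _ "\<lambda>x. 0"] simp: locally_integrable_def set_integrable_def)
  from compare[OF this has_weak_gradient_zero _ W_tuple]
  have "(LINT x|lebesgue. (norm (G x))\<^sup>2) \<le> 0"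
    using not_integrable_integral_eq[OF ni] by simp
  moreover have "0 \<le> (LINT x|lebesgue. (norm (G x))\<^sup>2)" by simp
  ultimately have "(LINT x|lebesgue. (norm (G x))\<^sup>2) = 0" by linarith
  then have "AE x in lebesgue. (norm (G x))\<^sup>2 = 0"
    by (subst (asm) integral_nonneg_eq_0_iff_AE[OF G_square_integrable]) auto
  then have G0: "AE x in lebesgue. G x = 0" by eventually_elim simp
  have "AE x in lebesgue. u1 x = 0"
  proof (rule zero_of_zero_gradient[OF u1_locally_integrable _ u1_zero])
    fix \<phi> :: "real^'n \<Rightarrow> real" and i assume \<phi>: "test_function UNIV \<phi>"
    have "(LINT x|lebesgue. u1 x * partial_deriv i \<phi> x) = - (LINT x|lebesgue. G x $ i * \<phi> x)"
      using weak_G \<phi> by (simp add: has_weak_gradient_def)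
    also have "(LINT x|lebesgue. G x $ i * \<phi> x) = 0"
    proof (rule integral_eq_zero_AE)
      show "AE x in lebesgue. G x $ i * \<phi> x = 0" using G0 by eventually_elim simp
    qed
    finally show "(LINT x|lebesgue. u1 x * partial_deriv i \<phi> x) = 0" by simp
  next
    show "W 1 \<in> sets lebesgue" using W1(1) by simp
    have "emeasure lebesgue (W 1) \<le> emeasure lebesgue \<Omega>" using W1 \<Omega>_borel by (intro emeasure_mono) auto
    then show "emeasure lebesgue (W 1) < \<infinity>" using \<Omega>_fin by (rule le_less_trans)
  qed
  then have "AE x in lebesgue. 0 = (u1 x)\<^sup>2 * f1 x - u1 x * g1 x" by eventually_elim simp
  moreover have "integrable lebesgue (\<lambda>x::real^'n. 0 :: real)" by simp
  moreover have "(\<lambda>x. (u1 x)\<^sup>2 * f1 x - u1 x * g1 x) \<in> borel_measurable lebesgue"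
    using u1_meas f1_meas g1_meas by measurable
  ultimately show False using ni integrable_cong_AE_imp by blast
qed

text \<open>
  Bounded variations with bounded gradient and compact support in a set where \<open>u\<^sub>1\<close> is bounded:
  all terms of the energy difference are then integrable.
\<close>
definition perturbation :: "(real^'n \<Rightarrow> real) \<Rightarrow> (real^'n \<Rightarrow> real^'n) \<Rightarrow> bool" where
  "perturbation w D \<longleftrightarrow> has_weak_gradient w D \<and> (\<exists>K c. compact K \<and> 0 \<le> c \<and>
     (\<forall>x. x \<notin> K \<longrightarrow> w x = 0 \<and> D x = 0) \<and> (\<forall>x. \<bar>w x\<bar> \<le> c) \<and> (AE x in lebesgue. norm (D x) \<le> c) \<and>
     (\<forall>x\<in>K. \<bar>u1 x\<bar> \<le> c))"

lemma perturbation_scale: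
  assumes "perturbation w D" shows "perturbation (\<lambda>x. t * w x) (\<lambda>x. t *\<^sub>R D x)"
proof -
  obtain K c where K: "has_weak_gradient w D" "compact K" "0 \<le> c" "\<forall>x. x \<notin> K \<longrightarrow> w x = 0 \<and> D x = 0"
    "\<forall>x. \<bar>w x\<bar> \<le> c" "AE x in lebesgue. norm (D x) \<le> c" "\<forall>x\<in>K. \<bar>u1 x\<bar> \<le> c"
    using assms unfolding perturbation_def by blast
  let ?c = "max 1 \<bar>t\<bar> * c"
  have le: "c \<le> ?c" using K(3) by (simp add: mult_le_cancel_right1)
  have le2: "\<bar>t\<bar> * a \<le> ?c" if "0 \<le> a" "a \<le> c" for a using that by (intro mult_mono) auto
  show ?thesis
    unfolding perturbation_def
  proof (intro conjI exI[of _ K] exI[of _ ?c] allI impI ballI)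
    show "has_weak_gradient (\<lambda>x. t * w x) (\<lambda>x. t *\<^sub>R D x)" by (rule has_weak_gradient_scale[OF K(1)])
    show "AE x in lebesgue. norm (t *\<^sub>R D x) \<le> ?c"
      using K(6) by eventually_elim (use le2 in auto)
    show "\<bar>t * w x\<bar> \<le> ?c" for x using K(5) le2[of "\<bar>w x\<bar>"] by (simp add: abs_mult)
    show "\<bar>u1 x\<bar> \<le> ?c" if "x \<in> K" for x using K(7) that le by force
  qed (use K in auto)
qed

lemma perturbation_facts:
  assumes "perturbation w D"
  shows "integrable lebesgue (\<lambda>x. (norm (D x))\<^sup>2)" "integrable lebesgue (\<lambda>x. G x \<bullet> D x)"
    "integrable lebesgue (\<lambda>x. f1 x * (w x)\<^sup>2)" "integrable lebesgue (\<lambda>x. f1 x * (u1 x * w x))"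
    "integrable lebesgue (\<lambda>x. g1 x * w x)" "(\<lambda>x. u1 x - w x) \<in> W12"
proof -
  obtain K c where K: "has_weak_gradient w D" "compact K" "0 \<le> c" "\<And>x. x \<notin> K \<Longrightarrow> w x = 0" "\<And>x. x \<notin> K \<Longrightarrow> D x = 0"
    "\<And>x. \<bar>w x\<bar> \<le> c" "AE x in lebesgue. norm (D x) \<le> c" "\<And>x. x \<in> K \<Longrightarrow> \<bar>u1 x\<bar> \<le> c"
    using assms unfolding perturbation_def by blast
  have wm: "w \<in> borel_measurable lebesgue" and Dm: "D \<in> borel_measurable lebesgue"
    using has_weak_gradient_measurable[OF K(1)] by auto
  have sq: "integrable lebesgue (\<lambda>x. (norm (D x))\<^sup>2)"
  proof (rule integrable_bounded_support[OF _ K(2), where M="c\<^sup>2"])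
    show "(\<lambda>x. (norm (D x))\<^sup>2) \<in> borel_measurable lebesgue" using Dm by measurable
    show "AE x in lebesgue. \<bar>(norm (D x))\<^sup>2\<bar> \<le> c\<^sup>2" using K(7) by eventually_elim (simp add: power_mono)
  qed (simp add: K(5))
  then show "integrable lebesgue (\<lambda>x. (norm (D x))\<^sup>2)" .
  show "integrable lebesgue (\<lambda>x. G x \<bullet> D x)"
  proof (rule Bochner_Integration.integrable_bound)
    show "integrable lebesgue (\<lambda>x. (norm (G x))\<^sup>2 + (norm (D x))\<^sup>2)" using G_square_integrable sq by simp
    show "(\<lambda>x. G x \<bullet> D x) \<in> borel_measurable lebesgue" using G_meas Dm by measurable
    show "AE x in lebesgue. norm (G x \<bullet> D x) \<le> norm ((norm (G x))\<^sup>2 + (norm (D x))\<^sup>2)"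
    proof (rule AE_I2)
      fix x
      have "\<bar>G x \<bullet> D x\<bar> \<le> norm (G x) * norm (D x)" by (rule Cauchy_Schwarz_ineq2)
      also have "\<dots> \<le> (norm (G x))\<^sup>2 + (norm (D x))\<^sup>2"
        using sum_squares_bound[of "norm (G x)" "norm (D x)"] mult_nonneg_nonneg[OF norm_ge_zero[of "G x"] norm_ge_zero[of "D x"]] by linarith
      finally show "norm (G x \<bullet> D x) \<le> norm ((norm (G x))\<^sup>2 + (norm (D x))\<^sup>2)" by simp
    qed
  qed
  have Mf0: "0 \<le> \<bar>Mf\<bar>" by simp
  have f': "AE x in lebesgue. \<bar>f1 x\<bar> \<le> \<bar>Mf\<bar>" using f1_bd by eventually_elim linarith
  have g': "AE x in lebesgue. \<bar>g1 x\<bar> \<le> \<bar>Mg\<bar>" using g1_bd by eventually_elim linarith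
  show "integrable lebesgue (\<lambda>x. f1 x * (w x)\<^sup>2)"
  proof (rule integrable_bounded_support[OF _ K(2), where M="\<bar>Mf\<bar> * c\<^sup>2"])
    show "(\<lambda>x. f1 x * (w x)\<^sup>2) \<in> borel_measurable lebesgue" using f1_meas wm by measurable
    show "AE x in lebesgue. \<bar>f1 x * (w x)\<^sup>2\<bar> \<le> \<bar>Mf\<bar> * c\<^sup>2"
      using f'
    proof eventually_elim
      case (elim x)
      have "(w x)\<^sup>2 \<le> c\<^sup>2" using K(3,6) by (metis abs_le_square_iff abs_of_nonneg)
      then show ?case using elim by (simp add: abs_mult mult_mono)
    qed
  qed (simp add: K(4))
  show "integrable lebesgue (\<lambda>x. f1 x * (u1 x * w x))"
  proof (rule integrable_bounded_support[OF _ K(2), where M="\<bar>Mf\<bar> * (c * c)"])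
    show "(\<lambda>x. f1 x * (u1 x * w x)) \<in> borel_measurable lebesgue" using f1_meas u1_meas wm by measurable
    show "AE x in lebesgue. \<bar>f1 x * (u1 x * w x)\<bar> \<le> \<bar>Mf\<bar> * (c * c)"
      using f'
    proof eventually_elim
      case (elim x)
      show ?case
      proof (cases "x \<in> K")
        case True
        then show ?thesis unfolding abs_mult using elim K(3) K(6)[of x] K(8)[OF True] by (intro mult_mono) auto
      qed (use K(3,4) in simp)
    qed
  qed (simp add: K(4))
  show "integrable lebesgue (\<lambda>x. g1 x * w x)"
  proof (rule integrable_bounded_support[OF _ K(2), where M="\<bar>Mg\<bar> * c"])
    show "(\<lambda>x. g1 x * w x) \<in> borel_measurable lebesgue" using g1_meas wm by measurable
    show "AE x in lebesgue. \<bar>g1 x * w x\<bar> \<le> \<bar>Mg\<bar> * c"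
      using g' by eventually_elim (use K(6) in \<open>simp add: abs_mult mult_mono\<close>)
  qed (simp add: K(4))
  show "(\<lambda>x. u1 x - w x) \<in> W12"
    unfolding W12_def
  proof (intro CollectI conjI exI)
    show m: "(\<lambda>x. u1 x - w x) \<in> borel_measurable lebesgue" using u1_meas wm by measurable
    show wg: "has_weak_gradient (\<lambda>x. u1 x - w x) (\<lambda>x. G x - D x)" by (rule has_weak_gradient_diff[OF weak_G K(1)])
    have sqd: "(norm (a - b))\<^sup>2 \<le> 2 * (norm a)\<^sup>2 + 2 * (norm b)\<^sup>2" for a b :: "'z::real_inner"
    proof -
      have "(norm (a - b))\<^sup>2 + (norm (a + b))\<^sup>2 = 2 * (norm a)\<^sup>2 + 2 * (norm b)\<^sup>2"
        by (simp add: power2_norm_eq_inner inner_diff inner_add inner_commute algebra_simps)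
      then show ?thesis using zero_le_power2[of "norm (a + b)"] by linarith
    qed
    show "integrable lebesgue (\<lambda>x. (norm (G x - D x))\<^sup>2)"
    proof (rule Bochner_Integration.integrable_bound)
      show "integrable lebesgue (\<lambda>x. 2 * (norm (G x))\<^sup>2 + 2 * (norm (D x))\<^sup>2)" using G_square_integrable sq by simp
      show "(\<lambda>x. (norm (G x - D x))\<^sup>2) \<in> borel_measurable lebesgue" using G_meas Dm by measurable
      show "AE x in lebesgue. norm ((norm (G x - D x))\<^sup>2) \<le> norm (2 * (norm (G x))\<^sup>2 + 2 * (norm (D x))\<^sup>2)"
        using sqd by (intro AE_I2) simp
    qed
    show "locally_integrable (\<lambda>x. (u1 x - w x)\<^sup>2)"
      unfolding locally_integrable_def set_integrable_def
    proof (intro allI impI)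
      fix L :: "(real^'n) set" assume L: "compact L"
      have Lm: "L \<in> sets lebesgue" using L by (simp add: lmeasurable_compact fmeasurableD)
      have 1: "integrable lebesgue (\<lambda>x. indicator L x *\<^sub>R (u1 x)\<^sup>2)"
        using u1_W12 L by (simp add: W12_def locally_integrable_def set_integrable_def)
      have 2: "integrable lebesgue (\<lambda>x. (w x)\<^sup>2)"
      proof (rule integrable_bounded_support[OF _ K(2), where M="c\<^sup>2"])
        show "(\<lambda>x. (w x)\<^sup>2) \<in> borel_measurable lebesgue" using wm by measurable
        have "(w x)\<^sup>2 \<le> c\<^sup>2" for x using K(3,6) by (metis abs_le_square_iff abs_of_nonneg)
        then show "AE x in lebesgue. \<bar>(w x)\<^sup>2\<bar> \<le> c\<^sup>2" by simp
      qed (simp add: K(4))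
      show "integrable lebesgue (\<lambda>x. indicator L x *\<^sub>R (u1 x - w x)\<^sup>2)"
      proof (rule Bochner_Integration.integrable_bound)
        show "integrable lebesgue (\<lambda>x. 2 * (indicator L x *\<^sub>R (u1 x)\<^sup>2) + 2 * (w x)\<^sup>2)"
          by (intro Bochner_Integration.integrable_add integrable_mult_right 1 2)
        show "(\<lambda>x. indicator L x *\<^sub>R (u1 x - w x)\<^sup>2) \<in> borel_measurable lebesgue"
          by (intro borel_measurable_scaleR borel_measurable_indicator Lm borel_measurable_power m)
        show "AE x in lebesgue. norm (indicator L x *\<^sub>R (u1 x - w x)\<^sup>2) \<le> norm (2 * (indicator L x *\<^sub>R (u1 x)\<^sup>2) + 2 * (w x)\<^sup>2)"
        proof (rule AE_I2)
          fix x
          show "norm (indicator L x *\<^sub>R (u1 x - w x)\<^sup>2) \<le> norm (2 * (indicator L x *\<^sub>R (u1 x)\<^sup>2) + 2 * (w x)\<^sup>2)"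
            using sqd[of "u1 x" "w x"] by (cases "x \<in> L") auto
        qed
      qed
    qed
  qed
qed

lemma energy_comparison:
  assumes p: "perturbation w D"
    and W': "W' \<in> disjoint_tuples N \<Omega>" "\<And>i. i \<in> {2..N} \<Longrightarrow> W i \<subseteq> W' i"
    and off: "AE x in lebesgue. x \<notin> W' 1 \<longrightarrow> u1 x - w x = 0"
  shows "0 \<le> (LINT x|lebesgue. (norm (D x))\<^sup>2 - 2 * (G x \<bullet> D x)) +
    (LINT x|lebesgue. f1 x * (w x)\<^sup>2 - 2 * (f1 x * (u1 x * w x)) + g1 x * w x) + F W' - F W"
proof -
  have wg: "has_weak_gradient (\<lambda>x. u1 x - w x) (\<lambda>x. G x - D x)"
    using p by (intro has_weak_gradient_diff[OF weak_G]) (simp add: perturbation_def)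
  note i = perturbation_facts[OF p]
  have e1: "(LINT x|lebesgue. (norm (G x - D x))\<^sup>2) = (LINT x|lebesgue. (norm (G x))\<^sup>2) + (LINT x|lebesgue. (norm (D x))\<^sup>2 - 2 * (G x \<bullet> D x))"
  proof -
    have "(LINT x|lebesgue. (norm (G x - D x))\<^sup>2) = (LINT x|lebesgue. (norm (G x))\<^sup>2 + ((norm (D x))\<^sup>2 - 2 * (G x \<bullet> D x)))"
      by (intro Bochner_Integration.integral_cong)
        (auto simp: power2_norm_eq_inner inner_diff inner_commute algebra_simps)
    then show ?thesis using G_square_integrable i(1,2) by simp
  qed
  have e2: "(LINT x|lebesgue. (u1 x - w x)\<^sup>2 * f1 x - (u1 x - w x) * g1 x)
     = (LINT x|lebesgue. (u1 x)\<^sup>2 * f1 x - u1 x * g1 x) + (LINT x|lebesgue. f1 x * (w x)\<^sup>2 - 2 * (f1 x * (u1 x * w x)) + g1 x * w x)"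
  proof -
    have "(LINT x|lebesgue. (u1 x - w x)\<^sup>2 * f1 x - (u1 x - w x) * g1 x)
      = (LINT x|lebesgue. ((u1 x)\<^sup>2 * f1 x - u1 x * g1 x) + (f1 x * (w x)\<^sup>2 - 2 * (f1 x * (u1 x * w x)) + g1 x * w x))"
      by (intro Bochner_Integration.integral_cong) (auto simp: power2_eq_square algebra_simps)
    also have "\<dots> = (LINT x|lebesgue. (u1 x)\<^sup>2 * f1 x - u1 x * g1 x) + (LINT x|lebesgue. f1 x * (w x)\<^sup>2 - 2 * (f1 x * (u1 x * w x)) + g1 x * w x)"
      by (intro Bochner_Integration.integral_add potential_integrable Bochner_Integration.integrable_add
          Bochner_Integration.integrable_diff integrable_mult_right i)
    finally show ?thesis .
  qed
  from compare[OF i(6) wg off W'] show ?thesis unfolding e1 e2 by linarith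
qed

text \<open>
  Along \<open>t w\<close> the energy difference is a quadratic polynomial in \<open>t\<close> without constant term; being
  nonnegative for all real \<open>t\<close>, it has no linear term.
\<close>
lemma Euler_Lagrange:
  assumes p: "perturbation w D" and off: "AE x in lebesgue. x \<notin> W 1 \<longrightarrow> w x = 0"
  shows "(LINT x|lebesgue. G x \<bullet> D x) + (LINT x|lebesgue. f1 x * (u1 x * w x)) - (LINT x|lebesgue. g1 x * w x) / 2 = 0"
    (is "?E = 0")
proof -
  note i = perturbation_facts[OF p]
  let ?A = "(LINT x|lebesgue. (norm (D x))\<^sup>2) + (LINT x|lebesgue. f1 x * (w x)\<^sup>2)"
  have q: "0 \<le> t * t * ?A - 2 * t * ?E" for t
  proof -
    have "0 \<le> (LINT x|lebesgue. (norm (t *\<^sub>R D x))\<^sup>2 - 2 * (G x \<bullet> (t *\<^sub>R D x))) +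
      (LINT x|lebesgue. f1 x * (t * w x)\<^sup>2 - 2 * (f1 x * (u1 x * (t * w x))) + g1 x * (t * w x)) + F W - F W"
    proof (rule energy_comparison[OF perturbation_scale[OF p] W_tuple])
      show "AE x in lebesgue. x \<notin> W 1 \<longrightarrow> u1 x - t * w x = 0"
        using off u1_zero by eventually_elim auto
    qed simp
    also have "(LINT x|lebesgue. (norm (t *\<^sub>R D x))\<^sup>2 - 2 * (G x \<bullet> (t *\<^sub>R D x)))
       = (LINT x|lebesgue. t * t * (norm (D x))\<^sup>2 - 2 * t * (G x \<bullet> D x))"
      by (intro Bochner_Integration.integral_cong) (auto simp: power_mult_distrib power2_eq_square)
    also have "\<dots> = t * t * (LINT x|lebesgue. (norm (D x))\<^sup>2) - 2 * t * (LINT x|lebesgue. G x \<bullet> D x)"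
      using i by simp
    also have "(LINT x|lebesgue. f1 x * (t * w x)\<^sup>2 - 2 * (f1 x * (u1 x * (t * w x))) + g1 x * (t * w x))
      = (LINT x|lebesgue. t * t * (f1 x * (w x)\<^sup>2) - 2 * t * (f1 x * (u1 x * w x)) + t * (g1 x * w x))"
      by (intro Bochner_Integration.integral_cong) (auto simp: power_mult_distrib power2_eq_square)
    also have "\<dots> = t * t * (LINT x|lebesgue. f1 x * (w x)\<^sup>2) - 2 * t * (LINT x|lebesgue. f1 x * (u1 x * w x)) + t * (LINT x|lebesgue. g1 x * w x)"
      using i by simp
    finally show ?thesis by (simp add: algebra_simps)
  qed
  show ?thesis
  proof (rule ccontr)
    assume E: "?E \<noteq> 0"
    \<comment> \<open>\<open>t = ?E / a\<close> makes the polynomial negative\<close>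
    define a where "a = \<bar>?A\<bar> + 1"
    have a: "a > 0" "?A < a" by (auto simp: a_def)
    have "0 \<le> (?E / a) * (?E / a) * ?A - 2 * (?E / a) * ?E" by (rule q)
    also have "\<dots> \<le> (?E / a) * (?E / a) * a - 2 * (?E / a) * ?E"
      using a by (intro diff_right_mono mult_left_mono) auto
    also have "\<dots> = - (?E * ?E / a)" using a by (simp add: field_simps)
    also have "\<dots> < 0"
    proof -
      have "0 < x * x" if "x \<noteq> 0" for x :: real using that by (auto simp: zero_less_mult_iff)
      from divide_pos_pos[OF this[OF E] a(1)] show ?thesis by linarith
    qed
    finally show False by simp
  qed
qed

end

section \<open>The distribution as a positive measure\<close>
(* The index 1 of u, f, g and W has to stay 1, so that facts about them match. *)
declare One_nat_def [simp del]

lemma smooth_step_deriv_ex: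
  obtains s' S where "smooth1 s'" "\<And>t. (smooth_step has_real_derivative s' t) (at t)" "\<And>t. 0 \<le> s' t" "\<And>t. s' t \<le> S"
    "\<And>t. t \<le> 0 \<Longrightarrow> s' t = 0" "\<And>t. 1 \<le> t \<Longrightarrow> s' t = 0" "S > 0"
proof -
  obtain s' where s': "\<And>t. (smooth_step has_real_derivative s' t) (at t)" "smooth1 s'"
    using smooth1_obtain_deriv[OF smooth1_smooth_step] by blast
  have nn: "0 \<le> s' t" for t
  proof (rule ccontr)
    assume "\<not> 0 \<le> s' t"
    then obtain d where "d > 0" "\<And>h. 0 < h \<Longrightarrow> h < d \<Longrightarrow> smooth_step (t + h) < smooth_step t"
      using DERIV_neg_dec_right[OF s'(1)[of t]] by auto
    from this(2)[of "d/2"] this(1) show False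
      using monoD[OF smooth_step_mono, of t "t + d/2"] by simp
  qed
  have z0: "s' t = 0" if "t \<le> 0" for t
    by (rule DERIV_local_min[OF s'(1) zero_less_one]) (use that smooth_step_0 smooth_step_nonneg in auto)
  have z1: "s' t = 0" if "1 \<le> t" for t
    by (rule DERIV_local_max[OF s'(1) zero_less_one]) (use that smooth_step_1 smooth_step_le_1 in auto)
  have "compact (s' ` {0..1})" by (rule compact_continuous_image[OF smooth1_continuous[OF s'(2)] compact_Icc])
  from compact_imp_bounded[OF this] obtain S where S: "S > 0" "\<forall>y\<in>s' ` {0..1}. norm y \<le> S"
    unfolding bounded_pos by blast
  have "s' t \<le> S" for t
  proof (cases "0 \<le> t \<and> t \<le> 1")
    case True
    then have "norm (s' t) \<le> S" using S(2) by simp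
    then show ?thesis by simp
  next
    case False then show ?thesis using z0[of t] z1[of t] S(1) by linarith
  qed
  then show thesis using that[OF s'(2,1) nn _ z0 z1 S(1)] by blast
qed

locale free_boundary = minimizer N \<Omega> f g F u W Mf Mg
  for N :: nat and \<Omega> :: "(real^'n::finite) set"
    and f g :: "nat \<Rightarrow> real^'n \<Rightarrow> real" and F :: "(nat \<Rightarrow> (real^'n) set) \<Rightarrow> real"
    and u :: "nat \<Rightarrow> real^'n \<Rightarrow> real" and W :: "nat \<Rightarrow> (real^'n) set" and Mf Mg :: real +
  fixes z :: "real^'n" and \<rho> C0 lam \<epsilon> :: real
  assumes Mf_nonneg: "0 \<le> Mf" and Mg_nonneg: "0 \<le> Mg" and lam_pos: "0 < lam"
    and lip_u1: "C0-lipschitz_on (ball z \<rho>) (u 1)"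
    and decrease: "\<And>A. A \<in> sets borel \<Longrightarrow> A \<subseteq> W 1 \<Longrightarrow> 0 < measure lebesgue A \<Longrightarrow> measure lebesgue A \<le> \<epsilon> \<Longrightarrow>
       \<exists>A'. (\<forall>j\<in>{2..N}. A' j \<in> sets borel \<and> A' j \<subseteq> A) \<and> disjoint_family_on A' {2..N} \<and>
             F (reassign N W A A') \<le> F W - lam * measure lebesgue A"
begin

abbreviation "B \<equiv> ball z \<rho>"

sublocale weak_lipschitz "ball z \<rho>" "u 1" "weak_gradient (u 1)" C0
proof
  show "locally_integrable G" using weak_G by (simp add: has_weak_gradient_def)
  fix \<phi> i assume "test_function (ball z \<rho>) \<phi>"
  then have "test_function UNIV \<phi>" by (rule test_function_mono) simp
  then show "(LINT x|lebesgue. u1 x * partial_deriv i \<phi> x) = - (LINT x|lebesgue. G x $ i * \<phi> x)"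
    using weak_G by (simp add: has_weak_gradient_def)
qed (use lip_u1 in auto)

lemma perturbation_comp:
  assumes "chain_pair H h" "test_function B \<zeta>"
  shows "perturbation (comp_fun H \<zeta>) (comp_grad H h \<zeta>)"
proof -
  obtain K c where K: "compact K" "K \<subseteq> B" "c \<ge> 0"
    "comp_fun H \<zeta> \<in> borel_measurable lebesgue" "comp_grad H h \<zeta> \<in> borel_measurable lebesgue"
    "\<And>x. x \<notin> K \<Longrightarrow> comp_fun H \<zeta> x = 0" "\<And>x. x \<notin> K \<Longrightarrow> comp_grad H h \<zeta> x = 0"
    "\<And>x. \<bar>comp_fun H \<zeta> x\<bar> \<le> c" "AE x in lebesgue. norm (comp_grad H h \<zeta> x) \<le> c"
    by (rule comp_props[OF assms]) blast
  obtain M where M: "M > 0" "\<And>x. x \<in> B \<Longrightarrow> \<bar>u1 x\<bar> \<le> M" using u_bounded by blast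
  let ?c = "c + M"
  show ?thesis unfolding perturbation_def
  proof (intro conjI exI[of _ K] exI[of _ ?c] allI impI ballI)
    show "has_weak_gradient (comp_fun H \<zeta>) (comp_grad H h \<zeta>)" by (rule has_weak_gradient_comp[OF assms])
    show "\<bar>comp_fun H \<zeta> x\<bar> \<le> ?c" for x using K(8)[of x] M(1) by linarith
    show "AE x in lebesgue. norm (comp_grad H h \<zeta> x) \<le> ?c" using K(9) by eventually_elim (use M(1) in linarith)
    show "\<bar>u1 x\<bar> \<le> ?c" if "x \<in> K" for x using M(2)[of x] K(2,3) that by force
  qed (use K M in auto)
qed

definition T :: "(real^'n \<Rightarrow> real) \<Rightarrow> real" where "T = mu_distr u1 f1 g1"

text \<open>
  The right-hand side of the equation for \<open>v\<close>, so that \<open>T = \<Delta>v - q\<close>.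
\<close>
definition q :: "real^'n \<Rightarrow> real" where
  "q x = (f1 x * max 0 (u1 x) - g1 x / 2) * indicat_real (positivity_set u1) x"

lemma T_eq: "T \<phi> = (LINT x|lebesgue. max 0 (u1 x) * laplacian \<phi> x) - (LINT x|lebesgue. q x * \<phi> x)"
  by (simp add: T_def mu_distr_def distr_laplacian_def distr_of_def q_def Let_def del: One_nat_def)

lemma q_alt: "q x = of_bool (0 < u1 x) * (f1 x * u1 x - g1 x / 2)"
  by (auto simp: q_def positivity_set_def indicator_def)

lemma q_meas: "q \<in> borel_measurable lebesgue"
proof -
  have "(\<lambda>x. of_bool (0 < u1 x) * (f1 x * u1 x - g1 x / 2) :: real) \<in> borel_measurable lebesgue"
    using u1_meas f1_meas g1_meas by measurable
  then show ?thesis by (simp add: q_alt[abs_def])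
qed

lemma q_bound:
  assumes "\<And>x. x \<in> S \<Longrightarrow> u1 x \<le> m" "0 \<le> m"
  shows "AE x in lebesgue. x \<in> S \<longrightarrow> \<bar>q x\<bar> \<le> Mf * m + Mg"
  using f1_bd g1_bd
proof eventually_elim
  case (elim x)
  show ?case
  proof
    assume x: "x \<in> S"
    show "\<bar>q x\<bar> \<le> Mf * m + Mg"
    proof (cases "0 < u1 x")
      case True
      have "\<bar>f1 x * u1 x\<bar> \<le> Mf * m" unfolding abs_mult
        using elim assms(1)[OF x] True Mf_nonneg by (intro mult_mono) auto
      then show ?thesis using elim True unfolding q_alt by simp
    next
      case False
      then show ?thesis using Mf_nonneg Mg_nonneg assms(2) by (simp add: q_alt)
    qed
  qed
qed

lemma integrable_q_test:
  assumes \<phi>: "test_function B \<phi>" shows "integrable lebesgue (\<lambda>x. q x * \<phi> x)"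
proof -
  obtain M where M: "M > 0" "\<And>x. x \<in> B \<Longrightarrow> \<bar>u1 x\<bar> \<le> M" using u_bounded by blast
  obtain K where K: "compact K" "K \<subseteq> B" "\<And>x. x \<notin> K \<Longrightarrow> \<phi> x = 0"
    by (rule test_function_support[OF \<phi>]) blast
  obtain m where m: "m > 0" "\<And>x. \<bar>\<phi> x\<bar> \<le> m" using test_function_bounded[OF \<phi>] by blast
  show ?thesis
  proof (rule integrable_bounded_support[OF _ K(1), where M="(Mf * M + Mg) * m"])
    show "(\<lambda>x. q x * \<phi> x) \<in> borel_measurable lebesgue"
      by (intro borel_measurable_times q_meas smooth_lebesgue test_function_smooth[OF \<phi>])
    have b: "AE x in lebesgue. x \<in> B \<longrightarrow> \<bar>q x\<bar> \<le> Mf * M + Mg"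
      by (rule q_bound) (use M in \<open>auto simp: abs_le_iff\<close>)
    have c0: "0 \<le> Mf * M + Mg" using Mf_nonneg Mg_nonneg M(1) by simp
    from b show "AE x in lebesgue. \<bar>q x * \<phi> x\<bar> \<le> (Mf * M + Mg) * m"
    proof eventually_elim
      case (elim x)
      show ?case
      proof (cases "x \<in> K")
        case True
        then show ?thesis unfolding abs_mult using elim K(2) m(2)[of x] c0 by (intro mult_mono) auto
      qed (use K(3) c0 m in simp)
    qed
  qed (simp add: K(3))
qed

lemma integrable_v_test:
  assumes \<phi>: "test_function B \<phi>" shows "integrable lebesgue (\<lambda>x. max 0 (u1 x) * \<phi> x)"
proof -
  obtain M where M: "M > 0" "\<And>x. x \<in> B \<Longrightarrow> \<bar>u1 x\<bar> \<le> M" using u_bounded by blast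
  show ?thesis
  proof (rule integrable_cut_test[OF _ _ \<phi>, where c=M])
    show "\<bar>max 0 (u1 x)\<bar> \<le> M" if "x \<in> B" for x using M(2)[OF that] M(1) by simp
  qed simp
qed

text \<open>
  The Euler-Lagrange equation for the variation \<open>\<eta>(k u) \<phi>\<close>, in the limit \<open>k \<rightarrow> \<infinity>\<close>. It exhibits
  \<open>T\<close> as a limit of nonnegative densities concentrated near the frontier.
\<close>
lemma T_limit:
  assumes s': "smooth1 s'" "\<And>t. (smooth_step has_real_derivative s' t) (at t)"
    and \<phi>: "test_function B \<phi>"
  shows "(\<lambda>k. LINT x|lebesgue. real (Suc k) * s' (real (Suc k) * u1 x) * (G x \<bullet> G x) * \<phi> x) \<longlonglongrightarrow> T \<phi>"
proof -
  define H where "H k t = smooth_step (real (Suc k) * t)" for k t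
  define h where "h k t = real (Suc k) * s' (real (Suc k) * t)" for k t
  have sH: "smooth1 (H k)" for k
    using smooth1_affine[OF smooth1_smooth_step, of "real (Suc k)" 0] by (simp add: H_def[abs_def])
  have dH: "(H k has_real_derivative h k t) (at t)" for k t
  proof -
    have "((\<lambda>t. smooth_step (real (Suc k) * t)) has_real_derivative s' (real (Suc k) * t) * real (Suc k)) (at t)"
      by (rule DERIV_chain2[OF s'(2)]) (auto intro!: derivative_eq_intros)
    then show ?thesis by (simp add: H_def[abs_def] h_def mult.commute)
  qed
  have ch: "chain_pair (H k) (h k)" for k by (rule chain_pair_smooth[OF sH dH])
  have Hb: "\<bar>H k t\<bar> \<le> 1" for k t by (simp add: H_def smooth_step_nonneg smooth_step_le_1)
  have Hm: "H k \<in> borel_measurable borel" for k by (rule borel_measurable_continuous_onI[OF smooth1_continuous[OF sH]])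
  have limH: "(\<lambda>k. H k t) \<longlonglongrightarrow> of_bool (0 < t)" for t
    unfolding H_def by (rule smooth_step_scaled_limit)
  have pd: "test_function B (partial_deriv i \<phi>)" for i by (rule test_function_partial_deriv[OF \<phi>])
  have pd2: "test_function B (partial_deriv i (partial_deriv i \<phi>))" for i by (rule test_function_partial_deriv[OF pd])
  define P where "P x = (\<chi> i. partial_deriv i \<phi> x)" for x
  have GP: "G x \<bullet> P x = (\<Sum>i\<in>UNIV. G x $ i * partial_deriv i \<phi> x)" for x by (simp add: P_def inner_vec_def)
  have bm: "(\<lambda>t::real. of_bool (0 < t) :: real) \<in> borel_measurable borel" by measurable
  have iGP: "integrable lebesgue (\<lambda>x. \<eta> (u1 x) * (G x \<bullet> P x))"
    if "\<eta> \<in> borel_measurable borel" "\<And>t. \<bar>\<eta> t\<bar> \<le> 1" for \<eta>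
  proof -
    have "integrable lebesgue (\<lambda>x. \<Sum>i\<in>UNIV. \<eta> (u1 x) * (G x $ i) * partial_deriv i \<phi> x)"
      by (intro Bochner_Integration.integrable_sum integrable_cut_G_test[OF that(1) _ pd, where c=1]) (rule that(2))
    then show ?thesis by (simp add: GP sum_distrib_left mult.assoc)
  qed
  have l1: "(\<lambda>k. LINT x|lebesgue. H k (u1 x) * (G x \<bullet> P x)) \<longlonglongrightarrow> (LINT x|lebesgue. of_bool (0 < u1 x) * (G x \<bullet> P x))"
  proof (rule integral_dominated_convergence[where w="\<lambda>x. \<bar>1 * (G x \<bullet> P x)\<bar>"])
    show "integrable lebesgue (\<lambda>x. \<bar>1 * (G x \<bullet> P x)\<bar>)" using iGP[of "\<lambda>_. 1"] by (intro integrable_abs) auto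
    show "(\<lambda>x. of_bool (0 < u1 x) * (G x \<bullet> P x)) \<in> borel_measurable lebesgue"
      by (rule borel_measurable_integrable[OF iGP[OF bm]]) auto
    show "(\<lambda>x. H k (u1 x) * (G x \<bullet> P x)) \<in> borel_measurable lebesgue" for k
      by (rule borel_measurable_integrable[OF iGP[OF Hm Hb]])
    show "AE x in lebesgue. (\<lambda>k. H k (u1 x) * (G x \<bullet> P x)) \<longlonglongrightarrow> of_bool (0 < u1 x) * (G x \<bullet> P x)"
      by (intro AE_I2 tendsto_mult limH tendsto_const)
    show "AE x in lebesgue. norm (H k (u1 x) * (G x \<bullet> P x)) \<le> \<bar>1 * (G x \<bullet> P x)\<bar>" for k
      using Hb by (intro AE_I2) (auto simp: abs_mult intro: mult_left_le_one_le)
  qed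
  have e1: "(LINT x|lebesgue. of_bool (0 < u1 x) * (G x \<bullet> P x)) = - (LINT x|lebesgue. max 0 (u1 x) * laplacian \<phi> x)"
  proof -
    have i: "integrable lebesgue (\<lambda>x. of_bool (0 < u1 x) * (G x $ i) * partial_deriv i \<phi> x)" for i
      by (rule integrable_cut_G_test[OF bm _ pd, where c=1]) simp
    have "(LINT x|lebesgue. of_bool (0 < u1 x) * (G x \<bullet> P x)) = (LINT x|lebesgue. (\<Sum>i\<in>UNIV. of_bool (0 < u1 x) * (G x $ i) * partial_deriv i \<phi> x))"
      by (simp add: GP sum_distrib_left mult.assoc)
    also have "\<dots> = (\<Sum>i\<in>UNIV. LINT x|lebesgue. of_bool (0 < u1 x) * (G x $ i) * partial_deriv i \<phi> x)"
      using i by (intro Bochner_Integration.integral_sum) auto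
    also have "\<dots> = (\<Sum>i\<in>UNIV. - (LINT x|lebesgue. max 0 (u1 x) * partial_deriv i (partial_deriv i \<phi>) x))"
      by (intro sum.cong refl) (simp only: chain_rule_pos[OF pd] minus_minus)
    also have "\<dots> = - (LINT x|lebesgue. (\<Sum>i\<in>UNIV. max 0 (u1 x) * partial_deriv i (partial_deriv i \<phi>) x))"
      using integrable_v_test[OF pd2] by (subst Bochner_Integration.integral_sum) (auto simp: sum_negf)
    finally show ?thesis by (simp add: laplacian_def sum_distrib_left)
  qed
  have iq: "integrable lebesgue (\<lambda>x. f1 x * (u1 x * (H k (u1 x) * \<phi> x)))" "integrable lebesgue (\<lambda>x. g1 x * (H k (u1 x) * \<phi> x))" for k
    using perturbation_facts(4,5)[OF perturbation_comp[OF ch \<phi>]] by (simp_all add: comp_fun_def)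
  obtain M where M: "M > 0" "\<And>x. x \<in> B \<Longrightarrow> \<bar>u1 x\<bar> \<le> M" using u_bounded by blast
  have l2: "(\<lambda>k. LINT x|lebesgue. H k (u1 x) * (f1 x * u1 x - g1 x / 2) * \<phi> x) \<longlonglongrightarrow> (LINT x|lebesgue. q x * \<phi> x)"
  proof (rule integral_dominated_convergence[where w="\<lambda>x. \<bar>(Mf * M + Mg) * \<phi> x\<bar>"])
    show "integrable lebesgue (\<lambda>x. \<bar>(Mf * M + Mg) * \<phi> x\<bar>)"
      using integrable_cut_test[where h="\<lambda>_. Mf * M + Mg" and c="Mf * M + Mg", OF _ _ \<phi>] Mf_nonneg Mg_nonneg M(1)
      by (intro integrable_abs) auto
    show "(\<lambda>x. q x * \<phi> x) \<in> borel_measurable lebesgue" by (rule borel_measurable_integrable[OF integrable_q_test[OF \<phi>]])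
    show "(\<lambda>x. H k (u1 x) * (f1 x * u1 x - g1 x / 2) * \<phi> x) \<in> borel_measurable lebesgue" for k
      by (intro borel_measurable_times borel_measurable_diff borel_measurable_divide borel_measurable_const
          measurable_compose[OF u1_meas Hm] f1_meas u1_meas g1_meas smooth_lebesgue test_function_smooth[OF \<phi>])
    show "AE x in lebesgue. (\<lambda>k. H k (u1 x) * (f1 x * u1 x - g1 x / 2) * \<phi> x) \<longlonglongrightarrow> q x * \<phi> x"
      unfolding q_alt by (intro AE_I2 tendsto_mult limH tendsto_const)
    show "AE x in lebesgue. norm (H k (u1 x) * (f1 x * u1 x - g1 x / 2) * \<phi> x) \<le> \<bar>(Mf * M + Mg) * \<phi> x\<bar>" for k
      using f1_bd g1_bd
    proof eventually_elim
      case (elim x)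
      show ?case
      proof (cases "x \<in> B")
        case True
        have "\<bar>f1 x * u1 x\<bar> \<le> Mf * M" unfolding abs_mult using elim M(2)[OF True] Mf_nonneg by (intro mult_mono) auto
        then have "\<bar>f1 x * u1 x - g1 x / 2\<bar> \<le> \<bar>Mf * M + Mg\<bar>" using elim by linarith
        then have "\<bar>H k (u1 x)\<bar> * \<bar>f1 x * u1 x - g1 x / 2\<bar> \<le> 1 * \<bar>Mf * M + Mg\<bar>" using Hb by (intro mult_mono) auto
        then have "\<bar>H k (u1 x)\<bar> * \<bar>f1 x * u1 x - g1 x / 2\<bar> * \<bar>\<phi> x\<bar> \<le> 1 * \<bar>Mf * M + Mg\<bar> * \<bar>\<phi> x\<bar>"
          by (rule mult_right_mono) simp
        then show ?thesis by (simp add: abs_mult)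
      next
        case False
        then have "\<phi> x = 0" using cut_test[OF \<phi>, of "\<lambda>_. 1" x] by (simp add: cut_def)
        then show ?thesis by simp
      qed
    qed
  qed
  have EL: "(LINT x|lebesgue. h k (u1 x) * (G x \<bullet> G x) * \<phi> x)
     = - (LINT x|lebesgue. H k (u1 x) * (G x \<bullet> P x)) - (LINT x|lebesgue. H k (u1 x) * (f1 x * u1 x - g1 x / 2) * \<phi> x)" for k
  proof -
    have p: "perturbation (comp_fun (H k) \<phi>) (comp_grad (H k) (h k) \<phi>)" by (rule perturbation_comp[OF ch \<phi>])
    have "(LINT x|lebesgue. G x \<bullet> comp_grad (H k) (h k) \<phi> x) + (LINT x|lebesgue. f1 x * (u1 x * comp_fun (H k) \<phi> x))
        - (LINT x|lebesgue. g1 x * comp_fun (H k) \<phi> x) / 2 = 0"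
    proof (rule Euler_Lagrange[OF p])
      show "AE x in lebesgue. x \<notin> W 1 \<longrightarrow> comp_fun (H k) \<phi> x = 0"
        using u1_zero by eventually_elim (auto simp: comp_fun_def H_def smooth_step_0)
    qed
    moreover have "(LINT x|lebesgue. G x \<bullet> comp_grad (H k) (h k) \<phi> x) 
      = (LINT x|lebesgue. H k (u1 x) * (G x \<bullet> P x)) + (LINT x|lebesgue. h k (u1 x) * (G x \<bullet> G x) * \<phi> x)"
    proof -
      have eq: "h k (u1 x) * (G x \<bullet> G x) * \<phi> x = G x \<bullet> comp_grad (H k) (h k) \<phi> x - H k (u1 x) * (G x \<bullet> P x)" for x
        by (simp add: comp_grad_def P_def inner_add_right algebra_simps)
      show ?thesis unfolding eq using perturbation_facts(2)[OF p] iGP[OF Hm Hb] by simp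
    qed
    moreover have "(LINT x|lebesgue. H k (u1 x) * (f1 x * u1 x - g1 x / 2) * \<phi> x)
      = (LINT x|lebesgue. f1 x * (u1 x * comp_fun (H k) \<phi> x)) - (LINT x|lebesgue. g1 x * comp_fun (H k) \<phi> x) / 2"
    proof -
      have "(LINT x|lebesgue. H k (u1 x) * (f1 x * u1 x - g1 x / 2) * \<phi> x)
        = (LINT x|lebesgue. f1 x * (u1 x * (H k (u1 x) * \<phi> x)) - g1 x * (H k (u1 x) * \<phi> x) / 2)"
        by (intro Bochner_Integration.integral_cong) (auto simp: algebra_simps)
      then show ?thesis using iq[of k] by (simp add: comp_fun_def)
    qed
    ultimately show ?thesis by linarith
  qed
  have "(\<lambda>k. - (LINT x|lebesgue. H k (u1 x) * (G x \<bullet> P x)) - (LINT x|lebesgue. H k (u1 x) * (f1 x * u1 x - g1 x / 2) * \<phi> x))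
     \<longlonglongrightarrow> - (- (LINT x|lebesgue. max 0 (u1 x) * laplacian \<phi> x)) - (LINT x|lebesgue. q x * \<phi> x)"
    using l1 l2 unfolding e1 by (intro tendsto_diff tendsto_minus)
  then have "(\<lambda>k. LINT x|lebesgue. h k (u1 x) * (G x \<bullet> G x) * \<phi> x) \<longlonglongrightarrow> T \<phi>"
    by (simp only: EL T_eq minus_minus)
  then show ?thesis by (simp add: h_def)
qed

lemma T_test_nonneg:
  assumes \<phi>: "test_function B \<phi>" "\<And>x. 0 \<le> \<phi> x" shows "0 \<le> T \<phi>"
proof -
  obtain s' S where s': "smooth1 s'" "\<And>t. (smooth_step has_real_derivative s' t) (at t)" "\<And>t. 0 \<le> s' t"
    by (rule smooth_step_deriv_ex) blast
  show ?thesis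
  proof (rule LIMSEQ_le_const[OF T_limit[OF s'(1,2) \<phi>(1)]], intro exI[of _ 0] allI impI Bochner_Integration.integral_nonneg)
    fix k x show "0 \<le> real (Suc k) * s' (real (Suc k) * u1 x) * (G x \<bullet> G x) * \<phi> x"
      using s'(3) \<phi>(2) by (intro mult_nonneg_nonneg) auto
  qed
qed

text \<open>
  If \<open>u\<close> avoids the interval from \<open>0\<close> to \<open>e\<close> on the support of \<open>\<phi>\<close>, the densities in \<open>T_limit\<close>
  vanish there as soon as \<open>1/k < e\<close>.
\<close>
lemma T_test_zero:
  assumes \<phi>: "test_function B \<phi>"
    and e: "e > 0" "\<And>x. \<phi> x \<noteq> 0 \<Longrightarrow> u1 x \<le> 0 \<or> e \<le> u1 x"
  shows "T \<phi> = 0"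
proof -
  obtain s' S where s': "smooth1 s'" "\<And>t. (smooth_step has_real_derivative s' t) (at t)"
    "\<And>t. t \<le> 0 \<Longrightarrow> s' t = 0" "\<And>t. 1 \<le> t \<Longrightarrow> s' t = 0"
    by (rule smooth_step_deriv_ex) blast
  obtain n where n: "inverse (real (Suc n)) < e" using reals_Archimedean[OF e(1)] by auto
  have z: "real (Suc k) * s' (real (Suc k) * u1 x) * (G x \<bullet> G x) * \<phi> x = 0" if "n \<le> k" for k x
  proof -
    consider "\<phi> x = 0" | "u1 x \<le> 0" | "e \<le> u1 x" using e(2) by blast
    then show ?thesis
    proof cases
      case 2
      then have "s' (real (Suc k) * u1 x) = 0" by (intro s'(3) mult_nonneg_nonpos) auto
      then show ?thesis by simp
    next
      case 3
      have "1 \<le> real (Suc n) * e" using n by (simp add: field_simps)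
      also have "\<dots> \<le> real (Suc k) * u1 x" using 3 that e(1) by (intro mult_mono) auto
      finally have "s' (real (Suc k) * u1 x) = 0" by (rule s'(4))
      then show ?thesis by simp
    qed simp
  qed
  have "0 = (LINT x|lebesgue. real (Suc k) * s' (real (Suc k) * u1 x) * (G x \<bullet> G x) * \<phi> x)" if "n \<le> k" for k
    by (simp only: z[OF that]) simp
  then have "\<forall>\<^sub>F k in sequentially. 0 = (LINT x|lebesgue. real (Suc k) * s' (real (Suc k) * u1 x) * (G x \<bullet> G x) * \<phi> x)"
    unfolding eventually_sequentially by blast
  from LIMSEQ_unique[OF Lim_transform_eventually[OF tendsto_const this] T_limit[OF s'(1,2) \<phi>]] show ?thesis by simp
qed

sublocale positive_distribution "ball z \<rho>" T
proof
  show "open (ball z \<rho>)" by simp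
  fix \<phi> \<psi> :: "real^'n \<Rightarrow> real" and c :: real
  assume \<phi>: "test_function (ball z \<rho>) \<phi>"
  note i\<phi> = integrable_v_test[OF test_function_laplacian[OF \<phi>]] integrable_q_test[OF \<phi>]
  show "T (\<lambda>x. c * \<phi> x) = c * T \<phi>"
    using i\<phi> by (simp add: T_eq laplacian_cmult[OF test_function_smooth[OF \<phi>]] mult.left_commute right_diff_distrib)
  show "0 \<le> T \<phi>" if "\<And>x. 0 \<le> \<phi> x" by (rule T_test_nonneg[OF \<phi> that])
  assume \<psi>: "test_function (ball z \<rho>) \<psi>"
  note i\<psi> = integrable_v_test[OF test_function_laplacian[OF \<psi>]] integrable_q_test[OF \<psi>]
  show "T (\<lambda>x. \<phi> x + \<psi> x) = T \<phi> + T \<psi>"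
    using i\<phi> i\<psi> by (simp add: T_eq laplacian_add[OF test_function_smooth[OF \<phi>] test_function_smooth[OF \<psi>]] distrib_left)
qed

end

section \<open>Nondegeneracy at the frontier\<close>
definition step_slope :: real where
  "step_slope = (SOME S. 0 < S \<and> (\<forall>t D. (smooth_step has_real_derivative D) (at t) \<longrightarrow> \<bar>D\<bar> \<le> S))"

lemma step_slope_pos: "0 < step_slope"
  and step_slope_bound: "(smooth_step has_real_derivative D) (at t) \<Longrightarrow> \<bar>D\<bar> \<le> step_slope"
proof -
  obtain s' S where s': "\<And>t. (smooth_step has_real_derivative s' t) (at t)" "\<And>t. 0 \<le> s' t" "\<And>t. s' t \<le> S" "S > 0"
    by (rule smooth_step_deriv_ex) blast
  have "\<bar>D\<bar> \<le> S" if "(smooth_step has_real_derivative D) (at t)" for t D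
    using DERIV_unique[OF that s'(1)] s'(2,3)[of t] by simp
  then have "\<exists>S. 0 < S \<and> (\<forall>t D. (smooth_step has_real_derivative D) (at t) \<longrightarrow> \<bar>D\<bar> \<le> S)" using s'(4) by blast
  from someI_ex[OF this] show "0 < step_slope" "(smooth_step has_real_derivative D) (at t) \<Longrightarrow> \<bar>D\<bar> \<le> step_slope"
    unfolding step_slope_def[symmetric] by blast+
qed

text \<open>
  Equal to \<open>1\<close> on the ball of radius \<open>s\<close> and to \<open>0\<close> off the ball of radius \<open>t\<close>, with a gradient of
  order \<open>1 / (t - s)\<close>.
\<close>
definition ball_cutoff :: "real^'n::finite \<Rightarrow> real \<Rightarrow> real \<Rightarrow> real^'n \<Rightarrow> real" where
  "ball_cutoff y s t x = smooth_step ((t\<^sup>2 - (norm (x - y))\<^sup>2) / (t\<^sup>2 - s\<^sup>2))"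

context
  fixes y :: "real^'n::finite" and s t :: real
  assumes st: "0 < s" "s < t"
begin

lemma sq_diff_pos: "0 < t\<^sup>2 - s\<^sup>2"
  using st by (simp add: power_strict_mono)

lemma ball_cutoff_range: "0 \<le> ball_cutoff y s t x" "ball_cutoff y s t x \<le> 1"
  by (simp_all add: ball_cutoff_def smooth_step_nonneg smooth_step_le_1)

lemma ball_cutoff_inside: "norm (x - y) \<le> s \<Longrightarrow> ball_cutoff y s t x = 1"
  unfolding ball_cutoff_def using sq_diff_pos by (intro smooth_step_1) (simp add: le_divide_eq power_mono)

lemma ball_cutoff_arg_nonpos: "t \<le> norm (x - y) \<Longrightarrow> (t\<^sup>2 - (norm (x - y))\<^sup>2) / (t\<^sup>2 - s\<^sup>2) \<le> 0"
  using sq_diff_pos st by (intro divide_nonpos_pos) (auto intro: power_mono)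

lemma ball_cutoff_outside: "t \<le> norm (x - y) \<Longrightarrow> ball_cutoff y s t x = 0"
  unfolding ball_cutoff_def by (rule smooth_step_0[OF ball_cutoff_arg_nonpos])

lemma ball_cutoff_radial:
  "ball_cutoff y s t = (\<lambda>x. (\<lambda>r. smooth_step (- inverse (t\<^sup>2 - s\<^sup>2) * r + t\<^sup>2 / (t\<^sup>2 - s\<^sup>2))) ((norm (x - y))\<^sup>2))"
  by (rule ext) (simp add: ball_cutoff_def divide_inverse algebra_simps)

lemma smooth_ball_cutoff: "smooth (ball_cutoff y s t)"
  unfolding ball_cutoff_radial by (rule smooth_compose[OF smooth1_affine[OF smooth1_smooth_step] smooth_norm_sq])

lemma test_function_ball_cutoff:
  assumes "cball y t \<subseteq> U" shows "test_function U (ball_cutoff y s t)"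
proof (rule test_functionI[OF smooth_ball_cutoff compact_cball assms])
  fix x assume "x \<notin> cball y t"
  then show "ball_cutoff y s t x = 0" by (intro ball_cutoff_outside) (simp add: dist_norm norm_minus_commute)
qed

lemma ball_cutoff_grad:
  "norm (\<chi> i. partial_deriv i (ball_cutoff y s t) x) \<le> real CARD('n) * (2 * step_slope / (t - s))"
  "t \<le> norm (x - y) \<Longrightarrow> partial_deriv i (ball_cutoff y s t) x = 0"
proof -
  obtain s' S where s': "\<And>t. (smooth_step has_real_derivative s' t) (at t)" "\<And>t. t \<le> 0 \<Longrightarrow> s' t = 0"
    by (rule smooth_step_deriv_ex) blast
  let ?a = "- inverse (t\<^sup>2 - s\<^sup>2)" and ?b = "t\<^sup>2 / (t\<^sup>2 - s\<^sup>2)"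
  have d: "((\<lambda>r. smooth_step (?a * r + ?b)) has_real_derivative s' (?a * r + ?b) * ?a) (at r)" for r
    by (rule DERIV_chain2[OF s'(1)]) (auto intro!: derivative_eq_intros)
  have pd: "partial_deriv i (ball_cutoff y s t) x = s' (?a * (norm (x - y))\<^sup>2 + ?b) * ?a * (2 * (x $ i - y $ i))" for i x
    unfolding ball_cutoff_radial by (subst partial_deriv_radial[OF d]) simp
  have arg: "?a * (norm (x - y))\<^sup>2 + ?b = (t\<^sup>2 - (norm (x - y))\<^sup>2) / (t\<^sup>2 - s\<^sup>2)" for x
    by (simp add: divide_inverse algebra_simps)
  have z: "partial_deriv i (ball_cutoff y s t) x = 0" if "t \<le> norm (x - y)" for i x
    unfolding pd arg using s'(2)[OF ball_cutoff_arg_nonpos[OF that]] by simp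
  then show "t \<le> norm (x - y) \<Longrightarrow> partial_deriv i (ball_cutoff y s t) x = 0" .
  have le: "\<bar>partial_deriv i (ball_cutoff y s t) x\<bar> \<le> 2 * step_slope / (t - s)" for i
  proof (cases "t \<le> norm (x - y)")
    case True
    then show ?thesis using z step_slope_pos st by simp
  next
    case False
    have xi: "\<bar>x $ i - y $ i\<bar> \<le> t" using component_le_norm_cart[of "x - y" i] False by simp
    have "\<bar>s' (?a * (norm (x - y))\<^sup>2 + ?b)\<bar> * inverse (t\<^sup>2 - s\<^sup>2) * (2 * \<bar>x $ i - y $ i\<bar>)
       \<le> step_slope * inverse (t\<^sup>2 - s\<^sup>2) * (2 * t)"
      using step_slope_bound[OF s'(1)] xi sq_diff_pos step_slope_pos st by (intro mult_mono) auto
    also have "\<dots> \<le> step_slope * inverse (t\<^sup>2 - s\<^sup>2) * (2 * (t + s))"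
      using step_slope_pos sq_diff_pos st by (intro mult_left_mono) auto
    also have "\<dots> = 2 * step_slope / (t - s)"
    proof -
      have "t\<^sup>2 - s\<^sup>2 = (t - s) * (t + s)" by (simp add: power2_eq_square algebra_simps)
      then show ?thesis using st by (simp add: divide_simps)
    qed
    finally show ?thesis unfolding pd abs_mult using sq_diff_pos by simp
  qed
  have "norm (\<chi> i. partial_deriv i (ball_cutoff y s t) x) \<le> (\<Sum>i\<in>UNIV. \<bar>(\<chi> i. partial_deriv i (ball_cutoff y s t) x) $ i\<bar>)"
    by (rule norm_le_l1_cart)
  also have "\<dots> \<le> (\<Sum>i\<in>(UNIV::'n set). 2 * step_slope / (t - s))" using le by (intro sum_mono) simp
  finally show "norm (\<chi> i. partial_deriv i (ball_cutoff y s t) x) \<le> real CARD('n) * (2 * step_slope / (t - s))" by simp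
qed

end

text \<open>
  Completing the square: with \<open>q\<close> the cutoff and \<open>p\<close> the value of \<open>u\<close>, the terms quadratic in \<open>b\<close> have a
  favourable sign, and everything else carries a factor \<open>p\<close>.
\<close>
lemma norm_sq_shift:
  fixes a b :: "'a::real_inner"
  shows "(norm (p *\<^sub>R a + q *\<^sub>R b))\<^sup>2 - 2 * (b \<bullet> (p *\<^sub>R a + q *\<^sub>R b))
    = p\<^sup>2 * (norm a)\<^sup>2 - 2 * p * (1 - q) * (a \<bullet> b) - q * (2 - q) * (norm b)\<^sup>2"
  by (simp add: power2_norm_eq_inner inner_add_left inner_add_right inner_commute[of b a]
      power2_eq_square[of p] algebra_simps)

context free_boundary
begin

definition mass :: "real^'n \<Rightarrow> real \<Rightarrow> real" where
  "mass y s = measure lebesgue ({x. 0 < u1 x} \<inter> ball y s)"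

lemma pos_sets: "{x. 0 < u1 x} \<in> sets lebesgue"
  using borel_measurable_less[OF borel_measurable_const u1_meas, of 0] by simp

lemma pos_ball_lmeasurable: "{x. 0 < u1 x} \<inter> ball y s \<in> lmeasurable"
  using fmeasurable_Int_fmeasurable[OF lmeasurable_ball pos_sets, of y s] by (simp add: Int_commute)

lemma mass_nonneg: "0 \<le> mass y s" by (simp add: mass_def)

lemma reassign_in_disjoint_tuples:
  assumes A: "A \<in> sets borel" "A \<subseteq> W 1" "\<And>j. j \<in> {2..N} \<Longrightarrow> A' j \<in> sets borel \<and> A' j \<subseteq> A" "disjoint_family_on A' {2..N}"
  shows "reassign N W A A' \<in> disjoint_tuples N \<Omega>"
proof -
  have WP: "W i \<in> sets borel" "W i \<subseteq> \<Omega>" if "i \<in> {1..N}" for i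
    using W_tuple that by (auto simp: disjoint_tuples_def)
  have Wd: "W i \<inter> W j = {}" if "i \<in> {1..N}" "j \<in> {1..N}" "i \<noteq> j" for i j
    using W_tuple that by (auto simp: disjoint_tuples_def disjoint_family_on_def)
  have Ad: "A' i \<inter> A' j = {}" if "i \<in> {2..N}" "j \<in> {2..N}" "i \<noteq> j" for i j
    using A(4) that by (auto simp: disjoint_family_on_def)
  have two: "i \<in> {2..N}" if "i \<in> {1..N}" "i \<noteq> 1" for i using that by auto
  show ?thesis
    unfolding disjoint_tuples_def
  proof (intro CollectI conjI)
    show "reassign N W A A' \<in> {1..N} \<rightarrow>\<^sub>E {A \<in> sets borel. A \<subseteq> \<Omega>}"
    proof (rule PiE_I)
      fix i assume i: "i \<in> {1..N}"
      show "reassign N W A A' i \<in> {A \<in> sets borel. A \<subseteq> \<Omega>}"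
      proof (cases "i = 1")
        case True
        then show ?thesis using i WP[OF i] A(1) by (auto simp: reassign_def)
      next
        case False
        have "A' i \<subseteq> \<Omega>" using A(2) A(3)[OF two[OF i False]] W1(2) by blast
        then show ?thesis using i WP[OF i] A(3)[OF two[OF i False]] False by (auto simp: reassign_def)
      qed
    next
      fix i assume "i \<notin> {1..N}"
      then show "reassign N W A A' i = undefined" by (simp only: reassign_def restrict_apply if_False)
    qed
    show "disjoint_family_on (reassign N W A A') {1..N}"
      unfolding disjoint_family_on_def
    proof (intro ballI impI)
      have key: "reassign N W A A' i \<inter> reassign N W A A' j = {}" if ij: "i \<in> {1..N}" "j \<in> {1..N}" "i \<noteq> j" "j \<noteq> 1" for i j
      proof (cases "i = 1")
        case True
        have "W 1 \<inter> W j = {}" "A' j \<subseteq> A" using Wd[of 1 j] A(3)[OF two[OF ij(2,4)]] ij one_in by auto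
        then show ?thesis using True ij by (auto simp: reassign_def)
      next
        case False
        have j: "A' j \<subseteq> W 1" and i: "A' i \<subseteq> W 1" using A(2) A(3)[OF two[OF ij(2,4)]] A(3)[OF two[OF ij(1) False]] by auto
        have "W i \<inter> W 1 = {}" "W j \<inter> W 1 = {}" using Wd[of i 1] Wd[of j 1] ij False one_in by auto
        then show ?thesis using Wd[OF ij(1,2,3)] Ad[OF two[OF ij(1) False] two[OF ij(2,4)] ij(3)] i j ij False
          by (auto simp: reassign_def)
      qed
      fix i j assume "i \<in> {1..N}" "j \<in> {1..N}" "i \<noteq> j"
      then show "reassign N W A A' i \<inter> reassign N W A A' j = {}"
        using key[of i j] key[of j i] by (cases "j = 1") (auto simp: Int_commute)
    qed
  qed
qed

text \<open>
  Compare with \<open>u - v \<zeta>\<close>, where \<open>\<zeta>\<close> is the cutoff between the radii \<open>s\<close> and \<open>t\<close>: it vanishes on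
  \<open>A = {u > 0} \<inter> ball y s\<close>, so \<open>A\<close> may be taken away from \<open>W 1\<close>, which lowers \<open>F\<close> by \<open>lam * mass y s\<close>. The
  energy changes only on \<open>{u > 0} \<inter> ball y t\<close>, and there by an amount that is small with the
  bound \<open>m\<close> of \<open>u\<close>.
\<close>
lemma mass_decay:
  assumes st: "0 < s" "s < t" and tB: "cball y t \<subseteq> B"
    and m: "0 \<le> m" "m \<le> 1" "\<And>x. x \<in> ball y t \<Longrightarrow> u1 x \<le> m"
    and small: "measure lebesgue (ball y s) \<le> \<epsilon>"
    and P: "P = real CARD('n) * (2 * step_slope / (t - s))"
  shows "lam * mass y s \<le> (2 * m * P * (real CARD('n) * C0) + m\<^sup>2 * P\<^sup>2 + (3 * Mf + Mg) * m) * mass y t"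
proof -
  define \<zeta> where "\<zeta> = ball_cutoff y s t"
  have \<zeta>: "test_function B \<zeta>" unfolding \<zeta>_def by (rule test_function_ball_cutoff[OF st tB])
  have \<zeta>r: "0 \<le> \<zeta> x" "\<zeta> x \<le> 1" for x using ball_cutoff_range[OF st] by (auto simp: \<zeta>_def)
  define D\<zeta> where "D\<zeta> x = (\<chi> i. partial_deriv i \<zeta> x)" for x
  have D\<zeta>P: "norm (D\<zeta> x) \<le> P" for x unfolding D\<zeta>_def \<zeta>_def P by (rule ball_cutoff_grad(1)[OF st])
  have out: "\<zeta> x = 0" "D\<zeta> x = 0" if "x \<notin> ball y t" for x
  proof -
    have "t \<le> norm (x - y)" using that by (simp add: dist_norm norm_minus_commute)
    then show "\<zeta> x = 0" "D\<zeta> x = 0"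
      using ball_cutoff_outside[OF st] ball_cutoff_grad(2)[OF st] by (auto simp: \<zeta>_def D\<zeta>_def vec_eq_iff)
  qed
  have P0: "0 \<le> P" using D\<zeta>P[of undefined] norm_ge_zero order_trans by blast
  let ?w = "comp_fun (max 0) \<zeta>" and ?D = "comp_grad (max 0) (\<lambda>t. of_bool (0 < t)) \<zeta>"
  have pert: "perturbation ?w ?D" by (rule perturbation_comp[OF chain_pair_pos \<zeta>])
  note pf = perturbation_facts[OF pert]
  let ?S = "{x. 0 < u1 x} \<inter> ball y t"
  let ?R = "2 * m * P * (real CARD('n) * C0) + m\<^sup>2 * P\<^sup>2 + (3 * Mf + Mg) * m"
  have R0: "0 \<le> ?R" using m P0 C0_nonneg Mf_nonneg Mg_nonneg by (intro add_nonneg_nonneg mult_nonneg_nonneg) auto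
  define A where "A = ({x. 0 < u1 x} \<inter> ball y s) \<inter> W 1"
  have sB: "ball y s \<subseteq> B" using tB st by (auto intro: subset_trans[OF _ tB])
  have "openin (top_of_set (ball y s)) (ball y s \<inter> u1 -` {0<..})"
    by (rule continuous_openin_preimage_gen[OF continuous_on_subset[OF u_cont sB] open_greaterThan])
  then have "open (ball y s \<inter> u1 -` {0<..})" by (simp add: openin_open_eq)
  moreover have "ball y s \<inter> u1 -` {0<..} = {x. 0 < u1 x} \<inter> ball y s" by auto
  ultimately have Ab: "A \<in> sets borel" using W1(1) by (auto simp: A_def)
  have Am: "measure lebesgue A = mass y s"
    unfolding mass_def
  proof (rule measure_eq_AE)
    show "AE x in lebesgue. (x \<in> A) = (x \<in> {x. 0 < u1 x} \<inter> ball y s)"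
      using u1_zero by eventually_elim (auto simp: A_def)
    show "A \<in> sets lebesgue" using Ab by simp
    show "{x. 0 < u1 x} \<inter> ball y s \<in> sets lebesgue" using pos_ball_lmeasurable by (rule fmeasurableD)
  qed
  show ?thesis
  proof (cases "mass y s = 0")
    case True
    then show ?thesis using R0 mass_nonneg[of y t] by simp
  next
    case False
    then have "0 < measure lebesgue A" using Am mass_nonneg[of y s] by simp
    moreover have "measure lebesgue A \<le> \<epsilon>"
    proof -
      have "mass y s \<le> measure lebesgue (ball y s)"
        unfolding mass_def by (rule measure_mono_fmeasurable) (use pos_ball_lmeasurable in \<open>auto intro: fmeasurableD\<close>)
      then show ?thesis using small Am by linarith
    qed
    moreover have "A \<subseteq> W 1" by (auto simp: A_def)
    ultimately obtain A' where A': "\<And>j. j \<in> {2..N} \<Longrightarrow> A' j \<in> sets borel \<and> A' j \<subseteq> A" "disjoint_family_on A' {2..N}"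
      "F (reassign N W A A') \<le> F W - lam * measure lebesgue A"
      using decrease[OF Ab] by blast
    have "0 \<le> (LINT x|lebesgue. (norm (?D x))\<^sup>2 - 2 * (G x \<bullet> ?D x)) +
      (LINT x|lebesgue. f1 x * (?w x)\<^sup>2 - 2 * (f1 x * (u1 x * ?w x)) + g1 x * ?w x) + F (reassign N W A A') - F W"
    proof (rule energy_comparison[OF pert])
      show "reassign N W A A' \<in> disjoint_tuples N \<Omega>"
        by (rule reassign_in_disjoint_tuples[OF Ab \<open>A \<subseteq> W 1\<close> A'(1,2)])
      show "W i \<subseteq> reassign N W A A' i" if "i \<in> {2..N}" for i using that by (auto simp: reassign_def)
      show "AE x in lebesgue. x \<notin> reassign N W A A' 1 \<longrightarrow> u1 x - ?w x = 0"
        using u1_zero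
      proof eventually_elim
        case (elim x)
        show ?case
        proof
          assume "x \<notin> reassign N W A A' 1"
          then consider "x \<notin> W 1" | "x \<in> A" using one_in by (auto simp: reassign_def)
          then show "u1 x - ?w x = 0"
          proof cases
            case 1 then show ?thesis using elim by (simp add: comp_fun_def)
          next
            case 2
            then have "norm (x - y) \<le> s" by (auto simp: A_def dist_norm norm_minus_commute)
            then have "\<zeta> x = 1" unfolding \<zeta>_def by (rule ball_cutoff_inside[OF st])
            then show ?thesis using 2 by (auto simp: comp_fun_def A_def)
          qed
        qed
      qed
    qed
    also have "(LINT x|lebesgue. (norm (?D x))\<^sup>2 - 2 * (G x \<bullet> ?D x)) +
      (LINT x|lebesgue. f1 x * (?w x)\<^sup>2 - 2 * (f1 x * (u1 x * ?w x)) + g1 x * ?w x)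
      = (LINT x|lebesgue. ((norm (?D x))\<^sup>2 - 2 * (G x \<bullet> ?D x)) + (f1 x * (?w x)\<^sup>2 - 2 * (f1 x * (u1 x * ?w x)) + g1 x * ?w x))"
      by (intro Bochner_Integration.integral_add[symmetric] Bochner_Integration.integrable_add Bochner_Integration.integrable_diff integrable_mult_right pf)
    also have "\<dots> \<le> (LINT x|lebesgue. indicator ?S x * ?R)"
    proof (rule integral_mono_AE)
      show "integrable lebesgue (\<lambda>x. ((norm (?D x))\<^sup>2 - 2 * (G x \<bullet> ?D x)) + (f1 x * (?w x)\<^sup>2 - 2 * (f1 x * (u1 x * ?w x)) + g1 x * ?w x))"
        by (intro Bochner_Integration.integrable_add Bochner_Integration.integrable_diff integrable_mult_right pf)
      show "integrable lebesgue (\<lambda>x. indicator ?S x * ?R)"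
        using pos_ball_lmeasurable[of y t] by (intro integrable_mult_left integrable_real_indicator) (auto simp: fmeasurable_def)
      show "AE x in lebesgue. ((norm (?D x))\<^sup>2 - 2 * (G x \<bullet> ?D x)) + (f1 x * (?w x)\<^sup>2 - 2 * (f1 x * (u1 x * ?w x)) + g1 x * ?w x) \<le> indicator ?S x * ?R"
        using G_norm_bound f1_bd g1_bd
      proof eventually_elim
        case (elim x)
        show ?case
        proof (cases "x \<in> ?S")
          case False
          have "?w x = 0" "?D x = 0"
            using False out[of x] unfolding comp_fun_def comp_grad_def D\<zeta>_def[symmetric] by auto
          then show ?thesis using False by simp
        next
          case True
          then have xb: "x \<in> ball y t" and up: "0 < u1 x" by auto
          have xB: "x \<in> B" using subsetD[OF tB, of x] xb by (simp add: less_imp_le)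
          have um: "u1 x \<le> m" by (rule m(3)[OF xb])
          have D: "?D x = u1 x *\<^sub>R D\<zeta> x + \<zeta> x *\<^sub>R G x" using up by (simp add: comp_grad_def D\<zeta>_def)
          have w: "?w x = u1 x * \<zeta> x" using up by (simp add: comp_fun_def)
          have Gn: "norm (G x) \<le> real CARD('n) * C0" using elim(1) xB by simp
          have "(norm (?D x))\<^sup>2 - 2 * (G x \<bullet> ?D x) = (u1 x)\<^sup>2 * (norm (D\<zeta> x))\<^sup>2 - 2 * u1 x * (1 - \<zeta> x) * (D\<zeta> x \<bullet> G x) - \<zeta> x * (2 - \<zeta> x) * (norm (G x))\<^sup>2"
            unfolding D by (rule norm_sq_shift)
          also have "\<dots> \<le> m\<^sup>2 * P\<^sup>2 + 2 * m * P * (real CARD('n) * C0)"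
          proof -
            have 1: "(u1 x)\<^sup>2 * (norm (D\<zeta> x))\<^sup>2 \<le> m\<^sup>2 * P\<^sup>2"
              using up um D\<zeta>P by (intro mult_mono power_mono) auto
            have "\<bar>D\<zeta> x \<bullet> G x\<bar> \<le> P * (real CARD('n) * C0)"
              by (rule order_trans[OF Cauchy_Schwarz_ineq2]) (use D\<zeta>P Gn P0 in \<open>intro mult_mono, auto\<close>)
            then have "(2 * u1 x) * (1 - \<zeta> x) * \<bar>D\<zeta> x \<bullet> G x\<bar> \<le> (2 * m) * 1 * (P * (real CARD('n) * C0))"
              using up um \<zeta>r[of x] m(1) by (intro mult_mono) auto
            moreover have "- (2 * u1 x * (1 - \<zeta> x) * (D\<zeta> x \<bullet> G x)) \<le> (2 * u1 x) * (1 - \<zeta> x) * \<bar>D\<zeta> x \<bullet> G x\<bar>"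
            proof -
              have "0 \<le> 2 * u1 x * (1 - \<zeta> x)" using up \<zeta>r[of x] by (intro mult_nonneg_nonneg) auto
              from mult_left_mono[OF abs_ge_minus_self[of "D\<zeta> x \<bullet> G x"] this] show ?thesis by simp
            qed
            moreover have "0 \<le> \<zeta> x * (2 - \<zeta> x) * (norm (G x))\<^sup>2" using \<zeta>r[of x] by (intro mult_nonneg_nonneg) auto
            ultimately show ?thesis using 1 by (simp add: mult.assoc)
          qed
          finally have A1: "(norm (?D x))\<^sup>2 - 2 * (G x \<bullet> ?D x) \<le> m\<^sup>2 * P\<^sup>2 + 2 * m * P * (real CARD('n) * C0)" .
          have wu: "0 \<le> ?w x" "?w x \<le> u1 x" unfolding w using up \<zeta>r[of x] by (auto simp: mult_left_le)
          have q1: "\<bar>f1 x * ((?w x)\<^sup>2 - 2 * (u1 x * ?w x))\<bar> \<le> Mf * (3 * m)"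
          proof -
            have a: "(?w x)\<^sup>2 \<le> m" and b: "u1 x * ?w x \<le> m"
            proof -
              have "u1 x * ?w x \<le> m * 1" using wu up um m by (intro mult_mono) auto
              then show "u1 x * ?w x \<le> m" by simp
              have "?w x * ?w x \<le> u1 x * ?w x" using wu by (intro mult_right_mono) auto
              then show "(?w x)\<^sup>2 \<le> m" using \<open>u1 x * ?w x \<le> m\<close> by (simp add: power2_eq_square)
            qed
            have "0 \<le> u1 x * ?w x" using wu up by simp
            then have "\<bar>(?w x)\<^sup>2 - 2 * (u1 x * ?w x)\<bar> \<le> 3 * m" using a b m(1) zero_le_power2[of "?w x"] by (intro abs_leI) linarith+
            then show ?thesis unfolding abs_mult using elim(2) Mf_nonneg by (intro mult_mono) auto
          qed
          have q2: "\<bar>g1 x * ?w x\<bar> \<le> Mg * m" unfolding abs_mult using elim(3) wu um Mg_nonneg by (intro mult_mono) auto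
          have "f1 x * (?w x)\<^sup>2 - 2 * (f1 x * (u1 x * ?w x)) + g1 x * ?w x = f1 x * ((?w x)\<^sup>2 - 2 * (u1 x * ?w x)) + g1 x * ?w x"
            by (simp add: algebra_simps)
          also have "\<dots> \<le> Mf * (3 * m) + Mg * m" using q1 q2 by linarith
          also have "\<dots> = (3 * Mf + Mg) * m" by (simp add: algebra_simps)
          finally show ?thesis using A1 True by simp
        qed
      qed
    qed
    also have "(LINT x|lebesgue. indicator ?S x * ?R) = ?R * mass y t"
      by (simp add: mass_def mult.commute)
    finally show ?thesis using A'(3) unfolding Am by linarith
  qed
qed

end

lemma measure_ball_eq:
  assumes "0 \<le> r"
  shows "measure lebesgue (ball (y::real^'n::finite) r) = unit_ball_vol (real CARD('n)) * r ^ CARD('n)"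
  using content_ball[OF assms, of y] by (simp add: measure_completion)

abbreviation "omega n \<equiv> unit_ball_vol (real n)"

lemma omega_pos: "0 < omega n" by simp

text \<open>
  The next constants are what the proofs below produce for radii at distance
  \<open>r / (4 * (n + 1))\<close> from each other; that they depend on nothing but their arguments is
  part of the theorem.
\<close>
definition cutoff_const :: "nat \<Rightarrow> real" where
  "cutoff_const n = 8 * real n * (real n + 1) * step_slope"

definition decay_const :: "nat \<Rightarrow> real \<Rightarrow> real \<Rightarrow> real \<Rightarrow> real \<Rightarrow> real" where
  "decay_const n C0 Mf Mg lam =
     (2 * cutoff_const n * (real n * C0) + (cutoff_const n)\<^sup>2 + 3 * Mf + Mg) / lam + 1"

definition nondeg_const :: "nat \<Rightarrow> real \<Rightarrow> real \<Rightarrow> real \<Rightarrow> real \<Rightarrow> real" where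
  "nondeg_const n C0 Mf Mg lam = 1 / (2 * decay_const n C0 Mf Mg lam ^ (n + 1) * (2 * (C0 + 1)) ^ n)"

context free_boundary
begin

lemma u1_lower_near:
  assumes "ball x e \<subseteq> B" "e > 0" "y \<in> ball x e" shows "u1 x - C0 * e \<le> u1 y"
proof -
  have "x \<in> ball x e" using assms(2) by simp
  then have "x \<in> B" "y \<in> B" using assms(1,3) by blast+
  from u_lip[OF this] have "u1 x - u1 y \<le> C0 * norm (x - y)" by linarith
  also have "\<dots> \<le> C0 * e" using assms(3) C0_nonneg by (intro mult_left_mono) (auto simp: dist_norm)
  finally show ?thesis by linarith
qed

lemma frontier_zero:
  assumes "a \<in> frontier (positivity_set u1)" "a \<in> B" shows "u1 a = 0"
proof -
  have "isCont u1 a" using u_cont open_B assms(2) by (simp add: continuous_on_eq_continuous_at)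
  then have c: "(u1 \<longlongrightarrow> u1 a) (nhds a)" by (simp add: isCont_def tendsto_at_iff_tendsto_nhds)
  have "\<not> 0 < u1 a"
  proof
    assume p: "0 < u1 a"
    have "\<forall>\<^sub>F x in nhds a. 0 < u1 x" by (rule order_tendstoD(1)[OF c p])
    then obtain S where "open S" "a \<in> S" "\<forall>x\<in>S. 0 < u1 x" unfolding eventually_nhds by blast
    then have "a \<in> interior (positivity_set u1)" unfolding interior_def positivity_set_def by blast
    then show False using assms(1) by (simp add: frontier_def)
  qed
  moreover have "\<not> u1 a < 0"
  proof
    assume p: "u1 a < 0"
    have "\<forall>\<^sub>F x in nhds a. u1 x < 0" by (rule order_tendstoD(2)[OF c p])
    then obtain S where "open S" "a \<in> S" "\<forall>x\<in>S. u1 x < 0" unfolding eventually_nhds by blast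
    then have "S \<inter> positivity_set u1 = {}" by (auto simp: positivity_set_def dest: bspec)
    then have "S \<inter> closure (positivity_set u1) = {}" using \<open>open S\<close> by (simp add: open_Int_closure_eq_empty)
    then have "a \<notin> closure (positivity_set u1)" using \<open>a \<in> S\<close> by blast
    then show False using assms(1) by (simp add: frontier_def)
  qed
  ultimately show ?thesis by simp
qed

lemma v_near_frontier:
  assumes "a \<in> frontier (positivity_set u1)" "a \<in> B" "x \<in> B" "norm (x - a) \<le> s"
  shows "max 0 (u1 x) \<le> C0 * s" "u1 x \<le> C0 * s" "0 \<le> C0 * s"
proof -
  have "\<bar>u1 x\<bar> \<le> C0 * norm (x - a)" using u_lip[OF assms(3,2)] frontier_zero[OF assms(1,2)] by simp
  also have "\<dots> \<le> C0 * s" using assms(4) C0_nonneg by (rule mult_left_mono)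
  finally have *: "\<bar>u1 x\<bar> \<le> C0 * s" .
  show "0 \<le> C0 * s" using C0_nonneg assms(4) norm_ge_zero[of "x - a"] by (meson mult_nonneg_nonneg order_trans)
  with * show "max 0 (u1 x) \<le> C0 * s" "u1 x \<le> C0 * s" by linarith+
qed

end

text \<open>
  The constants \<open>\<kappa>\<close> and \<open>c0\<close> are parameters fixed by equations, since their types do not determine
  the dimension.
\<close>
locale free_boundary_constants = free_boundary N \<Omega> f g F u W Mf Mg z \<rho> C0 lam \<epsilon>
  for N :: nat and \<Omega> :: "(real^'n::finite) set"
    and f g :: "nat \<Rightarrow> real^'n \<Rightarrow> real" and F :: "(nat \<Rightarrow> (real^'n) set) \<Rightarrow> real"
    and u :: "nat \<Rightarrow> real^'n \<Rightarrow> real" and W :: "nat \<Rightarrow> (real^'n) set" and Mf Mg :: real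
    and z :: "real^'n" and \<rho> C0 lam \<epsilon> :: real +
  fixes \<kappa> c0 :: real
  assumes kappa_eq: "\<kappa> = decay_const CARD('n) C0 Mf Mg lam"
    and c0_eq: "c0 = nondeg_const CARD('n) C0 Mf Mg lam"
begin

lemma cutoff_const_nonneg: "0 \<le> cutoff_const n"
  using step_slope_pos by (simp add: cutoff_const_def)

lemma decay_const_ge_1: "1 \<le> \<kappa>"
  unfolding kappa_eq decay_const_def
  using cutoff_const_nonneg[of "CARD('n)"] C0_nonneg Mf_nonneg Mg_nonneg lam_pos by simp

lemma nondeg_const_bounds: "0 < c0" "c0 \<le> 1 / 2"
proof -
  have "1 \<le> \<kappa> ^ (CARD('n) + 1)" by (rule one_le_power[OF decay_const_ge_1])
  moreover have "1 \<le> (2 * (C0 + 1)) ^ CARD('n)" using C0_nonneg by (intro one_le_power) simp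
  ultimately have "1 * 1 \<le> \<kappa> ^ (CARD('n) + 1) * (2 * (C0 + 1)) ^ CARD('n)" by (intro mult_mono) auto
  then show "0 < c0" "c0 \<le> 1 / 2" unfolding c0_eq nondeg_const_def kappa_eq[symmetric]
    by (auto simp: field_simps)
qed

lemma mass_le_ball: "0 \<le> r \<Longrightarrow> mass y r \<le> omega CARD('n) * r ^ CARD('n)"
  unfolding mass_def measure_ball_eq[symmetric, of r y]
  by (rule measure_mono_fmeasurable) (use pos_ball_lmeasurable in \<open>auto intro: fmeasurableD\<close>)

text \<open>
  One step of the decay, over the distance \<open>\<delta>\<close>: the gradient of the cutoff is of order \<open>1/r\<close> and
  \<open>u \<le> c r\<close>, so every term of \<open>mass_decay\<close> is at most a constant times \<open>c\<close>.
\<close>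
lemma mass_step:
  assumes c: "0 \<le> c" "c \<le> 1" and r: "0 < r" "r \<le> 1" "cball y r \<subseteq> B"
    and u: "\<And>x. x \<in> ball y r \<Longrightarrow> u1 x \<le> c * r"
    and small: "measure lebesgue (ball y r) \<le> \<epsilon>"
    and t: "r / 2 \<le> t" "t \<le> r" and \<delta>: "\<delta> = r / (4 * (real CARD('n) + 1))"
  shows "mass y (t - \<delta>) \<le> c * \<kappa> * mass y t"
proof -
  let ?n = "real CARD('n)"
  let ?p = "cutoff_const CARD('n)"
  have \<delta>b: "0 < \<delta>" "\<delta> < r / 2"
  proof -
    show "0 < \<delta>" unfolding \<delta> using r by simp
    have "r / (4 * (?n + 1)) \<le> r / 4" using r by (intro divide_left_mono) auto
    then show "\<delta> < r / 2" unfolding \<delta> using r by linarith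
  qed
  have P: "?p / r = ?n * (2 * step_slope / (t - (t - \<delta>)))"
    unfolding \<delta> cutoff_const_def using r by (simp add: field_simps)
  have "lam * mass y (t - \<delta>) \<le> (2 * (c * r) * (?p / r) * (?n * C0) + (c * r)\<^sup>2 * (?p / r)\<^sup>2 + (3 * Mf + Mg) * (c * r)) * mass y t"
  proof (rule mass_decay[OF _ _ _ _ _ _ _ P])
    show "0 < t - \<delta>" "t - \<delta> < t" using t \<delta>b by auto
    show "cball y t \<subseteq> B" using r(3) t(2) by (meson subset_cball subset_trans)
    show "0 \<le> c * r" "c * r \<le> 1" using c r by (auto intro: mult_le_one)
    show "u1 x \<le> c * r" if "x \<in> ball y t" for x using that t(2) by (intro u) auto
    have "measure lebesgue (ball y (t - \<delta>)) \<le> measure lebesgue (ball y r)"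
      using t \<delta>b by (intro measure_mono_fmeasurable) (auto intro: subset_ball simp: fmeasurableD)
    then show "measure lebesgue (ball y (t - \<delta>)) \<le> \<epsilon>" using small by linarith
  qed
  also have "\<dots> \<le> (lam * (c * \<kappa>)) * mass y t"
  proof (rule mult_right_mono[OF _ mass_nonneg])
    have "2 * (c * r) * (?p / r) * (?n * C0) = c * (2 * ?p * (?n * C0))" using r by simp
    moreover have "(c * r)\<^sup>2 * (?p / r)\<^sup>2 \<le> c * ?p\<^sup>2"
    proof -
      have "(c * r)\<^sup>2 * (?p / r)\<^sup>2 = (c * c) * ?p\<^sup>2" using r by (simp add: power2_eq_square)
      also have "\<dots> \<le> (c * 1) * ?p\<^sup>2" using c by (intro mult_right_mono mult_left_mono) auto
      finally show ?thesis by simp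
    qed
    moreover have "(3 * Mf + Mg) * (c * r) \<le> (3 * Mf + Mg) * (c * 1)"
      using Mf_nonneg Mg_nonneg c r by (intro mult_left_mono) auto
    ultimately have "2 * (c * r) * (?p / r) * (?n * C0) + (c * r)\<^sup>2 * (?p / r)\<^sup>2 + (3 * Mf + Mg) * (c * r)
      \<le> c * (2 * ?p * (?n * C0)) + c * ?p\<^sup>2 + (3 * Mf + Mg) * (c * 1)" by linarith
    also have "\<dots> = c * (2 * ?p * (?n * C0) + ?p\<^sup>2 + 3 * Mf + Mg)" by (simp add: algebra_simps)
    also have "\<dots> \<le> c * (lam * \<kappa>)"
      using lam_pos c by (intro mult_left_mono) (auto simp: kappa_eq decay_const_def field_simps)
    finally show "2 * (c * r) * (?p / r) * (?n * C0) + (c * r)\<^sup>2 * (?p / r)\<^sup>2 + (3 * Mf + Mg) * (c * r) \<le> lam * (c * \<kappa>)"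
      by (simp add: ac_simps)
  qed
  finally show ?thesis using lam_pos by (simp add: mult.assoc)
qed

lemma mass_three_quarters:
  assumes c: "0 \<le> c" "c \<le> 1" and r: "0 < r" "r \<le> 1" "cball y r \<subseteq> B"
    and u: "\<And>x. x \<in> ball y r \<Longrightarrow> u1 x \<le> c * r"
    and small: "measure lebesgue (ball y r) \<le> \<epsilon>"
  shows "mass y (3 * r / 4) \<le> (c * \<kappa>) ^ (CARD('n) + 1) * (omega CARD('n) * r ^ CARD('n))"
proof -
  define \<delta> where "\<delta> = r / (4 * (real CARD('n) + 1))"
  have \<delta>0: "0 < \<delta>" using r by (simp add: \<delta>_def)
  have tot: "(real CARD('n) + 1) * \<delta> = r / 4" by (simp add: \<delta>_def field_simps)
  have c\<kappa>: "0 \<le> c * \<kappa>" using c decay_const_ge_1 by simp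
  have "mass y (r - real j * \<delta>) \<le> (c * \<kappa>) ^ j * mass y r" if "j \<le> CARD('n) + 1" for j
    using that
  proof (induction j)
    case (Suc j)
    have "real j * \<delta> \<le> (real CARD('n) + 1) * \<delta>" using Suc.prems \<delta>0 by (intro mult_right_mono) auto
    then have "mass y (r - real j * \<delta> - \<delta>) \<le> c * \<kappa> * mass y (r - real j * \<delta>)"
      using tot r \<delta>0 by (intro mass_step[OF c r u small _ _ \<delta>_def]) auto
    also have "\<dots> \<le> c * \<kappa> * ((c * \<kappa>) ^ j * mass y r)"
      using Suc c\<kappa> by (intro mult_left_mono) auto
    finally show ?case by (simp add: algebra_simps)
  qed simp
  from this[of "CARD('n) + 1"] have "mass y (r - (real CARD('n) + 1) * \<delta>) \<le> (c * \<kappa>) ^ (CARD('n) + 1) * mass y r"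
    by (simp add: add.commute)
  moreover have "r - (real CARD('n) + 1) * \<delta> = 3 * r / 4" unfolding tot by simp
  ultimately have "mass y (3 * r / 4) \<le> (c * \<kappa>) ^ (CARD('n) + 1) * mass y r" by (simp only:)
  also have "\<dots> \<le> (c * \<kappa>) ^ (CARD('n) + 1) * (omega CARD('n) * r ^ CARD('n))"
    using c\<kappa> mass_le_ball[of r y] r by (intro mult_left_mono) auto
  finally show ?thesis .
qed

text \<open>
  By \<open>n + 1\<close> steps of decay the volume of \<open>{u > 0}\<close> is of order \<open>c0 ^ (n + 1) * r ^ n\<close> in the ball of
  radius \<open>3 r / 4\<close>. If \<open>u x > c0 r / 2\<close>, the Lipschitz bound gives a ball of radius
  comparable with \<open>c0 r\<close> in \<open>{u > 0}\<close>, of volume comparable with \<open>c0 ^ n * r ^ n\<close>. The value of \<open>c0\<close> makes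
  the two incompatible: the extra power of \<open>c0\<close> is the reason for taking one step more than
  the dimension.
\<close>
lemma halving:
  assumes r: "0 < r" "r \<le> 1" "cball y r \<subseteq> B"
    and u: "\<And>x. x \<in> ball y r \<Longrightarrow> u1 x \<le> c0 * r"
    and small: "measure lebesgue (ball y r) \<le> \<epsilon>"
    and x: "x \<in> ball y (r / 2)"
  shows "u1 x \<le> c0 * (r / 2)"
proof (rule ccontr)
  assume "\<not> u1 x \<le> c0 * (r / 2)"
  then have ux: "c0 * (r / 2) < u1 x" by simp
  let ?n = "CARD('n)"
  let ?L = "C0 + 1"
  note c0 = nondeg_const_bounds
  define e where "e = c0 / (2 * ?L) * r"
  have L: "1 \<le> ?L" using C0_nonneg by simp
  have e: "0 < e" using c0 r L by (simp add: e_def)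
  have e4: "e \<le> r / 4"
  proof -
    have "c0 / (2 * ?L) \<le> (1/2) / (2 * 1)" using c0 L by (intro frac_le) auto
    then have "c0 / (2 * ?L) * r \<le> (1/4) * r" using r by (intro mult_right_mono) auto
    then show ?thesis by (simp add: e_def)
  qed
  have sub: "ball x e \<subseteq> ball y (3 * r / 4)"
  proof
    fix w assume "w \<in> ball x e"
    then have "dist y w < r / 2 + e" using x dist_triangle[of y w x] by simp
    then show "w \<in> ball y (3 * r / 4)" using e4 by simp
  qed
  have subB: "ball x e \<subseteq> B"
    using sub r subset_trans[OF ball_subset_cball, of y "3*r/4"] subset_cball[of "3*r/4" r y] by auto
  have "ball x e \<subseteq> {x. 0 < u1 x} \<inter> ball y (3 * r / 4)"
  proof (intro Int_greatest sub subsetI CollectI)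
    fix w assume w: "w \<in> ball x e"
    have "C0 * e \<le> ?L * e" using e by (intro mult_right_mono) auto
    also have "\<dots> = c0 * (r / 2)" using L by (simp add: e_def field_simps)
    finally show "0 < u1 w" using u1_lower_near[OF subB e w] ux by linarith
  qed
  then have "measure lebesgue (ball x e) \<le> mass y (3 * r / 4)"
    unfolding mass_def by (rule measure_mono_fmeasurable) (use pos_ball_lmeasurable in auto)
  then have "omega ?n * e ^ ?n \<le> mass y (3 * r / 4)"
    unfolding measure_ball_eq[OF less_imp_le[OF e]] .
  also have "\<dots> \<le> (c0 * \<kappa>) ^ (?n + 1) * (omega ?n * r ^ ?n)"
    using c0 by (intro mass_three_quarters r u small) auto
  finally have "omega ?n * ((c0 / (2 * ?L)) ^ ?n * r ^ ?n) \<le> omega ?n * ((c0 * \<kappa>) ^ (?n + 1) * r ^ ?n)"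
    unfolding e_def power_mult_distrib[of "c0 / (2 * ?L)"] by (simp only: ac_simps)
  then have "(c0 / (2 * ?L)) ^ ?n * r ^ ?n \<le> (c0 * \<kappa>) ^ (?n + 1) * r ^ ?n"
    by (simp only: mult_le_cancel_left_pos[OF omega_pos])
  then have "(c0 / (2 * ?L)) ^ ?n \<le> (c0 * \<kappa>) ^ (?n + 1)"
    by (simp only: mult_le_cancel_right_pos[OF zero_less_power[OF r(1)]])
  then have "c0 ^ ?n / (2 * ?L) ^ ?n \<le> c0 ^ ?n * (c0 * \<kappa> ^ (?n + 1))"
    unfolding power_divide power_mult_distrib[of c0 \<kappa>] power_add[of c0 ?n 1] power_one_right by (simp only: ac_simps)
  then have "c0 ^ ?n * (1 / (2 * ?L) ^ ?n) \<le> c0 ^ ?n * (c0 * \<kappa> ^ (?n + 1))" by simp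
  then have "1 / (2 * ?L) ^ ?n \<le> c0 * \<kappa> ^ (?n + 1)" using c0 by (simp only: mult_le_cancel_left_pos zero_less_power)
  then have "1 \<le> c0 * \<kappa> ^ (?n + 1) * (2 * ?L) ^ ?n" using L by (simp add: pos_divide_le_eq)
  also have "\<dots> = 1 / 2"
  proof -
    have "\<kappa> ^ (?n + 1) * (2 * ?L) ^ ?n \<noteq> 0" using decay_const_ge_1 L by simp
    then show ?thesis unfolding c0_eq nondeg_const_def kappa_eq[symmetric] by (simp add: field_simps)
  qed
  finally show False by simp
qed

text \<open>
  Otherwise \<open>halving\<close> applies around every point \<open>y\<close> of the half ball, first at scale \<open>r/2\<close> and then at
  all smaller dyadic scales; so \<open>u y \<le> 0\<close> there, and \<open>a\<close> would not be in the closure of \<open>{u > 0}\<close>.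
\<close>
lemma nondegeneracy:
  assumes r: "0 < r" "r \<le> 1" "cball a r \<subseteq> B" and small: "measure lebesgue (ball a r) \<le> \<epsilon>"
    and a: "a \<in> frontier (positivity_set u1)"
  shows "\<exists>y\<in>ball a r. c0 / 2 * r < u1 y"
proof (rule ccontr)
  assume "\<not> ?thesis"
  then have u: "u1 y \<le> c0 / 2 * r" if "y \<in> ball a r" for y using that by force
  have half: "u1 y \<le> 0" if y: "y \<in> ball a (r / 2)" for y
  proof -
    have rk: "0 < r / 2 ^ Suc k" "r / 2 ^ Suc k \<le> r / 2" for k
    proof -
      show "0 < r / 2 ^ Suc k" using r by simp
      have "(2::real) ^ 1 \<le> 2 ^ Suc k" by (rule power_increasing) auto
      then show "r / 2 ^ Suc k \<le> r / 2" using r by (intro divide_left_mono) auto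
    qed
    have inb: "cball y (r / 2 ^ Suc k) \<subseteq> ball a r" for k
    proof
      fix w assume "w \<in> cball y (r / 2 ^ Suc k)"
      then have "dist a w < r / 2 + r / 2" using y rk(2)[of k] dist_triangle[of a w y] by simp
      then show "w \<in> ball a r" by simp
    qed
    have "u1 x \<le> c0 * (r / 2 ^ Suc k)" if "x \<in> ball y (r / 2 ^ Suc k)" for x k
      using that
    proof (induction k arbitrary: x)
      case 0
      then have "x \<in> cball y (r / 2 ^ Suc 0)" by (simp add: less_imp_le)
      then have "x \<in> ball a r" using inb[of 0] by blast
      from u[OF this] show ?case by simp
    next
      case (Suc k)
      have "u1 x \<le> c0 * (r / 2 ^ Suc k / 2)"
      proof (rule halving)
        show "0 < r / 2 ^ Suc k" by (rule rk)
        show "r / 2 ^ Suc k \<le> 1" using rk(2)[of k] r by linarith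
        show "cball y (r / 2 ^ Suc k) \<subseteq> B" using inb[of k] r(3) ball_subset_cball by blast
        have "measure lebesgue (ball y (r / 2 ^ Suc k)) \<le> measure lebesgue (ball a r)"
          using inb[of k] ball_subset_cball by (intro measure_mono_fmeasurable) (auto simp: fmeasurableD less_imp_le)
        then show "measure lebesgue (ball y (r / 2 ^ Suc k)) \<le> \<epsilon>" using small by linarith
        show "x \<in> ball y (r / 2 ^ Suc k / 2)" using Suc.prems by (simp add: mult.commute)
      qed (rule Suc.IH)
      then show ?case by (simp add: mult.commute)
    qed
    note bd = this
    have le: "u1 y \<le> c0 * r * (1/2) ^ Suc k" for k
    proof -
      have "u1 y \<le> c0 * (r / 2 ^ Suc k)" by (rule bd) (use rk(1)[of k] in simp)
      also have "\<dots> = c0 * r * (1/2) ^ Suc k" unfolding power_one_over by simp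
      finally show ?thesis .
    qed
    have "(\<lambda>k. c0 * r * (1/2) ^ Suc k) \<longlonglongrightarrow> c0 * r * 0"
      by (intro tendsto_mult tendsto_const LIMSEQ_Suc LIMSEQ_power_zero) simp
    then have "u1 y \<le> c0 * r * 0" by (rule LIMSEQ_le_const) (use le in blast)
    then show ?thesis by simp
  qed
  have "a \<in> closure (positivity_set u1)" using a by (simp add: frontier_def)
  then obtain y where "y \<in> positivity_set u1" "dist y a < r / 2"
    using r(1) unfolding closure_approachable by (meson half_gt_zero)
  then show False using half[of y] by (auto simp: positivity_set_def dist_commute)
qed

end

section \<open>Measure bounds at the frontier\<close>
definition bump_slope :: "real \<Rightarrow> real" where "bump_slope t = bump_exp t * (inverse t)\<^sup>2"

definition bump_curv :: "real \<Rightarrow> real" where "bump_curv = deriv bump_slope"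

lemma DERIV_bump_exp': "(bump_exp has_real_derivative bump_slope t) (at t)"
  using DERIV_bump_exp by (simp add: bump_slope_def)

lemma smooth1_bump_slope: "smooth1 bump_slope"
proof -
  obtain E where E: "\<And>t. (bump_exp has_real_derivative E t) (at t)" "smooth1 E"
    using smooth1_obtain_deriv[OF smooth1_bump_exp] by blast
  have "E = bump_slope" using DERIV_unique[OF E(1) DERIV_bump_exp'] by (intro ext)
  with E show ?thesis by simp
qed

lemma DERIV_bump_slope: "(bump_slope has_real_derivative bump_curv t) (at t)"
  and smooth1_bump_curv: "smooth1 bump_curv"
proof -
  obtain E where E: "\<And>t. (bump_slope has_real_derivative E t) (at t)" "smooth1 E"
    using smooth1_obtain_deriv[OF smooth1_bump_slope] by blast
  have "E = bump_curv" unfolding bump_curv_def using DERIV_imp_deriv[OF E(1)] by (intro ext) simp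
  with E show "(bump_slope has_real_derivative bump_curv t) (at t)" "smooth1 bump_curv" by auto
qed

lemma bump_slope_nonneg: "0 \<le> bump_slope t"
  and bump_slope_zero: "t \<le> 0 \<Longrightarrow> bump_slope t = 0"
  by (simp_all add: bump_slope_def bump_exp_nonneg bump_exp_zero)

lemma bump_curv_zero: "t \<le> 0 \<Longrightarrow> bump_curv t = 0"
  by (rule DERIV_local_min[OF DERIV_bump_slope zero_less_one])
    (simp add: bump_slope_zero bump_slope_nonneg)

lemma smooth1_bounded_below_1:
  assumes "smooth1 h" "\<And>t. t \<le> 0 \<Longrightarrow> h t = 0"
  shows "\<exists>e>0. \<forall>t\<le>1. \<bar>h t\<bar> \<le> e"
proof -
  have "compact (h ` {0..1})" by (rule compact_continuous_image[OF smooth1_continuous[OF assms(1)] compact_Icc])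
  from compact_imp_bounded[OF this] obtain e where e: "e > 0" "\<forall>y\<in>h ` {0..1}. norm y \<le> e"
    unfolding bounded_pos by blast
  have "\<bar>h t\<bar> \<le> e" if "t \<le> 1" for t
    using e that assms(2)[of t] by (cases "t \<le> 0") auto
  with e(1) show ?thesis by blast
qed

definition slope_bound :: real where "slope_bound = (SOME e. 0 < e \<and> (\<forall>t\<le>1. \<bar>bump_slope t\<bar> \<le> e))"
definition curv_bound :: real where "curv_bound = (SOME e. 0 < e \<and> (\<forall>t\<le>1. \<bar>bump_curv t\<bar> \<le> e))"

lemma slope_bound: "0 < slope_bound" "t \<le> 1 \<Longrightarrow> \<bar>bump_slope t\<bar> \<le> slope_bound"
proof -
  have "\<exists>e. 0 < e \<and> (\<forall>t\<le>1. \<bar>bump_slope t\<bar> \<le> e)"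
    by (rule smooth1_bounded_below_1[OF smooth1_bump_slope bump_slope_zero])
  from someI_ex[OF this] show "0 < slope_bound" "t \<le> 1 \<Longrightarrow> \<bar>bump_slope t\<bar> \<le> slope_bound"
    unfolding slope_bound_def by auto
qed

lemma curv_bound: "0 < curv_bound" "t \<le> 1 \<Longrightarrow> \<bar>bump_curv t\<bar> \<le> curv_bound"
proof -
  have "\<exists>e. 0 < e \<and> (\<forall>t\<le>1. \<bar>bump_curv t\<bar> \<le> e)"
    by (rule smooth1_bounded_below_1[OF smooth1_bump_curv bump_curv_zero])
  from someI_ex[OF this] show "0 < curv_bound" "t \<le> 1 \<Longrightarrow> \<bar>bump_curv t\<bar> \<le> curv_bound"
    unfolding curv_bound_def by auto
qed

lemma bump_exp_le_1: "bump_exp t \<le> 1" by (simp add: bump_exp_def)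

lemma laplacian_radial_bump:
  assumes s: "0 < s"
  shows "laplacian (radial_bump a s) (x :: real^'n::finite) =
    4 * (norm (x - a))\<^sup>2 * bump_curv (1 - (norm (x - a))\<^sup>2 / s\<^sup>2) / s ^ 4
      - 2 * real CARD('n) * bump_slope (1 - (norm (x - a))\<^sup>2 / s\<^sup>2) / s\<^sup>2"
proof -
  let ?Q = "\<lambda>r. bump_exp (1 - r / s\<^sup>2)"
  let ?Q' = "\<lambda>r. bump_slope (1 - r / s\<^sup>2) * (- (1 / s\<^sup>2))"
  let ?Q'' = "\<lambda>r. bump_curv (1 - r / s\<^sup>2) * (- (1 / s\<^sup>2)) * (- (1 / s\<^sup>2))"
  have i: "((\<lambda>r. 1 - r / s\<^sup>2) has_real_derivative (- (1 / s\<^sup>2))) (at r)" for r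
    by (rule DERIV_cong[OF DERIV_diff[OF DERIV_const DERIV_cdivide[OF DERIV_ident]]]) simp
  have d1: "(?Q has_real_derivative ?Q' r) (at r)" for r by (rule DERIV_chain2[OF DERIV_bump_exp' i])
  have d2: "(?Q' has_real_derivative ?Q'' r) (at r)" for r
    by (rule DERIV_cmult_right[OF DERIV_chain2[OF DERIV_bump_slope i]])
  have sm: "smooth1 ?Q'"
    using smooth1_mult[OF smooth1_affine[OF smooth1_bump_slope, of "- inverse (s\<^sup>2)" 1] smooth1_const[of "- (1 / s\<^sup>2)"]]
    by (simp add: divide_inverse mult.commute)
  have lap: "laplacian (\<lambda>x. ?Q ((norm (x - a))\<^sup>2)) x = 4 * (norm (x - a))\<^sup>2 * ?Q'' ((norm (x - a))\<^sup>2) + 2 * real CARD('n) * ?Q' ((norm (x - a))\<^sup>2)"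
    by (rule laplacian_radial[OF d1 d2 sm])
  have rb: "radial_bump a s = (\<lambda>x. ?Q ((norm (x - a))\<^sup>2))" by (simp add: radial_bump_def[abs_def])
  have s4: "s ^ 4 = s\<^sup>2 * s\<^sup>2" by (simp flip: power_add)
  show ?thesis unfolding rb lap s4 by simp
qed

definition lap_const :: "nat \<Rightarrow> real" where "lap_const n = 4 * curv_bound + 2 * real n * slope_bound"

lemma lap_const_nonneg: "0 \<le> lap_const n"
  using slope_bound(1) curv_bound(1) by (simp add: lap_const_def)

lemma laplacian_radial_bump_bound:
  assumes s: "0 < s" shows "\<bar>laplacian (radial_bump a s) (x :: real^'n::finite)\<bar> \<le> lap_const CARD('n) / s\<^sup>2"
    "s \<le> norm (x - a) \<Longrightarrow> laplacian (radial_bump a s) x = 0"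
proof -
  let ?\<tau> = "(norm (x - a))\<^sup>2"
  have z: "laplacian (radial_bump a s) x = 0" if "s \<le> norm (x - a)"
  proof -
    have "s\<^sup>2 \<le> ?\<tau>" using that s by (intro power_mono) auto
    then have "1 - ?\<tau> / s\<^sup>2 \<le> 0" using s by simp
    then show ?thesis unfolding laplacian_radial_bump[OF s] by (simp add: bump_curv_zero bump_slope_zero)
  qed
  then show "s \<le> norm (x - a) \<Longrightarrow> laplacian (radial_bump a s) x = 0" .
  show "\<bar>laplacian (radial_bump a s) x\<bar> \<le> lap_const CARD('n) / s\<^sup>2"
  proof (cases "s \<le> norm (x - a)")
    case True then show ?thesis using z lap_const_nonneg by simp
  next
    case False
    have t1: "1 - ?\<tau> / s\<^sup>2 \<le> 1" using s by simp
    have \<tau>: "?\<tau> \<le> s\<^sup>2" using False by (intro power_mono) auto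
    have "\<bar>4 * ?\<tau> * bump_curv (1 - ?\<tau> / s\<^sup>2) / s ^ 4\<bar> = 4 * ?\<tau> * \<bar>bump_curv (1 - ?\<tau> / s\<^sup>2)\<bar> / s ^ 4"
      using s by (simp add: abs_mult)
    also have "\<dots> \<le> 4 * s\<^sup>2 * curv_bound / s ^ 4"
      using \<tau> curv_bound(2)[OF t1] s by (intro divide_right_mono mult_mono) auto
    also have "\<dots> = 4 * curv_bound / s\<^sup>2"
    proof -
      have s4: "s ^ 4 = s\<^sup>2 * s\<^sup>2" by (simp flip: power_add)
      have gen: "4 * p * c / (p * p) = 4 * c / p" if "0 < p" for p c :: real using that by (simp add: field_simps)
      show ?thesis unfolding s4 by (rule gen) (use s in simp)
    qed
    finally have 1: "\<bar>4 * ?\<tau> * bump_curv (1 - ?\<tau> / s\<^sup>2) / s ^ 4\<bar> \<le> 4 * curv_bound / s\<^sup>2" .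
    have "\<bar>2 * real CARD('n) * bump_slope (1 - ?\<tau> / s\<^sup>2) / s\<^sup>2\<bar> = 2 * real CARD('n) * \<bar>bump_slope (1 - ?\<tau> / s\<^sup>2)\<bar> / s\<^sup>2"
      using s by (simp add: abs_mult)
    also have "\<dots> \<le> 2 * real CARD('n) * slope_bound / s\<^sup>2"
      using slope_bound(2)[OF t1] s by (intro divide_right_mono mult_left_mono) auto
    finally have 2: "\<bar>2 * real CARD('n) * bump_slope (1 - ?\<tau> / s\<^sup>2) / s\<^sup>2\<bar> \<le> 2 * real CARD('n) * slope_bound / s\<^sup>2" .
    have "lap_const CARD('n) / s\<^sup>2 = 4 * curv_bound / s\<^sup>2 + 2 * real CARD('n) * slope_bound / s\<^sup>2"
      by (simp add: lap_const_def add_divide_distrib)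
    then show ?thesis unfolding laplacian_radial_bump[OF s] using 1 2 by linarith
  qed
qed

text \<open>
  If \<open>E\<close> is \<open>bump_exp\<close>, the radial bump of radius \<open>s\<close> is \<open>E(1 - |y|\<^sup>2)\<close> with \<open>y = (x - a)/s\<close>, and this kernel
  is \<open>s ^ (- n)\<close> times \<open>\<rho>(y) = 2 E'(1 - |y|\<^sup>2)\<close>. Since \<open>y \<rho>(y)\<close> is minus the gradient of the bump, the
  derivative of the kernel in \<open>s\<close> is the Laplacian of the bump, up to a power of \<open>s\<close>.
\<close>
definition mean_kernel :: "real^'n::finite \<Rightarrow> real \<Rightarrow> real^'n \<Rightarrow> real" where
  "mean_kernel a s x = 2 * bump_slope (1 - (norm (x - a))\<^sup>2 / s\<^sup>2) / s ^ CARD('n)"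

lemma DERIV_mean_kernel:
  assumes s: "0 < s"
  shows "((\<lambda>s. mean_kernel a s (x :: real^'n::finite)) has_real_derivative
    laplacian (radial_bump a s) x * (s / s ^ CARD('n))) (at s)"
proof -
  let ?\<tau> = "(norm (x - a))\<^sup>2" and ?n = "CARD('n)"
  have i: "((\<lambda>s. 1 - ?\<tau> / s\<^sup>2) has_real_derivative 2 * ?\<tau> / s ^ 3) (at s)"
  proof -
    have "((\<lambda>s. 1 - ?\<tau> / s\<^sup>2) has_real_derivative 0 - (0 * s\<^sup>2 - ?\<tau> * (2 * s)) / (s\<^sup>2 * s\<^sup>2)) (at s)"
      using s by (intro DERIV_diff DERIV_const DERIV_divide) (auto intro!: derivative_eq_intros)
    moreover have "0 - (0 * s\<^sup>2 - ?\<tau> * (2 * s)) / (s\<^sup>2 * s\<^sup>2) = 2 * ?\<tau> / s ^ 3"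
    proof -
      have "0 - (0 * (s * s) - t * (2 * s)) / ((s * s) * (s * s)) = 2 * t / (s * s * s)" for t
        using s by (simp add: field_simps)
      then show ?thesis unfolding power2_eq_square[of s] power3_eq_cube[of s] .
    qed
    ultimately show ?thesis by (simp only:)
  qed
  have sn: "s * s ^ (?n - 1) = s ^ ?n" by (metis power_minus_mult zero_less_card_finite mult.commute)
  have "((\<lambda>s. 2 * bump_slope (1 - ?\<tau> / s\<^sup>2) / s ^ ?n) has_real_derivative
     (2 * (bump_curv (1 - ?\<tau> / s\<^sup>2) * (2 * ?\<tau> / s ^ 3)) * s ^ ?n - 2 * bump_slope (1 - ?\<tau> / s\<^sup>2) * (real ?n * s ^ (?n - 1))) / (s ^ ?n * s ^ ?n)) (at s)"
    using s by (intro DERIV_divide DERIV_cmult DERIV_chain2[OF DERIV_bump_slope i]) (auto intro!: derivative_eq_intros simp: One_nat_def)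
  moreover have "(2 * (bump_curv (1 - ?\<tau> / s\<^sup>2) * (2 * ?\<tau> / s ^ 3)) * s ^ ?n - 2 * bump_slope (1 - ?\<tau> / s\<^sup>2) * (real ?n * s ^ (?n - 1))) / (s ^ ?n * s ^ ?n)
     = laplacian (radial_bump a s) x * (s / s ^ ?n)"
  proof -
    have "(2 * (bc * (2 * \<tau> / s ^ 3)) * s ^ ?n - 2 * bs * (real ?n * s ^ (?n - 1))) / (s ^ ?n * s ^ ?n)
      = (4 * \<tau> * bc / s ^ 4 - 2 * real ?n * bs / s\<^sup>2) * (s / s ^ ?n)" for bc bs \<tau> :: real
    proof -
      have gen: "(2 * (bc * (2 * \<tau> / (s * s * s))) * p - 2 * bs * (N * (p / s))) / (p * p)
        = (4 * \<tau> * bc / (s * s * s * s) - 2 * N * bs / (s * s)) * (s / p)" if "0 < p" for p N :: real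
        using that s by (simp add: field_simps)
      have q: "s ^ (?n - 1) = s ^ ?n / s" using sn s by (simp add: field_simps)
      show ?thesis unfolding q power2_eq_square[of s] power3_eq_cube[of s] power4_eq_xxxx[of s]
        by (rule gen) (use s in simp)
    qed
    then show ?thesis unfolding laplacian_radial_bump[OF s] .
  qed
  ultimately show ?thesis unfolding mean_kernel_def by simp
qed

text \<open>
  Differentiation under the integral sign, by dominated convergence along sequences.
\<close>
lemma DERIV_integral:
  fixes h h' :: "real \<Rightarrow> 'a \<Rightarrow> real"
  assumes D: "\<And>s x. s \<in> {p<..<q} \<Longrightarrow> ((\<lambda>s. h s x) has_real_derivative h' s x) (at s)"
    and b: "\<And>s x. s \<in> {p<..<q} \<Longrightarrow> \<bar>h' s x\<bar> \<le> w x"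
    and i: "\<And>s. s \<in> {p<..<q} \<Longrightarrow> integrable M (h s)" and w: "integrable M w"
    and m: "h' s0 \<in> borel_measurable M" and s0: "s0 \<in> {p<..<q}"
  shows "((\<lambda>s. integral\<^sup>L M (h s)) has_real_derivative integral\<^sup>L M (h' s0)) (at s0)"
  unfolding DERIV_def tendsto_at_iff_sequentially
proof (intro allI impI)
  fix t :: "nat \<Rightarrow> real" assume t: "\<forall>k. t k \<in> UNIV - {0}" "t \<longlonglongrightarrow> 0"
  have "(\<lambda>k. s0 + t k) \<longlonglongrightarrow> s0 + 0" by (intro tendsto_add tendsto_const t)
  then have "\<forall>\<^sub>F k in sequentially. s0 + t k \<in> {p<..<q}"
    by (rule topological_tendstoD) (use s0 in auto)
  then obtain k0 where k0: "\<And>k. k0 \<le> k \<Longrightarrow> s0 + t k \<in> {p<..<q}" unfolding eventually_sequentially by blast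
  have "(\<lambda>k. LINT x|M. (h (s0 + t (k + k0)) x - h s0 x) / t (k + k0)) \<longlonglongrightarrow> integral\<^sup>L M (h' s0)"
  proof (rule integral_dominated_convergence[OF m _ w])
    show "(\<lambda>x. (h (s0 + t (k + k0)) x - h s0 x) / t (k + k0)) \<in> borel_measurable M" for k
      using i[OF k0[of "k + k0"]] i[OF s0] by (intro borel_measurable_divide borel_measurable_diff borel_measurable_const) auto
    show "AE x in M. (\<lambda>k. (h (s0 + t (k + k0)) x - h s0 x) / t (k + k0)) \<longlonglongrightarrow> h' s0 x"
    proof (rule AE_I2)
      fix x
      have "((\<lambda>e. (h (s0 + e) x - h s0 x) / e) \<longlongrightarrow> h' s0 x) (at 0)" using D[OF s0] by (simp add: DERIV_def)
      then have "((\<lambda>e. (h (s0 + e) x - h s0 x) / e) \<circ> t) \<longlonglongrightarrow> h' s0 x"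
        unfolding tendsto_at_iff_sequentially using t by blast
      from LIMSEQ_ignore_initial_segment[OF this, of k0]
      show "(\<lambda>k. (h (s0 + t (k + k0)) x - h s0 x) / t (k + k0)) \<longlonglongrightarrow> h' s0 x" by (simp add: o_def)
    qed
    show "AE x in M. norm ((h (s0 + t (k + k0)) x - h s0 x) / t (k + k0)) \<le> w x" for k
    proof (rule AE_I2)
      fix x
      have "norm (h (s0 + t (k + k0)) x - h s0 x) \<le> w x * norm (s0 + t (k + k0) - s0)"
      proof (rule field_differentiable_bound[of "{p<..<q}" "\<lambda>s. h s x" "\<lambda>s. h' s x"])
        show "((\<lambda>s. h s x) has_real_derivative h' z x) (at z within {p<..<q})" if "z \<in> {p<..<q}" for z
          using D[OF that] by (rule has_field_derivative_at_within)
        show "norm (h' z x) \<le> w x" if "z \<in> {p<..<q}" for z using b[OF that] by simp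
        show "s0 + t (k + k0) \<in> {p<..<q}" by (rule k0) simp
      qed (use s0 in auto)
      moreover have "t (k + k0) \<noteq> 0" using t(1) by blast
      ultimately show "norm ((h (s0 + t (k + k0)) x - h s0 x) / t (k + k0)) \<le> w x"
        by (simp add: pos_divide_le_eq)
    qed
  qed
  moreover have "(LINT x|M. (h (s0 + t (k + k0)) x - h s0 x) / t (k + k0)) = (integral\<^sup>L M (h (s0 + t (k + k0))) - integral\<^sup>L M (h s0)) / t (k + k0)" for k
    using i[OF k0[of "k + k0"]] i[OF s0] by simp
  ultimately have "(\<lambda>k. (integral\<^sup>L M (h (s0 + t (k + k0))) - integral\<^sup>L M (h s0)) / t (k + k0)) \<longlonglongrightarrow> integral\<^sup>L M (h' s0)"
    by (simp only:)
  then have "(\<lambda>k. (integral\<^sup>L M (h (s0 + t k)) - integral\<^sup>L M (h s0)) / t k) \<longlonglongrightarrow> integral\<^sup>L M (h' s0)"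
    by (rule LIMSEQ_offset)
  then show "((\<lambda>e. (integral\<^sup>L M (h (s0 + e)) - integral\<^sup>L M (h s0)) / e) \<circ> t) \<longlonglongrightarrow> integral\<^sup>L M (h' s0)"
    by (simp add: o_def)
qed

lemma measure_cball_eq:
  assumes "0 \<le> r"
  shows "measure lebesgue (cball (y::real^'n::finite) r) = unit_ball_vol (real CARD('n)) * r ^ CARD('n)"
  using content_cball[OF assms, of y] by (simp add: measure_completion)

context free_boundary
begin

lemma test_radial_bump: "0 < s \<Longrightarrow> cball a s \<subseteq> B \<Longrightarrow> test_function B (radial_bump a s)"
  by (rule test_function_radial_bump)

lemma radial_bump_le_1: "radial_bump a s x \<le> 1"
  by (simp add: radial_bump_def bump_exp_le_1)

lemma frontier_in_B: "ball a (2 * r) \<subseteq> B \<Longrightarrow> 0 < r \<Longrightarrow> a \<in> B"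
  using centre_in_ball[of a "2 * r"] by (meson mult_pos_pos subsetD zero_less_numeral)

lemma v_laplacian_bound:
  assumes a: "a \<in> frontier (positivity_set u1)" "a \<in> B" and s: "0 < s" "cball a s \<subseteq> B"
  shows "\<bar>LINT x|lebesgue. max 0 (u1 x) * laplacian (radial_bump a s) x\<bar>
    \<le> (C0 * s) * (lap_const CARD('n) / s\<^sup>2) * (omega CARD('n) * s ^ CARD('n))"
  unfolding measure_cball_eq[OF less_imp_le[OF s(1)], symmetric, of a]
proof (rule integral_abs_le_const)
  have tf: "test_function B (laplacian (radial_bump a s))" by (rule test_function_laplacian[OF test_radial_bump[OF s]])
  show "(\<lambda>x. max 0 (u1 x) * laplacian (radial_bump a s) x) \<in> borel_measurable lebesgue"
    by (rule borel_measurable_integrable[OF integrable_v_test[OF tf]])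
  have out: "laplacian (radial_bump a s) x = 0" if "x \<notin> cball a s" for x
    using that by (intro laplacian_radial_bump_bound(2) s(1)) (simp add: dist_norm norm_minus_commute)
  then show "max 0 (u1 x) * laplacian (radial_bump a s) x = 0" if "x \<notin> cball a s" for x using that by simp
  show "AE x in lebesgue. \<bar>max 0 (u1 x) * laplacian (radial_bump a s) x\<bar> \<le> C0 * s * (lap_const CARD('n) / s\<^sup>2)"
  proof (rule AE_I2)
    fix x
    have c: "0 \<le> C0 * s" using C0_nonneg s by simp
    have l: "0 \<le> lap_const CARD('n) / s\<^sup>2" using lap_const_nonneg by simp
    show "\<bar>max 0 (u1 x) * laplacian (radial_bump a s) x\<bar> \<le> C0 * s * (lap_const CARD('n) / s\<^sup>2)"
    proof (cases "x \<in> cball a s")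
      case True
      have "norm (x - a) \<le> s" using True by (simp add: dist_norm norm_minus_commute)
      from v_near_frontier[OF a _ this] have "max 0 (u1 x) \<le> C0 * s" using True s(2) by blast
      then show ?thesis unfolding abs_mult using laplacian_radial_bump_bound(1)[OF s(1), of a x] c
        by (intro mult_mono) auto
    next
      case False
      then show ?thesis using out[OF False] mult_nonneg_nonneg[OF c l] by simp
    qed
  qed
qed simp

lemma q_bump_bound:
  assumes a: "a \<in> frontier (positivity_set u1)" "a \<in> B" and s: "0 < s" "cball a s \<subseteq> B"
  shows "\<bar>LINT x|lebesgue. q x * radial_bump a s x\<bar> \<le> (Mf * (C0 * s) + Mg) * (omega CARD('n) * s ^ CARD('n))"
  unfolding measure_cball_eq[OF less_imp_le[OF s(1)], symmetric, of a]
proof (rule integral_abs_le_const)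
  have tf: "test_function B (radial_bump a s)" by (rule test_radial_bump[OF s])
  show "(\<lambda>x. q x * radial_bump a s x) \<in> borel_measurable lebesgue"
    by (rule borel_measurable_integrable[OF integrable_q_test[OF tf]])
  have out: "radial_bump a s x = 0" if "x \<notin> cball a s" for x
    using that by (intro radial_bump_outside s(1)) (simp add: dist_norm norm_minus_commute)
  then show "q x * radial_bump a s x = 0" if "x \<notin> cball a s" for x using that by simp
  have c: "0 \<le> C0 * s" using C0_nonneg s by simp
  have "AE x in lebesgue. x \<in> cball a s \<longrightarrow> \<bar>q x\<bar> \<le> Mf * (C0 * s) + Mg"
  proof (rule q_bound[OF _ c])
    fix x assume x: "x \<in> cball a s"
    then have "norm (x - a) \<le> s" by (simp add: dist_norm norm_minus_commute)
    from v_near_frontier(2)[OF a _ this] show "u1 x \<le> C0 * s" using x s(2) by blast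
  qed
  then show "AE x in lebesgue. \<bar>q x * radial_bump a s x\<bar> \<le> Mf * (C0 * s) + Mg"
  proof eventually_elim
    case (elim x)
    have c2: "0 \<le> Mf * (C0 * s) + Mg" using c Mf_nonneg Mg_nonneg by simp
    show ?case
    proof (cases "x \<in> cball a s")
      case True
      then have "\<bar>q x\<bar> * \<bar>radial_bump a s x\<bar> \<le> (Mf * (C0 * s) + Mg) * 1"
        using elim radial_bump_le_1[of a s x] radial_bump_nonneg[of a s x] c2 by (intro mult_mono) auto
      then show ?thesis by (simp add: abs_mult)
    qed (use out c2 in simp)
  qed
qed simp

abbreviation "\<nu> \<equiv> repr_measure"

text \<open>
  The bump of radius \<open>3 r / 2\<close> is at least \<open>bump_exp (5/9)\<close> on the ball of radius \<open>r\<close>, because \<open>1 - (2/3)\<^sup>2 = 5/9\<close>,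
  and its support stays in the ball of radius \<open>2 r\<close>.
\<close>
lemma upper_bound:
  assumes a: "a \<in> frontier (positivity_set u1)" and r: "0 < r" "r \<le> 1" "ball a (2 * r) \<subseteq> B"
  shows "emeasure \<nu> (ball a r) \<le> ennreal
    ((C0 * lap_const CARD('n) + 3 * (Mf * (2 * C0) + Mg)) * omega CARD('n) * 2 ^ CARD('n) / bump_exp (5/9) * r ^ (CARD('n) - 1))"
proof -
  let ?n = "CARD('n)"
  define s where "s = 3 * r / 2"
  have s: "0 < s" "s \<le> 2 * r" "s \<le> 3 / 2" using r by (auto simp: s_def)
  have "cball a s \<subseteq> ball a (2 * r)" using r by (auto simp: s_def)
  then have sB: "cball a s \<subseteq> B" using r(3) by blast
  have aB: "a \<in> B" by (rule frontier_in_B[OF r(3,1)])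
  have E: "0 < bump_exp (5/9)" by (simp add: bump_exp_pos)
  have tf: "test_function B (radial_bump a s)" by (rule test_radial_bump[OF s(1) sB])
  have tf2: "test_function B (\<lambda>x. inverse (bump_exp (5/9)) * radial_bump a s x)" by (rule test_function_cmult[OF tf])
  have "emeasure \<nu> (ball a r) \<le> ennreal (T (\<lambda>x. inverse (bump_exp (5/9)) * radial_bump a s x))"
  proof (rule emeasure_le_T[OF tf2])
    show "0 \<le> inverse (bump_exp (5/9)) * radial_bump a s x" for x using E by (simp add: radial_bump_nonneg)
    fix x assume "x \<in> ball a r"
    then have "norm (x - a) \<le> r" by (simp add: dist_norm norm_minus_commute)
    then have "(norm (x - a))\<^sup>2 \<le> r\<^sup>2" by (intro power_mono) auto
    then have "(norm (x - a))\<^sup>2 / s\<^sup>2 \<le> r\<^sup>2 / s\<^sup>2" by (intro divide_right_mono) auto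
    also have "\<dots> = 4 / 9" using r by (simp add: s_def power2_eq_square)
    finally have "bump_exp (5/9) \<le> radial_bump a s x" unfolding radial_bump_def by (intro bump_exp_mono) simp
    then show "1 \<le> inverse (bump_exp (5/9)) * radial_bump a s x" using E by (simp add: field_simps)
  qed simp
  also have "\<dots> \<le> ennreal ((C0 * lap_const ?n + 3 * (Mf * (2 * C0) + Mg)) * omega ?n * 2 ^ ?n / bump_exp (5/9) * r ^ (?n - 1))"
  proof (rule ennreal_leI)
    have sn: "s ^ ?n = s * s ^ (?n - 1)" by (metis power_minus_mult zero_less_card_finite mult.commute)
    have sl: "s ^ (?n - 1) \<le> 2 ^ ?n * r ^ (?n - 1)"
    proof -
      have "s ^ (?n - 1) \<le> (2 * r) ^ (?n - 1)" using s by (intro power_mono) auto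
      also have "\<dots> = 2 ^ (?n - 1) * r ^ (?n - 1)" by (rule power_mult_distrib)
      also have "\<dots> \<le> 2 ^ ?n * r ^ (?n - 1)" using r by (intro mult_right_mono power_increasing) auto
      finally show ?thesis .
    qed
    have "T (radial_bump a s) \<le> (C0 * s) * (lap_const ?n / s\<^sup>2) * (omega ?n * s ^ ?n) + (Mf * (C0 * s) + Mg) * (omega ?n * s ^ ?n)"
      unfolding T_eq using v_laplacian_bound[OF a aB s(1) sB] q_bump_bound[OF a aB s(1) sB] by linarith
    also have "\<dots> = (C0 * lap_const ?n + (Mf * (C0 * s) + Mg) * s) * (omega ?n * s ^ (?n - 1))"
      unfolding sn using s(1) by (simp add: field_simps power2_eq_square)
    also have "\<dots> \<le> (C0 * lap_const ?n + 3 * (Mf * (2 * C0) + Mg)) * (omega ?n * (2 ^ ?n * r ^ (?n - 1)))"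
    proof (rule mult_mono)
      have "(Mf * (C0 * s) + Mg) * s \<le> (Mf * (C0 * 2) + Mg) * 3"
        using s Mf_nonneg Mg_nonneg C0_nonneg by (intro mult_mono add_mono mult_left_mono) auto
      then show "C0 * lap_const ?n + (Mf * (C0 * s) + Mg) * s \<le> C0 * lap_const ?n + 3 * (Mf * (2 * C0) + Mg)" by (simp add: ac_simps)
      show "omega ?n * s ^ (?n - 1) \<le> omega ?n * (2 ^ ?n * r ^ (?n - 1))" using sl by (intro mult_left_mono) auto
      show "0 \<le> C0 * lap_const ?n + 3 * (Mf * (2 * C0) + Mg)" using C0_nonneg Mf_nonneg Mg_nonneg lap_const_nonneg by simp
      show "0 \<le> omega ?n * s ^ (?n - 1)" using s by simp
    qed
    finally have "T (radial_bump a s) \<le> (C0 * lap_const ?n + 3 * (Mf * (2 * C0) + Mg)) * (omega ?n * (2 ^ ?n * r ^ (?n - 1)))" .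
    then have "inverse (bump_exp (5/9)) * T (radial_bump a s) \<le> inverse (bump_exp (5/9)) * ((C0 * lap_const ?n + 3 * (Mf * (2 * C0) + Mg)) * (omega ?n * (2 ^ ?n * r ^ (?n - 1))))"
      using E by (intro mult_left_mono) auto
    then show "T (\<lambda>x. inverse (bump_exp (5/9)) * radial_bump a s x) \<le> (C0 * lap_const ?n + 3 * (Mf * (2 * C0) + Mg)) * omega ?n * 2 ^ ?n / bump_exp (5/9) * r ^ (?n - 1)"
      unfolding T_cmult[OF tf] by (simp only: divide_inverse ac_simps)
  qed
  finally show ?thesis .
qed

text \<open>
  A ball that misses the frontier lies in \<open>{u > 0}\<close> or in its complement. In the first case \<open>u\<close> is
  bounded below by a positive number on a smaller closed ball; in both cases \<open>T_test_zero\<close> applies.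
\<close>
lemma null_away_from_frontier:
  assumes x: "x \<in> B" "x \<notin> frontier (positivity_set u1)"
  shows "\<exists>r>0. emeasure \<nu> (ball x r) = 0"
proof -
  have "open (B - frontier (positivity_set u1))" by (simp add: open_Diff frontier_closed)
  then obtain d where d: "d > 0" "ball x d \<subseteq> B - frontier (positivity_set u1)"
    using x by (meson DiffI open_contains_ball)
  have conn: "ball x d \<subseteq> positivity_set u1 \<or> ball x d \<inter> positivity_set u1 = {}"
    using connected_Int_frontier[of "ball x d" "positivity_set u1"] d(2) by (auto simp: Int_commute)
  define s where "s = d / 2"
  have s: "0 < s" "cball x s \<subseteq> ball x d" using d by (auto simp: s_def)
  have sB: "cball x s \<subseteq> B" using s d by blast
  have tf: "test_function B (radial_bump x s)" by (rule test_radial_bump[OF s(1) sB])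
  have "\<exists>e>0. \<forall>y\<in>cball x s. u1 y \<le> 0 \<or> e \<le> u1 y"
  proof (cases "ball x d \<subseteq> positivity_set u1")
    case True
    have "\<exists>y\<in>cball x s. \<forall>w\<in>cball x s. u1 y \<le> u1 w"
      using s(1) by (intro continuous_attains_inf continuous_on_subset[OF u_cont sB]) auto
    then obtain y where y: "y \<in> cball x s" "\<forall>w\<in>cball x s. u1 y \<le> u1 w" by blast
    have "0 < u1 y" using True s(2) y(1) by (auto simp: positivity_set_def)
    then show ?thesis using y(2) by blast
  next
    case False
    then have "u1 y \<le> 0" if "y \<in> cball x s" for y using conn s(2) that by (fastforce simp: positivity_set_def)
    then show ?thesis by (intro exI[of _ 1]) auto
  qed
  then obtain e where e: "e > 0" "\<And>y. y \<in> cball x s \<Longrightarrow> u1 y \<le> 0 \<or> e \<le> u1 y" by blast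
  have T0: "T (radial_bump x s) = 0"
  proof (rule T_test_zero[OF tf e(1)])
    fix y assume "radial_bump x s y \<noteq> 0"
    then have "y \<in> cball x s" using radial_bump_outside[OF s(1), of y x] by (force simp: dist_norm norm_minus_commute)
    then show "u1 y \<le> 0 \<or> e \<le> u1 y" by (rule e(2))
  qed
  have E: "0 < bump_exp (1/2)" by (simp add: bump_exp_pos)
  have "emeasure \<nu> (ball x (s / 2)) \<le> ennreal (T (\<lambda>y. inverse (bump_exp (1/2)) * radial_bump x s y))"
  proof (rule emeasure_le_T[OF test_function_cmult[OF tf]])
    show "0 \<le> inverse (bump_exp (1/2)) * radial_bump x s y" for y using E by (simp add: radial_bump_nonneg)
    fix y assume "y \<in> ball x (s / 2)"
    then have "norm (y - x) \<le> s / 2" by (simp add: dist_norm norm_minus_commute)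
    then have "(norm (y - x))\<^sup>2 \<le> (s / 2)\<^sup>2" by (intro power_mono) auto
    then have "(norm (y - x))\<^sup>2 / s\<^sup>2 \<le> (s / 2)\<^sup>2 / s\<^sup>2" by (intro divide_right_mono) auto
    also have "\<dots> = 1 / 4" using s by (simp add: power2_eq_square)
    finally have "bump_exp (1/2) \<le> radial_bump x s y" unfolding radial_bump_def by (intro bump_exp_mono) linarith
    then show "1 \<le> inverse (bump_exp (1/2)) * radial_bump x s y" using E by (simp add: field_simps)
  qed simp
  then have "emeasure \<nu> (ball x (s / 2)) = 0" unfolding T_cmult[OF tf] T0 by simp
  then show ?thesis using s by (intro exI[of _ "s / 2"]) simp
qed

end

text \<open>
  \<open>mean_const\<close> bounds the mean of \<open>v\<close> at scale \<open>r\<close>, divided by \<open>r\<close>, from below; \<open>inner_ratio\<close> is the ratio of scales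
  at which the Lipschitz bound makes the mean less than half of that.
\<close>
definition mean_const :: "nat \<Rightarrow> real \<Rightarrow> real \<Rightarrow> real" where
  "mean_const n C0 c0 = c0 / 8 * (2 * bump_exp (7/16)) * (omega n * (c0 / (8 * (C0 + 1))) ^ n)"

definition inner_ratio :: "nat \<Rightarrow> real \<Rightarrow> real \<Rightarrow> real" where
  "inner_ratio n C0 c0 = min (1/2) (mean_const n C0 c0 / (4 * slope_bound * omega n * (C0 + 1)))"

lemma mean_kernel_nonneg: "0 < s \<Longrightarrow> 0 \<le> mean_kernel a s x"
  by (simp add: mean_kernel_def bump_slope_nonneg)

lemma mean_kernel_outside: "0 < s \<Longrightarrow> s \<le> norm (x - a) \<Longrightarrow> mean_kernel a s x = 0"
proof -
  assume s: "0 < s" "s \<le> norm (x - a)"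
  then have "s\<^sup>2 \<le> (norm (x - a))\<^sup>2" by (intro power_mono) auto
  then have "bump_slope (1 - (norm (x - a))\<^sup>2 / s\<^sup>2) = 0" using s by (intro bump_slope_zero) simp
  then show ?thesis by (simp add: mean_kernel_def)
qed

lemma test_function_mean_kernel:
  fixes a :: "real^'n::finite"
  assumes s: "0 < s" "cball a s \<subseteq> U" shows "test_function U (mean_kernel a s)"
proof (rule test_functionI[of _ "cball a s"])
  have "smooth (\<lambda>x. bump_slope (- inverse (s\<^sup>2) * (norm (x - a))\<^sup>2 + 1))"
    by (rule smooth_compose[OF smooth1_affine[OF smooth1_bump_slope] smooth_norm_sq])
  from smooth_mult[OF smooth_const[of "2 / s ^ CARD('n)"] this]
  have "smooth (\<lambda>x. 2 / s ^ CARD('n) * bump_slope (- inverse (s\<^sup>2) * (norm (x - a))\<^sup>2 + 1))" .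
  moreover have "mean_kernel a s = (\<lambda>x. 2 / s ^ CARD('n) * bump_slope (- inverse (s\<^sup>2) * (norm (x - a))\<^sup>2 + 1))"
    by (rule ext) (simp add: mean_kernel_def divide_inverse ac_simps)
  ultimately show "smooth (mean_kernel a s)" by simp
  show "mean_kernel a s x = 0" if "x \<notin> cball a s" for x
    using that s(1) by (intro mean_kernel_outside) (auto simp: dist_norm norm_minus_commute)
qed (use s in auto)

lemma mean_kernel_le:
  fixes a :: "real^'n::finite"
  assumes "0 < s" shows "mean_kernel a s x \<le> 2 * slope_bound / s ^ CARD('n)"
proof -
  have "bump_slope (1 - (norm (x - a))\<^sup>2 / s\<^sup>2) \<le> slope_bound"
    using slope_bound(2)[of "1 - (norm (x - a))\<^sup>2 / s\<^sup>2"] by simp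
  then show ?thesis unfolding mean_kernel_def using assms by (intro divide_right_mono) auto
qed

lemma mean_kernel_ge:
  fixes a :: "real^'n::finite"
  assumes s: "0 < s" and x: "norm (x - a) \<le> 3 * s / 4"
  shows "2 * bump_exp (7/16) / s ^ CARD('n) \<le> mean_kernel a s x"
proof -
  let ?t = "1 - (norm (x - a))\<^sup>2 / s\<^sup>2"
  have "(norm (x - a))\<^sup>2 / s\<^sup>2 \<le> (3 * s / 4)\<^sup>2 / s\<^sup>2" using x by (intro divide_right_mono power_mono) auto
  also have "\<dots> = 9 / 16" using s by (simp add: power2_eq_square)
  finally have t: "7/16 \<le> ?t" by linarith
  have t1: "?t \<le> 1" by simp
  have "1 \<le> inverse ?t" using t t1 by (intro one_le_inverse) linarith+
  then have "1 \<le> (inverse ?t)\<^sup>2" by (rule one_le_power)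
  then have "bump_exp ?t * 1 \<le> bump_slope ?t" unfolding bump_slope_def by (intro mult_left_mono bump_exp_nonneg)
  moreover have "bump_exp (7/16) \<le> bump_exp ?t" by (rule bump_exp_mono[OF t])
  ultimately have "bump_exp (7/16) \<le> bump_slope ?t" by linarith
  then show ?thesis unfolding mean_kernel_def using s by (intro divide_right_mono) auto
qed

context free_boundary
begin

definition mean :: "real^'n \<Rightarrow> real \<Rightarrow> real" where
  "mean a s = (LINT x|lebesgue. max 0 (u1 x) * mean_kernel a s x)"

lemma integrable_mean:
  "0 < s \<Longrightarrow> cball a s \<subseteq> B \<Longrightarrow> integrable lebesgue (\<lambda>x. max 0 (u1 x) * mean_kernel a s x)"
  by (intro integrable_v_test test_function_mean_kernel)

text \<open>
  The derivative of the mean is the integral of \<open>v\<close> against the Laplacian of a bump, that is, \<open>T\<close> plus the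
  integral of \<open>q\<close>.
\<close>
lemma DERIV_mean:
  assumes s: "0 < s" "s < R" "cball a R \<subseteq> B"
  shows "(mean a has_real_derivative (s / s ^ CARD('n)) * (T (radial_bump a s) + (LINT x|lebesgue. q x * radial_bump a s x))) (at s)"
proof -
  let ?n = "CARD('n)"
  let ?p = "s / 2"
  have sub: "cball a t \<subseteq> B" if "t \<in> {?p<..<R}" for t
    using that s(3) subset_cball[of t R a] by auto
  obtain M where M: "M > 0" "\<And>x. x \<in> B \<Longrightarrow> \<bar>u1 x\<bar> \<le> M" using u_bounded by blast
  define C where "C = M * (lap_const ?n / ?p\<^sup>2 * (R / ?p ^ ?n))"
  let ?h' = "\<lambda>t x. max 0 (u1 x) * (laplacian (radial_bump a t) x * (t / t ^ ?n))"
  have lapint: "integrable lebesgue (\<lambda>x. max 0 (u1 x) * laplacian (radial_bump a s) x)"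
    by (rule integrable_v_test[OF test_function_laplacian[OF test_radial_bump[OF s(1) sub]]]) (use s in auto)
  have "((\<lambda>t. LINT x|lebesgue. max 0 (u1 x) * mean_kernel a t x) has_real_derivative (LINT x|lebesgue. ?h' s x)) (at s)"
  proof (rule DERIV_integral[where p="?p" and q=R and w="\<lambda>x. indicator (cball a R) x * C"])
    show "((\<lambda>t. max 0 (u1 x) * mean_kernel a t x) has_real_derivative ?h' t x) (at t)" if "t \<in> {?p<..<R}" for t x
      using that s by (intro DERIV_cmult DERIV_mean_kernel) auto
    show "integrable lebesgue (\<lambda>x. indicator (cball a R) x * C)"
      using lmeasurable_cball[of a R] by (intro integrable_mult_left integrable_real_indicator) (auto simp: fmeasurable_def)
    show "integrable lebesgue (\<lambda>x. max 0 (u1 x) * mean_kernel a t x)" if "t \<in> {?p<..<R}" for t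
      using that s sub[OF that] by (intro integrable_mean) auto
    show "?h' s \<in> borel_measurable lebesgue"
      using borel_measurable_integrable[OF lapint] by (simp add: mult.assoc[symmetric])
    show "s \<in> {?p<..<R}" using s by auto
    fix t x assume t: "t \<in> {?p<..<R}"
    then have t0: "0 < t" using s by auto
    show "\<bar>?h' t x\<bar> \<le> indicator (cball a R) x * C"
    proof (cases "x \<in> cball a R")
      case True
      then have xB: "x \<in> B" using s(3) by blast
      have 1: "\<bar>laplacian (radial_bump a t) x\<bar> \<le> lap_const ?n / ?p\<^sup>2"
      proof (rule order_trans[OF laplacian_radial_bump_bound(1)[OF t0]])
        have "?p\<^sup>2 \<le> t\<^sup>2" using t s by (intro power_mono) auto
        then show "lap_const ?n / t\<^sup>2 \<le> lap_const ?n / ?p\<^sup>2"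
          using s lap_const_nonneg t0 by (intro divide_left_mono mult_pos_pos zero_less_power) auto
      qed
      have "?p ^ ?n \<le> t ^ ?n" using t s by (intro power_mono) auto
      then have 2: "t / t ^ ?n \<le> R / ?p ^ ?n" using t s by (intro frac_le) auto
      have 3: "\<bar>max 0 (u1 x)\<bar> \<le> M" using M(2)[OF xB] M(1) by simp
      have "\<bar>max 0 (u1 x)\<bar> * (\<bar>laplacian (radial_bump a t) x\<bar> * (t / t ^ ?n)) \<le> M * (lap_const ?n / ?p\<^sup>2 * (R / ?p ^ ?n))"
        using 1 2 3 t0 M(1) lap_const_nonneg by (intro mult_mono) auto
      then show ?thesis using True t0 by (simp add: abs_mult C_def)
    next
      case False
      then have "t \<le> norm (x - a)" using t by (simp add: dist_norm norm_minus_commute)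
      then have "laplacian (radial_bump a t) x = 0" by (rule laplacian_radial_bump_bound(2)[OF t0])
      then show ?thesis using False by simp
    qed
  qed
  moreover have "(LINT x|lebesgue. ?h' s x) = (s / s ^ ?n) * (LINT x|lebesgue. max 0 (u1 x) * laplacian (radial_bump a s) x)"
  proof -
    have "(LINT x|lebesgue. ?h' s x) = (LINT x|lebesgue. (s / s ^ ?n) * (max 0 (u1 x) * laplacian (radial_bump a s) x))"
      by (intro Bochner_Integration.integral_cong refl) (simp only: ac_simps)
    then show ?thesis by (simp only: integral_mult_right_zero)
  qed
  ultimately have "((\<lambda>t. LINT x|lebesgue. max 0 (u1 x) * mean_kernel a t x) has_real_derivative
      (s / s ^ ?n) * (LINT x|lebesgue. max 0 (u1 x) * laplacian (radial_bump a s) x)) (at s)" by (simp only:)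
  then show ?thesis unfolding mean_def[abs_def] T_eq by (simp only: diff_add_cancel)
qed

lemma mean_upper:
  assumes a: "a \<in> frontier (positivity_set u1)" "a \<in> B" and s: "0 < s" "cball a s \<subseteq> B"
  shows "mean a s \<le> 2 * slope_bound * omega CARD('n) * C0 * s"
proof -
  let ?n = "CARD('n)"
  have "\<bar>mean a s\<bar> \<le> (C0 * s * (2 * slope_bound / s ^ ?n)) * (omega ?n * s ^ ?n)"
    unfolding mean_def measure_cball_eq[OF less_imp_le[OF s(1)], symmetric, of a]
  proof (rule integral_abs_le_const)
    show "(\<lambda>x. max 0 (u1 x) * mean_kernel a s x) \<in> borel_measurable lebesgue"
      by (rule borel_measurable_integrable[OF integrable_mean[OF s]])
    have out: "mean_kernel a s x = 0" if "x \<notin> cball a s" for x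
      using that by (intro mean_kernel_outside s(1)) (simp add: dist_norm norm_minus_commute)
    then show "max 0 (u1 x) * mean_kernel a s x = 0" if "x \<notin> cball a s" for x using that by simp
    show "AE x in lebesgue. \<bar>max 0 (u1 x) * mean_kernel a s x\<bar> \<le> C0 * s * (2 * slope_bound / s ^ ?n)"
    proof (rule AE_I2)
      fix x
      have c: "0 \<le> C0 * s" using C0_nonneg s by simp
      show "\<bar>max 0 (u1 x) * mean_kernel a s x\<bar> \<le> C0 * s * (2 * slope_bound / s ^ ?n)"
      proof (cases "x \<in> cball a s")
        case True
        have "norm (x - a) \<le> s" using True by (simp add: dist_norm norm_minus_commute)
        from v_near_frontier(1)[OF a _ this] have "max 0 (u1 x) \<le> C0 * s" using True s(2) by blast
        then have "max 0 (u1 x) * mean_kernel a s x \<le> C0 * s * (2 * slope_bound / s ^ ?n)"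
          using mean_kernel_le[OF s(1), of a x] mean_kernel_nonneg[OF s(1), of a x] c by (intro mult_mono) auto
        then show ?thesis using mean_kernel_nonneg[OF s(1), of a x] by simp
      next
        case False
        then show ?thesis using out[OF False] c slope_bound(1) s(1) by simp
      qed
    qed
  qed simp
  also have "\<dots> = 2 * slope_bound * omega ?n * C0 * s" using s(1) by simp
  finally show ?thesis by linarith
qed

end

context free_boundary_constants
begin

lemma mean_const_pos: "0 < mean_const CARD('n) C0 c0"
  unfolding mean_const_def using nondeg_const_bounds C0_nonneg by (simp add: bump_exp_pos)

lemma inner_ratio_bounds: "0 < inner_ratio CARD('n) C0 c0" "inner_ratio CARD('n) C0 c0 \<le> 1 / 2"
  unfolding inner_ratio_def using mean_const_pos slope_bound(1) C0_nonneg by auto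

text \<open>
  Nondegeneracy at scale \<open>r/2\<close> and the Lipschitz bound give a ball of radius comparable with \<open>r\<close> on which \<open>u\<close>
  is comparable with \<open>r\<close>. It lies within distance \<open>3 r / 4\<close> of \<open>a\<close>, where the kernel is not small.
\<close>
lemma mean_lower:
  assumes a: "a \<in> frontier (positivity_set u1)" and r: "0 < r" "r \<le> 1" "cball a r \<subseteq> B"
    and small: "measure lebesgue (ball a r) \<le> \<epsilon>"
  shows "mean_const CARD('n) C0 c0 * r \<le> mean a r"
proof -
  let ?n = "CARD('n)"
  note c0 = nondeg_const_bounds
  have "\<exists>y\<in>ball a (r / 2). c0 / 2 * (r / 2) < u1 y"
  proof (rule nondegeneracy[OF _ _ _ _ a])
    show "cball a (r / 2) \<subseteq> B" using r subset_cball[of "r/2" r a] by auto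
    have "measure lebesgue (ball a (r / 2)) \<le> measure lebesgue (ball a r)"
      using r by (intro measure_mono_fmeasurable) (auto simp: fmeasurableD)
    then show "measure lebesgue (ball a (r / 2)) \<le> \<epsilon>" using small by linarith
  qed (use r in auto)
  then obtain y where y: "y \<in> ball a (r / 2)" "c0 / 4 * r < u1 y" by auto
  define e where "e = c0 / (8 * (C0 + 1)) * r"
  have L: "1 \<le> C0 + 1" using C0_nonneg by simp
  have e: "0 < e" using c0 r L by (simp add: e_def)
  have e4: "e \<le> r / 4"
  proof -
    have "c0 / (8 * (C0 + 1)) \<le> (1/2) / (8 * 1)" using c0 L by (intro frac_le) auto
    then have "c0 / (8 * (C0 + 1)) * r \<le> (1/16) * r" using r by (intro mult_right_mono) auto
    then show ?thesis unfolding e_def using r by linarith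
  qed
  have near: "norm (x - a) \<le> 3 * r / 4" if "x \<in> ball y e" for x
  proof -
    have "dist a x \<le> dist a y + dist y x" by (rule dist_triangle)
    then have "dist a x \<le> 3 * r / 4" using that y(1) e4 by simp
    then show ?thesis by (simp add: dist_norm norm_minus_commute)
  qed
  have subB: "ball y e \<subseteq> B"
  proof
    fix x assume "x \<in> ball y e"
    from near[OF this] have "x \<in> cball a r" using r by (simp add: dist_norm norm_minus_commute)
    then show "x \<in> B" using r(3) by blast
  qed
  have ux: "c0 / 8 * r \<le> u1 x" if "x \<in> ball y e" for x
  proof -
    have "C0 * e \<le> (C0 + 1) * e" using e by (intro mult_right_mono) auto
    also have "\<dots> = c0 / 8 * r"
    proof -
      have "l * (c / (8 * l) * r) = c / 8 * r" if "l \<noteq> 0" for l c :: real using that by simp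
      then show ?thesis unfolding e_def using L by (metis not_one_le_zero)
    qed
    finally show ?thesis using u1_lower_near[OF subB e that] y(2) by linarith
  qed
  have "(LINT x|lebesgue. indicator (ball y e) x * (c0 / 8 * r * (2 * bump_exp (7/16) / r ^ ?n))) \<le> mean a r"
    unfolding mean_def
  proof (rule integral_mono)
    show "integrable lebesgue (\<lambda>x. indicator (ball y e) x * (c0 / 8 * r * (2 * bump_exp (7/16) / r ^ ?n)))"
      using lmeasurable_ball[of y e] by (intro integrable_mult_left integrable_real_indicator) (auto simp: fmeasurable_def)
    show "integrable lebesgue (\<lambda>x. max 0 (u1 x) * mean_kernel a r x)" by (rule integrable_mean[OF r(1,3)])
    fix x
    show "indicator (ball y e) x * (c0 / 8 * r * (2 * bump_exp (7/16) / r ^ ?n)) \<le> max 0 (u1 x) * mean_kernel a r x"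
    proof (cases "x \<in> ball y e")
      case True
      have "c0 / 8 * r * (2 * bump_exp (7/16) / r ^ ?n) \<le> max 0 (u1 x) * mean_kernel a r x"
        using ux[OF True] mean_kernel_ge[OF r(1) near[OF True]] c0 r
        by (intro mult_mono) (auto simp: bump_exp_nonneg)
      then show ?thesis using True by simp
    next
      case False
      then show ?thesis using mean_kernel_nonneg[OF r(1), of a x] by simp
    qed
  qed
  also have "(LINT x|lebesgue. indicator (ball y e) x * (c0 / 8 * r * (2 * bump_exp (7/16) / r ^ ?n)))
     = measure lebesgue (ball y e) * (c0 / 8 * r * (2 * bump_exp (7/16) / r ^ ?n))"
    by simp
  also have "\<dots> = mean_const ?n C0 c0 * r"
  proof -
    have "measure lebesgue (ball y e) = omega ?n * ((c0 / (8 * (C0 + 1))) ^ ?n * r ^ ?n)"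
    proof -
      have "e ^ ?n = (c0 / (8 * (C0 + 1))) ^ ?n * r ^ ?n" unfolding e_def by (rule power_mult_distrib)
      then show ?thesis using measure_ball_eq[OF less_imp_le[OF e], of y] by (simp only:)
    qed
    moreover have "r ^ ?n * (1 / r ^ ?n) = 1" using r by simp
    moreover have "w * (p * R) * (c / 8 * r * (2 * b / R)) = c / 8 * (2 * b) * (w * p) * r * (R * (1 / R))"
      for w p R c b :: real by simp
    ultimately show ?thesis unfolding mean_const_def by (metis mult.right_neutral)
  qed
  finally show ?thesis .
qed

text \<open>
  The mean of \<open>v\<close> grows from at most \<open>c2 r / 2\<close> at scale \<open>\<delta> r\<close> to at least \<open>c2 r\<close> at scale \<open>r\<close>, so its derivative is
  at least \<open>c2 / 2\<close> at some scale \<open>\<zeta>\<close> in between. By \<open>DERIV_mean\<close> this is a lower bound for \<open>T\<close> on a bump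
  supported in the ball, and \<open>small2\<close> absorbs the contribution of \<open>q\<close>.
\<close>
lemma lower_bound:
  assumes a: "a \<in> frontier (positivity_set u1)" and r: "0 < r" "r \<le> 1" "ball a (2 * r) \<subseteq> B"
    and small: "measure lebesgue (ball a r) \<le> \<epsilon>"
    and small2: "(Mf * C0 + Mg) * omega CARD('n) * r \<le> mean_const CARD('n) C0 c0 / 4"
  shows "ennreal (mean_const CARD('n) C0 c0 / 4 * (inner_ratio CARD('n) C0 c0) ^ (CARD('n) - 1) * r ^ (CARD('n) - 1))
    \<le> emeasure \<nu> (ball a r)"
proof -
  let ?n = "CARD('n)"
  define c2 where "c2 = mean_const ?n C0 c0"
  define \<delta> where "\<delta> = inner_ratio ?n C0 c0"
  have c2: "0 < c2" using mean_const_pos by (simp add: c2_def)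
  have \<delta>: "0 < \<delta>" "\<delta> \<le> 1 / 2" using inner_ratio_bounds by (auto simp: \<delta>_def)
  have aB: "a \<in> B" by (rule frontier_in_B[OF r(3,1)])
  have q: "cball a (3 * r / 2) \<subseteq> B"
  proof -
    have "cball a (3 * r / 2) \<subseteq> ball a (2 * r)" using r by auto
    then show ?thesis using r(3) by blast
  qed
  have sub: "cball a t \<subseteq> B" if "t \<le> 3 * r / 2" for t using q subset_cball[OF that] by blast
  have \<delta>r: "0 < \<delta> * r" "\<delta> * r < r" "\<delta> * r \<le> r / 2"
    using \<delta> r mult_right_mono[OF \<delta>(2), of r] by auto
  define D where "D s = (s / s ^ ?n) * (T (radial_bump a s) + (LINT x|lebesgue. q x * radial_bump a s x))" for s
  have dm: "(mean a has_real_derivative D s) (at s)" if "\<delta> * r \<le> s" "s \<le> r" for s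
    unfolding D_def using that \<delta>r r by (intro DERIV_mean[of s "3 * r / 2"] q) auto
  obtain \<zeta> where \<zeta>: "\<delta> * r < \<zeta>" "\<zeta> < r" "mean a r - mean a (\<delta> * r) = (r - \<delta> * r) * D \<zeta>"
    using MVT2[OF \<delta>r(2), of "mean a" D] dm by blast
  have "c2 * r \<le> mean a r" unfolding c2_def by (rule mean_lower[OF a r(1,2) sub small]) (use r in simp)
  moreover have "mean a (\<delta> * r) \<le> c2 / 2 * r"
  proof -
    let ?k = "slope_bound * omega ?n"
    have k: "0 < ?k" using slope_bound(1) by simp
    have "mean a (\<delta> * r) \<le> 2 * slope_bound * omega ?n * C0 * (\<delta> * r)"
      by (rule mean_upper[OF a aB \<delta>r(1) sub]) (use \<delta>r r in simp)
    also have "\<dots> = 2 * ?k * C0 * \<delta> * r" by simp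
    also have "\<dots> \<le> c2 / 2 * r"
    proof (rule mult_right_mono)
      have "\<delta> \<le> c2 / (4 * slope_bound * omega ?n * (C0 + 1))" unfolding \<delta>_def inner_ratio_def c2_def by simp
      then have "2 * ?k * C0 * \<delta> \<le> 2 * ?k * (C0 + 1) * (c2 / (4 * slope_bound * omega ?n * (C0 + 1)))"
        using k C0_nonneg \<delta> slope_bound(1) by (intro mult_mono) auto
      also have "\<dots> = c2 / 2"
      proof -
        have gen: "2 * (S * w) * l * (c / (4 * S * w * l)) = c / 2" if "S \<noteq> 0" "w \<noteq> 0" "l \<noteq> 0" for S w l c :: real
          using that by simp
        show ?thesis by (rule gen[OF less_imp_neq[OF slope_bound(1), symmetric] less_imp_neq[OF omega_pos, symmetric]])
            (use C0_nonneg in simp)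
      qed
      finally show "2 * ?k * C0 * \<delta> \<le> c2 / 2" .
    qed (use r in simp)
    finally show ?thesis .
  qed
  ultimately have "c2 / 2 * r \<le> (r - \<delta> * r) * D \<zeta>" unfolding \<zeta>(3)[symmetric] by linarith
  have D: "c2 / 2 \<le> D \<zeta>"
  proof (rule ccontr)
    assume "\<not> c2 / 2 \<le> D \<zeta>"
    then have "(r - \<delta> * r) * D \<zeta> < (r - \<delta> * r) * (c2 / 2)" using \<delta>r by (intro mult_strict_left_mono) auto
    also have "\<dots> \<le> r * (c2 / 2)" using \<delta>r c2 by (intro mult_right_mono) auto
    finally show False using \<open>c2 / 2 * r \<le> (r - \<delta> * r) * D \<zeta>\<close> by (simp add: mult.commute)
  qed
  have \<zeta>0: "0 < \<zeta>" using \<zeta>(1) \<delta>r by linarith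
  have \<zeta>n: "\<zeta> ^ ?n = \<zeta> * \<zeta> ^ (?n - 1)" by (metis power_minus_mult zero_less_card_finite mult.commute)
  define X where "X = T (radial_bump a \<zeta>)"
  define Y where "Y = (LINT x|lebesgue. q x * radial_bump a \<zeta> x)"
  have \<zeta>B: "cball a \<zeta> \<subseteq> B" by (rule sub) (use \<zeta>(2) r in simp)
  have "D \<zeta> = (X + Y) / \<zeta> ^ (?n - 1)" unfolding D_def \<zeta>n X_def Y_def using \<zeta>0 by simp
  then have XY: "c2 / 2 * \<zeta> ^ (?n - 1) \<le> X + Y" using D \<zeta>0 by (simp add: pos_le_divide_eq)
  have "Y \<le> (Mf * (C0 * \<zeta>) + Mg) * (omega ?n * \<zeta> ^ ?n)"
    using q_bump_bound[OF a aB \<zeta>0 \<zeta>B] unfolding Y_def by linarith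
  also have "\<dots> = ((Mf * (C0 * \<zeta>) + Mg) * omega ?n * \<zeta>) * \<zeta> ^ (?n - 1)" unfolding \<zeta>n by simp
  also have "\<dots> \<le> (c2 / 4) * \<zeta> ^ (?n - 1)"
  proof (rule mult_right_mono)
    have "(Mf * (C0 * \<zeta>) + Mg) * omega ?n * \<zeta> \<le> (Mf * (C0 * 1) + Mg) * omega ?n * r"
      using \<zeta>0 \<zeta>(2) r Mf_nonneg Mg_nonneg C0_nonneg by (intro mult_mono add_mono mult_left_mono) auto
    then show "(Mf * (C0 * \<zeta>) + Mg) * omega ?n * \<zeta> \<le> c2 / 4"
      using small2 unfolding c2_def mult.right_neutral by linarith
  qed (use \<zeta>0 in simp)
  finally have "c2 / 4 * \<zeta> ^ (?n - 1) \<le> X" using XY by simp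
  moreover have "(\<delta> * r) ^ (?n - 1) \<le> \<zeta> ^ (?n - 1)" using \<zeta>(1) \<delta>r by (intro power_mono) auto
  then have "c2 / 4 * (\<delta> * r) ^ (?n - 1) \<le> c2 / 4 * \<zeta> ^ (?n - 1)" using c2 by (intro mult_left_mono) auto
  ultimately have "c2 / 4 * \<delta> ^ (?n - 1) * r ^ (?n - 1) \<le> X" by (simp add: power_mult_distrib)
  then have "ennreal (c2 / 4 * \<delta> ^ (?n - 1) * r ^ (?n - 1)) \<le> ennreal X" by (rule ennreal_leI)
  also have "\<dots> \<le> tau (ball a r)"
    unfolding X_def
  proof (rule le_tau)
    have "cball a \<zeta> \<subseteq> B \<inter> ball a r" using \<zeta>B \<zeta>(2) by auto
    then show "radial_bump a \<zeta> \<in> tests (ball a r)"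
      unfolding tests_def using test_function_radial_bump[OF \<zeta>0] radial_bump_nonneg radial_bump_le_1 by blast
  qed
  also have "\<dots> = emeasure \<nu> (ball a r)" by (rule emeasure_open[symmetric]) simp
  finally show ?thesis by (simp add: c2_def \<delta>_def)
qed

end

theorem proposition16p1:
  fixes Mf Mg C0 CF lam :: real
  assumes "CARD('n::finite) \<ge> 2"
    and "Mf \<ge> 0" and "Mg \<ge> 0" and "C0 \<ge> 0" and "CF \<ge> 0" and "lam > 0"
  shows "\<exists>C1\<ge>1. \<forall>\<epsilon>>0. \<exists>r0>0. r0 \<le> 1 \<and>
    (\<forall>(N::nat) (\<Omega> :: (real^'n) set) f g F u W z \<rho>.
       N \<ge> 1 \<and>
       \<Omega> \<in> sets borel \<and> emeasure lebesgue \<Omega> < \<infinity> \<and>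
       (\<forall>i\<in>{1..N}. ess_bounded_by (f i) Mf \<and> ess_bounded_by (g i) Mg) \<and>
       is_minimizer N \<Omega> f g F u W \<and>
       \<rho> > 0 \<and> C0-lipschitz_on (ball z \<rho>) (u 1) \<and>
       (\<forall>V\<in>disjoint_tuples N \<Omega>. \<forall>V'\<in>disjoint_tuples N \<Omega>.
          \<bar>F V - F V'\<bar> \<le> CF * (\<Sum>i=1..N. measure lebesgue (sym_diff (V i) (V' i)))) \<and>
       (\<forall>A\<in>sets borel. A \<subseteq> W 1 \<and> 0 < measure lebesgue A \<and> measure lebesgue A \<le> \<epsilon> \<longrightarrow>
          (\<exists>A'. (\<forall>j\<in>{2..N}. A' j \<in> sets borel \<and> A' j \<subseteq> A) \<and> disjoint_family_on A' {2..N} \<and>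
             F (reassign N W A A') \<le> F W - lam * measure lebesgue A))
       \<longrightarrow>
       (\<exists>\<nu>. is_positive_measure_in (ball z \<rho>) (mu_distr (u 1) (f 1) (g 1)) \<nu> \<and>
          measure_support_in (ball z \<rho>) \<nu> = frontier (positivity_set (u 1)) \<inter> ball z \<rho> \<and>
          (\<forall>x\<in>frontier (positivity_set (u 1)). \<forall>r.
             0 < r \<and> r \<le> r0 \<and> ball x (2 * r) \<subseteq> ball z \<rho> \<longrightarrow>
             ennreal (r ^ (CARD('n) - 1) / C1) \<le> emeasure \<nu> (ball x r) \<and>
             emeasure \<nu> (ball x r) \<le> ennreal (C1 * r ^ (CARD('n) - 1)))))"
proof -
  let ?n = "CARD('n)"
  define \<kappa> where "\<kappa> = decay_const ?n C0 Mf Mg lam"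
  define c0 where "c0 = nondeg_const ?n C0 Mf Mg lam"
  define c2 where "c2 = mean_const ?n C0 c0"
  define \<delta> where "\<delta> = inner_ratio ?n C0 c0"
  define lo where "lo = c2 / 4 * \<delta> ^ (?n - 1)"
  define up where "up = (C0 * lap_const ?n + 3 * (Mf * (2 * C0) + Mg)) * omega ?n * 2 ^ ?n / bump_exp (5/9)"
  define C1 where "C1 = max 1 (max up (1 / lo))"
  have C1: "1 \<le> C1" "up \<le> C1" "1 / lo \<le> C1" by (auto simp: C1_def)
  show ?thesis
  proof (rule exI[of _ C1], rule conjI[OF C1(1)], rule allI, rule impI, goal_cases)
    case (1 \<epsilon>)
    then have \<epsilon>: "0 < \<epsilon>" .
    define r0 where "r0 = (if c2 > 0 then min 1 (min (\<epsilon> / omega ?n) (c2 / (4 * ((Mf * C0 + Mg) * omega ?n + 1)))) else 1)"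
    have den: "0 < 4 * ((Mf * C0 + Mg) * omega ?n + 1)" using assms by (simp add: add_nonneg_pos)
    have r0: "0 < r0" "r0 \<le> 1"
      unfolding r0_def using \<epsilon> den by auto
    show ?case
    proof (intro exI[of _ r0] conjI r0 allI impI, goal_cases)
      case (1 N \<Omega> f g F u W z \<rho>)
      note H = this
      interpret free_boundary_constants N \<Omega> f g F u W Mf Mg z \<rho> C0 lam \<epsilon> \<kappa> c0
      proof
        show "1 \<le> N" "\<Omega> \<in> sets borel" "emeasure lebesgue \<Omega> < \<infinity>" "is_minimizer N \<Omega> f g F u W"
          "C0-lipschitz_on (ball z \<rho>) (u 1)" using H by blast+
        have "1 \<in> {1..N}" using H by simp
        then show "ess_bounded_by (f 1) Mf" "ess_bounded_by (g 1) Mg" using H by blast+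
        show "\<exists>A'. (\<forall>j\<in>{2..N}. A' j \<in> sets borel \<and> A' j \<subseteq> A) \<and> disjoint_family_on A' {2..N} \<and>
             F (reassign N W A A') \<le> F W - lam * measure lebesgue A"
          if "A \<in> sets borel" "A \<subseteq> W 1" "0 < measure lebesgue A" "measure lebesgue A \<le> \<epsilon>" for A
          using H that by blast
      qed (use assms \<kappa>_def c0_def in simp_all)
      have c2: "0 < c2" unfolding c2_def by (rule mean_const_pos)
      have \<delta>: "0 < \<delta>" unfolding \<delta>_def by (rule inner_ratio_bounds)
      have lo: "0 < lo" unfolding lo_def using c2 \<delta> by simp
      have r0_le: "r0 \<le> \<epsilon> / omega ?n" "r0 \<le> c2 / (4 * ((Mf * C0 + Mg) * omega ?n + 1))"
        unfolding r0_def using c2 by auto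
      have bounds: "ennreal (r ^ (?n - 1) / C1) \<le> emeasure repr_measure (ball x r) \<and>
          emeasure repr_measure (ball x r) \<le> ennreal (C1 * r ^ (?n - 1))"
        if x: "x \<in> frontier (positivity_set (u 1))" and r: "0 < r" "r \<le> r0" "ball x (2 * r) \<subseteq> ball z \<rho>" for x r
      proof
        have r1: "r \<le> 1" using r r0 by linarith
        have rn: "0 \<le> r ^ (?n - 1)" using r by simp
        have "measure lebesgue (ball x r) = omega ?n * r ^ ?n" by (rule measure_ball_eq) (use r in simp)
        also have "\<dots> \<le> omega ?n * r"
        proof (intro mult_left_mono)
          have "r ^ ?n \<le> r ^ 1" using r r1 assms(1) by (intro power_decreasing) auto
          then show "r ^ ?n \<le> r" by simp
        qed simp
        also have "\<dots> \<le> omega ?n * (\<epsilon> / omega ?n)" using r r0_le(1) by (intro mult_left_mono) auto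
        also have "\<dots> = \<epsilon>" by (simp add: less_imp_neq[OF omega_pos, symmetric])
        finally have sm: "measure lebesgue (ball x r) \<le> \<epsilon>" .
        have "(Mf * C0 + Mg) * omega ?n * r \<le> ((Mf * C0 + Mg) * omega ?n + 1) * r" using r by (simp add: distrib_right)
        also have "\<dots> \<le> ((Mf * C0 + Mg) * omega ?n + 1) * (c2 / (4 * ((Mf * C0 + Mg) * omega ?n + 1)))"
          using r r0_le(2) den by (intro mult_left_mono) auto
        also have "\<dots> = c2 / 4" using den by (simp add: field_simps)
        finally have sm2: "(Mf * C0 + Mg) * omega ?n * r \<le> c2 / 4" .
        have "ennreal (lo * r ^ (?n - 1)) \<le> emeasure repr_measure (ball x r)"
          unfolding lo_def c2_def \<delta>_def by (rule lower_bound[OF x r(1) r1 r(3) sm sm2[unfolded c2_def]])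
        moreover have "r ^ (?n - 1) / C1 \<le> lo * r ^ (?n - 1)"
        proof -
          have "1 / C1 \<le> lo" using C1 lo by (simp add: field_simps)
          from mult_right_mono[OF this rn] show ?thesis by simp
        qed
        ultimately show "ennreal (r ^ (?n - 1) / C1) \<le> emeasure repr_measure (ball x r)"
          by (meson ennreal_leI order_trans)
        have "emeasure repr_measure (ball x r) \<le> ennreal (up * r ^ (?n - 1))"
          unfolding up_def by (rule upper_bound[OF x r(1) r1 r(3)])
        also have "\<dots> \<le> ennreal (C1 * r ^ (?n - 1))" using C1(2) rn by (intro ennreal_leI mult_right_mono)
        finally show "emeasure repr_measure (ball x r) \<le> ennreal (C1 * r ^ (?n - 1))" .
      qed
      show ?case
      proof (intro exI[of _ repr_measure] conjI ballI allI impI)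
        show "is_positive_measure_in (ball z \<rho>) (mu_distr (u 1) (f 1) (g 1)) repr_measure"
          using representation by (simp add: T_def[symmetric])
        show "measure_support_in (ball z \<rho>) repr_measure = frontier (positivity_set (u 1)) \<inter> ball z \<rho>"
        proof (intro subset_antisym subsetI IntI)
          fix x assume x: "x \<in> measure_support_in (ball z \<rho>) repr_measure"
          then show xB: "x \<in> ball z \<rho>" by (simp add: measure_support_in_def)
          show "x \<in> frontier (positivity_set (u 1))"
          proof (rule ccontr)
            assume "x \<notin> frontier (positivity_set (u 1))"
            from null_away_from_frontier[OF xB this] x show False by (auto simp: measure_support_in_def)
          qed
        next
          fix x assume "x \<in> frontier (positivity_set (u 1)) \<inter> ball z \<rho>"
          then have x: "x \<in> frontier (positivity_set (u 1))" "x \<in> ball z \<rho>" by auto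
          obtain d where d: "d > 0" "ball x d \<subseteq> ball z \<rho>" using x(2) open_contains_ball open_ball by blast
          have "0 < emeasure repr_measure (ball x r)" if "r > 0" for r
          proof -
            define t where "t = min r (min r0 (d / 2))"
            have t: "0 < t" "t \<le> r" "t \<le> r0" "2 * t \<le> d" using that r0 d by (auto simp: t_def)
            have "ball x (2 * t) \<subseteq> ball z \<rho>" using d(2) t(4) subset_ball by blast
            from bounds[OF x(1) t(1,3) this] have "ennreal (t ^ (?n - 1) / C1) \<le> emeasure repr_measure (ball x t)" by blast
            also have "\<dots> \<le> emeasure repr_measure (ball x r)" using t(2) by (intro emeasure_mono subset_ball) auto
            finally have "ennreal (t ^ (?n - 1) / C1) \<le> emeasure repr_measure (ball x r)" .
            moreover have "0 < t ^ (?n - 1) / C1" using t(1) C1(1) by simp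
            ultimately show ?thesis by (meson ennreal_less_zero_iff less_le_trans)
          qed
          then show "x \<in> measure_support_in (ball z \<rho>) repr_measure" using x(2) by (simp add: measure_support_in_def)
        qed
        fix x r assume "x \<in> frontier (positivity_set (u 1))" "0 < r \<and> r \<le> r0 \<and> ball x (2 * r) \<subseteq> ball z \<rho>"
        then show "ennreal (r ^ (CARD('n) - 1) / C1) \<le> emeasure repr_measure (ball x r)"
          "emeasure repr_measure (ball x r) \<le> ennreal (C1 * r ^ (CARD('n) - 1))"
          using bounds by blast+
      qed
    qed
  qed
qed

end
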